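(* Let $B$ be a small category. There is a 2-equivalence of 2-categories $$\mathbf{Fib}(B)\simeq\mathbf{Psd}[B^{\mathrm{op}},\mathbf{Cat}],$$ where $\mathbf{Psd}[B^{\mathrm{op}},\mathbf{Cat}]$ is the 2-category of pseudo-functors $B^{\mathrm{op}}\rightsquigarrow\mathbf{Cat}$, pseudo-natural transformations, and modifications.
   Context: $\mathbf{Cat}$ is the 2-category of small categories. Given a functor $p\colon E\to B$, an arrow $g\colon e'\to e$ in $E$ is $p$-cartesian if for any $g'\colon e''\to e$ in $E$ and any $h$ in $B$ with $pg'=pg\cdot h$, there is a unique arrow $k\colon e''\to e'$ with $pk=h$ and $g'=g\cdot k$. A functor $p\colon E\to B$ is a fibration if for each object $e\in E$ each arrow $f\colon b\to pe$ in $B$ has a $p$-cartesian lift with codomain $e$. $\mathbf{Fib}(B)$ is the sub-2-category of the slice 2-category $\mathbf{Cat}_{/B}$ whose objects are the fibrations over $B$, whose 1-cells are the cartesian functors (functors over $B$ that preserve cartesian arrows), and whose 2-cells are all the 2-cells of $\mathbf{Cat}_{/B}$ between them (natural transformations lying over the identity of the projection to $B$). *)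

theory Defs
  imports "HOL-Library.FuncSet"
begin

section \<open>Categories, functors, natural transformations\<close>

record ('o, 'a) cat =
  Obj :: "'o set"
  Arr :: "'a set"
  Dom :: "'a \<Rightarrow> 'o"
  Cod :: "'a \<Rightarrow> 'o"
  Ide :: "'o \<Rightarrow> 'a"
  Comp :: "'a \<Rightarrow> 'a \<Rightarrow> 'a"

text \<open>\<open>Comp C g f\<close> is the composite \<open>g \<cdot> f\<close>, that is, first \<open>f\<close>, then \<open>g\<close>.\<close>

definition arrows :: "('o, 'a) cat \<Rightarrow> 'o \<Rightarrow> 'o \<Rightarrow> 'a set" where
  "arrows C x y = {f \<in> Arr C. Dom C f = x \<and> Cod C f = y}"

locale category =
  fixes C :: "('o, 'a) cat"
  assumes Dom_in: "f \<in> Arr C \<Longrightarrow> Dom C f \<in> Obj C"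
    and Cod_in: "f \<in> Arr C \<Longrightarrow> Cod C f \<in> Obj C"
    and Ide_in: "x \<in> Obj C \<Longrightarrow> Ide C x \<in> arrows C x x"
    and Comp_in: "f \<in> arrows C x y \<Longrightarrow> g \<in> arrows C y z \<Longrightarrow> Comp C g f \<in> arrows C x z"
    and Comp_Ide_right: "f \<in> arrows C x y \<Longrightarrow> Comp C f (Ide C x) = f"
    and Comp_Ide_left: "f \<in> arrows C x y \<Longrightarrow> Comp C (Ide C y) f = f"
    and Comp_assoc: "f \<in> arrows C w x \<Longrightarrow> g \<in> arrows C x y \<Longrightarrow> h \<in> arrows C y z \<Longrightarrow>
      Comp C (Comp C h g) f = Comp C h (Comp C g f)"

definition is_iso :: "('o, 'a) cat \<Rightarrow> 'a \<Rightarrow> bool" where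
  "is_iso C f \<longleftrightarrow> f \<in> Arr C \<and>
    (\<exists>g \<in> arrows C (Cod C f) (Dom C f).
      Comp C g f = Ide C (Dom C f) \<and> Comp C f g = Ide C (Cod C f))"

definition op_cat :: "('o, 'a) cat \<Rightarrow> ('o, 'a) cat" where
  "op_cat C = \<lparr>Obj = Obj C, Arr = Arr C, Dom = Cod C, Cod = Dom C, Ide = Ide C,
     Comp = (\<lambda>g f. Comp C f g)\<rparr>"

definition prod_cat :: "('o, 'a) cat \<Rightarrow> ('p, 'b) cat \<Rightarrow> ('o \<times> 'p, 'a \<times> 'b) cat" where
  "prod_cat C D = \<lparr>Obj = Obj C \<times> Obj D, Arr = Arr C \<times> Arr D,
     Dom = map_prod (Dom C) (Dom D), Cod = map_prod (Cod C) (Cod D),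
     Ide = map_prod (Ide C) (Ide D),
     Comp = (\<lambda>(g, g') (f, f'). (Comp C g f, Comp D g' f'))\<rparr>"

text \<open>The subcategory on the objects satisfying \<open>P\<close> and those arrows between them that
  satisfy \<open>Q\<close>.\<close>

definition sub_cat :: "('o, 'a) cat \<Rightarrow> ('o \<Rightarrow> bool) \<Rightarrow> ('a \<Rightarrow> bool) \<Rightarrow> ('o, 'a) cat" where
  "sub_cat C P Q = C\<lparr>Obj := {x \<in> Obj C. P x},
     Arr := {f \<in> Arr C. P (Dom C f) \<and> P (Cod C f) \<and> Q f}\<rparr>"

record ('o, 'a, 'p, 'b) ftor =
  OMap :: "'o \<Rightarrow> 'p"
  AMap :: "'a \<Rightarrow> 'b"

locale is_functor =
  dom_cat: category A + cod_cat: category B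
  for A :: "('o, 'a) cat" and B :: "('p, 'b) cat" and F :: "('o, 'a, 'p, 'b) ftor" +
  assumes OMap_in: "x \<in> Obj A \<Longrightarrow> OMap F x \<in> Obj B"
    and AMap_in: "f \<in> arrows A x y \<Longrightarrow> AMap F f \<in> arrows B (OMap F x) (OMap F y)"
    and AMap_Ide: "x \<in> Obj A \<Longrightarrow> AMap F (Ide A x) = Ide B (OMap F x)"
    and AMap_Comp: "f \<in> arrows A x y \<Longrightarrow> g \<in> arrows A y z \<Longrightarrow>
      AMap F (Comp A g f) = Comp B (AMap F g) (AMap F f)"

text \<open>HOL functions are total, so a structure determines its component functions only on the
  relevant carriers. To make equality of 1-cells and 2-cells mean equality of their components, all
  maps are required to take the value \<open>undefined\<close> elsewhere (\<open>extensional\<close>, \<open>restrict\<close>).\<close>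

definition functors :: "('o, 'a) cat \<Rightarrow> ('p, 'b) cat \<Rightarrow> ('o, 'a, 'p, 'b) ftor set" where
  "functors A B = {F. is_functor A B F \<and>
     OMap F \<in> extensional (Obj A) \<and> AMap F \<in> extensional (Arr A)}"

definition id_ftor :: "('o, 'a) cat \<Rightarrow> ('o, 'a, 'o, 'a) ftor" where
  "id_ftor A = \<lparr>OMap = (\<lambda>x\<in>Obj A. x), AMap = (\<lambda>f\<in>Arr A. f)\<rparr>"

definition comp_ftor :: "('o, 'a) cat \<Rightarrow> ('p, 'b, 'q, 'c) ftor \<Rightarrow> ('o, 'a, 'p, 'b) ftor \<Rightarrow>
    ('o, 'a, 'q, 'c) ftor" where
  "comp_ftor A G F = \<lparr>OMap = (\<lambda>x\<in>Obj A. OMap G (OMap F x)),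
     AMap = (\<lambda>f\<in>Arr A. AMap G (AMap F f))\<rparr>"

text \<open>A natural transformation carries its source and target functor.\<close>

record ('o, 'a, 'p, 'b) ntrans =
  NDom :: "('o, 'a, 'p, 'b) ftor"
  NCod :: "('o, 'a, 'p, 'b) ftor"
  NMap :: "'o \<Rightarrow> 'b"

definition ntranses :: "('o, 'a) cat \<Rightarrow> ('p, 'b) cat \<Rightarrow> ('o, 'a, 'p, 'b) ntrans set" where
  "ntranses A B = {\<tau>. NDom \<tau> \<in> functors A B \<and> NCod \<tau> \<in> functors A B \<and>
     NMap \<tau> \<in> extensional (Obj A) \<and>
     (\<forall>x\<in>Obj A. NMap \<tau> x \<in> arrows B (OMap (NDom \<tau>) x) (OMap (NCod \<tau>) x)) \<and>
     (\<forall>f\<in>Arr A. Comp B (NMap \<tau> (Cod A f)) (AMap (NDom \<tau>) f) =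
        Comp B (AMap (NCod \<tau>) f) (NMap \<tau> (Dom A f)))}"

definition functor_cat :: "('o, 'a) cat \<Rightarrow> ('p, 'b) cat \<Rightarrow>
    (('o, 'a, 'p, 'b) ftor, ('o, 'a, 'p, 'b) ntrans) cat" where
  "functor_cat A B = \<lparr>Obj = functors A B, Arr = ntranses A B, Dom = NDom, Cod = NCod,
     Ide = (\<lambda>F. \<lparr>NDom = F, NCod = F, NMap = (\<lambda>x\<in>Obj A. Ide B (OMap F x))\<rparr>),
     Comp = (\<lambda>\<sigma> \<tau>. \<lparr>NDom = NDom \<tau>, NCod = NCod \<sigma>,
       NMap = (\<lambda>x\<in>Obj A. Comp B (NMap \<sigma> x) (NMap \<tau> x))\<rparr>)\<rparr>"

text \<open>Horizontal composite of \<open>\<tau> : F \<Rightarrow> F' : A \<rightarrow> B\<close> and \<open>\<sigma> : G \<Rightarrow> G' : B \<rightarrow> C\<close>.\<close>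

definition hcomp_ntrans :: "('o, 'a) cat \<Rightarrow> ('q, 'c) cat \<Rightarrow> ('p, 'b, 'q, 'c) ntrans \<Rightarrow>
    ('o, 'a, 'p, 'b) ntrans \<Rightarrow> ('o, 'a, 'q, 'c) ntrans" where
  "hcomp_ntrans A C \<sigma> \<tau> = \<lparr>NDom = comp_ftor A (NDom \<sigma>) (NDom \<tau>),
     NCod = comp_ftor A (NCod \<sigma>) (NCod \<tau>),
     NMap = (\<lambda>x\<in>Obj A. Comp C (NMap \<sigma> (OMap (NCod \<tau>) x)) (AMap (NDom \<sigma>) (NMap \<tau> x)))\<rparr>"


section \<open>2-categories, 2-functors, 2-equivalence\<close>

text \<open>A (strict) 2-category is presented as a category enriched in categories: hom-categories
  (whose composition is vertical composition of 2-cells), unit 1-cells, and composition functors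
  \<open>Hom b c \<times> Hom a b \<rightarrow> Hom a c\<close>.\<close>

record ('o, 'f, 't) two_cat =
  Cell0 :: "'o set"
  Hom :: "'o \<Rightarrow> 'o \<Rightarrow> ('f, 't) cat"
  Unit :: "'o \<Rightarrow> 'f"
  HComp :: "'o \<Rightarrow> 'o \<Rightarrow> 'o \<Rightarrow> ('f \<times> 'f, 't \<times> 't, 'f, 't) ftor"

abbreviation Cell1 :: "('o, 'f, 't) two_cat \<Rightarrow> 'o \<Rightarrow> 'o \<Rightarrow> 'f set" where
  "Cell1 K a b \<equiv> Obj (Hom K a b)"

abbreviation Cell2 :: "('o, 'f, 't) two_cat \<Rightarrow> 'o \<Rightarrow> 'o \<Rightarrow> 't set" where
  "Cell2 K a b \<equiv> Arr (Hom K a b)"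

definition hc1 :: "('o, 'f, 't) two_cat \<Rightarrow> 'o \<Rightarrow> 'o \<Rightarrow> 'o \<Rightarrow> 'f \<Rightarrow> 'f \<Rightarrow> 'f" where
  "hc1 K a b c g f = OMap (HComp K a b c) (g, f)"

definition hc2 :: "('o, 'f, 't) two_cat \<Rightarrow> 'o \<Rightarrow> 'o \<Rightarrow> 'o \<Rightarrow> 't \<Rightarrow> 't \<Rightarrow> 't" where
  "hc2 K a b c \<sigma> \<tau> = AMap (HComp K a b c) (\<sigma>, \<tau>)"

text \<open>Whiskerings: \<open>lwh K a b c g \<tau>\<close> is \<open>1\<^sub>g * \<tau>\<close>, and \<open>rwh K a b c \<sigma> f\<close> is \<open>\<sigma> * 1\<^sub>f\<close>,
  for \<open>f\<close>, \<open>\<tau>\<close> between \<open>a\<close> and \<open>b\<close>, and \<open>g\<close>, \<open>\<sigma>\<close> between \<open>b\<close> and \<open>c\<close>.\<close>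

definition lwh :: "('o, 'f, 't) two_cat \<Rightarrow> 'o \<Rightarrow> 'o \<Rightarrow> 'o \<Rightarrow> 'f \<Rightarrow> 't \<Rightarrow> 't" where
  "lwh K a b c g \<tau> = hc2 K a b c (Ide (Hom K b c) g) \<tau>"

definition rwh :: "('o, 'f, 't) two_cat \<Rightarrow> 'o \<Rightarrow> 'o \<Rightarrow> 'o \<Rightarrow> 't \<Rightarrow> 'f \<Rightarrow> 't" where
  "rwh K a b c \<sigma> f = hc2 K a b c \<sigma> (Ide (Hom K a b) f)"

locale two_category =
  fixes K :: "('o, 'f, 't) two_cat"
  assumes Hom_category: "a \<in> Cell0 K \<Longrightarrow> b \<in> Cell0 K \<Longrightarrow> category (Hom K a b)"
    and Unit_in: "a \<in> Cell0 K \<Longrightarrow> Unit K a \<in> Cell1 K a a"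
    and HComp_functor: "a \<in> Cell0 K \<Longrightarrow> b \<in> Cell0 K \<Longrightarrow> c \<in> Cell0 K \<Longrightarrow>
      is_functor (prod_cat (Hom K b c) (Hom K a b)) (Hom K a c) (HComp K a b c)"
    and hc1_Unit_right: "a \<in> Cell0 K \<Longrightarrow> b \<in> Cell0 K \<Longrightarrow> f \<in> Cell1 K a b \<Longrightarrow>
      hc1 K a a b f (Unit K a) = f"
    and hc1_Unit_left: "a \<in> Cell0 K \<Longrightarrow> b \<in> Cell0 K \<Longrightarrow> f \<in> Cell1 K a b \<Longrightarrow>
      hc1 K a b b (Unit K b) f = f"
    and hc2_Unit_right: "a \<in> Cell0 K \<Longrightarrow> b \<in> Cell0 K \<Longrightarrow> \<tau> \<in> Cell2 K a b \<Longrightarrow>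
      rwh K a a b \<tau> (Unit K a) = \<tau>"
    and hc2_Unit_left: "a \<in> Cell0 K \<Longrightarrow> b \<in> Cell0 K \<Longrightarrow> \<tau> \<in> Cell2 K a b \<Longrightarrow>
      lwh K a b b (Unit K b) \<tau> = \<tau>"
    and hc1_assoc: "a \<in> Cell0 K \<Longrightarrow> b \<in> Cell0 K \<Longrightarrow> c \<in> Cell0 K \<Longrightarrow> d \<in> Cell0 K \<Longrightarrow>
      f \<in> Cell1 K a b \<Longrightarrow> g \<in> Cell1 K b c \<Longrightarrow> h \<in> Cell1 K c d \<Longrightarrow>
      hc1 K a b d (hc1 K b c d h g) f = hc1 K a c d h (hc1 K a b c g f)"
    and hc2_assoc: "a \<in> Cell0 K \<Longrightarrow> b \<in> Cell0 K \<Longrightarrow> c \<in> Cell0 K \<Longrightarrow> d \<in> Cell0 K \<Longrightarrow>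
      \<rho> \<in> Cell2 K a b \<Longrightarrow> \<sigma> \<in> Cell2 K b c \<Longrightarrow> \<tau> \<in> Cell2 K c d \<Longrightarrow>
      hc2 K a b d (hc2 K b c d \<tau> \<sigma>) \<rho> = hc2 K a c d \<tau> (hc2 K a b c \<sigma> \<rho>)"

definition is_iso1 :: "('o, 'f, 't) two_cat \<Rightarrow> 'o \<Rightarrow> 'o \<Rightarrow> 'f \<Rightarrow> bool" where
  "is_iso1 K a b f \<longleftrightarrow> f \<in> Cell1 K a b \<and>
    (\<exists>g \<in> Cell1 K b a. hc1 K a b a g f = Unit K a \<and> hc1 K b a b f g = Unit K b)"

record ('o, 'f, 't, 'p, 'g, 's) two_ftor =
  TObj :: "'o \<Rightarrow> 'p"
  THom :: "'o \<Rightarrow> 'o \<Rightarrow> ('f, 't, 'g, 's) ftor"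

locale two_functor =
  dom2: two_category C + cod2: two_category D
  for C :: "('o, 'f, 't) two_cat" and D :: "('p, 'g, 's) two_cat"
    and F :: "('o, 'f, 't, 'p, 'g, 's) two_ftor" +
  assumes TObj_in: "a \<in> Cell0 C \<Longrightarrow> TObj F a \<in> Cell0 D"
    and THom_functor: "a \<in> Cell0 C \<Longrightarrow> b \<in> Cell0 C \<Longrightarrow>
      is_functor (Hom C a b) (Hom D (TObj F a) (TObj F b)) (THom F a b)"
    and THom_Unit: "a \<in> Cell0 C \<Longrightarrow> OMap (THom F a a) (Unit C a) = Unit D (TObj F a)"
    and THom_hc1: "a \<in> Cell0 C \<Longrightarrow> b \<in> Cell0 C \<Longrightarrow> c \<in> Cell0 C \<Longrightarrow>
      f \<in> Cell1 C a b \<Longrightarrow> g \<in> Cell1 C b c \<Longrightarrow>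
      OMap (THom F a c) (hc1 C a b c g f) =
      hc1 D (TObj F a) (TObj F b) (TObj F c) (OMap (THom F b c) g) (OMap (THom F a b) f)"
    and THom_hc2: "a \<in> Cell0 C \<Longrightarrow> b \<in> Cell0 C \<Longrightarrow> c \<in> Cell0 C \<Longrightarrow>
      \<tau> \<in> Cell2 C a b \<Longrightarrow> \<sigma> \<in> Cell2 C b c \<Longrightarrow>
      AMap (THom F a c) (hc2 C a b c \<sigma> \<tau>) =
      hc2 D (TObj F a) (TObj F b) (TObj F c) (AMap (THom F b c) \<sigma>) (AMap (THom F a b) \<tau>)"

definition id_two_ftor :: "('o, 'f, 't, 'o, 'f, 't) two_ftor" where
  "id_two_ftor = \<lparr>TObj = (\<lambda>a. a), THom = (\<lambda>a b. \<lparr>OMap = (\<lambda>f. f), AMap = (\<lambda>\<tau>. \<tau>)\<rparr>)\<rparr>"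

definition comp_two_ftor :: "('p, 'g, 's, 'q, 'h, 'r) two_ftor \<Rightarrow>
    ('o, 'f, 't, 'p, 'g, 's) two_ftor \<Rightarrow> ('o, 'f, 't, 'q, 'h, 'r) two_ftor" where
  "comp_two_ftor G F = \<lparr>TObj = (\<lambda>a. TObj G (TObj F a)),
     THom = (\<lambda>a b. \<lparr>OMap = (\<lambda>f. OMap (THom G (TObj F a) (TObj F b)) (OMap (THom F a b) f)),
       AMap = (\<lambda>\<tau>. AMap (THom G (TObj F a) (TObj F b)) (AMap (THom F a b) \<tau>))\<rparr>)\<rparr>"

text \<open>A 2-natural isomorphism is a (strictly) 2-natural transformation all of whose components are
  invertible 1-cells; its inverse is then automatically 2-natural.\<close>

locale two_natural_iso =
  source: two_functor C D F + target: two_functor C D G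
  for C :: "('o, 'f, 't) two_cat" and D :: "('p, 'g, 's) two_cat"
    and F G :: "('o, 'f, 't, 'p, 'g, 's) two_ftor" +
  fixes \<eta> :: "'o \<Rightarrow> 'g"
  assumes component_iso: "a \<in> Cell0 C \<Longrightarrow> is_iso1 D (TObj F a) (TObj G a) (\<eta> a)"
    and natural1: "a \<in> Cell0 C \<Longrightarrow> b \<in> Cell0 C \<Longrightarrow> f \<in> Cell1 C a b \<Longrightarrow>
      hc1 D (TObj F a) (TObj F b) (TObj G b) (\<eta> b) (OMap (THom F a b) f) =
      hc1 D (TObj F a) (TObj G a) (TObj G b) (OMap (THom G a b) f) (\<eta> a)"
    and natural2: "a \<in> Cell0 C \<Longrightarrow> b \<in> Cell0 C \<Longrightarrow> \<tau> \<in> Cell2 C a b \<Longrightarrow>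
      lwh D (TObj F a) (TObj F b) (TObj G b) (\<eta> b) (AMap (THom F a b) \<tau>) =
      rwh D (TObj F a) (TObj G a) (TObj G b) (AMap (THom G a b) \<tau>) (\<eta> a)"

text \<open>2-equivalence in the strict, \<open>Cat\<close>-enriched sense (stronger than biequivalence).\<close>

definition two_equivalent :: "('o, 'f, 't) two_cat \<Rightarrow> ('p, 'g, 's) two_cat \<Rightarrow> bool" where
  "two_equivalent C D \<longleftrightarrow> two_category C \<and> two_category D \<and>
    (\<exists>F G \<eta> \<epsilon>. two_functor C D F \<and> two_functor D C G \<and>
      two_natural_iso C C id_two_ftor (comp_two_ftor G F) \<eta> \<and>
      two_natural_iso D D (comp_two_ftor F G) id_two_ftor \<epsilon>)"

text \<open>The locally full sub-2-category on the 0-cells satisfying \<open>P\<close> and the 1-cells satisfying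
  \<open>Q\<close>.\<close>

definition sub_two_cat :: "('o, 'f, 't) two_cat \<Rightarrow> ('o \<Rightarrow> bool) \<Rightarrow> ('o \<Rightarrow> 'o \<Rightarrow> 'f \<Rightarrow> bool) \<Rightarrow>
    ('o, 'f, 't) two_cat" where
  "sub_two_cat K P Q = K\<lparr>Cell0 := {a \<in> Cell0 K. P a},
     Hom := (\<lambda>a b. sub_cat (Hom K a b) (Q a b) (\<lambda>_. True))\<rparr>"

text \<open>The strict slice: 0-cells are pairs \<open>(e, p : e \<rightarrow> b)\<close>; 1-cells \<open>h\<close> from \<open>(e, p)\<close> to \<open>(e', p')\<close>
  satisfy \<open>p' \<cdot> h = p\<close>; 2-cells \<open>\<theta>\<close> satisfy \<open>1\<^bsub>p'\<^esub> * \<theta> = 1\<^sub>p\<close>.\<close>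

definition slice :: "('o, 'f, 't) two_cat \<Rightarrow> 'o \<Rightarrow> ('o \<times> 'f, 'f, 't) two_cat" where
  "slice K b = \<lparr>Cell0 = {(e, p). e \<in> Cell0 K \<and> p \<in> Cell1 K e b},
     Hom = (\<lambda>(e, p) (e', p'). sub_cat (Hom K e e')
       (\<lambda>h. hc1 K e e' b p' h = p)
       (\<lambda>\<theta>. lwh K e e' b p' \<theta> = Ide (Hom K e b) p)),
     Unit = (\<lambda>(e, p). Unit K e),
     HComp = (\<lambda>(e, p) (e', p') (e'', p''). HComp K e e' e'')\<rparr>"


section \<open>Pseudo-functors, pseudo-natural transformations, modifications\<close>

text \<open>Pseudo-functors \<open>A \<rightarrow> K\<close> from a category \<open>A\<close>, regarded as a locally discrete 2-category,
  to a 2-category \<open>K\<close>. The constraint 2-cells are \<open>PUnit F x : 1 \<Rightarrow> F 1\<^sub>x\<close> and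
  \<open>PComp F g f : F g \<cdot> F f \<Rightarrow> F (g \<cdot> f)\<close>; their naturality is vacuous because \<open>A\<close> has only
  identity 2-cells.\<close>

record ('o, 'a, 'p, 'f, 't) psfun =
  PObj :: "'o \<Rightarrow> 'p"
  PArr :: "'a \<Rightarrow> 'f"
  PUnit :: "'o \<Rightarrow> 't"
  PComp :: "'a \<Rightarrow> 'a \<Rightarrow> 't"

locale pseudofunctor =
  src: category A + trg: two_category K
  for A :: "('o, 'a) cat" and K :: "('p, 'f, 't) two_cat"
    and F :: "('o, 'a, 'p, 'f, 't) psfun" +
  assumes PObj_in: "x \<in> Obj A \<Longrightarrow> PObj F x \<in> Cell0 K"
    and PArr_in: "f \<in> arrows A x y \<Longrightarrow> PArr F f \<in> Cell1 K (PObj F x) (PObj F y)"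
    and PUnit_in: "x \<in> Obj A \<Longrightarrow> PUnit F x \<in> arrows (Hom K (PObj F x) (PObj F x))
      (Unit K (PObj F x)) (PArr F (Ide A x))"
    and PUnit_iso: "x \<in> Obj A \<Longrightarrow> is_iso (Hom K (PObj F x) (PObj F x)) (PUnit F x)"
    and PComp_in: "f \<in> arrows A x y \<Longrightarrow> g \<in> arrows A y z \<Longrightarrow>
      PComp F g f \<in> arrows (Hom K (PObj F x) (PObj F z))
        (hc1 K (PObj F x) (PObj F y) (PObj F z) (PArr F g) (PArr F f)) (PArr F (Comp A g f))"
    and PComp_iso: "f \<in> arrows A x y \<Longrightarrow> g \<in> arrows A y z \<Longrightarrow>
      is_iso (Hom K (PObj F x) (PObj F z)) (PComp F g f)"
    and PUnit_right: "f \<in> arrows A x y \<Longrightarrow>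
      Comp (Hom K (PObj F x) (PObj F y)) (PComp F f (Ide A x))
        (lwh K (PObj F x) (PObj F x) (PObj F y) (PArr F f) (PUnit F x)) =
      Ide (Hom K (PObj F x) (PObj F y)) (PArr F f)"
    and PUnit_left: "f \<in> arrows A x y \<Longrightarrow>
      Comp (Hom K (PObj F x) (PObj F y)) (PComp F (Ide A y) f)
        (rwh K (PObj F x) (PObj F y) (PObj F y) (PUnit F y) (PArr F f)) =
      Ide (Hom K (PObj F x) (PObj F y)) (PArr F f)"
    and PComp_assoc: "f \<in> arrows A w x \<Longrightarrow> g \<in> arrows A x y \<Longrightarrow> h \<in> arrows A y z \<Longrightarrow>
      Comp (Hom K (PObj F w) (PObj F z)) (PComp F (Comp A h g) f)
        (rwh K (PObj F w) (PObj F x) (PObj F z) (PComp F h g) (PArr F f)) =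
      Comp (Hom K (PObj F w) (PObj F z)) (PComp F h (Comp A g f))
        (lwh K (PObj F w) (PObj F y) (PObj F z) (PArr F h) (PComp F g f))"

definition pseudofunctors :: "('o, 'a) cat \<Rightarrow> ('p, 'f, 't) two_cat \<Rightarrow>
    ('o, 'a, 'p, 'f, 't) psfun set" where
  "pseudofunctors A K = {F. pseudofunctor A K F \<and>
     PObj F \<in> extensional (Obj A) \<and> PArr F \<in> extensional (Arr A) \<and>
     PUnit F \<in> extensional (Obj A) \<and>
     (\<forall>g f. \<not> (f \<in> Arr A \<and> g \<in> Arr A \<and> Dom A g = Cod A f) \<longrightarrow> PComp F g f = undefined)}"

text \<open>A pseudo-natural transformation \<open>\<alpha> : F \<Rightarrow> G\<close> has 1-cells \<open>PN1 \<alpha> x : F x \<rightarrow> G x\<close> and, for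
  each \<open>f : x \<rightarrow> y\<close>, an invertible 2-cell \<open>PN2 \<alpha> f : G f \<cdot> \<alpha>\<^sub>x \<Rightarrow> \<alpha>\<^sub>y \<cdot> F f\<close>.\<close>

record ('o, 'a, 'f, 't) psnat =
  PN1 :: "'o \<Rightarrow> 'f"
  PN2 :: "'a \<Rightarrow> 't"

locale pseudonatural =
  source: pseudofunctor A K F + target: pseudofunctor A K G
  for A :: "('o, 'a) cat" and K :: "('p, 'f, 't) two_cat"
    and F G :: "('o, 'a, 'p, 'f, 't) psfun" +
  fixes \<alpha> :: "('o, 'a, 'f, 't) psnat"
  assumes PN1_in: "x \<in> Obj A \<Longrightarrow> PN1 \<alpha> x \<in> Cell1 K (PObj F x) (PObj G x)"
    and PN2_in: "f \<in> arrows A x y \<Longrightarrow> PN2 \<alpha> f \<in> arrows (Hom K (PObj F x) (PObj G y))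
      (hc1 K (PObj F x) (PObj G x) (PObj G y) (PArr G f) (PN1 \<alpha> x))
      (hc1 K (PObj F x) (PObj F y) (PObj G y) (PN1 \<alpha> y) (PArr F f))"
    and PN2_iso: "f \<in> arrows A x y \<Longrightarrow> is_iso (Hom K (PObj F x) (PObj G y)) (PN2 \<alpha> f)"
    and PN2_Ide: "x \<in> Obj A \<Longrightarrow>
      Comp (Hom K (PObj F x) (PObj G x)) (PN2 \<alpha> (Ide A x))
        (rwh K (PObj F x) (PObj G x) (PObj G x) (PUnit G x) (PN1 \<alpha> x)) =
      lwh K (PObj F x) (PObj F x) (PObj G x) (PN1 \<alpha> x) (PUnit F x)"
    and PN2_Comp: "f \<in> arrows A x y \<Longrightarrow> g \<in> arrows A y z \<Longrightarrow>
      Comp (Hom K (PObj F x) (PObj G z)) (PN2 \<alpha> (Comp A g f))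
        (rwh K (PObj F x) (PObj G x) (PObj G z) (PComp G g f) (PN1 \<alpha> x)) =
      Comp (Hom K (PObj F x) (PObj G z))
        (lwh K (PObj F x) (PObj F z) (PObj G z) (PN1 \<alpha> z) (PComp F g f))
        (Comp (Hom K (PObj F x) (PObj G z))
          (rwh K (PObj F x) (PObj F y) (PObj G z) (PN2 \<alpha> g) (PArr F f))
          (lwh K (PObj F x) (PObj G y) (PObj G z) (PArr G g) (PN2 \<alpha> f)))"

definition pseudonaturals :: "('o, 'a) cat \<Rightarrow> ('p, 'f, 't) two_cat \<Rightarrow>
    ('o, 'a, 'p, 'f, 't) psfun \<Rightarrow> ('o, 'a, 'p, 'f, 't) psfun \<Rightarrow> ('o, 'a, 'f, 't) psnat set" where
  "pseudonaturals A K F G = {\<alpha>. pseudonatural A K F G \<alpha> \<and>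
     PN1 \<alpha> \<in> extensional (Obj A) \<and> PN2 \<alpha> \<in> extensional (Arr A)}"

definition id_psnat :: "('o, 'a) cat \<Rightarrow> ('p, 'f, 't) two_cat \<Rightarrow>
    ('o, 'a, 'p, 'f, 't) psfun \<Rightarrow> ('o, 'a, 'f, 't) psnat" where
  "id_psnat A K F = \<lparr>PN1 = (\<lambda>x\<in>Obj A. Unit K (PObj F x)),
     PN2 = (\<lambda>f\<in>Arr A. Ide (Hom K (PObj F (Dom A f)) (PObj F (Cod A f))) (PArr F f))\<rparr>"

text \<open>The composite of \<open>\<alpha> : F \<Rightarrow> G\<close> and \<open>\<beta> : G \<Rightarrow> H\<close> has, for \<open>f : x \<rightarrow> y\<close>, the 2-cell
  \<open>(\<beta>\<^sub>y * \<alpha>\<^sub>f) \<cdot> (\<beta>\<^sub>f * \<alpha>\<^sub>x) : H f \<cdot> \<beta>\<^sub>x \<cdot> \<alpha>\<^sub>x \<Rightarrow> \<beta>\<^sub>y \<cdot> \<alpha>\<^sub>y \<cdot> F f\<close>.\<close>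

definition comp_psnat :: "('o, 'a) cat \<Rightarrow> ('p, 'f, 't) two_cat \<Rightarrow>
    ('o, 'a, 'p, 'f, 't) psfun \<Rightarrow> ('o, 'a, 'p, 'f, 't) psfun \<Rightarrow> ('o, 'a, 'p, 'f, 't) psfun \<Rightarrow>
    ('o, 'a, 'f, 't) psnat \<Rightarrow> ('o, 'a, 'f, 't) psnat \<Rightarrow> ('o, 'a, 'f, 't) psnat" where
  "comp_psnat A K F G H \<beta> \<alpha> =
     \<lparr>PN1 = (\<lambda>x\<in>Obj A. hc1 K (PObj F x) (PObj G x) (PObj H x) (PN1 \<beta> x) (PN1 \<alpha> x)),
      PN2 = (\<lambda>f\<in>Arr A. let x = Dom A f; y = Cod A f in
        Comp (Hom K (PObj F x) (PObj H y))
          (lwh K (PObj F x) (PObj G y) (PObj H y) (PN1 \<beta> y) (PN2 \<alpha> f))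
          (rwh K (PObj F x) (PObj G x) (PObj H y) (PN2 \<beta> f) (PN1 \<alpha> x)))\<rparr>"

record ('o, 'a, 'f, 't) modif =
  MDom :: "('o, 'a, 'f, 't) psnat"
  MCod :: "('o, 'a, 'f, 't) psnat"
  MMap :: "'o \<Rightarrow> 't"

definition modifications :: "('o, 'a) cat \<Rightarrow> ('p, 'f, 't) two_cat \<Rightarrow>
    ('o, 'a, 'p, 'f, 't) psfun \<Rightarrow> ('o, 'a, 'p, 'f, 't) psfun \<Rightarrow> ('o, 'a, 'f, 't) modif set" where
  "modifications A K F G = {\<Gamma>. MDom \<Gamma> \<in> pseudonaturals A K F G \<and>
     MCod \<Gamma> \<in> pseudonaturals A K F G \<and> MMap \<Gamma> \<in> extensional (Obj A) \<and>
     (\<forall>x\<in>Obj A. MMap \<Gamma> x \<in>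
        arrows (Hom K (PObj F x) (PObj G x)) (PN1 (MDom \<Gamma>) x) (PN1 (MCod \<Gamma>) x)) \<and>
     (\<forall>x y f. f \<in> arrows A x y \<longrightarrow>
        Comp (Hom K (PObj F x) (PObj G y)) (PN2 (MCod \<Gamma>) f)
          (lwh K (PObj F x) (PObj G x) (PObj G y) (PArr G f) (MMap \<Gamma> x)) =
        Comp (Hom K (PObj F x) (PObj G y))
          (rwh K (PObj F x) (PObj F y) (PObj G y) (MMap \<Gamma> y) (PArr F f)) (PN2 (MDom \<Gamma>) f))}"

definition Psd_hom :: "('o, 'a) cat \<Rightarrow> ('p, 'f, 't) two_cat \<Rightarrow>
    ('o, 'a, 'p, 'f, 't) psfun \<Rightarrow> ('o, 'a, 'p, 'f, 't) psfun \<Rightarrow>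
    (('o, 'a, 'f, 't) psnat, ('o, 'a, 'f, 't) modif) cat" where
  "Psd_hom A K F G = \<lparr>Obj = pseudonaturals A K F G, Arr = modifications A K F G,
     Dom = MDom, Cod = MCod,
     Ide = (\<lambda>\<alpha>. \<lparr>MDom = \<alpha>, MCod = \<alpha>,
       MMap = (\<lambda>x\<in>Obj A. Ide (Hom K (PObj F x) (PObj G x)) (PN1 \<alpha> x))\<rparr>),
     Comp = (\<lambda>\<Delta> \<Gamma>. \<lparr>MDom = MDom \<Gamma>, MCod = MCod \<Delta>,
       MMap = (\<lambda>x\<in>Obj A. Comp (Hom K (PObj F x) (PObj G x)) (MMap \<Delta> x) (MMap \<Gamma> x))\<rparr>)\<rparr>"

definition hcomp_modif :: "('o, 'a) cat \<Rightarrow> ('p, 'f, 't) two_cat \<Rightarrow>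
    ('o, 'a, 'p, 'f, 't) psfun \<Rightarrow> ('o, 'a, 'p, 'f, 't) psfun \<Rightarrow> ('o, 'a, 'p, 'f, 't) psfun \<Rightarrow>
    ('o, 'a, 'f, 't) modif \<Rightarrow> ('o, 'a, 'f, 't) modif \<Rightarrow> ('o, 'a, 'f, 't) modif" where
  "hcomp_modif A K F G H \<Delta> \<Gamma> =
     \<lparr>MDom = comp_psnat A K F G H (MDom \<Delta>) (MDom \<Gamma>),
      MCod = comp_psnat A K F G H (MCod \<Delta>) (MCod \<Gamma>),
      MMap = (\<lambda>x\<in>Obj A. hc2 K (PObj F x) (PObj G x) (PObj H x) (MMap \<Delta> x) (MMap \<Gamma> x))\<rparr>"

definition Psd :: "('o, 'a) cat \<Rightarrow> ('p, 'f, 't) two_cat \<Rightarrow>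
    (('o, 'a, 'p, 'f, 't) psfun, ('o, 'a, 'f, 't) psnat, ('o, 'a, 'f, 't) modif) two_cat" where
  "Psd A K = \<lparr>Cell0 = pseudofunctors A K, Hom = Psd_hom A K, Unit = id_psnat A K,
     HComp = (\<lambda>F G H. \<lparr>OMap = (\<lambda>(\<beta>, \<alpha>). comp_psnat A K F G H \<beta> \<alpha>),
       AMap = (\<lambda>(\<Delta>, \<Gamma>). hcomp_modif A K F G H \<Delta> \<Gamma>)\<rparr>)\<rparr>"


section \<open>Small categories and fibrations\<close>

text \<open>The meaning of ``small'' is a parameter: a family \<open>U\<close> of sets over an infinite type \<open>'u\<close>,
  closed under the set formation needed to speak of small categories. Taking \<open>'u\<close> to be a
  Grothendieck universe and \<open>U\<close> its elements (viewed as subsets) gives the usual notion; taking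
  \<open>U = UNIV\<close> gives all categories carried by subsets of \<open>'u\<close>. Closure under pairing comes from
  infinitude of \<open>'u\<close> (an injection \<open>'u \<times> 'u \<rightarrow> 'u\<close>) and closure under images and unions.
  Closure under power sets is not demanded; asking for it would only restrict \<open>U\<close>.\<close>

definition universe :: "'u set set \<Rightarrow> bool" where
  "universe U \<longleftrightarrow> infinite (UNIV :: 'u set) \<and>
    (\<forall>x. {x} \<in> U) \<and>
    (\<forall>X\<in>U. \<forall>Y. Y \<subseteq> X \<longrightarrow> Y \<in> U) \<and>
    (\<forall>X\<in>U. \<forall>f :: 'u \<Rightarrow> 'u. f ` X \<in> U) \<and>
    (\<forall>I\<in>U. \<forall>X :: 'u \<Rightarrow> 'u set. (\<forall>i\<in>I. X i \<in> U) \<longrightarrow> (\<Union>i\<in>I. X i) \<in> U)"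

definition small_category :: "'u set set \<Rightarrow> ('u, 'u) cat \<Rightarrow> bool" where
  "small_category U C \<longleftrightarrow> category C \<and> Obj C \<in> U \<and> Arr C \<in> U \<and>
    Dom C \<in> extensional (Arr C) \<and> Cod C \<in> extensional (Arr C) \<and>
    Ide C \<in> extensional (Obj C) \<and>
    (\<forall>g f. \<not> (f \<in> Arr C \<and> g \<in> Arr C \<and> Dom C g = Cod C f) \<longrightarrow> Comp C g f = undefined)"

definition Cat :: "'u set set \<Rightarrow>
    (('u, 'u) cat, ('u, 'u, 'u, 'u) ftor, ('u, 'u, 'u, 'u) ntrans) two_cat" where
  "Cat U = \<lparr>Cell0 = {C. small_category U C}, Hom = functor_cat, Unit = id_ftor,
     HComp = (\<lambda>A B C. \<lparr>OMap = (\<lambda>(G, F). comp_ftor A G F),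
       AMap = (\<lambda>(\<sigma>, \<tau>). hcomp_ntrans A C \<sigma> \<tau>)\<rparr>)\<rparr>"

definition cartesian :: "('o, 'a) cat \<Rightarrow> ('p, 'b) cat \<Rightarrow> ('o, 'a, 'p, 'b) ftor \<Rightarrow> 'a \<Rightarrow> bool" where
  "cartesian E B p g \<longleftrightarrow> g \<in> Arr E \<and>
    (\<forall>g'\<in>Arr E. \<forall>h\<in>Arr B. Cod E g' = Cod E g \<longrightarrow> Cod B h = OMap p (Dom E g) \<longrightarrow>
      AMap p g' = Comp B (AMap p g) h \<longrightarrow>
      (\<exists>!k. k \<in> arrows E (Dom E g') (Dom E g) \<and> AMap p k = h \<and> g' = Comp E g k))"

definition fibration :: "('o, 'a) cat \<Rightarrow> ('p, 'b) cat \<Rightarrow> ('o, 'a, 'p, 'b) ftor \<Rightarrow> bool" where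
  "fibration E B p \<longleftrightarrow> is_functor E B p \<and>
    (\<forall>e\<in>Obj E. \<forall>f\<in>Arr B. Cod B f = OMap p e \<longrightarrow>
      (\<exists>g. cartesian E B p g \<and> Cod E g = e \<and> AMap p g = f))"

definition preserves_cartesian :: "('o, 'a) cat \<Rightarrow> ('o2, 'a2) cat \<Rightarrow> ('p, 'b) cat \<Rightarrow>
    ('o, 'a, 'p, 'b) ftor \<Rightarrow> ('o2, 'a2, 'p, 'b) ftor \<Rightarrow> ('o, 'a, 'o2, 'a2) ftor \<Rightarrow> bool" where
  "preserves_cartesian E E' B p p' H \<longleftrightarrow>
    (\<forall>g. cartesian E B p g \<longrightarrow> cartesian E' B p' (AMap H g))"

definition Fib :: "'u set set \<Rightarrow> ('u, 'u) cat \<Rightarrow>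
    (('u, 'u) cat \<times> ('u, 'u, 'u, 'u) ftor, ('u, 'u, 'u, 'u) ftor, ('u, 'u, 'u, 'u) ntrans) two_cat"
  where
  "Fib U B = sub_two_cat (slice (Cat U) B)
     (\<lambda>(E, p). fibration E B p)
     (\<lambda>(E, p) (E', p') H. preserves_cartesian E E' B p p' H)"

end

theory Submission
  imports Defs
begin

text \<open>The two sides are compared through \<^emph>\<open>presentations\<close>: a fibration \<open>E\<close> over \<open>B\<close>
  together with a pseudofunctor \<open>F\<close>, an identification of the fibres of \<open>E\<close> with the values of \<open>F\<close>,
  and a cleavage whose reindexing and coherence data are those of \<open>F\<close>. Given presentations of
  \<open>(E, F)\<close> and \<open>(E', F')\<close>, call a cartesian functor \<open>H\<close> and a pseudonatural transformation \<open>\<alpha>\<close>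
  related if \<open>H\<close> restricts to \<open>\<alpha>\<^sub>x\<close> on the fibre over \<open>x\<close> and \<open>\<alpha>\<^sub>f\<close> compares the chosen lift of \<open>f\<close>
  with the image under \<open>H\<close> of the chosen lift. Since every arrow of \<open>E\<close> is uniquely a vertical arrow
  followed by a chosen lift, this is a bijection compatible with all compositions, and likewise for
  2-cells; the coherence equations on the side of \<open>F\<close> all follow by cancelling cartesian arrows. As
  every fibration (by choosing a cleavage) and every pseudofunctor (by the Grothendieck construction)
  has a presentation, choosing presentations gives 2-functors in both directions, and the identities
  of the other leg lift to strictly invertible units and counits. In the same way \<open>Psd\<close> inherits the
  axioms of a 2-category from \<open>Fib\<close>.\<close>

text \<open>The passage from a fibration to a pseudofunctor depends on a cleavage, which cartesian
  functors need not respect, and explicit formulas for both 2-functors would have to be compared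
  with the identities by running through the coherence laws once per composite. With a relation,
  strict functoriality of the chosen partners follows from their uniqueness, and the failure of a
  functor to respect the cleavages is exactly the datum \<open>PN2\<close>. Partners of 1-cells are
  unique on the nose and not only up to isomorphism; this is what makes the equivalence strict. The
  fibres are identified with the values of \<open>F\<close> by arbitrary bijections because the two
  sources of presentations differ: with a cleavage these are identities, but in the Grothendieck
  construction an arrow of a fibre must be composed with the unit constraint before it lies over an
  identity of \<open>B\<close>. The total category has to be built inside the same type as its base,
  by coding pairs; this uses infinitude of the type and closure of \<open>U\<close> under images and
  unions.\<close>

abbreviation comp_in :: "'a \<Rightarrow> ('o, 'a) cat \<Rightarrow> 'a \<Rightarrow> 'a" ("_ \<cdot>[_]/ _" [66, 0, 65] 65) where
  "g \<cdot>[C] f \<equiv> Comp C g f"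

section \<open>Categories and functors in terms of domains and codomains\<close>

lemma arrows_iff: "f \<in> arrows C x y \<longleftrightarrow> f \<in> Arr C \<and> Dom C f = x \<and> Cod C f = y"
  by (simp add: arrows_def)

lemma categoryI:
  assumes "\<And>f. f \<in> Arr C \<Longrightarrow> Dom C f \<in> Obj C" "\<And>f. f \<in> Arr C \<Longrightarrow> Cod C f \<in> Obj C"
    and "\<And>x. x \<in> Obj C \<Longrightarrow> Ide C x \<in> Arr C" "\<And>x. x \<in> Obj C \<Longrightarrow> Dom C (Ide C x) = x"
      "\<And>x. x \<in> Obj C \<Longrightarrow> Cod C (Ide C x) = x"
    and "\<And>f g. f \<in> Arr C \<Longrightarrow> g \<in> Arr C \<Longrightarrow> Dom C g = Cod C f \<Longrightarrow> g \<cdot>[C] f \<in> Arr C"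
      "\<And>f g. f \<in> Arr C \<Longrightarrow> g \<in> Arr C \<Longrightarrow> Dom C g = Cod C f \<Longrightarrow> Dom C (g \<cdot>[C] f) = Dom C f"
      "\<And>f g. f \<in> Arr C \<Longrightarrow> g \<in> Arr C \<Longrightarrow> Dom C g = Cod C f \<Longrightarrow> Cod C (g \<cdot>[C] f) = Cod C g"
    and "\<And>f. f \<in> Arr C \<Longrightarrow> f \<cdot>[C] Ide C (Dom C f) = f"
      "\<And>f. f \<in> Arr C \<Longrightarrow> Ide C (Cod C f) \<cdot>[C] f = f"
    and "\<And>f g h. f \<in> Arr C \<Longrightarrow> g \<in> Arr C \<Longrightarrow> h \<in> Arr C \<Longrightarrow> Dom C g = Cod C f \<Longrightarrow>
      Dom C h = Cod C g \<Longrightarrow> (h \<cdot>[C] g) \<cdot>[C] f = h \<cdot>[C] (g \<cdot>[C] f)"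
  shows "category C"
  by unfold_locales (use assms in \<open>auto simp: arrows_iff\<close>)

text \<open>Composability is an equation between \<open>Dom\<close> and \<open>Cod\<close>, so the
  side conditions of these rules are again goals for the simplifier. Composites are normalised to
  the right; the identity laws take the object as a separate variable \<open>x\<close>, so that they
  also fire when it is only provably equal to the domain or codomain.\<close>

lemma
  assumes "category C"
  shows Dom_Obj [simp]: "f \<in> Arr C \<Longrightarrow> Dom C f \<in> Obj C"
    and Cod_Obj [simp]: "f \<in> Arr C \<Longrightarrow> Cod C f \<in> Obj C"
    and Ide_Arr [simp]: "x \<in> Obj C \<Longrightarrow> Ide C x \<in> Arr C"
    and Dom_Ide [simp]: "x \<in> Obj C \<Longrightarrow> Dom C (Ide C x) = x"
    and Cod_Ide [simp]: "x \<in> Obj C \<Longrightarrow> Cod C (Ide C x) = x"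
    and Comp_Arr [simp]: "f \<in> Arr C \<Longrightarrow> g \<in> Arr C \<Longrightarrow> Dom C g = Cod C f \<Longrightarrow> g \<cdot>[C] f \<in> Arr C"
    and Dom_Comp [simp]: "f \<in> Arr C \<Longrightarrow> g \<in> Arr C \<Longrightarrow> Dom C g = Cod C f \<Longrightarrow>
      Dom C (g \<cdot>[C] f) = Dom C f"
    and Cod_Comp [simp]: "f \<in> Arr C \<Longrightarrow> g \<in> Arr C \<Longrightarrow> Dom C g = Cod C f \<Longrightarrow>
      Cod C (g \<cdot>[C] f) = Cod C g"
    and Comp_Ide_r [simp]: "f \<in> Arr C \<Longrightarrow> x = Dom C f \<Longrightarrow> f \<cdot>[C] Ide C x = f"
    and Comp_Ide_l [simp]: "f \<in> Arr C \<Longrightarrow> x = Cod C f \<Longrightarrow> Ide C x \<cdot>[C] f = f"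
    and Comp_assoc' [simp]: "f \<in> Arr C \<Longrightarrow> g \<in> Arr C \<Longrightarrow> h \<in> Arr C \<Longrightarrow> Dom C g = Cod C f \<Longrightarrow>
      Dom C h = Cod C g \<Longrightarrow> (h \<cdot>[C] g) \<cdot>[C] f = h \<cdot>[C] (g \<cdot>[C] f)"
proof -
  interpret category C by fact
  show "f \<in> Arr C \<Longrightarrow> Dom C f \<in> Obj C" "f \<in> Arr C \<Longrightarrow> Cod C f \<in> Obj C"
    by (simp_all add: Dom_in Cod_in)
  show "x \<in> Obj C \<Longrightarrow> Ide C x \<in> Arr C" "x \<in> Obj C \<Longrightarrow> Dom C (Ide C x) = x"
    "x \<in> Obj C \<Longrightarrow> Cod C (Ide C x) = x"
    using Ide_in by (auto simp: arrows_iff)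
  show "f \<in> Arr C \<Longrightarrow> g \<in> Arr C \<Longrightarrow> Dom C g = Cod C f \<Longrightarrow> g \<cdot>[C] f \<in> Arr C"
    "f \<in> Arr C \<Longrightarrow> g \<in> Arr C \<Longrightarrow> Dom C g = Cod C f \<Longrightarrow> Dom C (g \<cdot>[C] f) = Dom C f"
    "f \<in> Arr C \<Longrightarrow> g \<in> Arr C \<Longrightarrow> Dom C g = Cod C f \<Longrightarrow> Cod C (g \<cdot>[C] f) = Cod C g"
    using Comp_in by (auto simp: arrows_iff)
  show "f \<in> Arr C \<Longrightarrow> x = Dom C f \<Longrightarrow> f \<cdot>[C] Ide C x = f"
    "f \<in> Arr C \<Longrightarrow> x = Cod C f \<Longrightarrow> Ide C x \<cdot>[C] f = f"
    using Comp_Ide_right Comp_Ide_left by (auto simp: arrows_iff)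
  show "f \<in> Arr C \<Longrightarrow> g \<in> Arr C \<Longrightarrow> h \<in> Arr C \<Longrightarrow> Dom C g = Cod C f \<Longrightarrow>
      Dom C h = Cod C g \<Longrightarrow> (h \<cdot>[C] g) \<cdot>[C] f = h \<cdot>[C] (g \<cdot>[C] f)"
    using Comp_assoc by (auto simp: arrows_iff)
qed

lemma category_op: "category C \<Longrightarrow> category (op_cat C)"
  by (rule categoryI) (auto simp: op_cat_def)

lemma category_prod: "category C \<Longrightarrow> category D \<Longrightarrow> category (prod_cat C D)"
  by (rule categoryI) (auto simp: prod_cat_def)

lemma is_functorI:
  assumes "category A" "category B"
    and "\<And>x. x \<in> Obj A \<Longrightarrow> OMap F x \<in> Obj B"
    and "\<And>f. f \<in> Arr A \<Longrightarrow> AMap F f \<in> Arr B"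
    and "\<And>f. f \<in> Arr A \<Longrightarrow> Dom B (AMap F f) = OMap F (Dom A f)"
    and "\<And>f. f \<in> Arr A \<Longrightarrow> Cod B (AMap F f) = OMap F (Cod A f)"
    and "\<And>x. x \<in> Obj A \<Longrightarrow> AMap F (Ide A x) = Ide B (OMap F x)"
    and "\<And>f g. f \<in> Arr A \<Longrightarrow> g \<in> Arr A \<Longrightarrow> Dom A g = Cod A f \<Longrightarrow>
      AMap F (g \<cdot>[A] f) = AMap F g \<cdot>[B] AMap F f"
  shows "is_functor A B F"
  using assms by (auto simp: is_functor_def is_functor_axioms_def arrows_iff)

lemma is_functorD:
  assumes "is_functor A B F"
  shows "category A" "category B"
    and "x \<in> Obj A \<Longrightarrow> OMap F x \<in> Obj B"
    and "f \<in> Arr A \<Longrightarrow> AMap F f \<in> Arr B"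
    and "f \<in> Arr A \<Longrightarrow> Dom B (AMap F f) = OMap F (Dom A f)"
    and "f \<in> Arr A \<Longrightarrow> Cod B (AMap F f) = OMap F (Cod A f)"
    and "x \<in> Obj A \<Longrightarrow> AMap F (Ide A x) = Ide B (OMap F x)"
    and "f \<in> Arr A \<Longrightarrow> g \<in> Arr A \<Longrightarrow> Dom A g = Cod A f \<Longrightarrow>
      AMap F (g \<cdot>[A] f) = AMap F g \<cdot>[B] AMap F f"
  using assms by (auto simp: is_functor_def is_functor_axioms_def arrows_iff)

lemma functorsD:
  assumes "F \<in> functors A B"
  shows "category A" "category B"
    and "x \<in> Obj A \<Longrightarrow> OMap F x \<in> Obj B"
    and "f \<in> Arr A \<Longrightarrow> AMap F f \<in> Arr B"
    and "f \<in> Arr A \<Longrightarrow> Dom B (AMap F f) = OMap F (Dom A f)"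
    and "f \<in> Arr A \<Longrightarrow> Cod B (AMap F f) = OMap F (Cod A f)"
    and "x \<in> Obj A \<Longrightarrow> AMap F (Ide A x) = Ide B (OMap F x)"
    and "f \<in> Arr A \<Longrightarrow> g \<in> Arr A \<Longrightarrow> Dom A g = Cod A f \<Longrightarrow>
      AMap F (g \<cdot>[A] f) = AMap F g \<cdot>[B] AMap F f"
    and "OMap F \<in> extensional (Obj A)" "AMap F \<in> extensional (Arr A)"
  using is_functorD[of A B F] assms by (auto simp: functors_def)

text \<open>Rests on \<open>functors\<close> fixing the values outside the carriers. The two
  codomains may differ because a functor record does not store them.\<close>

lemma functors_eqI:
  assumes "F \<in> functors A B" "G \<in> functors A B'"
    and "\<And>x. x \<in> Obj A \<Longrightarrow> OMap F x = OMap G x" "\<And>f. f \<in> Arr A \<Longrightarrow> AMap F f = AMap G f"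
  shows "F = G"
proof -
  have "OMap F = OMap G" "AMap F = AMap G"
    using assms functorsD(9,10)[OF assms(1)] functorsD(9,10)[OF assms(2)]
    by (auto intro: extensionalityI)
  then show ?thesis by simp
qed

lemma id_ftor_in: "category A \<Longrightarrow> id_ftor A \<in> functors A A"
  by (auto simp: functors_def id_ftor_def intro!: is_functorI)

lemma comp_ftor_in:
  assumes "F \<in> functors A B" "G \<in> functors B C"
  shows "comp_ftor A G F \<in> functors A C"
  using functorsD(1-8)[OF assms(1)] functorsD(1-8)[OF assms(2)]
  by (auto simp: functors_def comp_ftor_def intro!: is_functorI)

lemma OMap_id_ftor [simp]: "x \<in> Obj A \<Longrightarrow> OMap (id_ftor A) x = x"
  and AMap_id_ftor [simp]: "f \<in> Arr A \<Longrightarrow> AMap (id_ftor A) f = f"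
  and OMap_comp_ftor [simp]: "x \<in> Obj A \<Longrightarrow> OMap (comp_ftor A G F) x = OMap G (OMap F x)"
  and AMap_comp_ftor [simp]: "f \<in> Arr A \<Longrightarrow> AMap (comp_ftor A G F) f = AMap G (AMap F f)"
  by (auto simp: id_ftor_def comp_ftor_def)

lemma ntransesD:
  assumes "\<tau> \<in> ntranses A B"
  shows "NDom \<tau> \<in> functors A B" "NCod \<tau> \<in> functors A B" "NMap \<tau> \<in> extensional (Obj A)"
    and "x \<in> Obj A \<Longrightarrow> NMap \<tau> x \<in> Arr B" "x \<in> Obj A \<Longrightarrow> Dom B (NMap \<tau> x) = OMap (NDom \<tau>) x"
      "x \<in> Obj A \<Longrightarrow> Cod B (NMap \<tau> x) = OMap (NCod \<tau>) x"
    and "f \<in> Arr A \<Longrightarrow> NMap \<tau> (Cod A f) \<cdot>[B] AMap (NDom \<tau>) f =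
        AMap (NCod \<tau>) f \<cdot>[B] NMap \<tau> (Dom A f)"
  using assms by (auto simp: ntranses_def arrows_iff)

lemma ntransesI:
  assumes "NDom \<tau> \<in> functors A B" "NCod \<tau> \<in> functors A B" "NMap \<tau> \<in> extensional (Obj A)"
    and "\<And>x. x \<in> Obj A \<Longrightarrow> NMap \<tau> x \<in> Arr B"
      "\<And>x. x \<in> Obj A \<Longrightarrow> Dom B (NMap \<tau> x) = OMap (NDom \<tau>) x"
      "\<And>x. x \<in> Obj A \<Longrightarrow> Cod B (NMap \<tau> x) = OMap (NCod \<tau>) x"
    and "\<And>f. f \<in> Arr A \<Longrightarrow> NMap \<tau> (Cod A f) \<cdot>[B] AMap (NDom \<tau>) f =
        AMap (NCod \<tau>) f \<cdot>[B] NMap \<tau> (Dom A f)"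
  shows "\<tau> \<in> ntranses A B"
  using assms by (auto simp: ntranses_def arrows_iff)

lemma ntrans_eqI:
  fixes \<sigma> \<tau> :: "('o, 'a, 'p, 'b) ntrans"
  assumes "NDom \<sigma> = NDom \<tau>" "NCod \<sigma> = NCod \<tau>"
    and "NMap \<sigma> \<in> extensional X" "NMap \<tau> \<in> extensional X"
    and "\<And>x. x \<in> X \<Longrightarrow> NMap \<sigma> x = NMap \<tau> x"
  shows "\<sigma> = \<tau>"
  using assms extensionalityI[of "NMap \<sigma>" X "NMap \<tau>"] by (intro ntrans.equality) auto

lemma functor_cat_simps [simp]:
  "Obj (functor_cat A B) = functors A B" "Arr (functor_cat A B) = ntranses A B"
  "Dom (functor_cat A B) = NDom" "Cod (functor_cat A B) = NCod"
  "NDom (Ide (functor_cat A B) F) = F" "NCod (Ide (functor_cat A B) F) = F"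
  "NMap (Ide (functor_cat A B) F) = (\<lambda>x\<in>Obj A. Ide B (OMap F x))"
  "NDom (\<sigma> \<cdot>[functor_cat A B] \<tau>) = NDom \<tau>" "NCod (\<sigma> \<cdot>[functor_cat A B] \<tau>) = NCod \<sigma>"
  "NMap (\<sigma> \<cdot>[functor_cat A B] \<tau>) = (\<lambda>x\<in>Obj A. NMap \<sigma> x \<cdot>[B] NMap \<tau> x)"
  by (simp_all add: functor_cat_def)

lemma category_functor_cat:
  assumes A: "category A" and B: "category B"
  shows "category (functor_cat A B)"
proof (rule categoryI)
  fix F assume "F \<in> Obj (functor_cat A B)"
  then have F: "F \<in> functors A B" by simp
  note D = functorsD(1-8)[OF F]
  have "Ide (functor_cat A B) F \<in> ntranses A B"
    by (rule ntransesI) (use F D in auto)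
  then show "Ide (functor_cat A B) F \<in> Arr (functor_cat A B)" by simp
next
  fix \<sigma> \<tau>
  assume "\<tau> \<in> Arr (functor_cat A B)" "\<sigma> \<in> Arr (functor_cat A B)"
    and "Dom (functor_cat A B) \<sigma> = Cod (functor_cat A B) \<tau>"
  then have s: "\<sigma> \<in> ntranses A B" and t: "\<tau> \<in> ntranses A B" and eq: "NDom \<sigma> = NCod \<tau>"
    by simp_all
  note S = ntransesD[OF s] and T = ntransesD[OF t]
  note D1 = functorsD(3-6)[OF T(1)] and D2 = functorsD(3-6)[OF T(2)] and D3 =
    functorsD(3-6)[OF S(2)]
  have "\<sigma> \<cdot>[functor_cat A B] \<tau> \<in> ntranses A B"
  proof (rule ntransesI)
    fix f assume f: "f \<in> Arr A"
    let ?x = "Dom A f" and ?y = "Cod A f"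
    \<comment> \<open>Paste the naturality squares of the two factors along the middle
      functor.\<close>
    have "(NMap \<sigma> ?y \<cdot>[B] NMap \<tau> ?y) \<cdot>[B] AMap (NDom \<tau>) f = NMap \<sigma> ?y \<cdot>[B] (AMap (NCod \<tau>) f \<cdot>[B]
      NMap \<tau> ?x)"
      using f A B S(3-6) T(3-7) D1 eq by simp
    also have "\<dots> = (NMap \<sigma> ?y \<cdot>[B] AMap (NDom \<sigma>) f) \<cdot>[B] NMap \<tau> ?x"
      using f A B S(3-6) T(3-6) D1 D2 eq by simp
    also have "\<dots> = AMap (NCod \<sigma>) f \<cdot>[B] (NMap \<sigma> ?x \<cdot>[B] NMap \<tau> ?x)"
      using f A B S(3-7) T(3-6) D2 D3 eq by simp
    finally show "NMap (\<sigma> \<cdot>[functor_cat A B] \<tau>) (Cod A f) \<cdot>[B] AMap (NDom (\<sigma> \<cdot>[functor_cat A B]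
      \<tau>)) f =
        AMap (NCod (\<sigma> \<cdot>[functor_cat A B] \<tau>)) f \<cdot>[B] NMap (\<sigma> \<cdot>[functor_cat A B] \<tau>) (Dom A f)"
      using f A by simp
  qed (use A B S T eq in auto)
  then show "\<sigma> \<cdot>[functor_cat A B] \<tau> \<in> Arr (functor_cat A B)" by simp
next
  fix \<tau> assume "\<tau> \<in> Arr (functor_cat A B)"
  then have t: "\<tau> \<in> ntranses A B" by simp
  note T = ntransesD[OF t]
  note D1 = functorsD(3-6)[OF T(1)] and D2 = functorsD(3-6)[OF T(2)]
  show "\<tau> \<cdot>[functor_cat A B] Ide (functor_cat A B) (Dom (functor_cat A B) \<tau>) = \<tau>"
    by (rule ntrans_eqI[where X = "Obj A"]) (use T(3-6) D1 D2 B in auto)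
  show "Ide (functor_cat A B) (Cod (functor_cat A B) \<tau>) \<cdot>[functor_cat A B] \<tau> = \<tau>"
    by (rule ntrans_eqI[where X = "Obj A"]) (use T(3-6) D1 D2 B in auto)
next
  fix \<rho> \<sigma> \<tau>
  assume "\<rho> \<in> Arr (functor_cat A B)" "\<sigma> \<in> Arr (functor_cat A B)" "\<tau> \<in> Arr (functor_cat A B)"
    "Dom (functor_cat A B) \<sigma> = Cod (functor_cat A B) \<rho>" "Dom (functor_cat A B) \<tau> =
      Cod (functor_cat A B) \<sigma>"
  then show "(\<tau> \<cdot>[functor_cat A B] \<sigma>) \<cdot>[functor_cat A B] \<rho> = \<tau> \<cdot>[functor_cat A B] (\<sigma> \<cdot>[functor_cat A
    B] \<rho>)"
    using ntransesD(4-6)[of \<rho> A B] ntransesD(4-6)[of \<sigma> A B] ntransesD(4-6)[of \<tau> A B] B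
    by (intro ntrans_eqI[where X = "Obj A"]) auto
qed (auto dest: ntransesD)

section \<open>The 2-category of small categories\<close>

lemma small_categoryD: "small_category U C \<Longrightarrow> category C"
  by (simp add: small_category_def)

lemma hcomp_ntrans_simps [simp]:
  "NDom (hcomp_ntrans A C \<sigma> \<tau>) = comp_ftor A (NDom \<sigma>) (NDom \<tau>)"
  "NCod (hcomp_ntrans A C \<sigma> \<tau>) = comp_ftor A (NCod \<sigma>) (NCod \<tau>)"
  "NMap (hcomp_ntrans A C \<sigma> \<tau>) =
     (\<lambda>x\<in>Obj A. NMap \<sigma> (OMap (NCod \<tau>) x) \<cdot>[C] AMap (NDom \<sigma>) (NMap \<tau> x))"
  by (simp_all add: hcomp_ntrans_def)

lemma hcomp_ntrans_in:
  assumes t: "\<tau> \<in> ntranses A B" and s: "\<sigma> \<in> ntranses B C"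
  shows "hcomp_ntrans A C \<sigma> \<tau> \<in> ntranses A C"
proof -
  note S = ntransesD[OF s] and T = ntransesD[OF t]
  note D1 = functorsD(1-8)[OF T(1)] and D2 = functorsD(1-8)[OF T(2)]
    and E1 = functorsD(1-8)[OF S(1)] and E2 = functorsD(1-8)[OF S(2)]
  show ?thesis
  proof (rule ntransesI)
    fix f assume f: "f \<in> Arr A"
    let ?x = "Dom A f" and ?y = "Cod A f"
    let ?F = "NDom \<tau>" and ?F' = "NCod \<tau>" and ?G = "NDom \<sigma>" and ?G' = "NCod \<sigma>"
    have [simp]: "category A" "category B" "category C" using D1 E1 by auto
    \<comment> \<open>Naturality of \<open>\<tau>\<close> is used inside the functor
      \<open>?G\<close>, then naturality of \<open>\<sigma>\<close> at the arrow
      \<open>AMap ?F' f\<close>.\<close>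
    have "(NMap \<sigma> (OMap ?F' ?y) \<cdot>[C] AMap ?G (NMap \<tau> ?y)) \<cdot>[C] AMap ?G (AMap ?F f) =
        NMap \<sigma> (OMap ?F' ?y) \<cdot>[C] AMap ?G (NMap \<tau> ?y \<cdot>[B] AMap ?F f)"
      using f S(4-6) T(4-6) D1(3-6) D2(3-6) E1(3-8) by simp
    also have "\<dots> = NMap \<sigma> (OMap ?F' ?y) \<cdot>[C] AMap ?G (AMap ?F' f \<cdot>[B] NMap \<tau> ?x)"
      using T(7)[OF f] by simp
    also have "\<dots> = (NMap \<sigma> (OMap ?F' ?y) \<cdot>[C] AMap ?G (AMap ?F' f)) \<cdot>[C] AMap ?G (NMap \<tau> ?x)"
      using f S(4-6) T(4-6) D1(3-6) D2(3-6) E1(3-8) by simp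
    also have "\<dots> = (AMap ?G' (AMap ?F' f) \<cdot>[C] NMap \<sigma> (OMap ?F' ?x)) \<cdot>[C] AMap ?G (NMap \<tau> ?x)"
      using S(7)[of "AMap ?F' f"] D2(3-6) f by simp
    also have "\<dots> = AMap ?G' (AMap ?F' f) \<cdot>[C] (NMap \<sigma> (OMap ?F' ?x) \<cdot>[C] AMap ?G (NMap \<tau> ?x))"
      using f S(4-6) T(4-6) D1(3-6) D2(3-6) E1(3-8) E2(3-8) by simp
    finally show "NMap (hcomp_ntrans A C \<sigma> \<tau>) (Cod A f) \<cdot>[C] AMap (NDom (hcomp_ntrans A C \<sigma> \<tau>)) f =
        AMap (NCod (hcomp_ntrans A C \<sigma> \<tau>)) f \<cdot>[C] NMap (hcomp_ntrans A C \<sigma> \<tau>) (Dom A f)"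
      using f by simp
  qed (use S(1-6) T(1-6) D1(1-6) D2(1-6) E1(1-6) E2(1-6) in \<open>auto intro: comp_ftor_in\<close>)
qed

lemma Cat_simps [simp]:
  "Cell0 (Cat U) = {C. small_category U C}" "Hom (Cat U) = functor_cat" "Unit (Cat U) = id_ftor"
  "hc1 (Cat U) A B C G F = comp_ftor A G F" "hc2 (Cat U) A B C \<sigma> \<tau> = hcomp_ntrans A C \<sigma> \<tau>"
  "lwh (Cat U) A B C G \<tau> = hcomp_ntrans A C (Ide (functor_cat B C) G) \<tau>"
  "rwh (Cat U) A B C \<sigma> F = hcomp_ntrans A C \<sigma> (Ide (functor_cat A B) F)"
  by (simp_all add: Cat_def hc1_def hc2_def lwh_def rwh_def)

lemma hcomp_functor:
  assumes A: "category A" and B: "category B" and C: "category C"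
  shows "is_functor (prod_cat (functor_cat B C) (functor_cat A B)) (functor_cat A C)
     \<lparr>OMap = (\<lambda>(G, F). comp_ftor A G F), AMap = (\<lambda>(\<sigma>, \<tau>). hcomp_ntrans A C \<sigma> \<tau>)\<rparr>"
proof (rule is_functorI[OF category_prod[OF category_functor_cat[OF B C] category_functor_cat[OF A
  B]]
      category_functor_cat[OF A C]])
  fix z assume "z \<in> Obj (prod_cat (functor_cat B C) (functor_cat A B))"
  then obtain G F where z: "z = (G, F)" and G: "G \<in> functors B C" and F: "F \<in> functors A B"
    by (auto simp: prod_cat_def)
  note f = functorsD(1-8)[OF F] and g = functorsD(1-8)[OF G]
  show "AMap \<lparr>OMap = (\<lambda>(G, F). comp_ftor A G F), AMap = (\<lambda>(\<sigma>, \<tau>). hcomp_ntrans A C \<sigma> \<tau>)\<rparr> (Ide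
    (prod_cat (functor_cat B C) (functor_cat A B)) z) =
      Ide (functor_cat A C) (OMap \<lparr>OMap = (\<lambda>(G, F). comp_ftor A G F), AMap =
        (\<lambda>(\<sigma>, \<tau>). hcomp_ntrans A C \<sigma> \<tau>)\<rparr> z)"
    by (simp add: z prod_cat_def, rule ntrans_eqI[where X = "Obj A"]) (use f g in auto)
next
  fix z w assume "z \<in> Arr (prod_cat (functor_cat B C) (functor_cat A B))"
    "w \<in> Arr (prod_cat (functor_cat B C) (functor_cat A B))"
    "Dom (prod_cat (functor_cat B C) (functor_cat A B)) w = Cod (prod_cat (functor_cat B C)
      (functor_cat A B)) z"
  then obtain \<sigma> \<tau> \<sigma>' \<tau>' where z: "z = (\<sigma>, \<tau>)" and w: "w = (\<sigma>', \<tau>')"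
    and s: "\<sigma> \<in> ntranses B C" and t: "\<tau> \<in> ntranses A B" and s': "\<sigma>' \<in> ntranses B C" and t':
      "\<tau>' \<in> ntranses A B"
    and eq: "NDom \<sigma>' = NCod \<sigma>" "NDom \<tau>' = NCod \<tau>"
    by (cases z, cases w) (auto simp: prod_cat_def)
  note S = ntransesD[OF s] and T = ntransesD[OF t] and S' = ntransesD[OF s'] and T' =
    ntransesD[OF t']
  have "hcomp_ntrans A C (\<sigma>' \<cdot>[functor_cat B C] \<sigma>) (\<tau>' \<cdot>[functor_cat A B] \<tau>) =
     hcomp_ntrans A C \<sigma>' \<tau>' \<cdot>[functor_cat A C] hcomp_ntrans A C \<sigma> \<tau>"
  proof (rule ntrans_eqI[where X = "Obj A"])
    fix x assume x: "x \<in> Obj A"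
    let ?G = "NDom \<sigma>" and ?G' = "NCod \<sigma>"
    have o: "OMap (NCod \<tau>) x \<in> Obj B" "OMap (NCod \<tau>') x \<in> Obj B"
      using functorsD(3)[OF T(2) x] functorsD(3)[OF T'(2) x] by auto
    \<comment> \<open>The interchange law: the only move that is not formal is naturality of
      \<open>\<sigma>\<close> at the component of \<open>\<tau>'\<close>, which swaps the two middle
      factors.\<close>
    have "NMap \<sigma>' (OMap (NCod \<tau>') x) \<cdot>[C] NMap \<sigma> (OMap (NCod \<tau>') x) \<cdot>[C] AMap ?G (NMap \<tau>' x) \<cdot>[C]
      AMap ?G (NMap \<tau> x)
      = NMap \<sigma>' (OMap (NCod \<tau>') x) \<cdot>[C] (NMap \<sigma> (OMap (NCod \<tau>') x) \<cdot>[C] AMap ?G (NMap \<tau>' x)) \<cdot>[C]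
        AMap ?G (NMap \<tau> x)"
      using x o A B C eq S(4-6) T(4-6) T'(4-6) functorsD(3-6)[OF S(1)] by simp
    also have "\<dots> = NMap \<sigma>' (OMap (NCod \<tau>') x) \<cdot>[C] (AMap ?G' (NMap \<tau>' x) \<cdot>[C] NMap \<sigma> (OMap (NCod \<tau>)
      x)) \<cdot>[C] AMap ?G (NMap \<tau> x)"
      using S(7)[OF T'(4)[OF x]] x T'(5,6) eq by simp
    finally have "NMap \<sigma>' (OMap (NCod \<tau>') x) \<cdot>[C] NMap \<sigma> (OMap (NCod \<tau>') x) \<cdot>[C] AMap ?G (NMap \<tau>' x)
      \<cdot>[C] AMap ?G (NMap \<tau> x)
      = NMap \<sigma>' (OMap (NCod \<tau>') x) \<cdot>[C] (AMap ?G' (NMap \<tau>' x) \<cdot>[C] NMap \<sigma> (OMap (NCod \<tau>) x)) \<cdot>[C]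
        AMap ?G (NMap \<tau> x)" .
    then show "NMap (hcomp_ntrans A C (\<sigma>' \<cdot>[functor_cat B C] \<sigma>) (\<tau>' \<cdot>[functor_cat A B] \<tau>)) x =
      NMap (hcomp_ntrans A C \<sigma>' \<tau>' \<cdot>[functor_cat A C] hcomp_ntrans A C \<sigma> \<tau>) x"
      using x o A B C eq S(4-6) T(4-6) S'(4-6) T'(4-6) functorsD(3-8)[OF S(1)] functorsD(3-8)[OF
        S(2)]
      by simp
  qed auto
  then show "AMap \<lparr>OMap = (\<lambda>(G, F). comp_ftor A G F), AMap = (\<lambda>(\<sigma>, \<tau>). hcomp_ntrans A C \<sigma> \<tau>)\<rparr> (w
    \<cdot>[prod_cat (functor_cat B C) (functor_cat A B)] z) =
    AMap \<lparr>OMap = (\<lambda>(G, F). comp_ftor A G F), AMap = (\<lambda>(\<sigma>, \<tau>). hcomp_ntrans A C \<sigma> \<tau>)\<rparr> w \<cdot>[functor_cat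
      A C]
    AMap \<lparr>OMap = (\<lambda>(G, F). comp_ftor A G F), AMap = (\<lambda>(\<sigma>, \<tau>). hcomp_ntrans A C \<sigma> \<tau>)\<rparr> z"
    by (simp add: z w prod_cat_def)
qed (use assms in \<open>auto simp: prod_cat_def intro: comp_ftor_in hcomp_ntrans_in\<close>)

lemma comp_ftor_id_right: "F \<in> functors A B \<Longrightarrow> comp_ftor A F (id_ftor A) = F"
  using comp_ftor_in[OF id_ftor_in[of A], of F B] functorsD(1)[of F A B]
  by (intro functors_eqI[of _ A B F B]) auto

lemma comp_ftor_id_left: "F \<in> functors A B \<Longrightarrow> comp_ftor A (id_ftor B) F = F"
  using comp_ftor_in[OF _ id_ftor_in[of B], of F A] functorsD[of F A B]
  by (intro functors_eqI[of _ A B F B]) auto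

lemma comp_ftor_assoc:
  "F \<in> functors A B \<Longrightarrow> G \<in> functors B C \<Longrightarrow> H \<in> functors C D \<Longrightarrow>
    comp_ftor A (comp_ftor B H G) F = comp_ftor A H (comp_ftor A G F)"
  using comp_ftor_in[OF comp_ftor_in[of F A B G C], of H D] comp_ftor_in[OF _ comp_ftor_in[of G B C
    H D], of F A]
    functorsD[of F A B]
  by (intro functors_eqI[of _ A D _ D]) auto

lemma two_category_Cat: "two_category (Cat U)"
proof (rule two_category.intro)
  fix A B assume "A \<in> Cell0 (Cat U)" "B \<in> Cell0 (Cat U)"
  then have A: "category A" and B: "category B" by (auto dest: small_categoryD)
  show "category (Hom (Cat U) A B)" using A B by (simp add: category_functor_cat)
next
  fix A B F assume "A \<in> Cell0 (Cat U)" "B \<in> Cell0 (Cat U)" "F \<in> Cell1 (Cat U) A B"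
  then show "hc1 (Cat U) A A B F (Unit (Cat U) A) = F" "hc1 (Cat U) A B B (Unit (Cat U) B) F = F"
    by (simp_all add: comp_ftor_id_left comp_ftor_id_right)
next
  fix A assume "A \<in> Cell0 (Cat U)"
  then show "Unit (Cat U) A \<in> Cell1 (Cat U) A A"
    by (auto dest: small_categoryD intro: id_ftor_in)
next
  fix A B C assume "A \<in> Cell0 (Cat U)" "B \<in> Cell0 (Cat U)" "C \<in> Cell0 (Cat U)"
  then have "category A" "category B" "category C" by (auto dest: small_categoryD)
  then show "is_functor (prod_cat (Hom (Cat U) B C) (Hom (Cat U) A B)) (Hom (Cat U) A C) (HComp (Cat
    U) A B C)"
    using hcomp_functor by (simp add: Cat_def)
next
  fix A B \<tau> assume "A \<in> Cell0 (Cat U)" "B \<in> Cell0 (Cat U)" "\<tau> \<in> Cell2 (Cat U) A B"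
  then have [simp]: "category A" "category B" and t: "\<tau> \<in> ntranses A B"
    by (auto dest: small_categoryD)
  note T = ntransesD[OF t]
  note D1 = functorsD(3-8)[OF T(1)] and D2 = functorsD(3-8)[OF T(2)]
  show "rwh (Cat U) A A B \<tau> (Unit (Cat U) A) = \<tau>"
    by (rule ntrans_eqI[where X = "Obj A"]) (use T D1 D2 in \<open>auto simp: comp_ftor_id_right\<close>)
  show "lwh (Cat U) A B B (Unit (Cat U) B) \<tau> = \<tau>"
    by (rule ntrans_eqI[where X = "Obj A"]) (use T D1 D2 in \<open>auto simp: comp_ftor_id_left\<close>)
next
  fix A B C D F G H
  assume "A \<in> Cell0 (Cat U)" "B \<in> Cell0 (Cat U)" "C \<in> Cell0 (Cat U)" "D \<in> Cell0 (Cat U)"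
    "F \<in> Cell1 (Cat U) A B" "G \<in> Cell1 (Cat U) B C" "H \<in> Cell1 (Cat U) C D"
  then show "hc1 (Cat U) A B D (hc1 (Cat U) B C D H G) F = hc1 (Cat U) A C D H (hc1 (Cat U) A B C G
    F)"
    by (simp add: comp_ftor_assoc)
next
  fix A B C D \<rho> \<sigma> \<tau>
  assume "A \<in> Cell0 (Cat U)" "B \<in> Cell0 (Cat U)" "C \<in> Cell0 (Cat U)" "D \<in> Cell0 (Cat U)"
    "\<rho> \<in> Cell2 (Cat U) A B" "\<sigma> \<in> Cell2 (Cat U) B C" "\<tau> \<in> Cell2 (Cat U) C D"
  then have [simp]: "category A" "category B" "category C" "category D"
    and r: "\<rho> \<in> ntranses A B" and s: "\<sigma> \<in> ntranses B C" and t: "\<tau> \<in> ntranses C D"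
    by (auto dest: small_categoryD)
  note R = ntransesD[OF r] and S = ntransesD[OF s] and T = ntransesD[OF t]
  have "hcomp_ntrans A D (hcomp_ntrans B D \<tau> \<sigma>) \<rho> = hcomp_ntrans A D \<tau> (hcomp_ntrans A C \<sigma> \<rho>)"
  proof (rule ntrans_eqI[where X = "Obj A"])
    fix x assume x: "x \<in> Obj A"
    then show "NMap (hcomp_ntrans A D (hcomp_ntrans B D \<tau> \<sigma>) \<rho>) x =
      NMap (hcomp_ntrans A D \<tau> (hcomp_ntrans A C \<sigma> \<rho>)) x"
      using R(4-6) S(4-6) T(4-6) functorsD(3-8)[OF R(1)] functorsD(3-8)[OF R(2)]
        functorsD(3-8)[OF S(1)] functorsD(3-8)[OF S(2)] functorsD(3-8)[OF T(1)] functorsD(3-8)[OF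
          T(2)]
      by simp
  qed (use R(1-3) S(1-3) T(1-3) in \<open>auto simp: comp_ftor_assoc\<close>)
  then show "hc2 (Cat U) A B D (hc2 (Cat U) B C D \<tau> \<sigma>) \<rho> = hc2 (Cat U) A C D \<tau> (hc2 (Cat U) A B C \<sigma>
    \<rho>)"
    by simp
qed

section \<open>2-equivalences from spans of local isomorphisms\<close>

text \<open>The functor \<open>HComp\<close> on a product category, taken apart into statements
  about \<open>hc1\<close> and \<open>hc2\<close>; the last one is interchange.\<close>

lemma two_categoryD:
  assumes K: "two_category K" and ob: "a \<in> Cell0 K" "b \<in> Cell0 K" "c \<in> Cell0 K"
  shows "f \<in> Cell1 K a b \<Longrightarrow> g \<in> Cell1 K b c \<Longrightarrow> hc1 K a b c g f \<in> Cell1 K a c"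
    and "\<tau> \<in> Cell2 K a b \<Longrightarrow> \<sigma> \<in> Cell2 K b c \<Longrightarrow> hc2 K a b c \<sigma> \<tau> \<in> Cell2 K a c"
    and "\<tau> \<in> Cell2 K a b \<Longrightarrow> \<sigma> \<in> Cell2 K b c \<Longrightarrow>
      Dom (Hom K a c) (hc2 K a b c \<sigma> \<tau>) = hc1 K a b c (Dom (Hom K b c) \<sigma>) (Dom (Hom K a b) \<tau>)"
    and "\<tau> \<in> Cell2 K a b \<Longrightarrow> \<sigma> \<in> Cell2 K b c \<Longrightarrow>
      Cod (Hom K a c) (hc2 K a b c \<sigma> \<tau>) = hc1 K a b c (Cod (Hom K b c) \<sigma>) (Cod (Hom K a b) \<tau>)"
    and "f \<in> Cell1 K a b \<Longrightarrow> g \<in> Cell1 K b c \<Longrightarrow>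
      hc2 K a b c (Ide (Hom K b c) g) (Ide (Hom K a b) f) = Ide (Hom K a c) (hc1 K a b c g f)"
    and "\<tau> \<in> Cell2 K a b \<Longrightarrow> \<tau>' \<in> Cell2 K a b \<Longrightarrow> Dom (Hom K a b) \<tau>' = Cod (Hom K a b) \<tau> \<Longrightarrow>
      \<sigma> \<in> Cell2 K b c \<Longrightarrow> \<sigma>' \<in> Cell2 K b c \<Longrightarrow> Dom (Hom K b c) \<sigma>' = Cod (Hom K b c) \<sigma> \<Longrightarrow>
      hc2 K a b c (\<sigma>' \<cdot>[Hom K b c] \<sigma>) (\<tau>' \<cdot>[Hom K a b] \<tau>) =
      hc2 K a b c \<sigma>' \<tau>' \<cdot>[Hom K a c] hc2 K a b c \<sigma> \<tau>"
proof -
  note H = is_functorD[OF two_category.HComp_functor[OF K ob]]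
  show "f \<in> Cell1 K a b \<Longrightarrow> g \<in> Cell1 K b c \<Longrightarrow> hc1 K a b c g f \<in> Cell1 K a c"
    using H(3)[of "(g, f)"] by (simp add: hc1_def prod_cat_def)
  show "\<tau> \<in> Cell2 K a b \<Longrightarrow> \<sigma> \<in> Cell2 K b c \<Longrightarrow> hc2 K a b c \<sigma> \<tau> \<in> Cell2 K a c"
    using H(4)[of "(\<sigma>, \<tau>)"] by (simp add: hc2_def prod_cat_def)
  show "\<tau> \<in> Cell2 K a b \<Longrightarrow> \<sigma> \<in> Cell2 K b c \<Longrightarrow>
      Dom (Hom K a c) (hc2 K a b c \<sigma> \<tau>) = hc1 K a b c (Dom (Hom K b c) \<sigma>) (Dom (Hom K a b) \<tau>)"
    using H(5)[of "(\<sigma>, \<tau>)"] by (simp add: hc1_def hc2_def prod_cat_def)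
  show "\<tau> \<in> Cell2 K a b \<Longrightarrow> \<sigma> \<in> Cell2 K b c \<Longrightarrow>
      Cod (Hom K a c) (hc2 K a b c \<sigma> \<tau>) = hc1 K a b c (Cod (Hom K b c) \<sigma>) (Cod (Hom K a b) \<tau>)"
    using H(6)[of "(\<sigma>, \<tau>)"] by (simp add: hc1_def hc2_def prod_cat_def)
  show "f \<in> Cell1 K a b \<Longrightarrow> g \<in> Cell1 K b c \<Longrightarrow>
      hc2 K a b c (Ide (Hom K b c) g) (Ide (Hom K a b) f) = Ide (Hom K a c) (hc1 K a b c g f)"
    using H(7)[of "(g, f)"] by (simp add: hc1_def hc2_def prod_cat_def)
  show "\<tau> \<in> Cell2 K a b \<Longrightarrow> \<tau>' \<in> Cell2 K a b \<Longrightarrow> Dom (Hom K a b) \<tau>' = Cod (Hom K a b) \<tau> \<Longrightarrow>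
      \<sigma> \<in> Cell2 K b c \<Longrightarrow> \<sigma>' \<in> Cell2 K b c \<Longrightarrow> Dom (Hom K b c) \<sigma>' = Cod (Hom K b c) \<sigma> \<Longrightarrow>
      hc2 K a b c (\<sigma>' \<cdot>[Hom K b c] \<sigma>) (\<tau>' \<cdot>[Hom K a b] \<tau>) =
      hc2 K a b c \<sigma>' \<tau>' \<cdot>[Hom K a c] hc2 K a b c \<sigma> \<tau>"
    using H(8)[of "(\<sigma>, \<tau>)" "(\<sigma>', \<tau>')"] by (simp add: hc2_def prod_cat_def)
qed

lemma HComp_functorI:
  assumes "category (Hom K a b)" "category (Hom K b c)" "category (Hom K a c)"
    and "\<And>f g. f \<in> Cell1 K a b \<Longrightarrow> g \<in> Cell1 K b c \<Longrightarrow> hc1 K a b c g f \<in> Cell1 K a c"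
    and "\<And>\<sigma> \<tau>. \<tau> \<in> Cell2 K a b \<Longrightarrow> \<sigma> \<in> Cell2 K b c \<Longrightarrow> hc2 K a b c \<sigma> \<tau> \<in> Cell2 K a c \<and>
      Dom (Hom K a c) (hc2 K a b c \<sigma> \<tau>) = hc1 K a b c (Dom (Hom K b c) \<sigma>) (Dom (Hom K a b) \<tau>) \<and>
      Cod (Hom K a c) (hc2 K a b c \<sigma> \<tau>) = hc1 K a b c (Cod (Hom K b c) \<sigma>) (Cod (Hom K a b) \<tau>)"
    and "\<And>f g. f \<in> Cell1 K a b \<Longrightarrow> g \<in> Cell1 K b c \<Longrightarrow>
      hc2 K a b c (Ide (Hom K b c) g) (Ide (Hom K a b) f) = Ide (Hom K a c) (hc1 K a b c g f)"
    and "\<And>\<sigma> \<sigma>' \<tau> \<tau>'. \<tau> \<in> Cell2 K a b \<Longrightarrow> \<tau>' \<in> Cell2 K a b \<Longrightarrow>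
      Dom (Hom K a b) \<tau>' = Cod (Hom K a b) \<tau> \<Longrightarrow>
      \<sigma> \<in> Cell2 K b c \<Longrightarrow> \<sigma>' \<in> Cell2 K b c \<Longrightarrow> Dom (Hom K b c) \<sigma>' = Cod (Hom K b c) \<sigma> \<Longrightarrow>
      hc2 K a b c (\<sigma>' \<cdot>[Hom K b c] \<sigma>) (\<tau>' \<cdot>[Hom K a b] \<tau>) =
      hc2 K a b c \<sigma>' \<tau>' \<cdot>[Hom K a c] hc2 K a b c \<sigma> \<tau>"
  shows "is_functor (prod_cat (Hom K b c) (Hom K a b)) (Hom K a c) (HComp K a b c)"
  by (rule is_functorI)
    (use assms in \<open>auto simp: prod_cat_def hc1_def hc2_def category_prod[unfolded prod_cat_def]\<close>)

section \<open>Spans between 2-categories whose legs are locally isomorphisms\<close>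

definition sec :: "'i set \<Rightarrow> ('i \<Rightarrow> 'o) \<Rightarrow> 'o \<Rightarrow> 'i" where
  "sec I L a = (SOME i. i \<in> I \<and> L i = a)"

text \<open>\<open>THE\<close> picks the unique partner provided by \<open>r1_ex1\<close> and
  \<open>r2_ex1\<close> below, taken between the chosen indices of the two 0-cells.\<close>

definition span_ftor :: "'i set \<Rightarrow> ('i \<Rightarrow> 'o) \<Rightarrow> ('i \<Rightarrow> 'p) \<Rightarrow> ('i \<Rightarrow> 'i \<Rightarrow> 'f \<Rightarrow> 'g \<Rightarrow> bool) \<Rightarrow>
    ('i \<Rightarrow> 'i \<Rightarrow> 't \<Rightarrow> 's \<Rightarrow> bool) \<Rightarrow> ('o, 'f, 't, 'p, 'g, 's) two_ftor" where
  "span_ftor I L R r1 r2 = \<lparr>TObj = (\<lambda>a. R (sec I L a)),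
     THom = (\<lambda>a b. \<lparr>OMap = (\<lambda>f. THE g. r1 (sec I L a) (sec I L b) f g),
       AMap = (\<lambda>\<tau>. THE \<sigma>. r2 (sec I L a) (sec I L b) \<tau> \<sigma>)\<rparr>)\<rparr>"

lemma sec: "L ` I = A \<Longrightarrow> a \<in> A \<Longrightarrow> sec I L a \<in> I \<and> L (sec I L a) = a"
  unfolding sec_def by (rule someI_ex) auto

text \<open>For fixed indices \<open>i\<close>, \<open>j\<close> the relations \<open>r1\<close> and
  \<open>r2\<close> are the graph of an isomorphism between the two hom-categories; the last three
  axioms make these isomorphisms respect units and horizontal composition. Neither record is assumed
  to be a 2-category, so that the axioms can be carried from one to the other.\<close>

locale cell_span =
  fixes C :: "('o, 'f, 't) two_cat" and D :: "('p, 'g, 's) two_cat"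
    and I :: "'i set" and L :: "'i \<Rightarrow> 'o" and R :: "'i \<Rightarrow> 'p"
    and r1 :: "'i \<Rightarrow> 'i \<Rightarrow> 'f \<Rightarrow> 'g \<Rightarrow> bool" and r2 :: "'i \<Rightarrow> 'i \<Rightarrow> 't \<Rightarrow> 's \<Rightarrow> bool"
  assumes L: "L ` I = Cell0 C" and R: "R ` I = Cell0 D"
    and r1_cells: "i \<in> I \<Longrightarrow> j \<in> I \<Longrightarrow> r1 i j f g \<Longrightarrow> f \<in> Cell1 C (L i) (L j) \<and> g \<in> Cell1 D (R i) (R j)"
    and r2_cells: "i \<in> I \<Longrightarrow> j \<in> I \<Longrightarrow> r2 i j \<tau> \<sigma> \<Longrightarrow> \<tau> \<in> Cell2 C (L i) (L j) \<and> \<sigma> \<in> Cell2 D (R i) (R j)"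
    and r1_ex1: "i \<in> I \<Longrightarrow> j \<in> I \<Longrightarrow> f \<in> Cell1 C (L i) (L j) \<Longrightarrow> \<exists>!g. r1 i j f g"
      "i \<in> I \<Longrightarrow> j \<in> I \<Longrightarrow> g \<in> Cell1 D (R i) (R j) \<Longrightarrow> \<exists>!f. r1 i j f g"
    and r2_ex1: "i \<in> I \<Longrightarrow> j \<in> I \<Longrightarrow> \<tau> \<in> Cell2 C (L i) (L j) \<Longrightarrow> \<exists>!\<sigma>. r2 i j \<tau> \<sigma>"
      "i \<in> I \<Longrightarrow> j \<in> I \<Longrightarrow> \<sigma> \<in> Cell2 D (R i) (R j) \<Longrightarrow> \<exists>!\<tau>. r2 i j \<tau> \<sigma>"
    and r2_Dom: "i \<in> I \<Longrightarrow> j \<in> I \<Longrightarrow> r2 i j \<tau> \<sigma> \<Longrightarrow>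
      r1 i j (Dom (Hom C (L i) (L j)) \<tau>) (Dom (Hom D (R i) (R j)) \<sigma>)"
    and r2_Cod: "i \<in> I \<Longrightarrow> j \<in> I \<Longrightarrow> r2 i j \<tau> \<sigma> \<Longrightarrow>
      r1 i j (Cod (Hom C (L i) (L j)) \<tau>) (Cod (Hom D (R i) (R j)) \<sigma>)"
    and r2_Ide: "i \<in> I \<Longrightarrow> j \<in> I \<Longrightarrow> r1 i j f g \<Longrightarrow>
      r2 i j (Ide (Hom C (L i) (L j)) f) (Ide (Hom D (R i) (R j)) g)"
    and r2_Comp: "i \<in> I \<Longrightarrow> j \<in> I \<Longrightarrow> r2 i j \<tau> \<sigma> \<Longrightarrow> r2 i j \<tau>' \<sigma>' \<Longrightarrow>
      Dom (Hom C (L i) (L j)) \<tau>' = Cod (Hom C (L i) (L j)) \<tau> \<Longrightarrow>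
      Dom (Hom D (R i) (R j)) \<sigma>' = Cod (Hom D (R i) (R j)) \<sigma> \<Longrightarrow>
      r2 i j (\<tau>' \<cdot>[Hom C (L i) (L j)] \<tau>) (\<sigma>' \<cdot>[Hom D (R i) (R j)] \<sigma>)"
    and r1_Unit: "i \<in> I \<Longrightarrow> r1 i i (Unit C (L i)) (Unit D (R i))"
    and r1_hc1: "i \<in> I \<Longrightarrow> j \<in> I \<Longrightarrow> k \<in> I \<Longrightarrow> r1 i j f g \<Longrightarrow> r1 j k f' g' \<Longrightarrow>
      r1 i k (hc1 C (L i) (L j) (L k) f' f) (hc1 D (R i) (R j) (R k) g' g)"
    and r2_hc2: "i \<in> I \<Longrightarrow> j \<in> I \<Longrightarrow> k \<in> I \<Longrightarrow> r2 i j \<tau> \<sigma> \<Longrightarrow> r2 j k \<tau>' \<sigma>' \<Longrightarrow>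
      r2 i k (hc2 C (L i) (L j) (L k) \<tau>' \<tau>) (hc2 D (R i) (R j) (R k) \<sigma>' \<sigma>)"
begin

abbreviation "HC i j \<equiv> Hom C (L i) (L j)"
abbreviation "HD i j \<equiv> Hom D (R i) (R j)"

text \<open>The axioms treat the two legs alike, so every construction made for \<open>C\<close> is
  also available for \<open>D\<close>.\<close>

lemma swap: "cell_span D C I R L (\<lambda>i j g f. r1 i j f g) (\<lambda>i j \<sigma> \<tau>. r2 i j \<tau> \<sigma>)"
  by unfold_locales
    (use L R r1_cells r2_cells r1_ex1 r2_ex1 r2_Dom r2_Cod r2_Ide r2_Comp r1_Unit r1_hc1 r2_hc2
      in \<open>simp_all\<close>)

lemma r1_right_unique: "i \<in> I \<Longrightarrow> j \<in> I \<Longrightarrow> r1 i j f g \<Longrightarrow> r1 i j f g' \<Longrightarrow> g = g'"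
  using r1_ex1(1)[of i j f] r1_cells[of i j f] by blast

lemma r1_left_unique: "i \<in> I \<Longrightarrow> j \<in> I \<Longrightarrow> r1 i j f g \<Longrightarrow> r1 i j f' g \<Longrightarrow> f = f'"
  using r1_ex1(2)[of i j g] r1_cells[of i j _ g] by blast

lemma r2_right_unique: "i \<in> I \<Longrightarrow> j \<in> I \<Longrightarrow> r2 i j \<tau> \<sigma> \<Longrightarrow> r2 i j \<tau> \<sigma>' \<Longrightarrow> \<sigma> = \<sigma>'"
  using r2_ex1(1)[of i j \<tau>] r2_cells[of i j \<tau>] by blast

lemma r2_left_unique: "i \<in> I \<Longrightarrow> j \<in> I \<Longrightarrow> r2 i j \<tau> \<sigma> \<Longrightarrow> r2 i j \<tau>' \<sigma> \<Longrightarrow> \<tau> = \<tau>'"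
  using r2_ex1(2)[of i j \<sigma>] r2_cells[of i j _ \<sigma>] by blast

lemma obtain_r1:
  assumes "i \<in> I" "j \<in> I" "g \<in> Obj (HD i j)" obtains f where "r1 i j f g" "f \<in> Obj (HC i j)"
  using r1_ex1(2)[OF assms] r1_cells[OF assms(1,2)] by blast

lemma obtain_r2:
  assumes "i \<in> I" "j \<in> I" "\<sigma> \<in> Arr (HD i j)" obtains \<tau> where "r2 i j \<tau> \<sigma>" "\<tau> \<in> Arr (HC i j)"
  using r2_ex1(2)[OF assms] r2_cells[OF assms(1,2)] by blast

text \<open>\<open>r2_Comp\<close> asks for composability on both sides. Composability on the side
  of \<open>D\<close> implies the other: the domain of \<open>\<tau>'\<close> and the codomain of
  \<open>\<tau>\<close> are partners of the same 1-cell, and partners are unique.\<close>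

lemma composable:
  assumes "i \<in> I" "j \<in> I" "r2 i j \<tau> \<sigma>" "r2 i j \<tau>' \<sigma>'"
    and "Dom (HD i j) \<sigma>' = Cod (HD i j) \<sigma>"
  shows "Dom (HC i j) \<tau>' = Cod (HC i j) \<tau>"
  using r1_left_unique[OF assms(1,2) r2_Dom[OF assms(1,2,4)], folded assms(5)] assms
    r2_Cod[OF assms(1,2,3)] by simp

lemma r2_Comp':
  assumes "i \<in> I" "j \<in> I" "r2 i j \<tau> \<sigma>" "r2 i j \<tau>' \<sigma>'"
    and "Dom (HD i j) \<sigma>' = Cod (HD i j) \<sigma>"
  shows "r2 i j (\<tau>' \<cdot>[HC i j] \<tau>) (\<sigma>' \<cdot>[HD i j] \<sigma>)"
  using r2_Comp[OF assms(1-4) composable[OF assms] assms(5)] .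

section \<open>Transport of the 2-category axioms along the span\<close>

lemma L_in: "i \<in> I \<Longrightarrow> L i \<in> Cell0 C" and R_in: "i \<in> I \<Longrightarrow> R i \<in> Cell0 D"
  unfolding L[symmetric] R[symmetric] by auto

text \<open>Each axiom is an equation between cells of \<open>D\<close>. The given cells are
  replaced by their partners in \<open>C\<close>, where the axiom holds; then both sides of the
  equation are partners of one and the same cell.\<close>

lemma category_transport:
  assumes C: "two_category C" and i: "i \<in> I" and j: "j \<in> I"
  shows "category (HD i j)"
proof (rule categoryI)
  note cat[simp] = two_category.Hom_category[OF C L_in[OF i] L_in[OF j]]
  note r1c = r1_cells[OF i j] and r2c = r2_cells[OF i j]
  let ?H = "HC i j" and ?K = "HD i j"
  show "Dom ?K \<sigma> \<in> Obj (HD i j)" "Cod ?K \<sigma> \<in> Obj (HD i j)"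
    if s: "\<sigma> \<in> Arr (HD i j)" for \<sigma>
  proof -
    obtain \<tau> where t: "r2 i j \<tau> \<sigma>" "\<tau> \<in> Arr ?H" using obtain_r2[OF i j s] .
    show "Dom ?K \<sigma> \<in> Obj (HD i j)" "Cod ?K \<sigma> \<in> Obj (HD i j)"
      using r1c[OF r2_Dom[OF i j t(1)]] r1c[OF r2_Cod[OF i j t(1)]] by auto
  qed
  show "Ide ?K g \<in> Arr ?K" "Dom ?K (Ide ?K g) = g" "Cod ?K (Ide ?K g) = g" if g: "g \<in> Obj ?K" for g
  proof -
    obtain f where f: "r1 i j f g" "f \<in> Obj ?H" using obtain_r1[OF i j g] .
    have id: "r2 i j (Ide ?H f) (Ide ?K g)" using r2_Ide[OF i j f(1)] .
    show "Ide ?K g \<in> Arr ?K" using r2c[OF id] by simp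
    show "Dom ?K (Ide ?K g) = g" "Cod ?K (Ide ?K g) = g"
      by (rule r1_right_unique[OF i j _ f(1)], use r2_Dom[OF i j id] r2_Cod[OF i j id] f(2)
        in simp)+
  qed
  show "\<sigma>' \<cdot>[?K] \<sigma> \<in> Arr ?K" "Dom ?K (\<sigma>' \<cdot>[?K] \<sigma>) = Dom ?K \<sigma>" "Cod ?K (\<sigma>' \<cdot>[?K] \<sigma>) = Cod ?K \<sigma>'"
    if s: "\<sigma> \<in> Arr ?K" "\<sigma>' \<in> Arr ?K" "Dom ?K \<sigma>' = Cod ?K \<sigma>" for \<sigma> \<sigma>'
  proof -
    obtain \<tau> where t: "r2 i j \<tau> \<sigma>" "\<tau> \<in> Arr ?H" using obtain_r2[OF i j s(1)] .
    obtain \<tau>' where t': "r2 i j \<tau>' \<sigma>'" "\<tau>' \<in> Arr ?H" using obtain_r2[OF i j s(2)] .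
    note c = composable[OF i j t(1) t'(1) s(3)] and r = r2_Comp'[OF i j t(1) t'(1) s(3)]
    show "\<sigma>' \<cdot>[?K] \<sigma> \<in> Arr ?K" using r2c[OF r] by simp
    show "Dom ?K (\<sigma>' \<cdot>[?K] \<sigma>) = Dom ?K \<sigma>" "Cod ?K (\<sigma>' \<cdot>[?K] \<sigma>) = Cod ?K \<sigma>'"
      by (rule r1_right_unique[OF i j r2_Dom[OF i j r]], use r2_Dom[OF i j t(1)] t(2) t'(2) c
        in simp)
        (rule r1_right_unique[OF i j r2_Cod[OF i j r]], use r2_Cod[OF i j t'(1)] t(2) t'(2) c
          in simp)
  qed
  note comp = this
  show "\<sigma> \<cdot>[?K] Ide ?K (Dom ?K \<sigma>) = \<sigma>" "Ide ?K (Cod ?K \<sigma>) \<cdot>[?K] \<sigma> = \<sigma>" if s: "\<sigma> \<in> Arr ?K" for \<sigma>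
  proof -
    obtain \<tau> where t: "r2 i j \<tau> \<sigma>" "\<tau> \<in> Arr ?H" using obtain_r2[OF i j s(1)] .
    have d: "r2 i j (Ide ?H (Dom ?H \<tau>)) (Ide ?K (Dom ?K \<sigma>))"
      "r2 i j (Ide ?H (Cod ?H \<tau>)) (Ide ?K (Cod ?K \<sigma>))"
      using r2_Ide[OF i j] r2_Dom[OF i j t(1)] r2_Cod[OF i j t(1)] by auto
    have e: "Dom ?K \<sigma> = Cod ?K (Ide ?K (Dom ?K \<sigma>))" "Dom ?K (Ide ?K (Cod ?K \<sigma>)) = Cod ?K \<sigma>"
      by (rule r1_right_unique[OF i j r2_Dom[OF i j t(1)]], use r2_Cod[OF i j d(1)] t(2) in simp)
        (rule r1_right_unique[OF i j _ r2_Cod[OF i j t(1)]], use r2_Dom[OF i j d(2)] t(2) in simp)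
    show "\<sigma> \<cdot>[?K] Ide ?K (Dom ?K \<sigma>) = \<sigma>" "Ide ?K (Cod ?K \<sigma>) \<cdot>[?K] \<sigma> = \<sigma>"
      by (rule r2_right_unique[OF i j _ t(1)], use r2_Comp'[OF i j d(1) t(1) e(1)] t(2) in simp)
        (rule r2_right_unique[OF i j _ t(1)], use r2_Comp'[OF i j t(1) d(2) e(2)] t(2) in simp)
  qed
  show "(\<sigma>'' \<cdot>[?K] \<sigma>') \<cdot>[?K] \<sigma> = \<sigma>'' \<cdot>[?K] \<sigma>' \<cdot>[?K] \<sigma>"
    if s: "\<sigma> \<in> Arr ?K" "\<sigma>' \<in> Arr ?K" "\<sigma>'' \<in> Arr ?K" "Dom ?K \<sigma>' = Cod ?K \<sigma>" "Dom ?K \<sigma>'' = Cod ?K \<sigma>'"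
      for \<sigma> \<sigma>' \<sigma>''
  proof -
    obtain \<tau> where t: "r2 i j \<tau> \<sigma>" "\<tau> \<in> Arr ?H" using obtain_r2[OF i j s(1)] .
    obtain \<tau>' where t': "r2 i j \<tau>' \<sigma>'" "\<tau>' \<in> Arr ?H" using obtain_r2[OF i j s(2)] .
    obtain \<tau>'' where t'': "r2 i j \<tau>'' \<sigma>''" "\<tau>'' \<in> Arr ?H" using obtain_r2[OF i j s(3)] .
    note c = composable[OF i j t(1) t'(1) s(4)] and c' = composable[OF i j t'(1) t''(1) s(5)]
    note r = r2_Comp'[OF i j t(1) t'(1) s(4)] and r' = r2_Comp'[OF i j t'(1) t''(1) s(5)]
    have rr: "r2 i j ((\<tau>'' \<cdot>[?H] \<tau>') \<cdot>[?H] \<tau>) ((\<sigma>'' \<cdot>[?K] \<sigma>') \<cdot>[?K] \<sigma>)"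
      "r2 i j (\<tau>'' \<cdot>[?H] (\<tau>' \<cdot>[?H] \<tau>)) (\<sigma>'' \<cdot>[?K] (\<sigma>' \<cdot>[?K] \<sigma>))"
      using r2_Comp'[OF i j t(1) r'] r2_Comp'[OF i j r t''(1)] s comp by auto
    show ?thesis
      by (rule r2_right_unique[OF i j rr(1)]) (use rr(2) t(2) t'(2) t''(2) c c' in simp)
  qed
qed

lemma HComp_transport:
  assumes C: "two_category C" and i: "i \<in> I" and j: "j \<in> I" and k: "k \<in> I"
  shows "is_functor (prod_cat (HD j k) (HD i j)) (HD i k) (HComp D (R i) (R j) (R k))"
proof (rule HComp_functorI)
  show "category (HD i j)" "category (HD j k)" "category (HD i k)"
    using category_transport[OF C] i j k by auto
  note c = two_categoryD[OF C L_in[OF i] L_in[OF j] L_in[OF k]]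
  note comp = r1_hc1[OF i j k] r2_hc2[OF i j k]
  let ?hc1 = "hc1 D (R i) (R j) (R k)" and ?hc2 = "hc2 D (R i) (R j) (R k)"
  show "?hc1 g' g \<in> Obj (HD i k)" if g: "g \<in> Obj (HD i j)" "g' \<in> Obj (HD j k)" for g g'
  proof -
    obtain f where f: "r1 i j f g" using obtain_r1[OF i j g(1)] .
    obtain f' where f': "r1 j k f' g'" using obtain_r1[OF j k g(2)] .
    show ?thesis using r1_cells[OF i k comp(1)[OF f f']] by simp
  qed
  show "?hc2 \<sigma>' \<sigma> \<in> Arr (HD i k) \<and>
      Dom (HD i k) (?hc2 \<sigma>' \<sigma>) = ?hc1 (Dom (HD j k) \<sigma>') (Dom (HD i j) \<sigma>) \<and>
      Cod (HD i k) (?hc2 \<sigma>' \<sigma>) = ?hc1 (Cod (HD j k) \<sigma>') (Cod (HD i j) \<sigma>)"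
    if s: "\<sigma> \<in> Arr (HD i j)" "\<sigma>' \<in> Arr (HD j k)" for \<sigma> \<sigma>'
  proof -
    obtain \<tau> where t: "r2 i j \<tau> \<sigma>" "\<tau> \<in> Arr (HC i j)" using obtain_r2[OF i j s(1)] .
    obtain \<tau>' where t': "r2 j k \<tau>' \<sigma>'" "\<tau>' \<in> Arr (HC j k)" using obtain_r2[OF j k s(2)] .
    note r = comp(2)[OF t(1) t'(1)]
    have rr: "r1 i k (Dom (HC i k) (hc2 C (L i) (L j) (L k) \<tau>' \<tau>)) (?hc1 (Dom (HD j k) \<sigma>') (Dom (HD
      i j) \<sigma>))"
      "r1 i k (Cod (HC i k) (hc2 C (L i) (L j) (L k) \<tau>' \<tau>)) (?hc1 (Cod (HD j k) \<sigma>') (Cod (HD i j)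
        \<sigma>))"
      using comp(1)[OF r2_Dom[OF i j t(1)] r2_Dom[OF j k t'(1)]]
        comp(1)[OF r2_Cod[OF i j t(1)] r2_Cod[OF j k t'(1)]] c(3,4)[OF t(2) t'(2)] by auto
    show ?thesis using r2_cells[OF i k r] r1_right_unique[OF i k r2_Dom[OF i k r] rr(1)]
        r1_right_unique[OF i k r2_Cod[OF i k r] rr(2)] by simp
  qed
  show "?hc2 (Ide (HD j k) g') (Ide (HD i j) g) = Ide (HD i k) (?hc1 g' g)"
    if g: "g \<in> Obj (HD i j)" "g' \<in> Obj (HD j k)" for g g'
  proof -
    obtain f where f: "r1 i j f g" "f \<in> Obj (HC i j)" using obtain_r1[OF i j g(1)] .
    obtain f' where f': "r1 j k f' g'" "f' \<in> Obj (HC j k)" using obtain_r1[OF j k g(2)] .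
    show ?thesis
      by (rule r2_right_unique[OF i k comp(2)[OF r2_Ide[OF i j f(1)] r2_Ide[OF j k f'(1)]]])
        (use r2_Ide[OF i k comp(1)[OF f(1) f'(1)]] c(5)[OF f(2) f'(2)] in simp)
  qed
  show "?hc2 (\<sigma>' \<cdot>[HD j k] \<sigma>) (\<rho>' \<cdot>[HD i j] \<rho>) = ?hc2 \<sigma>' \<rho>' \<cdot>[HD i k] ?hc2 \<sigma> \<rho>"
    if s: "\<rho> \<in> Arr (HD i j)" "\<rho>' \<in> Arr (HD i j)" "Dom (HD i j) \<rho>' = Cod (HD i j) \<rho>"
      "\<sigma> \<in> Arr (HD j k)" "\<sigma>' \<in> Arr (HD j k)" "Dom (HD j k) \<sigma>' = Cod (HD j k) \<sigma>"
    for \<rho> \<rho>' \<sigma> \<sigma>'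
  proof -
    obtain u where u: "r2 i j u \<rho>" "u \<in> Arr (HC i j)" using obtain_r2[OF i j s(1)] .
    obtain u' where u': "r2 i j u' \<rho>'" "u' \<in> Arr (HC i j)" using obtain_r2[OF i j s(2)] .
    obtain t where t: "r2 j k t \<sigma>" "t \<in> Arr (HC j k)" using obtain_r2[OF j k s(4)] .
    obtain t' where t': "r2 j k t' \<sigma>'" "t' \<in> Arr (HC j k)" using obtain_r2[OF j k s(5)] .
    note d = composable[OF i j u(1) u'(1) s(3)] composable[OF j k t(1) t'(1) s(6)]
    have e': "Dom (HC i k) (hc2 C (L i) (L j) (L k) t' u') = Cod (HC i k) (hc2 C (L i) (L j) (L k) t
      u)"
      using c(3)[OF u'(2) t'(2)] c(4)[OF u(2) t(2)] d by simp
    have e: "Dom (HD i k) (?hc2 \<sigma>' \<rho>') = Cod (HD i k) (?hc2 \<sigma> \<rho>)"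
      by (rule r1_right_unique[OF i k r2_Dom[OF i k comp(2)[OF u'(1) t'(1)]]])
        (use r2_Cod[OF i k comp(2)[OF u(1) t(1)]] e' in simp)
    \<comment> \<open>Both sides are partners of the same cell because interchange,
      \<open>c(6)\<close>, holds in \<open>C\<close>.\<close>
    show ?thesis
      by (rule r2_right_unique[OF i k
            comp(2)[OF r2_Comp'[OF i j u(1) u'(1) s(3)] r2_Comp'[OF j k t(1) t'(1) s(6)],
              unfolded c(6)[OF u(2) u'(2) d(1) t(2) t'(2) d(2)]]
            r2_Comp'[OF i k comp(2)[OF u(1) t(1)] comp(2)[OF u'(1) t'(1)] e]])
  qed
qed

lemma obtain_index: assumes "a \<in> Cell0 D" obtains i where "i \<in> I" "R i = a"
  using assms unfolding R[symmetric] by blast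

text \<open>Surjectivity of \<open>R\<close> supplies an index for every 0-cell of \<open>D\<close>;
  after that the equations are transported as in \<open>category_transport\<close>.\<close>

lemma two_category_transport:
  assumes C: "two_category C"
  shows "two_category D"
proof (rule two_category.intro)
  show "category (Hom D a b)" if "a \<in> Cell0 D" "b \<in> Cell0 D" for a b
    using that category_transport[OF C] unfolding R[symmetric] by blast
  show "Unit D a \<in> Cell1 D a a" if a: "a \<in> Cell0 D" for a
  proof -
    obtain i where i: "i \<in> I" "R i = a" using obtain_index[OF a] .
    show ?thesis using r1_cells[OF i(1) i(1) r1_Unit[OF i(1)]] i(2) by simp
  qed
  show "is_functor (prod_cat (Hom D b c) (Hom D a b)) (Hom D a c) (HComp D a b c)"
    if "a \<in> Cell0 D" "b \<in> Cell0 D" "c \<in> Cell0 D" for a b c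
    using that HComp_transport[OF C] unfolding R[symmetric] by blast
next
  fix a b g assume ab: "a \<in> Cell0 D" "b \<in> Cell0 D" and g: "g \<in> Cell1 D a b"
  obtain i where i: "i \<in> I" "R i = a" using obtain_index[OF ab(1)] .
  obtain j where j: "j \<in> I" "R j = b" using obtain_index[OF ab(2)] .
  obtain f where f: "r1 i j f g" "f \<in> Obj (HC i j)"
    using obtain_r1[OF i(1) j(1)] g i j by auto
  note u = r1_Unit[OF i(1)] r1_Unit[OF j(1)]
  show "hc1 D a a b g (Unit D a) = g"
    using r1_right_unique[OF i(1) j(1) r1_hc1[OF i(1) i(1) j(1) u(1) f(1)], of g] f(1)
        two_category.hc1_Unit_right[OF C L_in[OF i(1)] L_in[OF j(1)] f(2)] i j by simp
  show "hc1 D a b b (Unit D b) g = g"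
    using r1_right_unique[OF i(1) j(1) r1_hc1[OF i(1) j(1) j(1) f(1) u(2)], of g] f(1)
        two_category.hc1_Unit_left[OF C L_in[OF i(1)] L_in[OF j(1)] f(2)] i j by simp
next
  fix a b g assume ab: "a \<in> Cell0 D" "b \<in> Cell0 D" and g: "g \<in> Cell2 D a b"
  obtain i where i: "i \<in> I" "R i = a" using obtain_index[OF ab(1)] .
  obtain j where j: "j \<in> I" "R j = b" using obtain_index[OF ab(2)] .
  obtain f where f: "r2 i j f g" "f \<in> Arr (HC i j)"
    using obtain_r2[OF i(1) j(1)] g i j by auto
  note u = r2_Ide[OF i(1) i(1) r1_Unit[OF i(1)]] r2_Ide[OF j(1) j(1) r1_Unit[OF j(1)]]
  show "rwh D a a b g (Unit D a) = g"
    using r2_right_unique[OF i(1) j(1) r2_hc2[OF i(1) i(1) j(1) u(1) f(1)], of g] f(1)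
        two_category.hc2_Unit_right[OF C L_in[OF i(1)] L_in[OF j(1)] f(2)] i j
          by (simp add: rwh_def)
  show "lwh D a b b (Unit D b) g = g"
    using r2_right_unique[OF i(1) j(1) r2_hc2[OF i(1) j(1) j(1) f(1) u(2)], of g] f(1)
        two_category.hc2_Unit_left[OF C L_in[OF i(1)] L_in[OF j(1)] f(2)] i j by (simp add: lwh_def)
next
  fix a b c d f g h
  assume ob: "a \<in> Cell0 D" "b \<in> Cell0 D" "c \<in> Cell0 D" "d \<in> Cell0 D"
    and ar: "f \<in> Cell1 D a b" "g \<in> Cell1 D b c" "h \<in> Cell1 D c d"
  obtain i where i: "i \<in> I" "R i = a" using obtain_index[OF ob(1)] .
  obtain j where j: "j \<in> I" "R j = b" using obtain_index[OF ob(2)] .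
  obtain k where k: "k \<in> I" "R k = c" using obtain_index[OF ob(3)] .
  obtain l where l: "l \<in> I" "R l = d" using obtain_index[OF ob(4)] .
  obtain f' where f: "r1 i j f' f" "f' \<in> Obj (HC i j)" using obtain_r1[OF i(1) j(1)] ar i j by auto
  obtain g' where g: "r1 j k g' g" "g' \<in> Obj (HC j k)" using obtain_r1[OF j(1) k(1)] ar j k by auto
  obtain h' where h: "r1 k l h' h" "h' \<in> Obj (HC k l)" using obtain_r1[OF k(1) l(1)] ar k l by auto
  show "hc1 D a b d (hc1 D b c d h g) f = hc1 D a c d h (hc1 D a b c g f)"
    using r1_right_unique[OF i(1) l(1)
        r1_hc1[OF i(1) j(1) l(1) f(1) r1_hc1[OF j(1) k(1) l(1) g(1) h(1)],
          unfolded two_category.hc1_assoc[OF C L_in[OF i(1)] L_in[OF j(1)] L_in[OF k(1)]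
            L_in[OF l(1)] f(2) g(2) h(2)]]
        r1_hc1[OF i(1) k(1) l(1) r1_hc1[OF i(1) j(1) k(1) f(1) g(1)] h(1)]] i j k l by simp
next
  fix a b c d f g h
  assume ob: "a \<in> Cell0 D" "b \<in> Cell0 D" "c \<in> Cell0 D" "d \<in> Cell0 D"
    and ar: "f \<in> Cell2 D a b" "g \<in> Cell2 D b c" "h \<in> Cell2 D c d"
  obtain i where i: "i \<in> I" "R i = a" using obtain_index[OF ob(1)] .
  obtain j where j: "j \<in> I" "R j = b" using obtain_index[OF ob(2)] .
  obtain k where k: "k \<in> I" "R k = c" using obtain_index[OF ob(3)] .
  obtain l where l: "l \<in> I" "R l = d" using obtain_index[OF ob(4)] .
  obtain f' where f: "r2 i j f' f" "f' \<in> Arr (HC i j)" using obtain_r2[OF i(1) j(1)] ar i j by auto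
  obtain g' where g: "r2 j k g' g" "g' \<in> Arr (HC j k)" using obtain_r2[OF j(1) k(1)] ar j k by auto
  obtain h' where h: "r2 k l h' h" "h' \<in> Arr (HC k l)" using obtain_r2[OF k(1) l(1)] ar k l by auto
  show "hc2 D a b d (hc2 D b c d h g) f = hc2 D a c d h (hc2 D a b c g f)"
    using r2_right_unique[OF i(1) l(1)
        r2_hc2[OF i(1) j(1) l(1) f(1) r2_hc2[OF j(1) k(1) l(1) g(1) h(1)],
          unfolded two_category.hc2_assoc[OF C L_in[OF i(1)] L_in[OF j(1)] L_in[OF k(1)]
            L_in[OF l(1)] f(2) g(2) h(2)]]
        r2_hc2[OF i(1) k(1) l(1) r2_hc2[OF i(1) j(1) k(1) f(1) g(1)] h(1)]] i j k l by simp
qed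

end

lemma two_functor_id: "two_category C \<Longrightarrow> two_functor C C id_two_ftor"
  by (auto simp: two_functor_def two_functor_axioms_def id_two_ftor_def two_category.Hom_category
      intro!: is_functorI)

lemma two_functor_comp:
  assumes F: "two_functor C D F" and G: "two_functor D E G"
  shows "two_functor C E (comp_two_ftor G F)"
proof -
  note f = F[unfolded two_functor_def two_functor_axioms_def] and g = G[unfolded two_functor_def
    two_functor_axioms_def]
  have C: "two_category C" and D: "two_category D" and E: "two_category E" using f g by auto
  have FO: "TObj F a \<in> Cell0 D" if "a \<in> Cell0 C" for a using f that by auto
  have GO: "TObj G a \<in> Cell0 E" if "a \<in> Cell0 D" for a using g that by auto
  have FH: "is_functor (Hom C a b) (Hom D (TObj F a) (TObj F b)) (THom F a b)"
    if "a \<in> Cell0 C" "b \<in> Cell0 C" for a b using f that by auto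
  have GH: "is_functor (Hom D a b) (Hom E (TObj G a) (TObj G b)) (THom G a b)"
    if "a \<in> Cell0 D" "b \<in> Cell0 D" for a b using g that by auto
  show ?thesis unfolding two_functor_def two_functor_axioms_def
  proof (intro conjI allI impI)
    fix a b assume ab: "a \<in> Cell0 C" "b \<in> Cell0 C"
    note FD = is_functorD[OF FH[OF ab]] and GD = is_functorD[OF GH[OF FO[OF ab(1)] FO[OF ab(2)]]]
    show "is_functor (Hom C a b) (Hom E (TObj (comp_two_ftor G F) a) (TObj (comp_two_ftor G F) b))
      (THom (comp_two_ftor G F) a b)"
      by (rule is_functorI) (use FD GD in \<open>auto simp: comp_two_ftor_def\<close>)
  next
    fix a b c f f' assume "a \<in> Cell0 C" "b \<in> Cell0 C" "c \<in> Cell0 C" "f \<in> Cell1 C a b"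
      "f' \<in> Cell1 C b c"
    then show "OMap (THom (comp_two_ftor G F) a c) (hc1 C a b c f' f) =
      hc1 E (TObj (comp_two_ftor G F) a) (TObj (comp_two_ftor G F) b) (TObj (comp_two_ftor G F) c)
        (OMap (THom (comp_two_ftor G F) b c) f') (OMap (THom (comp_two_ftor G F) a b) f)"
      using f g is_functorD(3)[OF FH] by (auto simp: comp_two_ftor_def)
  next
    fix a b c f f' assume "a \<in> Cell0 C" "b \<in> Cell0 C" "c \<in> Cell0 C" "f \<in> Cell2 C a b"
      "f' \<in> Cell2 C b c"
    then show "AMap (THom (comp_two_ftor G F) a c) (hc2 C a b c f' f) =
      hc2 E (TObj (comp_two_ftor G F) a) (TObj (comp_two_ftor G F) b) (TObj (comp_two_ftor G F) c)
        (AMap (THom (comp_two_ftor G F) b c) f') (AMap (THom (comp_two_ftor G F) a b) f)"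
      using f g is_functorD(4)[OF FH] by (auto simp: comp_two_ftor_def)
  qed (use f g in \<open>auto simp: comp_two_ftor_def\<close>)
qed

section \<open>The 2-functors chosen from a span, and their unit and counit\<close>

locale two_cat_span = cell_span + C: two_category C + D: two_category D
begin

abbreviation "sL \<equiv> sec I L"
abbreviation "F \<equiv> span_ftor I L R r1 r2"

lemma sL: "a \<in> Cell0 C \<Longrightarrow> sL a \<in> I" "a \<in> Cell0 C \<Longrightarrow> L (sL a) = a"
  using sec[OF L] by auto

lemma TObj_F: "TObj F a = R (sL a)"
  by (simp add: span_ftor_def)

lemma F_r1: "a \<in> Cell0 C \<Longrightarrow> b \<in> Cell0 C \<Longrightarrow> f \<in> Cell1 C a b \<Longrightarrow> r1 (sL a) (sL b) f (OMap (THom F a b) f)"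
  unfolding span_ftor_def using theI'[OF r1_ex1(1)[OF sL(1) sL(1), of a b f]] by (simp add: sL)

lemma F_r2: "a \<in> Cell0 C \<Longrightarrow> b \<in> Cell0 C \<Longrightarrow> \<tau> \<in> Cell2 C a b \<Longrightarrow> r2 (sL a) (sL b) \<tau> (AMap (THom F a b) \<tau>)"
  unfolding span_ftor_def using theI'[OF r2_ex1(1)[OF sL(1) sL(1), of a b \<tau>]] by (simp add: sL)

text \<open>The index is chosen once for each 0-cell, hence composable cells meet at a common index
  and \<open>r1_hc1\<close>, \<open>r2_hc2\<close> apply; uniqueness of partners then gives strict
  preservation.\<close>

lemma two_functor_F: "two_functor C D F"
proof -
  have O: "R (sL a) \<in> Cell0 D" if "a \<in> Cell0 C" for a using sL(1)[OF that] R_in by blast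
  have F: "is_functor (Hom C a b) (Hom D (R (sL a)) (R (sL b))) (THom F a b)"
    if a: "a \<in> Cell0 C" and b: "b \<in> Cell0 C" for a b
  proof (rule is_functorI)
    note ij = sL(1)[OF a] sL(1)[OF b]
    let ?T = "THom F a b"
    have [simp]: "category (Hom C a b)" "category (Hom D (R (sL a)) (R (sL b)))"
      using C.Hom_category D.Hom_category O a b by auto
    then show "category (Hom C a b)" "category (Hom D (R (sL a)) (R (sL b)))" .
    show "OMap ?T f \<in> Cell1 D (R (sL a)) (R (sL b))" if "f \<in> Cell1 C a b" for f
      using r1_cells[OF ij F_r1[OF a b that]] by simp
    show "AMap ?T f \<in> Cell2 D (R (sL a)) (R (sL b))" if "f \<in> Cell2 C a b" for f
      using r2_cells[OF ij F_r2[OF a b that]] by simp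
    show "Dom (Hom D (R (sL a)) (R (sL b))) (AMap ?T f) = OMap ?T (Dom (Hom C a b) f)"
      if "f \<in> Cell2 C a b" for f
      by (rule r1_right_unique[OF ij r2_Dom[OF ij F_r2[OF a b that]]])
        (use F_r1[OF a b, of "Dom (Hom C a b) f"] a b that in \<open>simp add: sL\<close>)
    show "Cod (Hom D (R (sL a)) (R (sL b))) (AMap ?T f) = OMap ?T (Cod (Hom C a b) f)"
      if "f \<in> Cell2 C a b" for f
      by (rule r1_right_unique[OF ij r2_Cod[OF ij F_r2[OF a b that]]])
        (use F_r1[OF a b, of "Cod (Hom C a b) f"] a b that in \<open>simp add: sL\<close>)
    show "AMap ?T (Ide (Hom C a b) f) = Ide (Hom D (R (sL a)) (R (sL b))) (OMap ?T f)"
      if "f \<in> Cell1 C a b" for f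
      by (rule r2_right_unique[OF ij _ r2_Ide[OF ij F_r1[OF a b that]]])
        (use F_r2[OF a b, of "Ide (Hom C a b) f"] a b that in \<open>simp add: sL\<close>)
    fix f g assume f: "f \<in> Cell2 C a b" and g: "g \<in> Cell2 C a b" and c: "Dom (Hom C a b) g =
      Cod (Hom C a b) f"
    have e: "Dom (Hom D (R (sL a)) (R (sL b))) (AMap ?T g) = Cod (Hom D (R (sL a)) (R (sL b))) (AMap
      ?T f)"
      by (rule r1_right_unique[OF ij r2_Dom[OF ij F_r2[OF a b g]]])
        (use r2_Cod[OF ij F_r2[OF a b f]] c a b in \<open>simp add: sL\<close>)
    show "AMap ?T (g \<cdot>[Hom C a b] f) = AMap ?T g \<cdot>[Hom D (R (sL a)) (R (sL b))] AMap ?T f"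
      by (rule r2_right_unique[OF ij _ r2_Comp'[OF ij F_r2[OF a b f] F_r2[OF a b g] e]])
        (use F_r2[OF a b, of "g \<cdot>[Hom C a b] f"] a b f g c in \<open>simp add: sL\<close>)
  qed
  show ?thesis unfolding two_functor_def two_functor_axioms_def
  proof (intro conjI allI impI)
    show "two_category C" "two_category D" by unfold_locales
    fix a assume a: "a \<in> Cell0 C"
    note i = sL(1)[OF a]
    show "TObj F a \<in> Cell0 D" using O[OF a] by (simp add: TObj_F)
    show "OMap (THom F a a) (Unit C a) = Unit D (TObj F a)"
      using r1_right_unique[OF i i F_r1[OF a a C.Unit_in[OF a]]] r1_Unit[OF i] sL(2)[OF a]
      by (simp add: TObj_F)
    fix b assume b: "b \<in> Cell0 C"
    note j = sL(1)[OF b]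
    show "is_functor (Hom C a b) (Hom D (TObj F a) (TObj F b)) (THom F a b)"
      using F[OF a b] by (simp add: TObj_F)
    fix c assume c: "c \<in> Cell0 C"
    note k = sL(1)[OF c]
    note h = two_categoryD(1,2)[OF C.two_category_axioms a b c]
    show "OMap (THom F a c) (hc1 C a b c g f) =
      hc1 D (TObj F a) (TObj F b) (TObj F c) (OMap (THom F b c) g) (OMap (THom F a b) f)"
      if "f \<in> Cell1 C a b" "g \<in> Cell1 C b c" for f g
      using r1_right_unique[OF i k F_r1[OF a c h(1)[OF that]]]
        r1_hc1[OF i j k F_r1[OF a b that(1)] F_r1[OF b c that(2)]] a b c by (simp add: TObj_F sL)
    show "AMap (THom F a c) (hc2 C a b c g f) =
      hc2 D (TObj F a) (TObj F b) (TObj F c) (AMap (THom F b c) g) (AMap (THom F a b) f)"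
      if "f \<in> Cell2 C a b" "g \<in> Cell2 C b c" for f g
      using r2_right_unique[OF i k F_r2[OF a c h(2)[OF that]]]
        r2_hc2[OF i j k F_r2[OF a b that(1)] F_r2[OF b c that(2)]] a b c by (simp add: TObj_F sL)
  qed
qed

text \<open>The components of the isomorphism are the lifts of the units of the common right legs.\<close>

lemma natural_iso_of_indices:
  assumes P: "two_functor C C P" and Q: "two_functor C C Q"
    and s: "\<And>a. a \<in> Cell0 C \<Longrightarrow> s a \<in> I \<and> L (s a) = TObj P a"
    and t: "\<And>a. a \<in> Cell0 C \<Longrightarrow> t a \<in> I \<and> L (t a) = TObj Q a"
    and st: "\<And>a. a \<in> Cell0 C \<Longrightarrow> R (s a) = R (t a)"
    and 1: "\<And>a b f. a \<in> Cell0 C \<Longrightarrow> b \<in> Cell0 C \<Longrightarrow> f \<in> Cell1 C a b \<Longrightarrow>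
      \<exists>g. r1 (s a) (s b) (OMap (THom P a b) f) g \<and> r1 (t a) (t b) (OMap (THom Q a b) f) g"
    and 2: "\<And>a b f. a \<in> Cell0 C \<Longrightarrow> b \<in> Cell0 C \<Longrightarrow> f \<in> Cell2 C a b \<Longrightarrow>
      \<exists>g. r2 (s a) (s b) (AMap (THom P a b) f) g \<and> r2 (t a) (t b) (AMap (THom Q a b) f) g"
  shows "\<exists>\<eta>. two_natural_iso C C P Q \<eta>"
proof
  let ?\<eta> = "\<lambda>a. THE e. r1 (s a) (t a) e (Unit D (R (s a)))"
  have \<eta>: "r1 (s a) (t a) (?\<eta> a) (Unit D (R (s a)))" if a: "a \<in> Cell0 C" for a
    by (rule theI'[OF r1_ex1(2)]) (use s t st a D.Unit_in[OF R_in] in auto)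
  show "two_natural_iso C C P Q ?\<eta>"
    unfolding two_natural_iso_def two_natural_iso_axioms_def
  proof (intro conjI allI impI P Q)
    fix a assume a: "a \<in> Cell0 C"
    have i: "s a \<in> I" "L (s a) = TObj P a" and i': "t a \<in> I" "L (t a) = TObj Q a"
      using s[OF a] t[OF a] by auto
    note u = \<eta>[OF a]
    \<comment> \<open>The same unit lifts to a 1-cell \<open>e\<close> in the opposite direction.
      The composites of the two lifts are partners of a composite of units, hence are units
      themselves.\<close>
    have "Unit D (R (s a)) \<in> Cell1 D (R (t a)) (R (s a))"
      using D.Unit_in[OF R_in[OF i(1)]] st[OF a] by simp
    then obtain e where e: "r1 (t a) (s a) e (Unit D (R (s a)))" "e \<in> Cell1 C (L (t a)) (L (s a))"
      using obtain_r1[OF i'(1) i(1)] by metis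
    have U: "hc1 D (R (s a)) (R (s a)) (R (s a)) (Unit D (R (s a))) (Unit D (R (s a))) =
      Unit D (R (s a))"
      using D.hc1_Unit_right[OF R_in R_in D.Unit_in[OF R_in]] i(1) by blast
    have "hc1 C (L (s a)) (L (t a)) (L (s a)) e (?\<eta> a) = Unit C (L (s a))"
      using r1_hc1[OF i(1) i'(1) i(1) u e(1)] r1_Unit[OF i(1)] r1_left_unique[OF i(1) i(1)]
        U st[OF a] by metis
    moreover have "hc1 C (L (t a)) (L (s a)) (L (t a)) (?\<eta> a) e = Unit C (L (t a))"
      using r1_hc1[OF i'(1) i(1) i'(1) e(1) u] r1_Unit[OF i'(1)] r1_left_unique[OF i'(1) i'(1)]
        U st[OF a] by metis
    ultimately show "is_iso1 C (TObj P a) (TObj Q a) (?\<eta> a)"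
      unfolding is_iso1_def using e(2) r1_cells[OF i(1) i'(1) u] i(2) i'(2) by auto
    fix b assume b: "b \<in> Cell0 C"
    have j: "s b \<in> I" "L (s b) = TObj P b" and j': "t b \<in> I" "L (t b) = TObj Q b"
      using s[OF b] t[OF b] by auto
    note v = \<eta>[OF b]
    fix f assume f: "f \<in> Cell1 C a b"
    obtain g where g: "r1 (s a) (s b) (OMap (THom P a b) f) g"
      "r1 (t a) (t b) (OMap (THom Q a b) f) g"
      using 1[OF a b f] by auto
    have g': "g \<in> Cell1 D (R (s a)) (R (s b))" using r1_cells[OF i(1) j(1) g(1)] by simp
    \<comment> \<open>Both composites are partners of \<open>g\<close>, once the unit is cancelled
      on either side of it.\<close>
    show "hc1 C (TObj P a) (TObj P b) (TObj Q b) (?\<eta> b) (OMap (THom P a b) f) =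
      hc1 C (TObj P a) (TObj Q a) (TObj Q b) (OMap (THom Q a b) f) (?\<eta> a)"
      using r1_hc1[OF i(1) j(1) j'(1) g(1) v] r1_hc1[OF i(1) i'(1) j'(1) u g(2)] r1_left_unique[OF
        i(1) j'(1)]
        D.hc1_Unit_left[OF R_in[OF i(1)] R_in[OF j(1)] g'] D.hc1_Unit_right[OF R_in[OF i(1)]
          R_in[OF j(1)] g']
        i(2) j(2) i'(2) j'(2) st[OF a] st[OF b] by metis
  next
    fix a b f assume a: "a \<in> Cell0 C" and b: "b \<in> Cell0 C" and f: "f \<in> Cell2 C a b"
    have i: "s a \<in> I" "L (s a) = TObj P a" and i': "t a \<in> I" "L (t a) = TObj Q a"
      using s[OF a] t[OF a] by auto
    have j: "s b \<in> I" "L (s b) = TObj P b" and j': "t b \<in> I" "L (t b) = TObj Q b"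
      using s[OF b] t[OF b] by auto
    have u: "r2 (s a) (t a) (Ide (Hom C (L (s a)) (L (t a))) (?\<eta> a)) (Ide (Hom D (R (s a)) (R (t
      a))) (Unit D (R (s a))))"
      and v: "r2 (s b) (t b) (Ide (Hom C (L (s b)) (L (t b))) (?\<eta> b)) (Ide (Hom D (R (s b)) (R (t
        b))) (Unit D (R (s b))))"
      using r2_Ide \<eta> a b i(1) i'(1) j(1) j'(1) by auto
    obtain g where g: "r2 (s a) (s b) (AMap (THom P a b) f) g"
      "r2 (t a) (t b) (AMap (THom Q a b) f) g"
      using 2[OF a b f] by auto
    have g': "g \<in> Cell2 D (R (s a)) (R (s b))" using r2_cells[OF i(1) j(1) g(1)] by simp
    show "lwh C (TObj P a) (TObj P b) (TObj Q b) (?\<eta> b) (AMap (THom P a b) f) =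
      rwh C (TObj P a) (TObj Q a) (TObj Q b) (AMap (THom Q a b) f) (?\<eta> a)"
      unfolding lwh_def rwh_def
      using r2_hc2[OF i(1) j(1) j'(1) g(1) v] r2_hc2[OF i(1) i'(1) j'(1) u g(2)] r2_left_unique[OF
        i(1) j'(1)]
        D.hc2_Unit_left[OF R_in[OF i(1)] R_in[OF j(1)] g', unfolded lwh_def]
        D.hc2_Unit_right[OF R_in[OF i(1)] R_in[OF j(1)] g', unfolded rwh_def]
        i(2) j(2) i'(2) j'(2) st[OF a] st[OF b] by metis
  qed
qed

sublocale swapped: two_cat_span D C I R L "\<lambda>i j g f. r1 i j f g" "\<lambda>i j \<sigma> \<tau>. r2 i j \<tau> \<sigma>"
  by (intro two_cat_span.intro swap C.two_category_axioms D.two_category_axioms)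

abbreviation "G \<equiv> swapped.F"

lemma unit_counit:
  "\<exists>\<eta>. two_natural_iso C C id_two_ftor (comp_two_ftor G F) \<eta>"
  "\<exists>\<epsilon>. two_natural_iso C C (comp_two_ftor G F) id_two_ftor \<epsilon>"
proof -
  \<comment> \<open>Going to \<open>D\<close> and back chooses a second index \<open>?t a\<close>,
    which need not be \<open>sL a\<close> but has the same right leg; these are the two families of
    indices for \<open>natural_iso_of_indices\<close>.\<close>
  let ?t = "\<lambda>a. sec I R (R (sL a))"
  have R_sL: "R (sL a) \<in> Cell0 D" if "a \<in> Cell0 C" for a
    using sL(1)[OF that] R_in by blast
  have s: "sL a \<in> I \<and> L (sL a) = TObj id_two_ftor a" if "a \<in> Cell0 C" for a
    using sL that by (simp add: id_two_ftor_def)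
  have t: "?t a \<in> I \<and> L (?t a) = TObj (comp_two_ftor G F) a" and st: "R (sL a) = R (?t a)"
    if "a \<in> Cell0 C" for a
    using swapped.sL R_sL[OF that] by (simp_all add: comp_two_ftor_def TObj_F swapped.TObj_F)
  have 1: "\<exists>g. r1 (sL a) (sL b) (OMap (THom id_two_ftor a b) f) g \<and>
      r1 (?t a) (?t b) (OMap (THom (comp_two_ftor G F) a b) f) g"
    if a: "a \<in> Cell0 C" and b: "b \<in> Cell0 C" and f: "f \<in> Cell1 C a b" for a b f
    using F_r1[OF a b f] swapped.F_r1[OF R_sL[OF a] R_sL[OF b]] r1_cells[OF sL(1)[OF a] sL(1)[OF b]
      F_r1[OF a b f]]
    by (auto simp: id_two_ftor_def comp_two_ftor_def TObj_F)
  have 2: "\<exists>g. r2 (sL a) (sL b) (AMap (THom id_two_ftor a b) f) g \<and>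
      r2 (?t a) (?t b) (AMap (THom (comp_two_ftor G F) a b) f) g"
    if a: "a \<in> Cell0 C" and b: "b \<in> Cell0 C" and f: "f \<in> Cell2 C a b" for a b f
    using F_r2[OF a b f] swapped.F_r2[OF R_sL[OF a] R_sL[OF b]] r2_cells[OF sL(1)[OF a] sL(1)[OF b]
      F_r2[OF a b f]]
    by (auto simp: id_two_ftor_def comp_two_ftor_def TObj_F)
  note tf = two_functor_id[OF C.two_category_axioms] two_functor_comp[OF two_functor_F
    swapped.two_functor_F]
  show "\<exists>\<eta>. two_natural_iso C C id_two_ftor (comp_two_ftor G F) \<eta>"
    by (rule natural_iso_of_indices[OF tf s t st 1 2])
  show "\<exists>\<epsilon>. two_natural_iso C C (comp_two_ftor G F) id_two_ftor \<epsilon>"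
    by (rule natural_iso_of_indices[OF tf(2,1) t s]) (use st 1 2 in \<open>auto simp: conj_commute\<close>)
qed

end

theorem (in cell_span) two_equivalent:
  assumes "two_category C"
  shows "two_equivalent C D"
proof -
  interpret two_cat_span C D I L R r1 r2
    by (intro two_cat_span.intro cell_span_axioms assms two_category_transport)
  \<comment> \<open>The counit on \<open>D\<close> is the second part of \<open>unit_counit\<close>,
    read for the span with its legs exchanged.\<close>
  show ?thesis
    unfolding two_equivalent_def
    using unit_counit(1) two_cat_span.unit_counit(2)[OF swapped.two_cat_span_axioms]
      two_functor_F swapped.two_functor_F
      C.two_category_axioms D.two_category_axioms by blast
qed

section \<open>The 2-category of fibrations\<close>

lemma sub_cat_simps [simp]:
  "Obj (sub_cat C P Q) = {x \<in> Obj C. P x}"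
  "Arr (sub_cat C P Q) = {f \<in> Arr C. P (Dom C f) \<and> P (Cod C f) \<and> Q f}"
  "Dom (sub_cat C P Q) = Dom C" "Cod (sub_cat C P Q) = Cod C"
  "Ide (sub_cat C P Q) = Ide C" "Comp (sub_cat C P Q) = Comp C"
  by (simp_all add: sub_cat_def)

text \<open>A sub-2-category inherits every equation; what is left are the closure conditions on
  \<open>P\<close> and \<open>Q\<close>. The map \<open>\<pi>\<close> forgets the extra data of a
  0-cell of \<open>M\<close>: a slice object carries its projection, so several 0-cells of
  \<open>M\<close> may lie over one of \<open>K\<close>.\<close>

lemma two_category_sub:
  fixes K :: "('o, 'f, 't) two_cat" and M :: "('p, 'f, 't) two_cat"
  assumes K: "two_category K" and obj: "\<And>a. a \<in> Cell0 M \<Longrightarrow> \<pi> a \<in> Cell0 K"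
    and Hom: "\<And>a b. a \<in> Cell0 M \<Longrightarrow> b \<in> Cell0 M \<Longrightarrow> Hom M a b = sub_cat (Hom K (\<pi> a) (\<pi> b)) (P a b) (Q a
      b)"
    and Unit: "\<And>a. a \<in> Cell0 M \<Longrightarrow> Unit M a = Unit K (\<pi> a)"
    and HComp: "\<And>a b c. a \<in> Cell0 M \<Longrightarrow> b \<in> Cell0 M \<Longrightarrow> c \<in> Cell0 M \<Longrightarrow>
      HComp M a b c = HComp K (\<pi> a) (\<pi> b) (\<pi> c)"
    and P_Unit: "\<And>a. a \<in> Cell0 M \<Longrightarrow> P a a (Unit K (\<pi> a))"
    and P_hc1: "\<And>a b c f g. a \<in> Cell0 M \<Longrightarrow> b \<in> Cell0 M \<Longrightarrow> c \<in> Cell0 M \<Longrightarrow>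
      f \<in> Cell1 M a b \<Longrightarrow> g \<in> Cell1 M b c \<Longrightarrow> P a c (hc1 K (\<pi> a) (\<pi> b) (\<pi> c) g f)"
    and Q_Ide: "\<And>a b f. a \<in> Cell0 M \<Longrightarrow> b \<in> Cell0 M \<Longrightarrow> f \<in> Cell1 M a b \<Longrightarrow>
      Q a b (Ide (Hom K (\<pi> a) (\<pi> b)) f)"
    and Q_Comp: "\<And>a b \<sigma> \<tau>. a \<in> Cell0 M \<Longrightarrow> b \<in> Cell0 M \<Longrightarrow> \<tau> \<in> Cell2 M a b \<Longrightarrow> \<sigma> \<in> Cell2 M a b \<Longrightarrow>
      Dom (Hom K (\<pi> a) (\<pi> b)) \<sigma> = Cod (Hom K (\<pi> a) (\<pi> b)) \<tau> \<Longrightarrow> Q a b (\<sigma> \<cdot>[Hom K (\<pi> a) (\<pi> b)] \<tau>)"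
    and Q_hc2: "\<And>a b c \<sigma> \<tau>. a \<in> Cell0 M \<Longrightarrow> b \<in> Cell0 M \<Longrightarrow> c \<in> Cell0 M \<Longrightarrow>
      \<tau> \<in> Cell2 M a b \<Longrightarrow> \<sigma> \<in> Cell2 M b c \<Longrightarrow> Q a c (hc2 K (\<pi> a) (\<pi> b) (\<pi> c) \<sigma> \<tau>)"
  shows "two_category M"
proof (rule two_category.intro)
  have hc: "hc1 M a b c = hc1 K (\<pi> a) (\<pi> b) (\<pi> c)" "hc2 M a b c = hc2 K (\<pi> a) (\<pi> b) (\<pi> c)"
    if "a \<in> Cell0 M" "b \<in> Cell0 M" "c \<in> Cell0 M" for a b c
    by (simp_all add: hc1_def hc2_def HComp that fun_eq_iff)
  have cat[simp]: "category (Hom K (\<pi> a) (\<pi> b))" if "a \<in> Cell0 M" "b \<in> Cell0 M" for a b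
    using two_category.Hom_category[OF K] obj that by simp
  show H: "category (Hom M a b)" if ab: "a \<in> Cell0 M" "b \<in> Cell0 M" for a b
    by (rule categoryI; simp add: Hom[OF ab] ab) (use Q_Ide[OF ab] Q_Comp[OF ab]
      in \<open>auto simp: Hom ab\<close>)
  show "Unit M a \<in> Cell1 M a a" if "a \<in> Cell0 M" for a
    using that two_category.Unit_in[OF K] obj P_Unit by (simp add: Hom Unit)
  show "is_functor (prod_cat (Hom M b c) (Hom M a b)) (Hom M a c) (HComp M a b c)"
    if abc: "a \<in> Cell0 M" "b \<in> Cell0 M" "c \<in> Cell0 M" for a b c
  proof -
    note D = two_categoryD[OF K obj[OF abc(1)] obj[OF abc(2)] obj[OF abc(3)]]
    show ?thesis
    proof (rule HComp_functorI)
      show "hc1 M a b c g f \<in> Cell1 M a c" if "f \<in> Cell1 M a b" "g \<in> Cell1 M b c" for f g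
        using that D(1)[of f g] P_hc1[OF abc that] by (simp add: hc abc Hom)
      show "hc2 M a b c \<sigma> \<tau> \<in> Cell2 M a c \<and>
        Dom (Hom M a c) (hc2 M a b c \<sigma> \<tau>) = hc1 M a b c (Dom (Hom M b c) \<sigma>) (Dom (Hom M a b) \<tau>) \<and>
        Cod (Hom M a c) (hc2 M a b c \<sigma> \<tau>) = hc1 M a b c (Cod (Hom M b c) \<sigma>) (Cod (Hom M a b) \<tau>)"
        if t: "\<tau> \<in> Cell2 M a b" "\<sigma> \<in> Cell2 M b c" for \<sigma> \<tau>
        using t D(2-4)[of \<tau> \<sigma>] Q_hc2[OF abc t] P_hc1[OF abc, of "Dom (Hom K (\<pi> a) (\<pi> b)) \<tau>"
          "Dom (Hom K (\<pi> b) (\<pi> c)) \<sigma>"]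
          P_hc1[OF abc, of "Cod (Hom K (\<pi> a) (\<pi> b)) \<tau>" "Cod (Hom K (\<pi> b) (\<pi> c)) \<sigma>"]
        by (simp add: hc abc Hom)
      show "hc2 M a b c (Ide (Hom M b c) g) (Ide (Hom M a b) f) = Ide (Hom M a c) (hc1 M a b c g f)"
        if "f \<in> Cell1 M a b" "g \<in> Cell1 M b c" for f g
        using that D(5)[of f g] by (simp add: hc abc Hom)
      show "hc2 M a b c (\<sigma>' \<cdot>[Hom M b c] \<sigma>) (\<tau>' \<cdot>[Hom M a b] \<tau>) =
        hc2 M a b c \<sigma>' \<tau>' \<cdot>[Hom M a c] hc2 M a b c \<sigma> \<tau>"
        if "\<tau> \<in> Cell2 M a b" "\<tau>' \<in> Cell2 M a b" "Dom (Hom M a b) \<tau>' = Cod (Hom M a b) \<tau>"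
          "\<sigma> \<in> Cell2 M b c" "\<sigma>' \<in> Cell2 M b c" "Dom (Hom M b c) \<sigma>' = Cod (Hom M b c) \<sigma>"
            for \<tau> \<tau>' \<sigma> \<sigma>'
        using that D(6)[of \<tau> \<tau>' \<sigma> \<sigma>'] by (simp add: hc abc Hom)
    qed (use H abc in auto)
  qed
  fix a b assume ab: "a \<in> Cell0 M" "b \<in> Cell0 M"
  show "hc1 M a a b f (Unit M a) = f" "hc1 M a b b (Unit M b) f = f" if "f \<in> Cell1 M a b" for f
    using that two_category.hc1_Unit_right[OF K obj obj] two_category.hc1_Unit_left[OF K obj obj] ab
    by (auto simp: hc Hom Unit)
  show "rwh M a a b \<tau> (Unit M a) = \<tau>" "lwh M a b b (Unit M b) \<tau> = \<tau>" if "\<tau> \<in> Cell2 M a b" for \<tau>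
    using that two_category.hc2_Unit_right[OF K obj obj] two_category.hc2_Unit_left[OF K obj obj] ab
    by (auto simp: lwh_def rwh_def hc Hom Unit)
next
  have hc: "hc1 M a b c = hc1 K (\<pi> a) (\<pi> b) (\<pi> c)" "hc2 M a b c = hc2 K (\<pi> a) (\<pi> b) (\<pi> c)"
    if "a \<in> Cell0 M" "b \<in> Cell0 M" "c \<in> Cell0 M" for a b c
    by (simp_all add: hc1_def hc2_def HComp that fun_eq_iff)
  fix a b c d assume ob: "a \<in> Cell0 M" "b \<in> Cell0 M" "c \<in> Cell0 M" "d \<in> Cell0 M"
  show "hc1 M a b d (hc1 M b c d h g) f = hc1 M a c d h (hc1 M a b c g f)"
    if "f \<in> Cell1 M a b" "g \<in> Cell1 M b c" "h \<in> Cell1 M c d" for f g h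
    using that two_category.hc1_assoc[OF K obj obj obj obj, of a b c d f g h] ob
      by (simp add: hc Hom)
  show "hc2 M a b d (hc2 M b c d h g) f = hc2 M a c d h (hc2 M a b c g f)"
    if "f \<in> Cell2 M a b" "g \<in> Cell2 M b c" "h \<in> Cell2 M c d" for f g h
    using that two_category.hc2_assoc[OF K obj obj obj obj, of a b c d f g h] ob
      by (simp add: hc Hom)
qed

section \<open>The hom-categories of \<open>Fib\<close> in pointwise form\<close>

definition cartesian_over :: "('o, 'a) cat \<Rightarrow> ('o2, 'a2) cat \<Rightarrow> ('p, 'b) cat \<Rightarrow>
    ('o, 'a, 'p, 'b) ftor \<Rightarrow> ('o2, 'a2, 'p, 'b) ftor \<Rightarrow> ('o, 'a, 'o2, 'a2) ftor \<Rightarrow> bool" where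
  "cartesian_over E E' B p p' H \<longleftrightarrow> (\<forall>e\<in>Obj E. OMap p' (OMap H e) = OMap p e) \<and>
     (\<forall>k\<in>Arr E. AMap p' (AMap H k) = AMap p k) \<and> preserves_cartesian E E' B p p' H"

lemma comp_ftor_eq_iff:
  assumes "p \<in> functors E B"
  shows "comp_ftor E p' H = p \<longleftrightarrow> (\<forall>e\<in>Obj E. OMap p' (OMap H e) = OMap p e) \<and>
     (\<forall>k\<in>Arr E. AMap p' (AMap H k) = AMap p k)"
proof
  assume "comp_ftor E p' H = p"
  then show "(\<forall>e\<in>Obj E. OMap p' (OMap H e) = OMap p e) \<and> (\<forall>k\<in>Arr E. AMap p' (AMap H k) = AMap p k)"
    using OMap_comp_ftor[of _ E p' H] AMap_comp_ftor[of _ E p' H] by auto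
next
  assume *: "(\<forall>e\<in>Obj E. OMap p' (OMap H e) = OMap p e) \<and> (\<forall>k\<in>Arr E. AMap p' (AMap H k) = AMap p k)"
  have "OMap (comp_ftor E p' H) = OMap p" "AMap (comp_ftor E p' H) = AMap p"
    by (rule extensionalityI[of _ "Obj E"], use * functorsD(9)[OF assms]
      in \<open>auto simp: comp_ftor_def\<close>)
      (rule extensionalityI[of _ "Arr E"], use * functorsD(10)[OF assms]
        in \<open>auto simp: comp_ftor_def\<close>)
  then show "comp_ftor E p' H = p" by simp
qed

lemma Fib_Cell0: "(E, p) \<in> Cell0 (Fib U B) \<longleftrightarrow> small_category U E \<and> p \<in> functors E B \<and>
  fibration E B p"
  by (auto simp: Fib_def sub_two_cat_def slice_def)

lemma Fib_Unit [simp]: "Unit (Fib U B) (E, p) = id_ftor E"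
  and Fib_hc1 [simp]: "hc1 (Fib U B) (E, p) (E', p') (E'', p'') G H = comp_ftor E G H"
  and Fib_hc2 [simp]: "hc2 (Fib U B) (E, p) (E', p') (E'', p'') \<sigma> \<tau> = hcomp_ntrans E E'' \<sigma> \<tau>"
  by (simp_all add: Fib_def sub_two_cat_def slice_def hc1_def hc2_def Cat_def)

text \<open>By extensionality the slice conditions, which are equations between functors and between
  transformations, become pointwise: \<open>H\<close> lies over \<open>B\<close>, and each component
  of a 2-cell lies over an identity.\<close>

lemma Fib_Hom:
  assumes "(E, p) \<in> Cell0 (Fib U B)" "(E', p') \<in> Cell0 (Fib U B)"
  shows "Hom (Fib U B) (E, p) (E', p') = sub_cat (functor_cat E E') (cartesian_over E E' B p p')
     (\<lambda>\<theta>. \<forall>e\<in>Obj E. AMap p' (NMap \<theta> e) = Ide B (OMap p e))"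
proof -
  have p: "p \<in> functors E B" and p': "p' \<in> functors E' B" using assms by (auto simp: Fib_Cell0)
  have *: "hcomp_ntrans E B (Ide (functor_cat E' B) p') \<theta> = Ide (functor_cat E B) p \<longleftrightarrow>
     (\<forall>e\<in>Obj E. AMap p' (NMap \<theta> e) = Ide B (OMap p e))"
    if t: "\<theta> \<in> ntranses E E'" and c: "comp_ftor E p' (NDom \<theta>) = p" "comp_ftor E p' (NCod \<theta>) = p"
      for \<theta>
  proof -
    note T = ntransesD[OF t]
    have eq: "NMap (hcomp_ntrans E B (Ide (functor_cat E' B) p') \<theta>) e = AMap p' (NMap \<theta> e)"
      if "e \<in> Obj E" for e
      using that T(4-6) functorsD(2-6)[OF p'] functorsD(3)[OF T(2)] by simp
    show ?thesis
    proof
      assume "hcomp_ntrans E B (Ide (functor_cat E' B) p') \<theta> = Ide (functor_cat E B) p"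
      then have "NMap (hcomp_ntrans E B (Ide (functor_cat E' B) p') \<theta>) = NMap (Ide (functor_cat E B)
        p)" by simp
      then show "\<forall>e\<in>Obj E. AMap p' (NMap \<theta> e) = Ide B (OMap p e)"
        using eq by (auto simp del: hcomp_ntrans_simps)
    next
      assume "\<forall>e\<in>Obj E. AMap p' (NMap \<theta> e) = Ide B (OMap p e)"
      then show "hcomp_ntrans E B (Ide (functor_cat E' B) p') \<theta> = Ide (functor_cat E B) p"
        by (intro ntrans_eqI[where X = "Obj E"]) (auto simp: eq c simp del: hcomp_ntrans_simps(3),
          auto)
    qed
  qed
  have "Obj (Hom (Fib U B) (E, p) (E', p')) = Obj (sub_cat (functor_cat E E') (cartesian_over E E' B
    p p')
     (\<lambda>\<theta>. \<forall>e\<in>Obj E. AMap p' (NMap \<theta> e) = Ide B (OMap p e)))"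
    "Arr (Hom (Fib U B) (E, p) (E', p')) = Arr (sub_cat (functor_cat E E') (cartesian_over E E' B p
      p')
     (\<lambda>\<theta>. \<forall>e\<in>Obj E. AMap p' (NMap \<theta> e) = Ide B (OMap p e)))"
    using * by (auto simp: Fib_def sub_two_cat_def slice_def cartesian_over_def comp_ftor_eq_iff[OF
      p])
  then show ?thesis
    by (intro cat.equality) (simp_all add: Fib_def sub_two_cat_def slice_def)
qed

lemma Fib_Cell1:
  assumes "(E, p) \<in> Cell0 (Fib U B)" "(E', p') \<in> Cell0 (Fib U B)"
  shows "H \<in> Cell1 (Fib U B) (E, p) (E', p') \<longleftrightarrow> H \<in> functors E E' \<and> cartesian_over E E' B p p' H"
  by (simp add: Fib_Hom[OF assms])

lemma Fib_Cell2:
  assumes "(E, p) \<in> Cell0 (Fib U B)" "(E', p') \<in> Cell0 (Fib U B)"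
  shows "\<theta> \<in> Cell2 (Fib U B) (E, p) (E', p') \<longleftrightarrow> \<theta> \<in> ntranses E E' \<and>
    cartesian_over E E' B p p' (NDom \<theta>) \<and> cartesian_over E E' B p p' (NCod \<theta>) \<and>
    (\<forall>e\<in>Obj E. AMap p' (NMap \<theta> e) = Ide B (OMap p e))"
  by (simp add: Fib_Hom[OF assms])

lemma cartesian_over_comp:
  assumes "H \<in> functors E E'" "cartesian_over E E' B p p' H" "cartesian_over E' E'' B p' p'' G"
  shows "cartesian_over E E'' B p p'' (comp_ftor E G H)"
proof -
  have "g \<in> Arr E" if "cartesian E B p g" for g using that by (simp add: cartesian_def)
  then show ?thesis
    using assms functorsD[OF assms(1)] by (auto simp: cartesian_over_def preserves_cartesian_def)
qed

lemma two_category_Fib: "two_category (Fib U B)"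
proof (rule two_category_sub[OF two_category_Cat[of U], where \<pi> = fst and
      P = "\<lambda>(E, p) (E', p'). cartesian_over E E' B p p'" and
      Q = "\<lambda>(E, p) (E', p') \<theta>. \<forall>e\<in>Obj E. AMap p' (NMap \<theta> e) = Ide B (OMap p e)"]; clarify?)
  show "fst (E, p) \<in> Cell0 (Cat U)" if "(E, p) \<in> Cell0 (Fib U B)" for E p
    using that by (simp add: Fib_Cell0)
  show "cartesian_over E E B p p (Unit (Cat U) (fst (E, p)))" if "(E, p) \<in> Cell0 (Fib U B)" for E p
    by (auto simp: cartesian_over_def preserves_cartesian_def cartesian_def)
next
  fix E p E' p' E'' p'' G H
  assume ob: "(E, p) \<in> Cell0 (Fib U B)" "(E', p') \<in> Cell0 (Fib U B)" "(E'', p'') \<in> Cell0 (Fib U B)"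
    and "H \<in> Cell1 (Fib U B) (E, p) (E', p')" "G \<in> Cell1 (Fib U B) (E', p') (E'', p'')"
  then show "cartesian_over E E'' B p p'' (hc1 (Cat U) (fst (E, p)) (fst (E', p')) (fst (E'',
    p'')) G H)"
    by (auto simp: Fib_Cell1 intro: cartesian_over_comp)
next
  fix E p E' p' H e
  assume ob: "(E, p) \<in> Cell0 (Fib U B)" "(E', p') \<in> Cell0 (Fib U B)"
    and "H \<in> Cell1 (Fib U B) (E, p) (E', p')" "e \<in> Obj E"
  then show "AMap p' (NMap (Ide (Hom (Cat U) (fst (E, p)) (fst (E', p'))) H) e) = Ide B (OMap p e)"
    by (auto simp: Fib_Cell1 Fib_Cell0 functorsD cartesian_over_def)
next
  fix E p E' p' \<sigma> \<tau> e
  assume ob: "(E, p) \<in> Cell0 (Fib U B)" "(E', p') \<in> Cell0 (Fib U B)"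
    and st: "\<tau> \<in> Cell2 (Fib U B) (E, p) (E', p')" "\<sigma> \<in> Cell2 (Fib U B) (E, p) (E', p')" and e:
      "e \<in> Obj E"
    and c: "Dom (Hom (Cat U) (fst (E, p)) (fst (E', p'))) \<sigma> = Cod (Hom (Cat U) (fst (E,
      p)) (fst (E', p'))) \<tau>"
  have t: "\<tau> \<in> ntranses E E'" and s: "\<sigma> \<in> ntranses E E'" and p: "p \<in> functors E B" and p':
    "p' \<in> functors E' B"
    using ob st by (auto simp: Fib_Cell2 Fib_Cell0)
  have "AMap p' (NMap \<tau> e) = Ide B (OMap p e)" "AMap p' (NMap \<sigma> e) = Ide B (OMap p e)"
    using ob st e by (auto simp: Fib_Cell2)
  then show "AMap p' (NMap (\<sigma> \<cdot>[Hom (Cat U) (fst (E, p)) (fst (E', p'))] \<tau>) e) = Ide B (OMap p e)"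
    using e c ntransesD(4-6)[OF t] ntransesD(4-6)[OF s] functorsD(8)[OF p'] functorsD(2,3)[OF p]
      by simp
next
  fix E p E' p' E'' p'' \<sigma> \<tau> e
  assume ob: "(E, p) \<in> Cell0 (Fib U B)" "(E', p') \<in> Cell0 (Fib U B)" "(E'', p'') \<in> Cell0 (Fib U B)"
    and st: "\<tau> \<in> Cell2 (Fib U B) (E, p) (E', p')" "\<sigma> \<in> Cell2 (Fib U B) (E', p') (E'', p'')" and e:
      "e \<in> Obj E"
  have t: "\<tau> \<in> ntranses E E'" and s: "\<sigma> \<in> ntranses E' E''" and p: "p \<in> functors E B" and p':
    "p' \<in> functors E' B"
    and p'': "p'' \<in> functors E'' B"
    using ob st by (auto simp: Fib_Cell2 Fib_Cell0)
  \<comment> \<open>A component of the horizontal composite is a component of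
    \<open>\<sigma>\<close> after the image of a component of \<open>\<tau>\<close> under
    \<open>NDom \<sigma>\<close>. That functor lies over \<open>B\<close>, so both factors lie over
    the same identity.\<close>
  have "AMap p' (NMap \<tau> e) = Ide B (OMap p e)"
    "\<forall>e\<in>Obj E'. AMap p'' (NMap \<sigma> e) = Ide B (OMap p' e)" "cartesian_over E' E'' B p' p'' (NDom \<sigma>)"
    "cartesian_over E E' B p p' (NCod \<tau>)"
    using ob st e by (auto simp: Fib_Cell2)
  moreover note T = ntransesD[OF t] and S = ntransesD[OF s]
  ultimately show "AMap p'' (NMap (hc2 (Cat U) (fst (E, p)) (fst (E', p')) (fst (E'',
    p'')) \<sigma> \<tau>) e) = Ide B (OMap p e)"
    using e T(4-6) S(4-6) functorsD(3)[OF T(2) e] functorsD(3-6)[OF S(1)] functorsD(8)[OF p'']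
      functorsD(2,3)[OF p] by (simp add: cartesian_over_def)
qed (auto simp: Fib_Hom, auto simp: Fib_def sub_two_cat_def slice_def)

section \<open>Pseudofunctors to the 2-category of categories, in components\<close>

lemma op_cat_simps [simp]:
  "Obj (op_cat B) = Obj B" "Arr (op_cat B) = Arr B" "Dom (op_cat B) = Cod B" "Cod (op_cat B) =
    Dom B"
  "Ide (op_cat B) = Ide B" "Comp (op_cat B) g f = f \<cdot>[B] g"
  by (simp_all add: op_cat_def)

lemma is_isoI: "f \<in> Arr C \<Longrightarrow> g \<in> Arr C \<Longrightarrow> Dom C g = Cod C f \<Longrightarrow> Cod C g = Dom C f \<Longrightarrow>
    g \<cdot>[C] f = Ide C (Dom C f) \<Longrightarrow> f \<cdot>[C] g = Ide C (Cod C f) \<Longrightarrow> is_iso C f"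
  by (auto simp: is_iso_def arrows_iff)

text \<open>Pointwise inverses are automatically natural, so an invertible 2-cell of
  \<open>Cat\<close> may be handled one object at a time.\<close>

lemma is_iso_functor_cat:
  assumes t: "\<tau> \<in> ntranses A B"
  shows "is_iso (functor_cat A B) \<tau> \<longleftrightarrow> (\<forall>x\<in>Obj A. is_iso B (NMap \<tau> x))"
proof
  note T = ntransesD[OF t]
  note D1 = functorsD(1-6)[OF T(1)] and D2 = functorsD(3-6)[OF T(2)]
  {
    assume "is_iso (functor_cat A B) \<tau>"
    then obtain \<sigma> where s: "\<sigma> \<in> ntranses A B" "NDom \<sigma> = NCod \<tau>" "NCod \<sigma> = NDom \<tau>"
      "\<sigma> \<cdot>[functor_cat A B] \<tau> = Ide (functor_cat A B) (NDom \<tau>)"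
      "\<tau> \<cdot>[functor_cat A B] \<sigma> = Ide (functor_cat A B) (NCod \<tau>)"
      by (auto simp: is_iso_def arrows_iff)
    note S = ntransesD[OF s(1)]
    show "\<forall>x\<in>Obj A. is_iso B (NMap \<tau> x)"
    proof
      fix x assume x: "x \<in> Obj A"
      show "is_iso B (NMap \<tau> x)"
        by (rule is_isoI[where g = "NMap \<sigma> x"])
          (use x T(4-6) S(4-6) s(2,3) arg_cong[OF s(4), of "\<lambda>t. NMap t x"] arg_cong[OF s(5),
            of "\<lambda>t. NMap t x"] in auto)
    qed
  }
  assume *: "\<forall>x\<in>Obj A. is_iso B (NMap \<tau> x)"
  then have "\<forall>x\<in>Obj A. \<exists>g. g \<in> Arr B \<and> Dom B g = OMap (NCod \<tau>) x \<and> Cod B g = OMap (NDom \<tau>) x \<and>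
      g \<cdot>[B] NMap \<tau> x = Ide B (OMap (NDom \<tau>) x) \<and> NMap \<tau> x \<cdot>[B] g = Ide B (OMap (NCod \<tau>) x)"
    using T(4-6) by (simp add: is_iso_def Bex_def arrows_iff conj_assoc)
  then obtain i where i: "\<And>x. x \<in> Obj A \<Longrightarrow> i x \<in> Arr B \<and> Dom B (i x) = OMap (NCod \<tau>) x \<and>
    Cod B (i x) = OMap (NDom \<tau>) x \<and>
      i x \<cdot>[B] NMap \<tau> x = Ide B (OMap (NDom \<tau>) x) \<and> NMap \<tau> x \<cdot>[B] i x = Ide B (OMap (NCod \<tau>) x)"
    by metis
  let ?\<sigma> = "\<lparr>NDom = NCod \<tau>, NCod = NDom \<tau>, NMap = (\<lambda>x\<in>Obj A. i x)\<rparr>"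
  have s: "?\<sigma> \<in> ntranses A B"
  proof (rule ntransesI)
    fix f assume f: "f \<in> Arr A"
    let ?x = "Dom A f" and ?y = "Cod A f"
    have xy: "?x \<in> Obj A" "?y \<in> Obj A" using f D1(1) by auto
    note ix = i[OF xy(1)] and iy = i[OF xy(2)]
    \<comment> \<open>Insert \<open>NMap \<tau> ?x \<cdot>[B] i ?x\<close>, which is an identity,
      move the first factor across by naturality, and cancel it at the other end.\<close>
    have "i ?y \<cdot>[B] AMap (NCod \<tau>) f = i ?y \<cdot>[B] AMap (NCod \<tau>) f \<cdot>[B] (NMap \<tau> ?x \<cdot>[B] i ?x)"
      using f ix D1(1,2) D2 by simp
    also have "\<dots> = i ?y \<cdot>[B] (AMap (NCod \<tau>) f \<cdot>[B] NMap \<tau> ?x) \<cdot>[B] i ?x"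
      using f xy ix iy D1(1,2) D2 T(4-6) by simp
    also have "\<dots> = i ?y \<cdot>[B] (NMap \<tau> ?y \<cdot>[B] AMap (NDom \<tau>) f) \<cdot>[B] i ?x"
      using T(7)[OF f] by simp
    also have "\<dots> = (i ?y \<cdot>[B] NMap \<tau> ?y) \<cdot>[B] AMap (NDom \<tau>) f \<cdot>[B] i ?x"
      using f xy ix iy[THEN conjunct1] iy[THEN conjunct2, THEN conjunct1] iy[THEN conjunct2,
        THEN conjunct2, THEN conjunct1]
        D1 D2 T(4-6) by simp
    also have "\<dots> = AMap (NDom \<tau>) f \<cdot>[B] i ?x"
      using f xy ix iy D1 by simp
    finally show "NMap ?\<sigma> ?y \<cdot>[B] AMap (NDom ?\<sigma>) f = AMap (NCod ?\<sigma>) f \<cdot>[B] NMap ?\<sigma> ?x"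
      using xy by simp
  qed (use T i in auto)
  show "is_iso (functor_cat A B) \<tau>"
    by (rule is_isoI[where g = ?\<sigma>]) (use s t i T in \<open>auto intro!: ntrans_eqI[where X = "Obj A"]\<close>)
qed

abbreviation "pobj F f \<equiv> OMap (PArr F f)"
abbreviation "parr F f \<equiv> AMap (PArr F f)"
abbreviation "punit F x \<equiv> NMap (PUnit F x)"
abbreviation "pcomp F g f \<equiv> NMap (PComp F g f)"
abbreviation "nobj \<alpha> x \<equiv> OMap (PN1 \<alpha> x)"
abbreviation "narr \<alpha> x \<equiv> AMap (PN1 \<alpha> x)"
abbreviation "ncell \<alpha> f \<equiv> NMap (PN2 \<alpha> f)"
abbreviation "mcell \<Gamma> x \<equiv> NMap (MMap \<Gamma> x)"

type_synonym 'u cat_psfun = "('u, 'u, ('u, 'u) cat, ('u, 'u, 'u, 'u) ftor, ('u, 'u, 'u,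
  'u) ntrans) psfun"
type_synonym 'u cat_psnat = "('u, 'u, ('u, 'u, 'u, 'u) ftor, ('u, 'u, 'u, 'u) ntrans) psnat"
type_synonym 'u cat_modif = "('u, 'u, ('u, 'u, 'u, 'u) ftor, ('u, 'u, 'u, 'u) ntrans) modif"

text \<open>Composition in \<open>op_cat B\<close> is reversed: \<open>PArr F f\<close> goes from
  the fibre over \<open>Cod B f\<close> to the one over \<open>Dom B f\<close>, and the constraint
  \<open>PComp F g f\<close> ends in \<open>PArr F (f \<cdot>[B] g)\<close>. Equations between
  2-cells are evaluated at objects \<open>u\<close>.\<close>

locale indexed_category =
  fixes U :: "'u set set" and B :: "('u, 'u) cat"
    and F :: "'u cat_psfun"
  assumes category_B [simp]: "category B"
    and small_fibre: "x \<in> Obj B \<Longrightarrow> small_category U (PObj F x)"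
    and PArr_functor: "f \<in> Arr B \<Longrightarrow> PArr F f \<in> functors (PObj F (Cod B f)) (PObj F (Dom B f))"
    and PUnit_ntrans: "x \<in> Obj B \<Longrightarrow> PUnit F x \<in> ntranses (PObj F x) (PObj F x)"
    and PUnit_Dom: "x \<in> Obj B \<Longrightarrow> NDom (PUnit F x) = id_ftor (PObj F x)"
    and PUnit_Cod: "x \<in> Obj B \<Longrightarrow> NCod (PUnit F x) = PArr F (Ide B x)"
    and PUnit_is_iso: "x \<in> Obj B \<Longrightarrow> u \<in> Obj (PObj F x) \<Longrightarrow> is_iso (PObj F x) (punit F x u)"
    and PComp_ntrans: "f \<in> Arr B \<Longrightarrow> g \<in> Arr B \<Longrightarrow> Dom B f = Cod B g \<Longrightarrow>
      PComp F g f \<in> ntranses (PObj F (Cod B f)) (PObj F (Dom B g))"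
    and PComp_Dom: "f \<in> Arr B \<Longrightarrow> g \<in> Arr B \<Longrightarrow> Dom B f = Cod B g \<Longrightarrow>
      NDom (PComp F g f) = comp_ftor (PObj F (Cod B f)) (PArr F g) (PArr F f)"
    and PComp_Cod: "f \<in> Arr B \<Longrightarrow> g \<in> Arr B \<Longrightarrow> Dom B f = Cod B g \<Longrightarrow>
      NCod (PComp F g f) = PArr F (f \<cdot>[B] g)"
    and PComp_is_iso: "f \<in> Arr B \<Longrightarrow> g \<in> Arr B \<Longrightarrow> Dom B f = Cod B g \<Longrightarrow> u \<in> Obj (PObj F (Cod B f)) \<Longrightarrow>
      is_iso (PObj F (Dom B g)) (pcomp F g f u)"
    and unit_right: "f \<in> Arr B \<Longrightarrow> u \<in> Obj (PObj F (Cod B f)) \<Longrightarrow>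
      pcomp F f (Ide B (Cod B f)) u \<cdot>[PObj F (Dom B f)] parr F f (punit F (Cod B f) u) =
      Ide (PObj F (Dom B f)) (pobj F f u)"
    and unit_left: "f \<in> Arr B \<Longrightarrow> u \<in> Obj (PObj F (Cod B f)) \<Longrightarrow>
      pcomp F (Ide B (Dom B f)) f u \<cdot>[PObj F (Dom B f)] punit F (Dom B f) (pobj F f u) =
      Ide (PObj F (Dom B f)) (pobj F f u)"
    and assoc: "f \<in> Arr B \<Longrightarrow> g \<in> Arr B \<Longrightarrow> h \<in> Arr B \<Longrightarrow> Dom B f = Cod B g \<Longrightarrow> Dom B g = Cod B h \<Longrightarrow>
      u \<in> Obj (PObj F (Cod B f)) \<Longrightarrow>
      pcomp F (g \<cdot>[B] h) f u \<cdot>[PObj F (Dom B h)] pcomp F h g (pobj F f u) =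
      pcomp F h (f \<cdot>[B] g) u \<cdot>[PObj F (Dom B h)] parr F h (pcomp F g f u)"
begin

lemma category_fibre [simp]: "x \<in> Obj B \<Longrightarrow> category (PObj F x)"
  using small_fibre small_categoryD by blast

lemma
  assumes "f \<in> Arr B" "y = Dom B f"
  shows reindex_Obj [simp]: "u \<in> Obj (PObj F (Cod B f)) \<Longrightarrow> pobj F f u \<in> Obj (PObj F y)"
    and reindex_Arr [simp]: "\<phi> \<in> Arr (PObj F (Cod B f)) \<Longrightarrow> parr F f \<phi> \<in> Arr (PObj F y)"
    and Dom_reindex [simp]: "\<phi> \<in> Arr (PObj F (Cod B f)) \<Longrightarrow>
      Dom (PObj F y) (parr F f \<phi>) = pobj F f (Dom (PObj F (Cod B f)) \<phi>)"
    and Cod_reindex [simp]: "\<phi> \<in> Arr (PObj F (Cod B f)) \<Longrightarrow>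
      Cod (PObj F y) (parr F f \<phi>) = pobj F f (Cod (PObj F (Cod B f)) \<phi>)"
    and reindex_Ide [simp]: "x = Cod B f \<Longrightarrow> u \<in> Obj (PObj F x) \<Longrightarrow>
      parr F f (Ide (PObj F x) u) = Ide (PObj F y) (pobj F f u)"
    and reindex_Comp: "x = Cod B f \<Longrightarrow> \<phi> \<in> Arr (PObj F x) \<Longrightarrow> \<psi> \<in> Arr (PObj F x) \<Longrightarrow>
      Dom (PObj F x) \<psi> = Cod (PObj F x) \<phi> \<Longrightarrow>
      parr F f (\<psi> \<cdot>[PObj F x] \<phi>) = parr F f \<psi> \<cdot>[PObj F y] parr F f \<phi>"
  using functorsD(3-8)[OF PArr_functor[OF assms(1)]] assms(2) by auto

lemma
  assumes "x \<in> Obj B" "u \<in> Obj (PObj F x)"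
  shows PUnit_Arr [simp]: "punit F x u \<in> Arr (PObj F x)"
    and Dom_PUnit [simp]: "Dom (PObj F x) (punit F x u) = u"
    and Cod_PUnit [simp]: "Cod (PObj F x) (punit F x u) = pobj F (Ide B x) u"
  using ntransesD(4-6)[OF PUnit_ntrans[OF assms(1)] assms(2)] assms
    by (auto simp: PUnit_Dom PUnit_Cod)

lemma PUnit_natural:
  "x \<in> Obj B \<Longrightarrow> \<phi> \<in> Arr (PObj F x) \<Longrightarrow> punit F x (Cod (PObj F x) \<phi>) \<cdot>[PObj F x] \<phi> =
    parr F (Ide B x) \<phi> \<cdot>[PObj F x] punit F x (Dom (PObj F x) \<phi>)"
  using ntransesD(7)[OF PUnit_ntrans] by (simp add: PUnit_Dom PUnit_Cod)

lemma
  assumes "f \<in> Arr B" "g \<in> Arr B" "Dom B f = Cod B g" "z = Dom B g" "u \<in> Obj (PObj F (Cod B f))"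
  shows PComp_Arr [simp]: "pcomp F g f u \<in> Arr (PObj F z)"
    and Dom_PComp [simp]: "Dom (PObj F z) (pcomp F g f u) = pobj F g (pobj F f u)"
    and Cod_PComp [simp]: "Cod (PObj F z) (pcomp F g f u) = pobj F (f \<cdot>[B] g) u"
  using ntransesD(4-6)[OF PComp_ntrans[OF assms(1-3)] assms(5)] assms
    by (auto simp: PComp_Dom PComp_Cod)

lemma PComp_natural:
  "f \<in> Arr B \<Longrightarrow> g \<in> Arr B \<Longrightarrow> Dom B f = Cod B g \<Longrightarrow> \<phi> \<in> Arr (PObj F (Cod B f)) \<Longrightarrow>
    pcomp F g f (Cod (PObj F (Cod B f)) \<phi>) \<cdot>[PObj F (Dom B g)] parr F g (parr F f \<phi>) =
    parr F (f \<cdot>[B] g) \<phi> \<cdot>[PObj F (Dom B g)] pcomp F g f (Dom (PObj F (Cod B f)) \<phi>)"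
  using ntransesD(7)[OF PComp_ntrans] by (simp add: PComp_Dom PComp_Cod)

end

text \<open>Evaluating the equations between 2-cells at an object turns whiskerings into
  \<open>parr\<close> and \<open>pobj\<close>, up to identity factors that the simplifier
  removes.\<close>

lemma pseudofunctorD:
  assumes "pseudofunctor (op_cat B) (Cat U) F" and B: "category B"
  shows "indexed_category U B F"
proof -
  interpret pseudofunctor "op_cat B" "Cat U" F by fact
  have F0: "small_category U (PObj F x)" if "x \<in> Obj B" for x using PObj_in that by simp
  have cat: "category (PObj F x)" if "x \<in> Obj B" for x using small_categoryD[OF F0[OF that]] .
  have F1: "PArr F f \<in> functors (PObj F (Cod B f)) (PObj F (Dom B f))" if "f \<in> Arr B" for f
    using PArr_in[of f "Cod B f" "Dom B f"] that by (simp add: arrows_iff)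
  note U = PUnit_in[simplified, simplified arrows_iff, simplified]
  have C: "PComp F g f \<in> ntranses (PObj F (Cod B f)) (PObj F (Dom B g)) \<and>
      NDom (PComp F g f) = comp_ftor (PObj F (Cod B f)) (PArr F g) (PArr F f) \<and>
      NCod (PComp F g f) = PArr F (f \<cdot>[B] g)"
    if "f \<in> Arr B" "g \<in> Arr B" "Dom B f = Cod B g" for f g
    using PComp_in[of f "Cod B f" "Dom B f" g "Dom B g"] that by (simp add: arrows_iff)
  show ?thesis
  proof (rule indexed_category.intro)
    fix f u assume f: "f \<in> Arr B" and u: "u \<in> Obj (PObj F (Cod B f))"
    have x: "Cod B f \<in> Obj B" "Dom B f \<in> Obj B" using f B by auto
    note D = functorsD(3-8)[OF F1[OF f]]
    have fa: "f \<in> arrows (op_cat B) (Cod B f) (Dom B f)" using f by (simp add: arrows_iff)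
    have "PUnit F (Cod B f) \<in> ntranses (PObj F (Cod B f)) (PObj F (Cod B f))" using U x by auto
    note T = ntransesD(4-6)[OF this u]
    show "pcomp F f (Ide B (Cod B f)) u \<cdot>[PObj F (Dom B f)] parr F f (punit F (Cod B f) u) =
      Ide (PObj F (Dom B f)) (pobj F f u)"
      using arg_cong[OF PUnit_right[OF fa], of "\<lambda>t. NMap t u"] u x f D T U cat B
        functorsD(3)[OF F1[of "Ide B (Cod B f)"]] by simp
    show "pcomp F (Ide B (Dom B f)) f u \<cdot>[PObj F (Dom B f)] punit F (Dom B f) (pobj F f u) =
      Ide (PObj F (Dom B f)) (pobj F f u)"
      using arg_cong[OF PUnit_left[OF fa], of "\<lambda>t. NMap t u"] u x f D U cat
        ntransesD(4-6)[of "PUnit F (Dom B f)" "PObj F (Dom B f)" "PObj F (Dom B f)" "pobj F f u"]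
          by simp
  next
    fix f g h u assume f: "f \<in> Arr B" "g \<in> Arr B" "h \<in> Arr B" "Dom B f = Cod B g"
      "Dom B g = Cod B h"
      and u: "u \<in> Obj (PObj F (Cod B f))"
    have ar: "f \<in> arrows (op_cat B) (Cod B f) (Dom B f)" "g \<in> arrows (op_cat B) (Dom B f) (Dom B g)"
      "h \<in> arrows (op_cat B) (Dom B g) (Dom B h)" using f by (auto simp: arrows_iff)
    have x: "Cod B f \<in> Obj B" "Dom B f \<in> Obj B" "Cod B g \<in> Obj B" "Dom B g \<in> Obj B"
      "Cod B h \<in> Obj B" "Dom B h \<in> Obj B"
      using f(1-3) B by auto
    have Ff: "pobj F f u \<in> Obj (PObj F (Cod B g))" using functorsD(3)[OF F1[OF f(1)] u] f by simp
    have c1: "PComp F h g \<in> ntranses (PObj F (Cod B g)) (PObj F (Dom B h))"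
      and c2: "PComp F g f \<in> ntranses (PObj F (Cod B f)) (PObj F (Dom B g))"
      using C[OF f(2,3,5)] C[OF f(1,2,4)] by auto
    show "pcomp F (g \<cdot>[B] h) f u \<cdot>[PObj F (Dom B h)] pcomp F h g (pobj F f u) =
      pcomp F h (f \<cdot>[B] g) u \<cdot>[PObj F (Dom B h)] parr F h (pcomp F g f u)"
      using arg_cong[OF PComp_assoc[OF ar], of "\<lambda>t. NMap t u"] u x f Ff cat C
        functorsD(3-8)[OF F1[OF f(1)]] functorsD(3-8)[OF F1[OF f(2)]] functorsD(3-8)[OF F1[OF f(3)]]
        ntransesD(4-6)[OF c1 Ff] ntransesD(4-6)[OF c2 u] functorsD(3)[OF F1[of "f \<cdot>[B] g"]] B
          by simp
  next
    fix x u assume "x \<in> Obj B" "u \<in> Obj (PObj F x)"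
    then show "is_iso (PObj F x) (punit F x u)"
      using PUnit_iso[of x] U by (simp add: is_iso_functor_cat)
  next
    fix f g u assume f: "f \<in> Arr B" "g \<in> Arr B" "Dom B f = Cod B g" and "u \<in> Obj (PObj F (Cod B f))"
    then show "is_iso (PObj F (Dom B g)) (pcomp F g f u)"
      using PComp_iso[of f "Cod B f" "Dom B f" g "Dom B g"] C[OF f]
        by (simp add: is_iso_functor_cat arrows_iff)
  qed (use B F0 F1 U C in auto)
qed

lemma (in indexed_category) pseudofunctor: "pseudofunctor (op_cat B) (Cat U) F"
proof (intro pseudofunctor.intro pseudofunctor_axioms.intro category_op two_category_Cat)
  fix x assume x: "x \<in> Obj (op_cat B)"
  then have x: "x \<in> Obj B" by simp
  show "PObj F x \<in> Cell0 (Cat U)" using small_fibre x by simp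
  show "PUnit F x \<in> arrows (Hom (Cat U) (PObj F x) (PObj F x)) (Unit (Cat U) (PObj F x)) (PArr F
    (Ide (op_cat B) x))"
    using PUnit_ntrans PUnit_Dom PUnit_Cod x by (simp add: arrows_iff)
  show "is_iso (Hom (Cat U) (PObj F x) (PObj F x)) (PUnit F x)"
    using PUnit_is_iso PUnit_ntrans x by (simp add: is_iso_functor_cat)
next
  fix f x y assume "f \<in> arrows (op_cat B) x y"
  then have f: "f \<in> Arr B" and xy: "x = Cod B f" "y = Dom B f" by (auto simp: arrows_iff)
  have ob: "x \<in> Obj B" "y \<in> Obj B" using f xy by auto
  note F = PArr_functor[OF f, folded xy]
  show "PArr F f \<in> Cell1 (Cat U) (PObj F x) (PObj F y)" using F by simp
  show "PComp F f (Ide (op_cat B) x) \<cdot>[Hom (Cat U) (PObj F x) (PObj F y)]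
      lwh (Cat U) (PObj F x) (PObj F x) (PObj F y) (PArr F f) (PUnit F x) =
        Ide (Hom (Cat U) (PObj F x) (PObj F y)) (PArr F f)"
    by simp (rule ntrans_eqI[where X = "Obj (PObj F x)"],
      use f ob F unit_right[OF f] xy in \<open>auto simp: PUnit_Dom PUnit_Cod PComp_Dom PComp_Cod
        comp_ftor_id_right\<close>)
  show "PComp F (Ide (op_cat B) y) f \<cdot>[Hom (Cat U) (PObj F x) (PObj F y)]
      rwh (Cat U) (PObj F x) (PObj F y) (PObj F y) (PUnit F y) (PArr F f) =
        Ide (Hom (Cat U) (PObj F x) (PObj F y)) (PArr F f)"
    by simp (rule ntrans_eqI[where X = "Obj (PObj F x)"],
      use f ob F unit_left[OF f] xy in \<open>auto simp: PUnit_Dom PUnit_Cod PComp_Dom PComp_Cod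
        comp_ftor_id_left\<close>)
  fix g z assume "g \<in> arrows (op_cat B) y z"
  then have g: "g \<in> Arr B" "Dom B f = Cod B g" and z: "z = Dom B g" by (auto simp: arrows_iff xy)
  show "PComp F g f \<in> arrows (Hom (Cat U) (PObj F x) (PObj F z))
        (hc1 (Cat U) (PObj F x) (PObj F y) (PObj F z) (PArr F g) (PArr F f)) (PArr F (Comp (op_cat
          B) g f))"
    using PComp_ntrans[OF f g] PComp_Dom[OF f g] PComp_Cod[OF f g] xy z by (simp add: arrows_iff)
  show "is_iso (Hom (Cat U) (PObj F x) (PObj F z)) (PComp F g f)"
    using PComp_ntrans[OF f g] PComp_is_iso[OF f g] xy z by (simp add: is_iso_functor_cat)
  fix h w assume "h \<in> arrows (op_cat B) z w"
  then have h: "h \<in> Arr B" "Dom B g = Cod B h" and w: "w = Dom B h" by (auto simp: arrows_iff z)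
  have "z \<in> Obj B" "w \<in> Obj B" using g h z w by auto
  then show "PComp F (Comp (op_cat B) h g) f \<cdot>[Hom (Cat U) (PObj F x) (PObj F w)]
      rwh (Cat U) (PObj F x) (PObj F y) (PObj F w) (PComp F h g) (PArr F f) =
      PComp F h (Comp (op_cat B) g f) \<cdot>[Hom (Cat U) (PObj F x) (PObj F w)]
      lwh (Cat U) (PObj F x) (PObj F z) (PObj F w) (PArr F h) (PComp F g f)"
    using f g h xy z w ob assoc[OF f g(1) h(1) g(2) h(2)] PArr_functor[OF f] PArr_functor[OF g(1)]
      PArr_functor[OF h(1)]
    by (simp, intro ntrans_eqI[where X = "Obj (PObj F x)"]) (auto simp:
      PComp_Dom PComp_Cod comp_ftor_assoc)
qed simp

section \<open>Pseudonatural transformations in components\<close>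

locale indexed_transformation = source: indexed_category U B F + target: indexed_category U B G
  for U :: "'u set set" and B :: "('u, 'u) cat"
    and F G :: "'u cat_psfun" +
  fixes \<alpha> :: "'u cat_psnat"
  assumes PN1_functor: "x \<in> Obj B \<Longrightarrow> PN1 \<alpha> x \<in> functors (PObj F x) (PObj G x)"
    and PN2_ntrans: "f \<in> Arr B \<Longrightarrow> PN2 \<alpha> f \<in> ntranses (PObj F (Cod B f)) (PObj G (Dom B f))"
    and PN2_Dom: "f \<in> Arr B \<Longrightarrow> NDom (PN2 \<alpha> f) = comp_ftor (PObj F (Cod B f)) (PArr G f) (PN1 \<alpha> (Cod B
      f))"
    and PN2_Cod: "f \<in> Arr B \<Longrightarrow> NCod (PN2 \<alpha> f) = comp_ftor (PObj F (Cod B f)) (PN1 \<alpha> (Dom B f)) (PArr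
      F f)"
    and PN2_is_iso: "f \<in> Arr B \<Longrightarrow> u \<in> Obj (PObj F (Cod B f)) \<Longrightarrow> is_iso (PObj G (Dom B f)) (ncell \<alpha> f
      u)"
    and unit: "x \<in> Obj B \<Longrightarrow> u \<in> Obj (PObj F x) \<Longrightarrow>
      ncell \<alpha> (Ide B x) u \<cdot>[PObj G x] punit G x (nobj \<alpha> x u) =
      narr \<alpha> x (punit F x u)"
    and comp: "f \<in> Arr B \<Longrightarrow> g \<in> Arr B \<Longrightarrow> Dom B f = Cod B g \<Longrightarrow> u \<in> Obj (PObj F (Cod B f)) \<Longrightarrow>
      ncell \<alpha> (f \<cdot>[B] g) u \<cdot>[PObj G (Dom B g)] pcomp G g f (nobj \<alpha> (Cod B f) u) =
      narr \<alpha> (Dom B g) (pcomp F g f u) \<cdot>[PObj G (Dom B g)]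
        ncell \<alpha> g (pobj F f u) \<cdot>[PObj G (Dom B g)] parr G g (ncell \<alpha> f u)"
begin

lemma
  assumes "x \<in> Obj B"
  shows PN1_Obj [simp]: "u \<in> Obj (PObj F x) \<Longrightarrow> nobj \<alpha> x u \<in> Obj (PObj G x)"
    and PN1_Arr [simp]: "\<phi> \<in> Arr (PObj F x) \<Longrightarrow> narr \<alpha> x \<phi> \<in> Arr (PObj G x)"
    and Dom_PN1 [simp]: "\<phi> \<in> Arr (PObj F x) \<Longrightarrow>
      Dom (PObj G x) (narr \<alpha> x \<phi>) = nobj \<alpha> x (Dom (PObj F x) \<phi>)"
    and Cod_PN1 [simp]: "\<phi> \<in> Arr (PObj F x) \<Longrightarrow>
      Cod (PObj G x) (narr \<alpha> x \<phi>) = nobj \<alpha> x (Cod (PObj F x) \<phi>)"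
    and PN1_Ide [simp]: "u \<in> Obj (PObj F x) \<Longrightarrow>
      narr \<alpha> x (Ide (PObj F x) u) = Ide (PObj G x) (nobj \<alpha> x u)"
    and PN1_Comp: "\<phi> \<in> Arr (PObj F x) \<Longrightarrow> \<psi> \<in> Arr (PObj F x) \<Longrightarrow> Dom (PObj F x) \<psi> = Cod (PObj F x) \<phi> \<Longrightarrow>
      narr \<alpha> x (\<psi> \<cdot>[PObj F x] \<phi>) = narr \<alpha> x \<psi> \<cdot>[PObj G x] narr \<alpha> x \<phi>"
  using functorsD(3-8)[OF PN1_functor[OF assms]] by auto

lemma
  assumes "f \<in> Arr B" "y = Dom B f" "u \<in> Obj (PObj F (Cod B f))"
  shows PN2_Arr [simp]: "ncell \<alpha> f u \<in> Arr (PObj G y)"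
    and Dom_PN2 [simp]: "Dom (PObj G y) (ncell \<alpha> f u) = pobj G f (nobj \<alpha> (Cod B f) u)"
    and Cod_PN2 [simp]: "Cod (PObj G y) (ncell \<alpha> f u) = nobj \<alpha> y (pobj F f u)"
  using ntransesD(4-6)[OF PN2_ntrans[OF assms(1)] assms(3)] assms by (auto simp: PN2_Dom PN2_Cod)

lemma PN2_natural:
  "f \<in> Arr B \<Longrightarrow> \<phi> \<in> Arr (PObj F (Cod B f)) \<Longrightarrow>
    ncell \<alpha> f (Cod (PObj F (Cod B f)) \<phi>) \<cdot>[PObj G (Dom B f)] parr G f (narr \<alpha> (Cod B f) \<phi>) =
    narr \<alpha> (Dom B f) (parr F f \<phi>) \<cdot>[PObj G (Dom B f)] ncell \<alpha> f (Dom (PObj F (Cod B f)) \<phi>)"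
  using ntransesD(7)[OF PN2_ntrans] by (simp add: PN2_Dom PN2_Cod)

lemma pseudonatural: "pseudonatural (op_cat B) (Cat U) F G \<alpha>"
proof (intro pseudonatural.intro pseudonatural_axioms.intro source.pseudofunctor
  target.pseudofunctor)
  fix x assume "x \<in> Obj (op_cat B)"
  then have x: "x \<in> Obj B" by simp
  note F = PN1_functor[OF x]
  show "PN1 \<alpha> x \<in> Cell1 (Cat U) (PObj F x) (PObj G x)" using F by simp
  have i: "PArr F (Ide B x) \<in> functors (PObj F x) (PObj F x)"
    "PArr G (Ide B x) \<in> functors (PObj G x) (PObj G x)"
    using source.PArr_functor[of "Ide B x"] target.PArr_functor[of "Ide B x"] x by auto
  have "PN2 \<alpha> (Ide B x) \<cdot>[functor_cat (PObj F x) (PObj G x)]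
        hcomp_ntrans (PObj F x) (PObj G x) (PUnit G x) (Ide (functor_cat (PObj F x) (PObj G x)) (PN1
          \<alpha> x)) =
      hcomp_ntrans (PObj F x) (PObj G x) (Ide (functor_cat (PObj F x) (PObj G x)) (PN1 \<alpha> x)) (PUnit
        F x)"
    by (rule ntrans_eqI[where X = "Obj (PObj F x)"])
      (use x F i unit[OF x] in \<open>auto simp: PN2_Dom PN2_Cod source.PUnit_Dom source.PUnit_Cod
        target.PUnit_Dom target.PUnit_Cod comp_ftor_id_left comp_ftor_id_right\<close>)
  then show "PN2 \<alpha> (Ide (op_cat B) x) \<cdot>[Hom (Cat U) (PObj F x) (PObj G x)]
        rwh (Cat U) (PObj F x) (PObj G x) (PObj G x) (PUnit G x) (PN1 \<alpha> x) =
      lwh (Cat U) (PObj F x) (PObj F x) (PObj G x) (PN1 \<alpha> x) (PUnit F x)" by simp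
next
  fix f x y assume "f \<in> arrows (op_cat B) x y"
  then have f: "f \<in> Arr B" and xy: "x = Cod B f" "y = Dom B f" by (auto simp: arrows_iff)
  have ob: "x \<in> Obj B" "y \<in> Obj B" using f xy by auto
  show "PN2 \<alpha> f \<in> arrows (Hom (Cat U) (PObj F x) (PObj G y))
      (hc1 (Cat U) (PObj F x) (PObj G x) (PObj G y) (PArr G f) (PN1 \<alpha> x))
      (hc1 (Cat U) (PObj F x) (PObj F y) (PObj G y) (PN1 \<alpha> y) (PArr F f))"
    using PN2_ntrans[OF f] PN2_Dom[OF f] PN2_Cod[OF f] xy by (simp add: arrows_iff)
  show "is_iso (Hom (Cat U) (PObj F x) (PObj G y)) (PN2 \<alpha> f)"
    using PN2_ntrans[OF f] PN2_is_iso[OF f] xy by (simp add: is_iso_functor_cat)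
  fix g z assume "g \<in> arrows (op_cat B) y z"
  then have g: "g \<in> Arr B" "Dom B f = Cod B g" and z: "z = Dom B g" by (auto simp: arrows_iff xy)
  have zo: "z \<in> Obj B" using g z by auto
  have "PN2 \<alpha> (f \<cdot>[B] g) \<cdot>[functor_cat (PObj F x) (PObj G z)]
      hcomp_ntrans (PObj F x) (PObj G z) (PComp G g f) (Ide (functor_cat (PObj F x) (PObj G x)) (PN1
        \<alpha> x)) =
    hcomp_ntrans (PObj F x) (PObj G z) (Ide (functor_cat (PObj F z) (PObj G z)) (PN1 \<alpha> z)) (PComp F
      g f)
      \<cdot>[functor_cat (PObj F x) (PObj G z)]
    hcomp_ntrans (PObj F x) (PObj G z) (PN2 \<alpha> g) (Ide (functor_cat (PObj F x) (PObj F y)) (PArr F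
      f))
      \<cdot>[functor_cat (PObj F x) (PObj G z)]
    hcomp_ntrans (PObj F x) (PObj G z) (Ide (functor_cat (PObj G y) (PObj G z)) (PArr G g)) (PN2 \<alpha>
      f)"
    using f g xy z ob zo comp[OF f g] PN1_functor source.PArr_functor[OF f] target.PArr_functor[OF
      f]
      source.PArr_functor[OF g(1)] target.PArr_functor[OF g(1)]
    by (intro ntrans_eqI[where X = "Obj (PObj F x)"])
      (auto simp: PN2_Dom PN2_Cod source.PComp_Dom source.PComp_Cod target.PComp_Dom
        target.PComp_Cod comp_ftor_assoc)
  then show "PN2 \<alpha> (Comp (op_cat B) g f) \<cdot>[Hom (Cat U) (PObj F x) (PObj G z)]
      rwh (Cat U) (PObj F x) (PObj G x) (PObj G z) (PComp G g f) (PN1 \<alpha> x) =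
    lwh (Cat U) (PObj F x) (PObj F z) (PObj G z) (PN1 \<alpha> z) (PComp F g f)
      \<cdot>[Hom (Cat U) (PObj F x) (PObj G z)]
    rwh (Cat U) (PObj F x) (PObj F y) (PObj G z) (PN2 \<alpha> g) (PArr F f)
      \<cdot>[Hom (Cat U) (PObj F x) (PObj G z)]
    lwh (Cat U) (PObj F x) (PObj G y) (PObj G z) (PArr G g) (PN2 \<alpha> f)" by simp
qed

end

lemma pseudonaturalD:
  assumes "pseudonatural (op_cat B) (Cat U) F G \<alpha>" and B: "category B"
  shows "indexed_transformation U B F G \<alpha>"
proof -
  interpret pseudonatural "op_cat B" "Cat U" F G \<alpha> by fact
  interpret F: indexed_category U B F by (rule pseudofunctorD[OF source.pseudofunctor_axioms B])
  interpret G: indexed_category U B G by (rule pseudofunctorD[OF target.pseudofunctor_axioms B])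
  have F1: "PN1 \<alpha> x \<in> functors (PObj F x) (PObj G x)" if "x \<in> Obj B" for x
    using PN1_in[of x] that by simp
  have F2: "PN2 \<alpha> f \<in> ntranses (PObj F (Cod B f)) (PObj G (Dom B f))"
    "NDom (PN2 \<alpha> f) = comp_ftor (PObj F (Cod B f)) (PArr G f) (PN1 \<alpha> (Cod B f))"
    "NCod (PN2 \<alpha> f) = comp_ftor (PObj F (Cod B f)) (PN1 \<alpha> (Dom B f)) (PArr F f)"
    if "f \<in> Arr B" for f
    using PN2_in[of f "Cod B f" "Dom B f"] that by (auto simp: arrows_iff)
  show ?thesis
  proof (intro indexed_transformation.intro indexed_transformation_axioms.intro
    F.indexed_category_axioms
      G.indexed_category_axioms F1 F2)
    fix f u assume f: "f \<in> Arr B" and u: "u \<in> Obj (PObj F (Cod B f))"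
    then show "is_iso (PObj G (Dom B f)) (ncell \<alpha> f u)"
      using PN2_iso[of f "Cod B f" "Dom B f"] F2(1)[OF f]
        by (simp add: is_iso_functor_cat arrows_iff)
  next
    fix x u assume x: "x \<in> Obj B" and u: "u \<in> Obj (PObj F x)"
    then show "ncell \<alpha> (Ide B x) u \<cdot>[PObj G x] punit G x (nobj \<alpha> x u) =
      narr \<alpha> x (punit F x u)"
      using arg_cong[OF PN2_Ide[of x], of "\<lambda>t. NMap t u"] functorsD(3-7)[OF F1[OF x]]
      by (simp add: F.PUnit_Cod G.PUnit_Dom G.PUnit_Cod)
  next
    fix f g u assume f: "f \<in> Arr B" and g: "g \<in> Arr B" and fg: "Dom B f = Cod B g" and u:
      "u \<in> Obj (PObj F (Cod B f))"
    have ar: "f \<in> arrows (op_cat B) (Cod B f) (Dom B f)" "g \<in> arrows (op_cat B) (Dom B f) (Dom B g)"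
      using f g fg by (auto simp: arrows_iff)
    have x: "Cod B f \<in> Obj B" "Cod B g \<in> Obj B" "Dom B g \<in> Obj B" using f g by auto
    have Ff: "pobj F f u \<in> Obj (PObj F (Cod B g))" using f fg u by simp
    show "ncell \<alpha> (f \<cdot>[B] g) u \<cdot>[PObj G (Dom B g)] pcomp G g f (nobj \<alpha> (Cod B f) u) =
      narr \<alpha> (Dom B g) (pcomp F g f u) \<cdot>[PObj G (Dom B g)]
        ncell \<alpha> g (pobj F f u) \<cdot>[PObj G (Dom B g)] parr G g (ncell \<alpha> f u)"
      using arg_cong[OF PN2_Comp[OF ar], of "\<lambda>t. NMap t u"] u f g fg x Ff F2[OF f] F2[OF g]
        functorsD(3-7)[OF F1[OF x(1)]] functorsD(3-7)[OF F1[OF x(2)]] functorsD(3-7)[OF F1[OF x(3)]]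
        ntransesD(4-6)[OF F2(1)[OF f] u] ntransesD(4-6)[OF F2(1)[OF g] Ff]
      by (simp add: F.PComp_Cod G.PComp_Dom G.PComp_Cod)
  qed
qed

lemma pseudofunctor_iff: "category B \<Longrightarrow> pseudofunctor (op_cat B) (Cat U) F \<longleftrightarrow> indexed_category U B F"
  using pseudofunctorD indexed_category.pseudofunctor by blast

lemma pseudonatural_iff: "category B \<Longrightarrow> pseudonatural (op_cat B) (Cat U) F G \<alpha> \<longleftrightarrow>
  indexed_transformation U B F G \<alpha>"
  using pseudonaturalD indexed_transformation.pseudonatural by blast

section \<open>Modifications in components\<close>

lemma Psd_simps [simp]:
  "Cell0 (Psd A K) = pseudofunctors A K" "Hom (Psd A K) = Psd_hom A K" "Unit (Psd A K) =
    id_psnat A K"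
  "hc1 (Psd A K) F G H \<beta> \<alpha> = comp_psnat A K F G H \<beta> \<alpha>"
  "hc2 (Psd A K) F G H \<Delta> \<Gamma> = hcomp_modif A K F G H \<Delta> \<Gamma>"
  by (simp_all add: Psd_def hc1_def hc2_def)

lemma Psd_hom_simps [simp]:
  "Obj (Psd_hom A K F G) = pseudonaturals A K F G" "Arr (Psd_hom A K F G) = modifications A K F G"
  "Dom (Psd_hom A K F G) = MDom" "Cod (Psd_hom A K F G) = MCod"
  "MDom (Ide (Psd_hom A K F G) \<alpha>) = \<alpha>" "MCod (Ide (Psd_hom A K F G) \<alpha>) = \<alpha>"
  "MMap (Ide (Psd_hom A K F G) \<alpha>) = (\<lambda>x\<in>Obj A. Ide (Hom K (PObj F x) (PObj G x)) (PN1 \<alpha> x))"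
  "MDom (\<Delta> \<cdot>[Psd_hom A K F G] \<Gamma>) = MDom \<Gamma>" "MCod (\<Delta> \<cdot>[Psd_hom A K F G] \<Gamma>) = MCod \<Delta>"
  "MMap (\<Delta> \<cdot>[Psd_hom A K F G] \<Gamma>) = (\<lambda>x\<in>Obj A. MMap \<Delta> x \<cdot>[Hom K (PObj F x) (PObj G x)] MMap \<Gamma> x)"
  by (simp_all add: Psd_hom_def)

text \<open>The typing of a modification without its compatibility with \<open>PN2\<close>: for a
  modification obtained from a 2-cell between functors, that compatibility is derived.\<close>

definition modif_data :: "('u, 'u) cat \<Rightarrow> 'u cat_psfun \<Rightarrow>
    'u cat_psfun \<Rightarrow>
    'u cat_modif \<Rightarrow> bool" where
  "modif_data B F G \<Gamma> \<longleftrightarrow> MMap \<Gamma> \<in> extensional (Obj B) \<and>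
     (\<forall>x\<in>Obj B. MMap \<Gamma> x \<in> ntranses (PObj F x) (PObj G x) \<and>
       NDom (MMap \<Gamma> x) = PN1 (MDom \<Gamma>) x \<and> NCod (MMap \<Gamma> x) = PN1 (MCod \<Gamma>) x)"

lemma modifications_iff:
  assumes B: "category B"
  shows "\<Gamma> \<in> modifications (op_cat B) (Cat U) F G \<longleftrightarrow>
    MDom \<Gamma> \<in> pseudonaturals (op_cat B) (Cat U) F G \<and> MCod \<Gamma> \<in> pseudonaturals (op_cat B) (Cat U) F G
      \<and>
    modif_data B F G \<Gamma> \<and>
    (\<forall>f\<in>Arr B. \<forall>u\<in>Obj (PObj F (Cod B f)).
      ncell (MCod \<Gamma>) f u \<cdot>[PObj G (Dom B f)] parr G f (mcell \<Gamma> (Cod B f) u) =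
      mcell \<Gamma> (Dom B f) (pobj F f u) \<cdot>[PObj G (Dom B f)] ncell (MDom \<Gamma>) f u)"
    (is "_ \<longleftrightarrow> ?P \<and> ?Q \<and> ?R \<and> ?S")
\<comment> \<open>Evaluating the whiskerings relies on the typing conditions, so the equations are
  compared only when these hold; otherwise both sides are false.\<close>
proof (cases "?P \<and> ?Q \<and> ?R")
  case True
  then interpret D: indexed_transformation U B F G "MDom \<Gamma>"
    using B by (simp add: pseudonaturals_def pseudonatural_iff)
  interpret C: indexed_transformation U B F G "MCod \<Gamma>"
    using B True by (simp add: pseudonaturals_def pseudonatural_iff)
  have "(ncell (MCod \<Gamma>) f u \<cdot>[PObj G (Dom B f)] parr G f (mcell \<Gamma> (Cod B f) u) =
      mcell \<Gamma> (Dom B f) (pobj F f u) \<cdot>[PObj G (Dom B f)] ncell (MDom \<Gamma>) f u) \<longleftrightarrow>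
      NMap (PN2 (MCod \<Gamma>) f \<cdot>[functor_cat (PObj F (Cod B f)) (PObj G (Dom B f))]
          hcomp_ntrans (PObj F (Cod B f)) (PObj G (Dom B f)) (Ide (functor_cat (PObj G (Cod B f))
            (PObj G (Dom B f))) (PArr G f)) (MMap \<Gamma> (Cod B f))) u =
      NMap (hcomp_ntrans (PObj F (Cod B f)) (PObj G (Dom B f)) (MMap \<Gamma> (Dom B f)) (Ide (functor_cat
        (PObj F (Cod B f)) (PObj F (Dom B f))) (PArr F f))
        \<cdot>[functor_cat (PObj F (Cod B f)) (PObj G (Dom B f))] PN2 (MDom \<Gamma>) f) u"
    if f: "f \<in> Arr B" and u: "u \<in> Obj (PObj F (Cod B f))" for f u
  proof -
    have m: "MMap \<Gamma> (Cod B f) \<in> ntranses (PObj F (Cod B f)) (PObj G (Cod B f))"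
      "NDom (MMap \<Gamma> (Cod B f)) = PN1 (MDom \<Gamma>) (Cod B f)" "NCod (MMap \<Gamma> (Cod B f)) =
        PN1 (MCod \<Gamma>) (Cod B f)"
      "MMap \<Gamma> (Dom B f) \<in> ntranses (PObj F (Dom B f)) (PObj G (Dom B f))"
      "NDom (MMap \<Gamma> (Dom B f)) = PN1 (MDom \<Gamma>) (Dom B f)" "NCod (MMap \<Gamma> (Dom B f)) =
        PN1 (MCod \<Gamma>) (Dom B f)"
      using True f by (auto simp: modif_data_def)
    show ?thesis
      using ntransesD(4-6)[OF m(1) u] ntransesD(4-6)[OF m(4), of "pobj F f u"] m f u by simp
  qed
  note eq = this
  have "PN2 (MCod \<Gamma>) f \<cdot>[functor_cat (PObj F (Cod B f)) (PObj G (Dom B f))]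
          hcomp_ntrans (PObj F (Cod B f)) (PObj G (Dom B f)) (Ide (functor_cat (PObj G (Cod B f))
            (PObj G (Dom B f))) (PArr G f)) (MMap \<Gamma> (Cod B f)) =
      hcomp_ntrans (PObj F (Cod B f)) (PObj G (Dom B f)) (MMap \<Gamma> (Dom B f)) (Ide (functor_cat (PObj
        F (Cod B f)) (PObj F (Dom B f))) (PArr F f))
        \<cdot>[functor_cat (PObj F (Cod B f)) (PObj G (Dom B f))] PN2 (MDom \<Gamma>) f \<longleftrightarrow>
      (\<forall>u\<in>Obj (PObj F (Cod B f)).
      ncell (MCod \<Gamma>) f u \<cdot>[PObj G (Dom B f)] parr G f (mcell \<Gamma> (Cod B f) u) =
      mcell \<Gamma> (Dom B f) (pobj F f u) \<cdot>[PObj G (Dom B f)] ncell (MDom \<Gamma>) f u)" (is "?l = ?r \<longleftrightarrow> ?A")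
    if f: "f \<in> Arr B" for f
  proof
    assume "?l = ?r" then show ?A using eq[OF f] by simp
  next
    assume ?A
    then show "?l = ?r"
      using eq[OF f] True f
      by (intro ntrans_eqI[where X = "Obj (PObj F (Cod B f))"])
        (auto simp: modif_data_def D.PN2_Dom C.PN2_Cod simp del: functor_cat_simps(10), auto)
  qed
  then show ?thesis
    using True by (auto simp: modifications_def modif_data_def arrows_iff)
next
  case False
  then show ?thesis by (auto simp: modifications_def modif_data_def arrows_iff)
qed

section \<open>Cartesian arrows\<close>

lemma cartesian_Arr: "cartesian E B p g \<Longrightarrow> g \<in> Arr E"
  by (simp add: cartesian_def)

text \<open>Uniqueness of factorisations through \<open>g\<close>, applied to the arrow
  \<open>g \<cdot>[E] k\<close> itself.\<close>

lemma cartesian_cancel: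
  assumes p: "is_functor E B p" and g: "cartesian E B p g"
    and k: "k \<in> Arr E" "Cod E k = Dom E g" and k': "k' \<in> Arr E" "Cod E k' = Dom E g"
    and eq: "Dom E k = Dom E k'" "AMap p k = AMap p k'" "g \<cdot>[E] k = g \<cdot>[E] k'"
  shows "k = k'"
proof -
  note P = is_functorD[OF p]
  have "\<exists>!m. m \<in> arrows E (Dom E (g \<cdot>[E] k)) (Dom E g) \<and> AMap p m = AMap p k \<and> g \<cdot>[E] k = g \<cdot>[E] m"
    using g[unfolded cartesian_def, THEN conjunct2, rule_format, of "g \<cdot>[E] k" "AMap p k"]
      k P cartesian_Arr[OF g] by simp
  moreover have "k \<in> arrows E (Dom E (g \<cdot>[E] k)) (Dom E g)" "k' \<in> arrows E (Dom E (g \<cdot>[E]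
    k)) (Dom E g)"
    using k k' P(1) eq(1) cartesian_Arr[OF g] by (auto simp: arrows_iff)
  ultimately show ?thesis using eq(2,3) by metis
qed

lemma cartesian_factor:
  assumes "cartesian E B p g" "g' \<in> Arr E" "Cod E g' = Cod E g" "h \<in> Arr B"
    "Cod B h = OMap p (Dom E g)"
    "AMap p g' = AMap p g \<cdot>[B] h"
  obtains k where "k \<in> Arr E" "Dom E k = Dom E g'" "Cod E k = Dom E g" "AMap p k = h"
    "g' = g \<cdot>[E] k"
  using assms unfolding cartesian_def arrows_iff by (metis (no_types, lifting))

lemma cartesian_comp_iso:
  assumes p: "is_functor E B p" and g: "cartesian E B p g" and k: "is_iso E k" and c:
    "Dom E g = Cod E k"
  shows "cartesian E B p (g \<cdot>[E] k)"
  unfolding cartesian_def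
proof (intro conjI ballI impI)
  note P[simp] = is_functorD[OF p]
  have ga[simp]: "g \<in> Arr E" using cartesian_Arr[OF g] .
  obtain i where k'[simp]: "k \<in> Arr E" "i \<in> Arr E" "Dom E i = Cod E k" "Cod E i = Dom E k"
    and i: "i \<cdot>[E] k = Ide E (Dom E k)" "k \<cdot>[E] i = Ide E (Cod E k)"
    using k by (auto simp: is_iso_def arrows_iff)
  show "g \<cdot>[E] k \<in> Arr E" using c by simp
  fix g' h assume g'[simp]: "g' \<in> Arr E" and h[simp]: "h \<in> Arr B" and c': "Cod E g' = Cod E (g \<cdot>[E]
    k)"
    "Cod B h = OMap p (Dom E (g \<cdot>[E] k))" and eq: "AMap p g' = AMap p (g \<cdot>[E] k) \<cdot>[B] h"
  have "Cod E g' = Cod E g" "AMap p k \<cdot>[B] h \<in> Arr B" "Cod B (AMap p k \<cdot>[B] h) = OMap p (Dom E g)"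
    "AMap p g' = AMap p g \<cdot>[B] AMap p k \<cdot>[B] h"
    using c c' eq by simp_all
  then obtain m where m[simp]: "m \<in> Arr E" "Dom E m = Dom E g'" "Cod E m = Dom E g"
    and m': "AMap p m = AMap p k \<cdot>[B] h" "g' = g \<cdot>[E] m"
    by (rule cartesian_factor[OF g g'])
  show "\<exists>!n. n \<in> arrows E (Dom E g') (Dom E (g \<cdot>[E] k)) \<and> AMap p n = h \<and> g' = (g \<cdot>[E] k) \<cdot>[E] n"
  \<comment> \<open>Factor through \<open>g\<close> first, which gives \<open>m\<close>, then undo
    \<open>k\<close> with its inverse \<open>i\<close>.\<close>
  proof (rule ex1I[of _ "i \<cdot>[E] m"])
    have "AMap p (i \<cdot>[E] m) = AMap p (i \<cdot>[E] k) \<cdot>[B] h"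
      using c c' m' by simp
    also have "\<dots> = h" using c c' by (subst i) simp
    finally have 1: "AMap p (i \<cdot>[E] m) = h" .
    have "(g \<cdot>[E] k) \<cdot>[E] i \<cdot>[E] m = g \<cdot>[E] (k \<cdot>[E] i) \<cdot>[E] m" using c by simp
    also have "\<dots> = g'" using c m' by (subst i) simp
    finally show "i \<cdot>[E] m \<in> arrows E (Dom E g') (Dom E (g \<cdot>[E] k)) \<and> AMap p (i \<cdot>[E] m) = h \<and> g' =
      (g \<cdot>[E] k) \<cdot>[E] i \<cdot>[E] m"
      using 1 c by (simp add: arrows_iff)
    fix n assume "n \<in> arrows E (Dom E g') (Dom E (g \<cdot>[E] k)) \<and> AMap p n = h \<and> g' = (g \<cdot>[E] k) \<cdot>[E]
      n"
    then have n: "n \<in> Arr E" "Dom E n = Dom E g'" "Cod E n = Dom E (g \<cdot>[E] k)"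
      and n': "AMap p n = h" "g' = (g \<cdot>[E] k) \<cdot>[E] n"
      unfolding arrows_iff by blast+
    note n(1,2)[simp]
    have [simp]: "Cod E n = Dom E k" using c n(3) by simp
    have "k \<cdot>[E] n = m"
      by (rule cartesian_cancel[OF p g]) (use c n'(1) m'(1) n'(2)[symmetric] m'(2)[symmetric]
        in simp_all)
    then have "i \<cdot>[E] m = (i \<cdot>[E] k) \<cdot>[E] n" by (auto simp del: i)
    then show "n = i \<cdot>[E] m" by (simp only: i) simp
  qed
qed

section \<open>Presentations of fibrations by pseudofunctors\<close>

text \<open>A presentation identifies the fibres of \<open>p\<close> with the values of \<open>F\<close>, and singles out a cleavage
  from which the reindexing functors and the constraint 2-cells of \<open>F\<close> can be read off.\<close>

locale presentation = indexed_category U B F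
  for U :: "'u set set" and B :: "('u, 'u) cat"
    and F :: "'u cat_psfun" +
  fixes E :: "('u, 'u) cat" and p :: "('u, 'u, 'u, 'u) ftor"
    and ob vert lift :: "'u \<Rightarrow> 'u \<Rightarrow> 'u"
  assumes small_E: "small_category U E" and p_functor: "p \<in> functors E B" and fibration:
    "fibration E B p"
    and ob_bij: "x \<in> Obj B \<Longrightarrow> bij_betw (ob x) (Obj (PObj F x)) {e \<in> Obj E. OMap p e = x}"
    and vert_bij: "x \<in> Obj B \<Longrightarrow> bij_betw (vert x) (Arr (PObj F x)) {k \<in> Arr E. AMap p k = Ide B x}"
    and Dom_vert [simp]: "x \<in> Obj B \<Longrightarrow> \<phi> \<in> Arr (PObj F x) \<Longrightarrow> Dom E (vert x \<phi>) =
      ob x (Dom (PObj F x) \<phi>)"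
    and Cod_vert [simp]: "x \<in> Obj B \<Longrightarrow> \<phi> \<in> Arr (PObj F x) \<Longrightarrow> Cod E (vert x \<phi>) =
      ob x (Cod (PObj F x) \<phi>)"
    and vert_Ide: "x \<in> Obj B \<Longrightarrow> u \<in> Obj (PObj F x) \<Longrightarrow> vert x (Ide (PObj F x) u) = Ide E (ob x u)"
    and vert_Comp: "x \<in> Obj B \<Longrightarrow> \<phi> \<in> Arr (PObj F x) \<Longrightarrow> \<psi> \<in> Arr (PObj F x) \<Longrightarrow>
      Dom (PObj F x) \<psi> = Cod (PObj F x) \<phi> \<Longrightarrow> vert x (\<psi> \<cdot>[PObj F x] \<phi>) = vert x \<psi> \<cdot>[E] vert x \<phi>"
    and lift_cartesian: "f \<in> Arr B \<Longrightarrow> u \<in> Obj (PObj F (Cod B f)) \<Longrightarrow> cartesian E B p (lift f u)"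
    and Dom_lift [simp]: "f \<in> Arr B \<Longrightarrow> u \<in> Obj (PObj F (Cod B f)) \<Longrightarrow>
      Dom E (lift f u) = ob (Dom B f) (pobj F f u)"
    and Cod_lift [simp]: "f \<in> Arr B \<Longrightarrow> u \<in> Obj (PObj F (Cod B f)) \<Longrightarrow> Cod E (lift f u) =
      ob (Cod B f) u"
    and p_lift [simp]: "f \<in> Arr B \<Longrightarrow> u \<in> Obj (PObj F (Cod B f)) \<Longrightarrow> AMap p (lift f u) = f"
    and lift_natural: "f \<in> Arr B \<Longrightarrow> \<phi> \<in> Arr (PObj F (Cod B f)) \<Longrightarrow>
      lift f (Cod (PObj F (Cod B f)) \<phi>) \<cdot>[E] vert (Dom B f) (parr F f \<phi>) =
      vert (Cod B f) \<phi> \<cdot>[E] lift f (Dom (PObj F (Cod B f)) \<phi>)"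
    and lift_Ide: "x \<in> Obj B \<Longrightarrow> u \<in> Obj (PObj F x) \<Longrightarrow>
      lift (Ide B x) u \<cdot>[E] vert x (punit F x u) = Ide E (ob x u)"
    and lift_Comp: "f \<in> Arr B \<Longrightarrow> g \<in> Arr B \<Longrightarrow> Dom B f = Cod B g \<Longrightarrow> u \<in> Obj (PObj F (Cod B f)) \<Longrightarrow>
      lift (f \<cdot>[B] g) u \<cdot>[E] vert (Dom B g) (pcomp F g f u) =
      lift f u \<cdot>[E] lift g (pobj F f u)"
begin

lemma category_E [simp]: "category E" using small_E by (rule small_categoryD)

lemma p_is_functor: "is_functor E B p" using p_functor by (simp add: functors_def)

lemmas p_simps [simp] = functorsD(3-8)[OF p_functor]

lemma lift_Arr [simp]: "f \<in> Arr B \<Longrightarrow> u \<in> Obj (PObj F (Cod B f)) \<Longrightarrow> lift f u \<in> Arr E"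
  using cartesian_Arr[OF lift_cartesian] .

lemma ob_Obj [simp]: "x \<in> Obj B \<Longrightarrow> u \<in> Obj (PObj F x) \<Longrightarrow> ob x u \<in> Obj E"
  and p_ob [simp]: "x \<in> Obj B \<Longrightarrow> u \<in> Obj (PObj F x) \<Longrightarrow> OMap p (ob x u) = x"
  using ob_bij[of x] by (auto dest: bij_betwE)

lemma vert_Arr [simp]: "x \<in> Obj B \<Longrightarrow> \<phi> \<in> Arr (PObj F x) \<Longrightarrow> vert x \<phi> \<in> Arr E"
  and p_vert [simp]: "x \<in> Obj B \<Longrightarrow> \<phi> \<in> Arr (PObj F x) \<Longrightarrow> AMap p (vert x \<phi>) = Ide B x"
  using vert_bij[of x] by (auto dest: bij_betwE)

lemma ob_eq_iff: "x \<in> Obj B \<Longrightarrow> u \<in> Obj (PObj F x) \<Longrightarrow> v \<in> Obj (PObj F x) \<Longrightarrow> ob x u = ob x v \<longleftrightarrow> u = v"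
  using inj_on_eq_iff[OF bij_betw_imp_inj_on[OF ob_bij]] by simp

lemma vert_eq_iff: "x \<in> Obj B \<Longrightarrow> \<phi> \<in> Arr (PObj F x) \<Longrightarrow> \<psi> \<in> Arr (PObj F x) \<Longrightarrow> vert x \<phi> = vert x \<psi> \<longleftrightarrow> \<phi> =
  \<psi>"
  using inj_on_eq_iff[OF bij_betw_imp_inj_on[OF vert_bij]] by simp

lemma obtain_ob:
  assumes "e \<in> Obj E" obtains u where "u \<in> Obj (PObj F (OMap p e))" "e = ob (OMap p e) u"
  using bij_betw_imp_surj_on[OF ob_bij[of "OMap p e"]] assms by (auto simp: image_def set_eq_iff)

lemma obtain_vert:
  assumes x: "x \<in> Obj B" and k: "k \<in> Arr E" "AMap p k = Ide B x"
  obtains \<phi> where "\<phi> \<in> Arr (PObj F x)" "k = vert x \<phi>"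
  using bij_betw_imp_surj_on[OF vert_bij[OF x]] k by (auto simp: image_def set_eq_iff)

text \<open>Arrows of a value of \<open>F\<close> are compared in \<open>E\<close>, after
  composition with a chosen lift; this is how equations in the fibres are obtained from equations in
  the total category.\<close>

lemma lift_cancel:
  assumes f: "f \<in> Arr B" and u: "u \<in> Obj (PObj F (Cod B f))" and y: "y = Dom B f"
    and \<phi>: "\<phi> \<in> Arr (PObj F y)" "Cod (PObj F y) \<phi> = pobj F f u"
    and \<psi>: "\<psi> \<in> Arr (PObj F y)" "Cod (PObj F y) \<psi> = pobj F f u"
    and eq: "Dom (PObj F y) \<phi> = Dom (PObj F y) \<psi>" "lift f u \<cdot>[E] vert y \<phi> = lift f u \<cdot>[E] vert y \<psi>"
  shows "\<phi> = \<psi>"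
proof -
  have "vert y \<phi> = vert y \<psi>"
    by (rule cartesian_cancel[OF p_is_functor lift_cartesian[OF f u]]) (use assms in auto)
  then show ?thesis using assms by (simp add: vert_eq_iff)
qed

text \<open>The factorisation of an arrow into a vertical one followed by a chosen lift:
  \<open>k\<close> is factored through the lift of its own image, over an identity of
  \<open>B\<close>.\<close>

lemma obtain_factor:
  assumes k: "k \<in> Arr E" "AMap p k = f" "Cod E k = ob (Cod B f) u" and u:
    "u \<in> Obj (PObj F (Cod B f))"
  obtains \<phi> where "\<phi> \<in> Arr (PObj F (Dom B f))" "Cod (PObj F (Dom B f)) \<phi> = pobj F f u"
    "k = lift f u \<cdot>[E] vert (Dom B f) \<phi>"
proof -
  have f: "f \<in> Arr B" using k by auto
  have a: "Cod E k = Cod E (lift f u)" "Ide B (Dom B f) \<in> Arr B" "Cod B (Ide B (Dom B f)) =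
    OMap p (Dom E (lift f u))"
    "AMap p k = AMap p (lift f u) \<cdot>[B] Ide B (Dom B f)"
    using k f u by simp_all
  obtain m where m: "m \<in> Arr E" "Dom E m = Dom E k" "Cod E m = Dom E (lift f u)"
    "AMap p m = Ide B (Dom B f)"
    "k = lift f u \<cdot>[E] m"
    using cartesian_factor[OF lift_cartesian[OF f u] k(1) a] by blast
  obtain \<phi> where \<phi>: "\<phi> \<in> Arr (PObj F (Dom B f))" "m = vert (Dom B f) \<phi>"
    using obtain_vert[OF _ m(1,4)] f by auto
  have "Cod (PObj F (Dom B f)) \<phi> = pobj F f u"
    using m(3) f u \<phi> by (simp add: ob_eq_iff)
  then show ?thesis using that \<phi> m by simp
qed

lemma vert_is_iso:
  assumes x: "x \<in> Obj B" and \<phi>: "\<phi> \<in> Arr (PObj F x)"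
  shows "is_iso E (vert x \<phi>) \<longleftrightarrow> is_iso (PObj F x) \<phi>"
proof
  assume "is_iso (PObj F x) \<phi>"
  then obtain \<psi> where \<psi>: "\<psi> \<in> Arr (PObj F x)" "Dom (PObj F x) \<psi> = Cod (PObj F x) \<phi>"
    "Cod (PObj F x) \<psi> = Dom (PObj F x) \<phi>"
    and "\<psi> \<cdot>[PObj F x] \<phi> = Ide (PObj F x) (Dom (PObj F x) \<phi>)" "\<phi> \<cdot>[PObj F x] \<psi> =
      Ide (PObj F x) (Cod (PObj F x) \<phi>)"
    by (auto simp: is_iso_def arrows_iff)
  then have "vert x (\<psi> \<cdot>[PObj F x] \<phi>) = Ide E (ob x (Dom (PObj F x) \<phi>))" "vert x (\<phi> \<cdot>[PObj F x] \<psi>) =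
    Ide E (ob x (Cod (PObj F x) \<phi>))"
    using x \<phi> by (simp_all add: vert_Ide)
  then show "is_iso E (vert x \<phi>)"
    using x \<phi> \<psi> by (intro is_isoI[where g = "vert x \<psi>"]) (auto simp: vert_Comp)
next
  assume "is_iso E (vert x \<phi>)"
  then obtain k where k: "k \<in> Arr E" "Dom E k = ob x (Cod (PObj F x) \<phi>)"
    "Cod E k = ob x (Dom (PObj F x) \<phi>)"
    and eq: "k \<cdot>[E] vert x \<phi> = Ide E (ob x (Dom (PObj F x) \<phi>))" "vert x \<phi> \<cdot>[E] k =
      Ide E (ob x (Cod (PObj F x) \<phi>))"
    using x \<phi> by (auto simp: is_iso_def arrows_iff)
  \<comment> \<open>An inverse in \<open>E\<close> of a vertical arrow is vertical, since composing
    its image with an identity gives an identity; hence it comes from an arrow of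
    \<open>PObj F x\<close>.\<close>
  have "AMap p k = AMap p (k \<cdot>[E] vert x \<phi>)" using x \<phi> k by simp
  then have "AMap p k = Ide B x" using x \<phi> eq(1) by simp
  then obtain \<psi> where \<psi>: "\<psi> \<in> Arr (PObj F x)" "k = vert x \<psi>" using obtain_vert[OF x k(1)] by auto
  have d: "Dom (PObj F x) \<psi> = Cod (PObj F x) \<phi>" "Cod (PObj F x) \<psi> = Dom (PObj F x) \<phi>"
    using k(2,3) \<psi> x \<phi> by (simp_all add: ob_eq_iff)
  have "vert x (\<psi> \<cdot>[PObj F x] \<phi>) = vert x (Ide (PObj F x) (Dom (PObj F x) \<phi>))"
    "vert x (\<phi> \<cdot>[PObj F x] \<psi>) = vert x (Ide (PObj F x) (Cod (PObj F x) \<phi>))"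
    using eq \<psi> d x \<phi> by (simp_all add: vert_Comp vert_Ide)
  then show "is_iso (PObj F x) \<phi>"
    using x \<phi> \<psi> d by (intro is_isoI[where g = \<psi>]) (simp_all add: vert_eq_iff)
qed

end

section \<open>Functors and transformations related across two presentations\<close>

definition psnat_data :: "('u, 'u) cat \<Rightarrow> 'u cat_psfun \<Rightarrow>
    'u cat_psfun \<Rightarrow>
    'u cat_psnat \<Rightarrow> bool" where
  "psnat_data B F G \<alpha> \<longleftrightarrow> PN1 \<alpha> \<in> extensional (Obj B) \<and> PN2 \<alpha> \<in> extensional (Arr B) \<and>
     (\<forall>x\<in>Obj B. PN1 \<alpha> x \<in> functors (PObj F x) (PObj G x)) \<and>
     (\<forall>f\<in>Arr B. NDom (PN2 \<alpha> f) = comp_ftor (PObj F (Cod B f)) (PArr G f) (PN1 \<alpha> (Cod B f)) \<and>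
       NCod (PN2 \<alpha> f) = comp_ftor (PObj F (Cod B f)) (PN1 \<alpha> (Dom B f)) (PArr F f) \<and>
       ncell \<alpha> f \<in> extensional (Obj (PObj F (Cod B f))) \<and>
       (\<forall>u\<in>Obj (PObj F (Cod B f)). ncell \<alpha> f u \<in> Arr (PObj G (Dom B f)) \<and>
         Dom (PObj G (Dom B f)) (ncell \<alpha> f u) = pobj G f (nobj \<alpha> (Cod B f) u) \<and>
         Cod (PObj G (Dom B f)) (ncell \<alpha> f u) = nobj \<alpha> (Dom B f) (pobj F f u)))"

locale presentation_pair = P: presentation U B F E p ob vert lift + Q: presentation U B F' E' p' ob'
  vert' lift'
  for U :: "'u set set" and B F E p ob vert lift F' E' p' ob' vert' lift'
begin

text \<open>The arrow \<open>AMap H (lift f u)\<close> starts at the object named by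
  \<open>nobj \<alpha> (Dom B f) (pobj F f u)\<close>, the chosen lift of \<open>E'\<close> at the
  one named by \<open>pobj F' f (nobj \<alpha> (Cod B f) u)\<close>. The first is cartesian when
  \<open>H\<close> is, so the second factors through it by a vertical arrow. This arrow has the
  direction of \<open>PN2\<close>, and the last clause says that it is \<open>PN2\<close>.\<close>

definition compat :: "('u, 'u, 'u, 'u) ftor \<Rightarrow> 'u cat_psnat \<Rightarrow> bool" where
  "compat H \<alpha> \<longleftrightarrow> (\<forall>x\<in>Obj B. \<forall>u\<in>Obj (PObj F x). OMap H (ob x u) = ob' x (nobj \<alpha> x u)) \<and>
     (\<forall>x\<in>Obj B. \<forall>\<phi>\<in>Arr (PObj F x). AMap H (vert x \<phi>) = vert' x (narr \<alpha> x \<phi>)) \<and>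
     (\<forall>f\<in>Arr B. \<forall>u\<in>Obj (PObj F (Cod B f)).
       AMap H (lift f u) \<cdot>[E'] vert' (Dom B f) (ncell \<alpha> f u) = lift' f (nobj \<alpha> (Cod B f) u))"

end

locale cartesian_functor = presentation_pair U B F E p ob vert lift F' E' p' ob' vert' lift'
  for U :: "'u set set" and B F E p ob vert lift F' E' p' ob' vert' lift' +
  fixes H :: "('u, 'u, 'u, 'u) ftor"
  assumes H: "H \<in> functors E E'" and over: "cartesian_over E E' B p p' H"
begin

lemmas H_simps [simp] = functorsD(3-7)[OF H]
lemmas H_Comp = functorsD(8)[OF H]

lemma p_H [simp]: "e \<in> Obj E \<Longrightarrow> OMap p' (OMap H e) = OMap p e" "k \<in> Arr E \<Longrightarrow> AMap p' (AMap H k) =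
  AMap p k"
  using over by (auto simp: cartesian_over_def)

lemma H_lift_cartesian: "f \<in> Arr B \<Longrightarrow> u \<in> Obj (PObj F (Cod B f)) \<Longrightarrow> cartesian E' B p' (AMap H (lift f
  u))"
  using over P.lift_cartesian by (simp add: cartesian_over_def preserves_cartesian_def)

end

text \<open>Of \<open>\<alpha>\<close> only the typing \<open>psnat_data\<close> is assumed;
  naturality, invertibility and the coherence equations are consequences, proved in
  \<open>indexed_transformation\<close>.\<close>

locale related = cartesian_functor U B F E p ob vert lift F' E' p' ob' vert' lift' H
  for U :: "'u set set" and B F E p ob vert lift F' E' p' ob' vert' lift' H +
  fixes \<alpha> :: "'u cat_psnat"
  assumes data: "psnat_data B F F' \<alpha>" and compat: "compat H \<alpha>"
begin

lemma H_ob [simp]: "x \<in> Obj B \<Longrightarrow> u \<in> Obj (PObj F x) \<Longrightarrow> OMap H (ob x u) = ob' x (nobj \<alpha> x u)"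
  and H_vert [simp]: "x \<in> Obj B \<Longrightarrow> \<phi> \<in> Arr (PObj F x) \<Longrightarrow> AMap H (vert x \<phi>) = vert' x (narr \<alpha> x \<phi>)"
  and H_lift: "f \<in> Arr B \<Longrightarrow> u \<in> Obj (PObj F (Cod B f)) \<Longrightarrow>
       AMap H (lift f u) \<cdot>[E'] vert' (Dom B f) (ncell \<alpha> f u) = lift' f (nobj \<alpha> (Cod B f) u)"
  using compat by (auto simp: compat_def)

lemma PN1_functor: "x \<in> Obj B \<Longrightarrow> PN1 \<alpha> x \<in> functors (PObj F x) (PObj F' x)"
  using data by (simp add: psnat_data_def)

lemmas PN1_simps [simp] = functorsD(3-7)[OF PN1_functor]

lemma
  assumes "f \<in> Arr B" "y = Dom B f" "u \<in> Obj (PObj F (Cod B f))"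
  shows PN2_Arr [simp]: "ncell \<alpha> f u \<in> Arr (PObj F' y)"
    and Dom_PN2 [simp]: "Dom (PObj F' y) (ncell \<alpha> f u) = pobj F' f (nobj \<alpha> (Cod B f) u)"
    and Cod_PN2 [simp]: "Cod (PObj F' y) (ncell \<alpha> f u) = nobj \<alpha> y (pobj F f u)"
  using data assms by (auto simp: psnat_data_def)

text \<open>Since \<open>H\<close> preserves cartesian arrows, the image of a chosen lift can be
  cancelled; this reduces the equations for \<open>\<alpha>\<close> to equations in
  \<open>E'\<close>.\<close>

lemma H_lift_cancel:
  assumes f: "f \<in> Arr B" and u: "u \<in> Obj (PObj F (Cod B f))" and y: "y = Dom B f"
    and \<phi>: "\<phi> \<in> Arr (PObj F' y)" "Cod (PObj F' y) \<phi> = nobj \<alpha> y (pobj F f u)"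
    and \<psi>: "\<psi> \<in> Arr (PObj F' y)" "Cod (PObj F' y) \<psi> = nobj \<alpha> y (pobj F f u)"
    and eq: "Dom (PObj F' y) \<phi> = Dom (PObj F' y) \<psi>" "AMap H (lift f u) \<cdot>[E'] vert' y \<phi> =
      AMap H (lift f u) \<cdot>[E'] vert' y \<psi>"
  shows "\<phi> = \<psi>"
proof -
  have "vert' y \<phi> = vert' y \<psi>"
    by (rule cartesian_cancel[OF Q.p_is_functor H_lift_cartesian[OF f u]]) (use assms in auto)
  then show ?thesis using assms by (simp add: Q.vert_eq_iff)
qed

text \<open>Each equation is checked after composition with the image of a chosen lift. There
  \<open>H_lift\<close> trades components of \<open>\<alpha>\<close> for chosen lifts of
  \<open>E'\<close>, and \<open>H\<close> carries the laws of the first cleavage into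
  \<open>E'\<close>, where they meet those of the second.\<close>

lemma indexed_transformation: "indexed_transformation U B F F' \<alpha>"
proof (intro indexed_transformation.intro indexed_transformation_axioms.intro
  P.indexed_category_axioms
      Q.indexed_category_axioms)
  show "PN1 \<alpha> x \<in> functors (PObj F x) (PObj F' x)" if "x \<in> Obj B" for x using PN1_functor[OF that] .
  fix f assume f: "f \<in> Arr B"
  let ?x = "Cod B f" and ?y = "Dom B f"
  have xy: "?x \<in> Obj B" "?y \<in> Obj B" using f by auto
  show NDom: "NDom (PN2 \<alpha> f) = comp_ftor (PObj F (Cod B f)) (PArr F' f) (PN1 \<alpha> (Cod B f))"
    and NCod: "NCod (PN2 \<alpha> f) = comp_ftor (PObj F (Cod B f)) (PN1 \<alpha> (Dom B f)) (PArr F f)"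
    using data f by (auto simp: psnat_data_def)
  show "PN2 \<alpha> f \<in> ntranses (PObj F ?x) (PObj F' ?y)"
  proof (rule ntransesI)
    show "NDom (PN2 \<alpha> f) \<in> functors (PObj F ?x) (PObj F' ?y)"
      "NCod (PN2 \<alpha> f) \<in> functors (PObj F ?x) (PObj F' ?y)"
      unfolding NDom NCod using PN1_functor xy P.PArr_functor[OF f] Q.PArr_functor[OF f]
      by (auto intro: comp_ftor_in)
    show "ncell \<alpha> f \<in> extensional (Obj (PObj F ?x))" using data f by (auto simp: psnat_data_def)
    fix \<phi> assume \<phi>: "\<phi> \<in> Arr (PObj F ?x)"
    let ?u = "Dom (PObj F ?x) \<phi>" and ?v = "Cod (PObj F ?x) \<phi>"
    have uv: "?u \<in> Obj (PObj F ?x)" "?v \<in> Obj (PObj F ?x)" using \<phi> xy by auto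
    have "AMap H (lift f ?v) \<cdot>[E'] vert' ?y (ncell \<alpha> f ?v \<cdot>[PObj F' ?y] parr F' f (narr \<alpha> ?x \<phi>)) =
        (AMap H (lift f ?v) \<cdot>[E'] vert' ?y (ncell \<alpha> f ?v)) \<cdot>[E'] vert' ?y (parr F' f (narr \<alpha> ?x \<phi>))"
      using f \<phi> xy uv by (simp add: Q.vert_Comp)
    also have "\<dots> = vert' ?x (narr \<alpha> ?x \<phi>) \<cdot>[E'] lift' f (nobj \<alpha> ?x ?u)"
      using Q.lift_natural[OF f, of "narr \<alpha> ?x \<phi>"] \<phi> xy H_lift[OF f uv(2)] by simp
    also have "\<dots> = vert' ?x (narr \<alpha> ?x \<phi>) \<cdot>[E'] AMap H (lift f ?u) \<cdot>[E'] vert' ?y (ncell \<alpha> f ?u)"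
      using H_lift[OF f uv(1)] by simp
    also have "\<dots> = AMap H (vert ?x \<phi> \<cdot>[E] lift f ?u) \<cdot>[E'] vert' ?y (ncell \<alpha> f ?u)"
      using f \<phi> xy uv by (simp add: H_Comp)
    also have "\<dots> = AMap H (lift f ?v \<cdot>[E] vert ?y (parr F f \<phi>)) \<cdot>[E'] vert' ?y (ncell \<alpha> f ?u)"
      using P.lift_natural[OF f \<phi>] by simp
    also have "\<dots> = AMap H (lift f ?v) \<cdot>[E'] vert' ?y (narr \<alpha> ?y (parr F f \<phi>) \<cdot>[PObj F' ?y]
      ncell \<alpha> f ?u)"
      using f \<phi> xy uv by (simp add: H_Comp Q.vert_Comp)
    finally have eq: "AMap H (lift f ?v) \<cdot>[E'] vert' ?y (ncell \<alpha> f ?v \<cdot>[PObj F' ?y] parr F' f (narr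
      \<alpha> ?x \<phi>)) =
      AMap H (lift f ?v) \<cdot>[E'] vert' ?y (narr \<alpha> ?y (parr F f \<phi>) \<cdot>[PObj F' ?y] ncell \<alpha> f ?u)" .
    have "ncell \<alpha> f ?v \<cdot>[PObj F' ?y] parr F' f (narr \<alpha> ?x \<phi>) =
      narr \<alpha> ?y (parr F f \<phi>) \<cdot>[PObj F' ?y] ncell \<alpha> f ?u"
      by (rule H_lift_cancel[OF f uv(2) refl _ _ _ _ _ eq]) (use f \<phi> xy uv in simp_all)
    then show "ncell \<alpha> f ?v \<cdot>[PObj F' ?y] AMap (NDom (PN2 \<alpha> f)) \<phi> = AMap (NCod (PN2 \<alpha> f)) \<phi> \<cdot>[PObj
      F' ?y] ncell \<alpha> f ?u"
      using \<phi> by (simp add: NDom NCod)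
  qed (use f in \<open>auto simp: NDom NCod\<close>)
  show "is_iso (PObj F' ?y) (ncell \<alpha> f u)" if u: "u \<in> Obj (PObj F ?x)" for u
  proof -
    \<comment> \<open>The inverse is the comparison in the other direction:
      \<open>AMap H (lift f u)\<close> factored through the chosen lift of \<open>E'\<close>. Each
      of the two composites is an identity by cancelling one cartesian arrow.\<close>
    obtain b where b: "b \<in> Arr (PObj F' ?y)" "Cod (PObj F' ?y) b = pobj F' f (nobj \<alpha> ?x u)"
      "AMap H (lift f u) = lift' f (nobj \<alpha> ?x u) \<cdot>[E'] vert' ?y b"
      by (rule Q.obtain_factor[of "AMap H (lift f u)" f "nobj \<alpha> ?x u"]) (use f u xy in auto)
    have "ob' ?y (nobj \<alpha> ?y (pobj F f u)) = Dom E' (AMap H (lift f u))"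
      using f u xy by simp
    also have "\<dots> = ob' ?y (Dom (PObj F' ?y) b)"
      unfolding b(3) using b(1,2) f u xy by simp
    finally have d: "Dom (PObj F' ?y) b = nobj \<alpha> ?y (pobj F f u)"
      using b(1) f u xy by (simp add: Q.ob_eq_iff)
    have 1: "b \<cdot>[PObj F' ?y] ncell \<alpha> f u = Ide (PObj F' ?y) (pobj F' f (nobj \<alpha> ?x u))"
    proof (rule Q.lift_cancel[OF f])
      have "lift' f (nobj \<alpha> ?x u) \<cdot>[E'] vert' ?y (b \<cdot>[PObj F' ?y] ncell \<alpha> f u) =
        (lift' f (nobj \<alpha> ?x u) \<cdot>[E'] vert' ?y b) \<cdot>[E'] vert' ?y (ncell \<alpha> f u)"
        using f u xy b(1,2) d by (simp add: Q.vert_Comp)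
      then show "lift' f (nobj \<alpha> ?x u) \<cdot>[E'] vert' ?y (b \<cdot>[PObj F' ?y] ncell \<alpha> f u) =
        lift' f (nobj \<alpha> ?x u) \<cdot>[E'] vert' ?y (Ide (PObj F' ?y) (pobj F' f (nobj \<alpha> ?x u)))"
        using f u xy by (simp add: b(3)[symmetric] H_lift Q.vert_Ide)
    qed (use f u xy b(1,2) d in auto)
    have 2: "ncell \<alpha> f u \<cdot>[PObj F' ?y] b = Ide (PObj F' ?y) (nobj \<alpha> ?y (pobj F f u))"
    proof (rule H_lift_cancel[OF f u])
      have "AMap H (lift f u) \<cdot>[E'] vert' ?y (ncell \<alpha> f u \<cdot>[PObj F' ?y] b) =
        (AMap H (lift f u) \<cdot>[E'] vert' ?y (ncell \<alpha> f u)) \<cdot>[E'] vert' ?y b"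
        using f u xy b(1,2) d by (simp add: Q.vert_Comp)
      then show "AMap H (lift f u) \<cdot>[E'] vert' ?y (ncell \<alpha> f u \<cdot>[PObj F' ?y] b) =
        AMap H (lift f u) \<cdot>[E'] vert' ?y (Ide (PObj F' ?y) (nobj \<alpha> ?y (pobj F f u)))"
        using f u xy by (simp add: b(3)[symmetric] H_lift Q.vert_Ide)
    qed (use f u xy b(1,2) d in auto)
    show ?thesis
      by (rule is_isoI[where g = b]) (use f u xy b(1,2) d 1 2 in auto)
  qed
next
  fix x u assume x: "x \<in> Obj B" and u: "u \<in> Obj (PObj F x)"
  let ?i = "Ide B x"
  show "ncell \<alpha> ?i u \<cdot>[PObj F' x] punit F' x (nobj \<alpha> x u) = narr \<alpha> x (punit F x u)"
  proof (rule H_lift_cancel[of ?i u])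
    have "AMap H (lift ?i u) \<cdot>[E'] vert' x (ncell \<alpha> ?i u \<cdot>[PObj F' x] punit F' x (nobj \<alpha> x u)) =
      (AMap H (lift ?i u) \<cdot>[E'] vert' x (ncell \<alpha> ?i u)) \<cdot>[E'] vert' x (punit F' x (nobj \<alpha> x u))"
      using x u by (simp add: Q.vert_Comp)
    also have "\<dots> = Ide E' (ob' x (nobj \<alpha> x u))"
      using H_lift[of ?i u] Q.lift_Ide[of x "nobj \<alpha> x u"] x u by simp
    also have "\<dots> = AMap H (lift ?i u \<cdot>[E] vert x (punit F x u))"
      using P.lift_Ide[OF x u] x u by simp
    also have "\<dots> = AMap H (lift ?i u) \<cdot>[E'] vert' x (narr \<alpha> x (punit F x u))"
      using x u by (simp add: H_Comp)
    finally show "AMap H (lift ?i u) \<cdot>[E'] vert' x (ncell \<alpha> ?i u \<cdot>[PObj F' x] punit F' x (nobj \<alpha> x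
      u)) =
      AMap H (lift ?i u) \<cdot>[E'] vert' x (narr \<alpha> x (punit F x u))" .
  qed (use x u in auto)
next
  fix f g u assume f: "f \<in> Arr B" and g: "g \<in> Arr B" and fg: "Dom B f = Cod B g" and u:
    "u \<in> Obj (PObj F (Cod B f))"
  let ?x = "Cod B f" and ?z = "Dom B g" and ?h = "f \<cdot>[B] g"
  let ?v = "pobj F f u" and ?a = "nobj \<alpha> (Cod B f) u"
  have ob: "?x \<in> Obj B" "Cod B g \<in> Obj B" "?z \<in> Obj B" "Dom B f \<in> Obj B" using f g by auto
  have v: "?v \<in> Obj (PObj F (Cod B g))" using f fg u by simp
  show "ncell \<alpha> ?h u \<cdot>[PObj F' ?z] pcomp F' g f ?a =
    narr \<alpha> ?z (pcomp F g f u) \<cdot>[PObj F' ?z] ncell \<alpha> g ?v \<cdot>[PObj F' ?z] parr F' g (ncell \<alpha> f u)"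
    (is "?l = ?r")
  proof (rule H_lift_cancel[of ?h u])
    \<comment> \<open>After \<open>Q.lift_Comp\<close> has split the lift along
      \<open>f \<cdot>[B] g\<close>, \<open>H_lift\<close> is used for \<open>f\<close> and for
      \<open>g\<close>; in between, \<open>Q.lift_natural\<close> moves the comparison at
      \<open>f\<close> across the lift of \<open>g\<close>.\<close>
    have "AMap H (lift ?h u) \<cdot>[E'] vert' ?z ?l =
      (AMap H (lift ?h u) \<cdot>[E'] vert' ?z (ncell \<alpha> ?h u)) \<cdot>[E'] vert' ?z (pcomp F' g f ?a)"
      using f g fg u ob by (simp add: Q.vert_Comp)
    also have "\<dots> = lift' f ?a \<cdot>[E'] lift' g (pobj F' f ?a)"
      using H_lift[of ?h u] Q.lift_Comp[OF f g fg, of ?a] f g fg u ob by simp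
    also have "\<dots> = (AMap H (lift f u) \<cdot>[E'] vert' (Cod B g) (ncell \<alpha> f u)) \<cdot>[E'] lift' g (pobj F' f
      ?a)"
      using H_lift[OF f u] fg by simp
    also have "\<dots> = AMap H (lift f u) \<cdot>[E'] vert' (Cod B g) (ncell \<alpha> f u) \<cdot>[E'] lift' g (pobj F' f
      ?a)"
      using f g fg u ob by simp
    also have "\<dots> = AMap H (lift f u) \<cdot>[E'] lift' g (nobj \<alpha> (Cod B g) ?v) \<cdot>[E'] vert' ?z (parr F' g
      (ncell \<alpha> f u))"
      using Q.lift_natural[OF g, of "ncell \<alpha> f u"] f fg u by simp
    also have "\<dots> = AMap H (lift f u) \<cdot>[E'] (AMap H (lift g ?v) \<cdot>[E'] vert' ?z (ncell \<alpha> g ?v)) \<cdot>[E']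
      vert' ?z (parr F' g (ncell \<alpha> f u))"
      using H_lift[OF g v] by simp
    also have "\<dots> = AMap H (lift f u \<cdot>[E] lift g ?v) \<cdot>[E'] vert' ?z (ncell \<alpha> g ?v) \<cdot>[E']
      vert' ?z (parr F' g (ncell \<alpha> f u))"
      using f g fg u v ob by (simp add: H_Comp)
    also have "\<dots> = AMap H (lift ?h u \<cdot>[E] vert ?z (pcomp F g f u)) \<cdot>[E'] vert' ?z (ncell \<alpha> g ?v)
      \<cdot>[E'] vert' ?z (parr F' g (ncell \<alpha> f u))"
      using P.lift_Comp[OF f g fg u] by simp
    also have "\<dots> = AMap H (lift ?h u) \<cdot>[E'] vert' ?z ?r"
      using f g fg u v ob by (simp add: H_Comp Q.vert_Comp)
    finally show "AMap H (lift ?h u) \<cdot>[E'] vert' ?z ?l = AMap H (lift ?h u) \<cdot>[E'] vert' ?z ?r" .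
  qed (use f g fg u v ob in auto)
qed

lemma in_pseudonaturals: "\<alpha> \<in> pseudonaturals (op_cat B) (Cat U) F F'"
  using indexed_transformation.pseudonatural[OF indexed_transformation] data
  by (simp add: pseudonaturals_def psnat_data_def)

end

lemma iso_cancel_right:
  assumes C: "category C" and a: "is_iso C a"
    and k: "k \<in> Arr C" "k' \<in> Arr C" "Dom C k = Cod C a" "Dom C k' = Cod C a"
    and eq: "k \<cdot>[C] a = k' \<cdot>[C] a"
  shows "k = k'"
proof -
  obtain b where b: "a \<in> Arr C" "b \<in> Arr C" "Dom C b = Cod C a" "Cod C b = Dom C a"
    "a \<cdot>[C] b = Ide C (Cod C a)"
    using a by (auto simp: is_iso_def arrows_iff)
  have "k = k \<cdot>[C] a \<cdot>[C] b" using C k b by simp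
  also have "\<dots> = (k \<cdot>[C] a) \<cdot>[C] b" using C k b(1-4) by simp
  also have "\<dots> = k' \<cdot>[C] a \<cdot>[C] b" unfolding eq using C k b(1-4) by simp
  also have "\<dots> = k'" using C k b by simp
  finally show ?thesis .
qed

lemma functor_is_iso:
  assumes F: "F \<in> functors A B" and a: "is_iso A a"
  shows "is_iso B (AMap F a)"
proof -
  note D = functorsD(1-8)[OF F]
  obtain b where b: "a \<in> Arr A" "b \<in> Arr A" "Dom A b = Cod A a" "Cod A b = Dom A a"
    "b \<cdot>[A] a = Ide A (Dom A a)" "a \<cdot>[A] b = Ide A (Cod A a)"
    using a by (auto simp: is_iso_def arrows_iff)
  have "AMap F b \<cdot>[B] AMap F a = Ide B (OMap F (Dom A a))" "AMap F a \<cdot>[B] AMap F b =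
    Ide B (OMap F (Cod A a))"
    using D(8)[of a b] D(8)[of b a] b D(1,2,7) by auto
  then show ?thesis using b D(1-6) by (intro is_isoI[where g = "AMap F b"]) auto
qed

text \<open>Two cartesian arrows over the same arrow with the same codomain differ by a vertical
  isomorphism. Here \<open>k\<close> is this comparison, and its inverse is the factorisation of
  \<open>g\<close> through \<open>g \<cdot>[E] k\<close>.\<close>

lemma cartesian_factor_is_iso:
  assumes p: "is_functor E B p" and g: "cartesian E B p g" and k: "k \<in> Arr E" "Cod E k = Dom E g"
    and pk: "AMap p k = Ide B (OMap p (Dom E k))" and gk: "cartesian E B p (g \<cdot>[E] k)"
  shows "is_iso E k"
proof -
  note P[simp] = is_functorD[OF p]
  have ga[simp]: "g \<in> Arr E" "k \<in> Arr E" using cartesian_Arr[OF g] k by auto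
  have "Cod B (AMap p k) = OMap p (Dom E k)" unfolding pk by simp
  then have pd: "OMap p (Dom E g) = OMap p (Dom E k)" using k by simp
  have c: "Cod E g = Cod E (g \<cdot>[E] k)" "Ide B (OMap p (Dom E k)) \<in> Arr B"
    "Cod B (Ide B (OMap p (Dom E k))) = OMap p (Dom E (g \<cdot>[E] k))"
    "AMap p g = AMap p (g \<cdot>[E] k) \<cdot>[B] Ide B (OMap p (Dom E k))"
    using k pk pd by simp_all
  obtain m where m: "m \<in> Arr E" "Dom E m = Dom E g" "Cod E m = Dom E (g \<cdot>[E] k)"
    "AMap p m = Ide B (OMap p (Dom E k))"
    "g = (g \<cdot>[E] k) \<cdot>[E] m"
    using cartesian_factor[OF gk ga(1) c] by blast
  have m3: "Cod E m = Dom E k" using m(3) k by simp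
  have gkm: "g \<cdot>[E] k \<cdot>[E] m = g" using m(1,2,5) m3 k by simp
  have 1: "k \<cdot>[E] m = Ide E (Dom E g)"
    by (rule cartesian_cancel[OF p g]) (use m(1,2,4) m3 gkm k pk pd in simp_all)
  have 2: "m \<cdot>[E] k = Ide E (Dom E k)"
  proof (rule cartesian_cancel[OF p gk])
    have "(g \<cdot>[E] k) \<cdot>[E] m \<cdot>[E] k = (g \<cdot>[E] k \<cdot>[E] m) \<cdot>[E] k" using m(1,2) m3 k by simp
    then show "(g \<cdot>[E] k) \<cdot>[E] m \<cdot>[E] k = (g \<cdot>[E] k) \<cdot>[E] Ide E (Dom E k)"
      using k by (simp add: gkm)
  qed (use m(1,2,4) m3 k pk pd in simp_all)
  show ?thesis by (rule is_isoI[where g = m]) (use m(1,2) m3 k 1 2 in auto)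
qed

section \<open>Cartesian functors correspond to pseudonatural transformations\<close>

context cartesian_functor
begin

text \<open>The functors between the fibres are read off through the bijections \<open>ob'\<close>
  and \<open>vert'\<close>, whose injectivity transfers functoriality from \<open>H\<close>.\<close>

lemma ex_transformation: "\<exists>\<alpha>. psnat_data B F F' \<alpha> \<and> compat H \<alpha>"
proof -
  have "\<exists>v. v \<in> Obj (PObj F' x) \<and> OMap H (ob x u) = ob' x v" if "x \<in> Obj B" "u \<in> Obj (PObj F x)"
    for x u
    using Q.obtain_ob[of "OMap H (ob x u)"] that by auto
  then obtain o' where o': "\<And>x u. x \<in> Obj B \<Longrightarrow> u \<in> Obj (PObj F x) \<Longrightarrow> o' x u \<in> Obj (PObj F' x)"
    "\<And>x u. x \<in> Obj B \<Longrightarrow> u \<in> Obj (PObj F x) \<Longrightarrow> OMap H (ob x u) = ob' x (o' x u)"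
    by metis
  have "\<exists>\<psi>. \<psi> \<in> Arr (PObj F' x) \<and> AMap H (vert x \<phi>) = vert' x \<psi>" if "x \<in> Obj B" "\<phi> \<in> Arr (PObj F x)"
    for x \<phi>
    using Q.obtain_vert[of x "AMap H (vert x \<phi>)"] that by auto
  then obtain m' where m': "\<And>x \<phi>. x \<in> Obj B \<Longrightarrow> \<phi> \<in> Arr (PObj F x) \<Longrightarrow> m' x \<phi> \<in> Arr (PObj F' x)"
    "\<And>x \<phi>. x \<in> Obj B \<Longrightarrow> \<phi> \<in> Arr (PObj F x) \<Longrightarrow> AMap H (vert x \<phi>) = vert' x (m' x \<phi>)"
    by metis
  have m'_Dom: "Dom (PObj F' x) (m' x \<phi>) = o' x (Dom (PObj F x) \<phi>)" if "x \<in> Obj B"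
    "\<phi> \<in> Arr (PObj F x)" for x \<phi>
  proof -
    have "ob' x (Dom (PObj F' x) (m' x \<phi>)) = Dom E' (AMap H (vert x \<phi>))" using that m' by simp
    also have "\<dots> = ob' x (o' x (Dom (PObj F x) \<phi>))" using that o' by simp
    finally show ?thesis using Q.ob_eq_iff that o' m' by simp
  qed
  have m'_Cod: "Cod (PObj F' x) (m' x \<phi>) = o' x (Cod (PObj F x) \<phi>)" if "x \<in> Obj B"
    "\<phi> \<in> Arr (PObj F x)" for x \<phi>
  proof -
    have "ob' x (Cod (PObj F' x) (m' x \<phi>)) = Cod E' (AMap H (vert x \<phi>))" using that m' by simp
    also have "\<dots> = ob' x (o' x (Cod (PObj F x) \<phi>))" using that o' by simp
    finally show ?thesis using Q.ob_eq_iff that o' m' by simp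
  qed
  \<comment> \<open>The component at \<open>f\<close> is the vertical factor of the chosen lift of
    \<open>E'\<close> through the cartesian image of \<open>lift f u\<close>.\<close>
  have "\<exists>\<psi>. \<psi> \<in> Arr (PObj F' (Dom B f)) \<and> Dom (PObj F' (Dom B f)) \<psi> = pobj F' f (o' (Cod B f) u) \<and>
      Cod (PObj F' (Dom B f)) \<psi> = o' (Dom B f) (pobj F f u) \<and>
      AMap H (lift f u) \<cdot>[E'] vert' (Dom B f) \<psi> = lift' f (o' (Cod B f) u)"
    if f: "f \<in> Arr B" and u: "u \<in> Obj (PObj F (Cod B f))" for f u
  proof -
    have ob: "Cod B f \<in> Obj B" "Dom B f \<in> Obj B" using f by auto
    have l: "lift' f (o' (Cod B f) u) \<in> Arr E'" using f u ob o' by simp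
    have a: "Cod E' (lift' f (o' (Cod B f) u)) = Cod E' (AMap H (lift f u))"
      "Ide B (Dom B f) \<in> Arr B"
      "Cod B (Ide B (Dom B f)) = OMap p' (Dom E' (AMap H (lift f u)))"
      "AMap p' (lift' f (o' (Cod B f) u)) = AMap p' (AMap H (lift f u)) \<cdot>[B] Ide B (Dom B f)"
      using f u ob o' by simp_all
    obtain m where m: "m \<in> Arr E'" "Dom E' m = Dom E' (lift' f (o' (Cod B f) u))"
      "Cod E' m = Dom E' (AMap H (lift f u))"
      "AMap p' m = Ide B (Dom B f)" "lift' f (o' (Cod B f) u) = AMap H (lift f u) \<cdot>[E'] m"
      using cartesian_factor[OF H_lift_cartesian[OF f u] l a] by blast
    obtain \<psi> where \<psi>: "\<psi> \<in> Arr (PObj F' (Dom B f))" "m = vert' (Dom B f) \<psi>"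
      using Q.obtain_vert[OF ob(2) m(1,4)] by blast
    have "ob' (Dom B f) (Dom (PObj F' (Dom B f)) \<psi>) = ob' (Dom B f) (pobj F' f (o' (Cod B f) u))"
      "ob' (Dom B f) (Cod (PObj F' (Dom B f)) \<psi>) = ob' (Dom B f) (o' (Dom B f) (pobj F f u))"
      using m(2,3) \<psi> f u ob o' by simp_all
    then show ?thesis using \<psi> m(5) f u ob o' by (intro exI[of _ \<psi>]) (simp add: Q.ob_eq_iff)
  qed
  then obtain n' where n': "\<And>f u. f \<in> Arr B \<Longrightarrow> u \<in> Obj (PObj F (Cod B f)) \<Longrightarrow>
      n' f u \<in> Arr (PObj F' (Dom B f)) \<and> Dom (PObj F' (Dom B f)) (n' f u) =
        pobj F' f (o' (Cod B f) u) \<and>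
      Cod (PObj F' (Dom B f)) (n' f u) = o' (Dom B f) (pobj F f u) \<and>
      AMap H (lift f u) \<cdot>[E'] vert' (Dom B f) (n' f u) = lift' f (o' (Cod B f) u)"
    by metis
  define A where "A = (\<lambda>x\<in>Obj B. \<lparr>OMap = (\<lambda>u\<in>Obj (PObj F x). o' x u), AMap =
    (\<lambda>\<phi>\<in>Arr (PObj F x). m' x \<phi>)\<rparr>)"
  define \<alpha> where "\<alpha> = \<lparr>PN1 = A, PN2 = (\<lambda>f\<in>Arr B.
     \<lparr>NDom = comp_ftor (PObj F (Cod B f)) (PArr F' f) (A (Cod B f)),
      NCod = comp_ftor (PObj F (Cod B f)) (A (Dom B f)) (PArr F f),
      NMap = (\<lambda>u\<in>Obj (PObj F (Cod B f)). n' f u)\<rparr>)\<rparr>"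
  have A: "A x \<in> functors (PObj F x) (PObj F' x)" if x: "x \<in> Obj B" for x
  proof -
    have "is_functor (PObj F x) (PObj F' x) (A x)"
    proof (rule is_functorI)
      fix u assume u: "u \<in> Obj (PObj F x)"
      have "vert' x (m' x (Ide (PObj F x) u)) = AMap H (vert x (Ide (PObj F x) u))"
        using x u m' by simp
      also have "\<dots> = vert' x (Ide (PObj F' x) (o' x u))"
        using x u o' by (simp add: P.vert_Ide Q.vert_Ide)
      finally have "m' x (Ide (PObj F x) u) = Ide (PObj F' x) (o' x u)"
        using x u m' o' by (simp add: Q.vert_eq_iff)
      then show "AMap (A x) (Ide (PObj F x) u) = Ide (PObj F' x) (OMap (A x) u)"
        using x u by (simp add: A_def)
    next
      fix \<phi> \<psi> assume a: "\<phi> \<in> Arr (PObj F x)" "\<psi> \<in> Arr (PObj F x)" "Dom (PObj F x) \<psi> =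
        Cod (PObj F x) \<phi>"
      have "vert' x (m' x (\<psi> \<cdot>[PObj F x] \<phi>)) = AMap H (vert x (\<psi> \<cdot>[PObj F x] \<phi>))"
        using x a m' by simp
      also have "\<dots> = AMap H (vert x \<psi>) \<cdot>[E'] AMap H (vert x \<phi>)"
        using x a by (simp add: P.vert_Comp H_Comp)
      also have "\<dots> = vert' x (m' x \<psi> \<cdot>[PObj F' x] m' x \<phi>)" using x a m' m'_Dom m'_Cod
        by (simp add: Q.vert_Comp)
      finally have "m' x (\<psi> \<cdot>[PObj F x] \<phi>) = m' x \<psi> \<cdot>[PObj F' x] m' x \<phi>"
        using x a m' m'_Dom m'_Cod by (simp add: Q.vert_eq_iff)
      then show "AMap (A x) (\<psi> \<cdot>[PObj F x] \<phi>) = AMap (A x) \<psi> \<cdot>[PObj F' x] AMap (A x) \<phi>"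
        using x a by (simp add: A_def)
    qed (use x o' m' m'_Dom m'_Cod in \<open>auto simp: A_def\<close>)
    then show ?thesis using x by (simp add: functors_def A_def)
  qed
  have AO: "OMap (A x) u = o' x u" if "x \<in> Obj B" "u \<in> Obj (PObj F x)"
    for x u using that by (simp add: A_def)
  have AA: "AMap (A x) u = m' x u" if "x \<in> Obj B" "u \<in> Arr (PObj F x)"
    for x u using that by (simp add: A_def)
  have "psnat_data B F F' \<alpha>"
    unfolding psnat_data_def using A n' by (auto simp: \<alpha>_def AO) (simp add: A_def)
  moreover have "compat H \<alpha>"
    unfolding compat_def using n' o' m' by (auto simp: \<alpha>_def AO AA)
  ultimately show ?thesis by blast
qed

end

section \<open>Uniqueness of related transformations and functors\<close>

context presentation_pair
begin

text \<open>The maps \<open>ob'\<close> and \<open>vert'\<close> are injective and images of chosen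
  lifts are cartesian, so \<open>compat\<close> determines every component.\<close>

lemma transformation_unique:
  assumes 1: "related U B F E p ob vert lift F' E' p' ob' vert' lift' H \<alpha>"
    and 2: "related U B F E p ob vert lift F' E' p' ob' vert' lift' H \<beta>"
  shows "\<alpha> = \<beta>"
proof -
  interpret r1: related U B F E p ob vert lift F' E' p' ob' vert' lift' H \<alpha> by fact
  interpret r2: related U B F E p ob vert lift F' E' p' ob' vert' lift' H \<beta> by fact
  have PN1: "PN1 \<alpha> x = PN1 \<beta> x" if x: "x \<in> Obj B" for x
  proof (rule functors_eqI[OF r1.PN1_functor[OF x] r2.PN1_functor[OF x]])
    show "nobj \<alpha> x u = nobj \<beta> x u" if u: "u \<in> Obj (PObj F x)" for u
      using r1.H_ob[OF x u] r2.H_ob[OF x u] Q.ob_eq_iff[OF x r1.PN1_simps(1)[OF x u]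
        r2.PN1_simps(1)[OF x u]] by simp
    show "narr \<alpha> x u = narr \<beta> x u" if u: "u \<in> Arr (PObj F x)" for u
      using r1.H_vert[OF x u] r2.H_vert[OF x u] Q.vert_eq_iff[OF x r1.PN1_simps(2)[OF x u]
        r2.PN1_simps(2)[OF x u]] by simp
  qed
  have PN2: "PN2 \<alpha> f = PN2 \<beta> f" if f: "f \<in> Arr B" for f
  proof (rule ntrans_eqI[where X = "Obj (PObj F (Cod B f))"])
    have ob: "Cod B f \<in> Obj B" "Dom B f \<in> Obj B" using f by auto
    show "NDom (PN2 \<alpha> f) = NDom (PN2 \<beta> f)" "NCod (PN2 \<alpha> f) = NCod (PN2 \<beta> f)"
      "ncell \<alpha> f \<in> extensional (Obj (PObj F (Cod B f)))" "ncell \<beta> f \<in> extensional (Obj (PObj F (Cod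
        B f)))"
      using r1.data r2.data f PN1[OF ob(1)] PN1[OF ob(2)] by (simp_all add: psnat_data_def)
    fix u assume u: "u \<in> Obj (PObj F (Cod B f))"
    show "ncell \<alpha> f u = ncell \<beta> f u"
      by (rule r1.H_lift_cancel[OF f u refl])
        (use f u ob PN1[OF ob(1)] PN1[OF ob(2)] r1.H_lift[OF f u] r2.H_lift[OF f u] in simp_all)
  qed
  have "PN1 \<alpha> = PN1 \<beta>" "PN2 \<alpha> = PN2 \<beta>"
    using r1.data r2.data PN1 PN2 by (auto simp: psnat_data_def intro: extensionalityI)
  then show ?thesis by simp
qed

text \<open>\<open>H\<close> is determined on vertical arrows by \<open>compat\<close>, and on the
  cleavage because the components of \<open>\<alpha>\<close> are invertible and can be cancelled;
  vertical arrows and chosen lifts generate all arrows.\<close>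

lemma functor_unique:
  assumes 1: "related U B F E p ob vert lift F' E' p' ob' vert' lift' H \<alpha>"
    and 2: "related U B F E p ob vert lift F' E' p' ob' vert' lift' H' \<alpha>"
  shows "H = H'"
proof -
  interpret r1: related U B F E p ob vert lift F' E' p' ob' vert' lift' H \<alpha> by fact
  interpret r2: related U B F E p ob vert lift F' E' p' ob' vert' lift' H' \<alpha> by fact
  interpret t: indexed_transformation U B F F' \<alpha> by (rule r1.indexed_transformation)
  show ?thesis
  proof (rule functors_eqI[OF r1.H r2.H])
    fix e assume e: "e \<in> Obj E"
    obtain u where u: "u \<in> Obj (PObj F (OMap p e))" "e = ob (OMap p e) u" using P.obtain_ob[OF e] .
    have "OMap p e \<in> Obj B" using e by simp
    then have "OMap H (ob (OMap p e) u) = OMap H' (ob (OMap p e) u)" using u(1) by simp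
    then show "OMap H e = OMap H' e" using u(2) by simp
  next
    fix k assume k: "k \<in> Arr E"
    define f where "f = AMap p k"
    have f: "f \<in> Arr B" and pc: "OMap p (Cod E k) = Cod B f" using k by (simp_all add: f_def)
    obtain u where u: "u \<in> Obj (PObj F (Cod B f))" "Cod E k = ob (Cod B f) u"
      using P.obtain_ob[of "Cod E k"] k pc by auto
    obtain \<phi> where \<phi>: "\<phi> \<in> Arr (PObj F (Dom B f))" "Cod (PObj F (Dom B f)) \<phi> = pobj F f u"
      "k = lift f u \<cdot>[E] vert (Dom B f) \<phi>"
      using P.obtain_factor[OF k f_def[symmetric] u(2,1)] .
    have "AMap H (lift f u) = AMap H' (lift f u)"
      by (rule iso_cancel_right[where a = "vert' (Dom B f) (ncell \<alpha> f u)" and C = E'])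
        (use f u(1) t.PN2_is_iso[OF f u(1)] r1.H_lift[OF f u(1)] r2.H_lift[OF f u(1)]
          in \<open>simp_all add: Q.vert_is_iso\<close>)
    then show "AMap H k = AMap H' k"
      unfolding \<phi>(3) using f u(1) \<phi>(1,2) by (simp add: r1.H_Comp r2.H_Comp)
  qed
qed

end

section \<open>The cartesian functor induced by a pseudonatural transformation\<close>

locale transformation_of_presentations =
  presentation_pair U B F E p ob vert lift F' E' p' ob' vert' lift' + T: indexed_transformation U B
    F F' \<alpha>
  for U :: "'u set set" and B F E p ob vert lift F' E' p' ob' vert' lift' \<alpha>
begin

text \<open>The pointwise inverse of \<open>PN2\<close>. Compatibility describes the image of a lift
  only after composition with \<open>ncell \<alpha> f u\<close>, so solving for that image takes
  this inverse.\<close>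

definition inv2 :: "'u \<Rightarrow> 'u \<Rightarrow> 'u" where
  "inv2 f u = (SOME b. b \<in> Arr (PObj F' (Dom B f)) \<and> Dom (PObj F' (Dom B f)) b =
    nobj \<alpha> (Dom B f) (pobj F f u) \<and>
     Cod (PObj F' (Dom B f)) b = pobj F' f (nobj \<alpha> (Cod B f) u) \<and>
     b \<cdot>[PObj F' (Dom B f)] ncell \<alpha> f u = Ide (PObj F' (Dom B f)) (pobj F' f (nobj \<alpha> (Cod B f) u)) \<and>
     ncell \<alpha> f u \<cdot>[PObj F' (Dom B f)] b = Ide (PObj F' (Dom B f)) (nobj \<alpha> (Dom B f) (pobj F f u)))"

lemma inv2:
  assumes f: "f \<in> Arr B" and u: "u \<in> Obj (PObj F (Cod B f))" and y: "y = Dom B f"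
  shows inv2_Arr [simp]: "inv2 f u \<in> Arr (PObj F' y)"
    and Dom_inv2 [simp]: "Dom (PObj F' y) (inv2 f u) = nobj \<alpha> y (pobj F f u)"
    and Cod_inv2 [simp]: "Cod (PObj F' y) (inv2 f u) = pobj F' f (nobj \<alpha> (Cod B f) u)"
    and inv2_left: "inv2 f u \<cdot>[PObj F' y] ncell \<alpha> f u = Ide (PObj F' y) (pobj F' f (nobj \<alpha> (Cod B f)
      u))"
    and inv2_right: "ncell \<alpha> f u \<cdot>[PObj F' y] inv2 f u = Ide (PObj F' y) (nobj \<alpha> y (pobj F f u))"
proof -
  have "\<exists>b. b \<in> Arr (PObj F' (Dom B f)) \<and> Dom (PObj F' (Dom B f)) b = nobj \<alpha> (Dom B f) (pobj F f u)
    \<and>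
     Cod (PObj F' (Dom B f)) b = pobj F' f (nobj \<alpha> (Cod B f) u) \<and>
     b \<cdot>[PObj F' (Dom B f)] ncell \<alpha> f u = Ide (PObj F' (Dom B f)) (pobj F' f (nobj \<alpha> (Cod B f) u)) \<and>
     ncell \<alpha> f u \<cdot>[PObj F' (Dom B f)] b = Ide (PObj F' (Dom B f)) (nobj \<alpha> (Dom B f) (pobj F f u))"
    using T.PN2_is_iso[OF f u] f u by (auto simp: is_iso_def arrows_iff)
  note b = someI_ex[OF this, folded inv2_def]
  show "inv2 f u \<in> Arr (PObj F' y)" "Dom (PObj F' y) (inv2 f u) = nobj \<alpha> y (pobj F f u)"
    "Cod (PObj F' y) (inv2 f u) = pobj F' f (nobj \<alpha> (Cod B f) u)"
    "inv2 f u \<cdot>[PObj F' y] ncell \<alpha> f u = Ide (PObj F' y) (pobj F' f (nobj \<alpha> (Cod B f) u))"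
    "ncell \<alpha> f u \<cdot>[PObj F' y] inv2 f u = Ide (PObj F' y) (nobj \<alpha> y (pobj F f u))"
    using b y by simp_all
qed

text \<open>The value that the functor induced by \<open>\<alpha>\<close> must take on the cleavage.\<close>

definition H_lift :: "'u \<Rightarrow> 'u \<Rightarrow> 'u" where
  "H_lift f u = lift' f (nobj \<alpha> (Cod B f) u) \<cdot>[E'] vert' (Dom B f) (inv2 f u)"

lemma
  assumes f: "f \<in> Arr B" and u: "u \<in> Obj (PObj F (Cod B f))"
  shows H_lift_Arr [simp]: "H_lift f u \<in> Arr E'"
    and Dom_H_lift [simp]: "Dom E' (H_lift f u) = ob' (Dom B f) (nobj \<alpha> (Dom B f) (pobj F f u))"
    and Cod_H_lift [simp]: "Cod E' (H_lift f u) = ob' (Cod B f) (nobj \<alpha> (Cod B f) u)"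
    and p_H_lift [simp]: "AMap p' (H_lift f u) = f"
    and H_lift_PN2: "H_lift f u \<cdot>[E'] vert' (Dom B f) (ncell \<alpha> f u) = lift' f (nobj \<alpha> (Cod B f) u)"
    and H_lift_cartesian: "cartesian E' B p' (H_lift f u)"
proof -
  show "H_lift f u \<in> Arr E'" "Dom E' (H_lift f u) = ob' (Dom B f) (nobj \<alpha> (Dom B f) (pobj F f u))"
    "Cod E' (H_lift f u) = ob' (Cod B f) (nobj \<alpha> (Cod B f) u)" "AMap p' (H_lift f u) = f"
    using f u by (simp_all add: H_lift_def)
  have "H_lift f u \<cdot>[E'] vert' (Dom B f) (ncell \<alpha> f u) =
      lift' f (nobj \<alpha> (Cod B f) u) \<cdot>[E'] vert' (Dom B f) (inv2 f u \<cdot>[PObj F' (Dom B f)]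
        ncell \<alpha> f u)"
    using f u by (simp add: H_lift_def Q.vert_Comp)
  then show "H_lift f u \<cdot>[E'] vert' (Dom B f) (ncell \<alpha> f u) = lift' f (nobj \<alpha> (Cod B f) u)"
    using f u by (simp add: inv2_left Q.vert_Ide)
  have "is_iso (PObj F' (Dom B f)) (inv2 f u)"
    by (rule is_isoI[where g = "ncell \<alpha> f u"]) (use f u in \<open>simp_all add: inv2_left inv2_right\<close>)
  then show "cartesian E' B p' (H_lift f u)"
    unfolding H_lift_def using f u
    by (intro cartesian_comp_iso[OF Q.p_is_functor Q.lift_cartesian]) (simp_all add: Q.vert_is_iso)
qed

text \<open>An equation between arrows out of the domain of \<open>H_lift f u\<close> may be tested
  after composition with the invertible comparison, where \<open>H_lift_PN2\<close> replaces
  \<open>H_lift\<close> by chosen lifts.\<close>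

lemma PN2_cancel:
  assumes f: "f \<in> Arr B" and u: "u \<in> Obj (PObj F (Cod B f))" and y: "y = Dom B f"
    and k: "k \<in> Arr E'" "Dom E' k = ob' y (nobj \<alpha> y (pobj F f u))"
    and k': "k' \<in> Arr E'" "Dom E' k' = ob' y (nobj \<alpha> y (pobj F f u))"
    and eq: "k \<cdot>[E'] vert' y (ncell \<alpha> f u) = k' \<cdot>[E'] vert' y (ncell \<alpha> f u)"
  shows "k = k'"
  by (rule iso_cancel_right[OF Q.category_E _ k(1) k'(1) _ _ eq])
    (use f u y k k' T.PN2_is_iso[OF f u] in \<open>simp_all add: Q.vert_is_iso\<close>)

text \<open>\<open>H_lift_natural\<close>, \<open>H_lift_Comp\<close> and \<open>H_lift_Ide\<close>
  are the images of the laws \<open>lift_natural\<close>, \<open>lift_Comp\<close> and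
  \<open>lift_Ide\<close> of the cleavage; functoriality of the induced functor reduces to these and
  to functoriality of \<open>PN1\<close>.\<close>

lemma H_lift_natural:
  assumes g: "g \<in> Arr B" and \<phi>: "\<phi> \<in> Arr (PObj F (Cod B g))"
  shows "vert' (Cod B g) (narr \<alpha> (Cod B g) \<phi>) \<cdot>[E'] H_lift g (Dom (PObj F (Cod B g)) \<phi>) =
    H_lift g (Cod (PObj F (Cod B g)) \<phi>) \<cdot>[E'] vert' (Dom B g) (narr \<alpha> (Dom B g) (parr F g \<phi>))"
proof -
  let ?y = "Cod B g" and ?z = "Dom B g"
  let ?v = "Dom (PObj F ?y) \<phi>" and ?v' = "Cod (PObj F ?y) \<phi>"
  have ob: "?y \<in> Obj B" "?z \<in> Obj B" using g by auto
  have v: "?v \<in> Obj (PObj F ?y)" "?v' \<in> Obj (PObj F ?y)" using \<phi> ob by auto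
  show ?thesis
  proof (rule PN2_cancel[OF g v(1) refl])
    have "(vert' ?y (narr \<alpha> ?y \<phi>) \<cdot>[E'] H_lift g ?v) \<cdot>[E'] vert' ?z (ncell \<alpha> g ?v) =
      vert' ?y (narr \<alpha> ?y \<phi>) \<cdot>[E'] lift' g (nobj \<alpha> ?y ?v)"
      using g \<phi> ob v by (simp add: H_lift_PN2)
    also have "\<dots> = lift' g (nobj \<alpha> ?y ?v') \<cdot>[E'] vert' ?z (parr F' g (narr \<alpha> ?y \<phi>))"
      using Q.lift_natural[OF g, of "narr \<alpha> ?y \<phi>"] \<phi> ob by simp
    also have "\<dots> = (H_lift g ?v' \<cdot>[E'] vert' ?z (ncell \<alpha> g ?v')) \<cdot>[E'] vert' ?z (parr F' g (narr \<alpha>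
      ?y \<phi>))"
      using H_lift_PN2[OF g v(2)] by simp
    also have "\<dots> = H_lift g ?v' \<cdot>[E'] vert' ?z (ncell \<alpha> g ?v' \<cdot>[PObj F' ?z] parr F' g (narr \<alpha> ?y
      \<phi>))"
      using g \<phi> ob v by (simp add: Q.vert_Comp)
    also have "\<dots> = H_lift g ?v' \<cdot>[E'] vert' ?z (narr \<alpha> ?z (parr F g \<phi>) \<cdot>[PObj F' ?z] ncell \<alpha> g ?v)"
      using T.PN2_natural[OF g \<phi>] by simp
    also have "\<dots> = (H_lift g ?v' \<cdot>[E'] vert' ?z (narr \<alpha> ?z (parr F g \<phi>))) \<cdot>[E'] vert' ?z (ncell \<alpha> g
      ?v)"
      using g \<phi> ob v by (simp add: Q.vert_Comp)
    finally show "(vert' ?y (narr \<alpha> ?y \<phi>) \<cdot>[E'] H_lift g ?v) \<cdot>[E'] vert' ?z (ncell \<alpha> g ?v) =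
      (H_lift g ?v' \<cdot>[E'] vert' ?z (narr \<alpha> ?z (parr F g \<phi>))) \<cdot>[E'] vert' ?z (ncell \<alpha> g ?v)" .
  qed (use g \<phi> ob v in simp_all)
qed

lemma H_lift_Comp:
  assumes f: "f \<in> Arr B" and g: "g \<in> Arr B" and fg: "Dom B f = Cod B g" and u:
    "u \<in> Obj (PObj F (Cod B f))"
  shows "H_lift f u \<cdot>[E'] H_lift g (pobj F f u) =
    H_lift (f \<cdot>[B] g) u \<cdot>[E'] vert' (Dom B g) (narr \<alpha> (Dom B g) (pcomp F g f u))"
proof -
  let ?x = "Cod B f" and ?z = "Dom B g" and ?h = "f \<cdot>[B] g"
  let ?v = "pobj F f u" and ?a = "nobj \<alpha> (Cod B f) u"
  have ob: "?x \<in> Obj B" "Cod B g \<in> Obj B" "?z \<in> Obj B" "Dom B f \<in> Obj B" using f g by auto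
  have v: "?v \<in> Obj (PObj F (Cod B g))" using f fg u by simp
  \<comment> \<open>The comparison for two composed lifts has two factors, the one at
    \<open>g\<close> and the reindexed one at \<open>f\<close>. The latter, \<open>?i\<close>, is
    cancelled here, the former by \<open>PN2_cancel\<close> at the end.\<close>
  let ?i = "vert' ?z (parr F' g (ncell \<alpha> f u))"
  have iso: "is_iso E' ?i"
    using f g fg u ob functor_is_iso[OF Q.PArr_functor[OF g]] T.PN2_is_iso[OF f u]
      by (simp add: Q.vert_is_iso)
  let ?l = "H_lift f u \<cdot>[E'] H_lift g ?v" and ?r = "H_lift ?h u \<cdot>[E'] vert' ?z (narr \<alpha> ?z (pcomp F g
    f u))"
  have "?l \<cdot>[E'] vert' ?z (ncell \<alpha> g ?v) = ?r \<cdot>[E'] vert' ?z (ncell \<alpha> g ?v)"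
  proof (rule iso_cancel_right[OF Q.category_E iso])
    have "(?l \<cdot>[E'] vert' ?z (ncell \<alpha> g ?v)) \<cdot>[E'] ?i =
      H_lift f u \<cdot>[E'] (H_lift g ?v \<cdot>[E'] vert' ?z (ncell \<alpha> g ?v)) \<cdot>[E'] ?i"
      using f g fg u v ob by simp
    also have "\<dots> = H_lift f u \<cdot>[E'] lift' g (nobj \<alpha> (Cod B g) ?v) \<cdot>[E'] ?i"
      using H_lift_PN2[OF g v] by simp
    also have "\<dots> = H_lift f u \<cdot>[E'] vert' (Cod B g) (ncell \<alpha> f u) \<cdot>[E'] lift' g (pobj F' f ?a)"
      using Q.lift_natural[OF g, of "ncell \<alpha> f u"] f fg u by simp
    also have "\<dots> = (H_lift f u \<cdot>[E'] vert' (Cod B g) (ncell \<alpha> f u)) \<cdot>[E'] lift' g (pobj F' f ?a)"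
      using f g fg u ob by simp
    also have "\<dots> = lift' ?h ?a \<cdot>[E'] vert' ?z (pcomp F' g f ?a)"
      using H_lift_PN2[OF f u] Q.lift_Comp[OF f g fg, of ?a] u ob fg by simp
    also have "\<dots> = (H_lift ?h u \<cdot>[E'] vert' ?z (ncell \<alpha> ?h u)) \<cdot>[E'] vert' ?z (pcomp F' g f ?a)"
      using H_lift_PN2[of ?h u] f g fg u by simp
    also have "\<dots> = H_lift ?h u \<cdot>[E'] vert' ?z (ncell \<alpha> ?h u \<cdot>[PObj F' ?z] pcomp F' g f ?a)"
      using f g fg u ob by (simp add: Q.vert_Comp)
    also have "\<dots> = H_lift ?h u \<cdot>[E'] vert' ?z (narr \<alpha> ?z (pcomp F g f u) \<cdot>[PObj F' ?z]
        ncell \<alpha> g ?v \<cdot>[PObj F' ?z] parr F' g (ncell \<alpha> f u))"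
      using T.comp[OF f g fg u] by simp
    also have "\<dots> = (?r \<cdot>[E'] vert' ?z (ncell \<alpha> g ?v)) \<cdot>[E'] ?i"
      using f g fg u v ob by (simp add: Q.vert_Comp)
    finally show "(?l \<cdot>[E'] vert' ?z (ncell \<alpha> g ?v)) \<cdot>[E'] ?i = (?r \<cdot>[E'] vert' ?z (ncell \<alpha> g ?v))
      \<cdot>[E'] ?i" .
  qed (use f g fg u v ob in simp_all)
  then show ?thesis
    by (rule PN2_cancel[OF g v refl, rotated -1]) (use f g fg u v ob in simp_all)
qed

lemma H_lift_Ide:
  assumes x: "x \<in> Obj B" and u: "u \<in> Obj (PObj F x)"
  shows "H_lift (Ide B x) u \<cdot>[E'] vert' x (narr \<alpha> x (punit F x u)) = Ide E' (ob' x (nobj \<alpha> x u))"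
proof -
  have "H_lift (Ide B x) u \<cdot>[E'] vert' x (narr \<alpha> x (punit F x u)) =
    (H_lift (Ide B x) u \<cdot>[E'] vert' x (ncell \<alpha> (Ide B x) u)) \<cdot>[E'] vert' x (punit F' x (nobj \<alpha> x
      u))"
    using x u by (simp add: T.unit[OF x u, symmetric] Q.vert_Comp)
  also have "\<dots> = Ide E' (ob' x (nobj \<alpha> x u))"
    using H_lift_PN2[of "Ide B x" u] Q.lift_Ide[of x "nobj \<alpha> x u"] x u by simp
  finally show ?thesis .
qed

text \<open>\<open>H\<close> is defined on the factorisation of an arrow, sending the lift to
  \<open>H_lift\<close> and the vertical part through \<open>PN1\<close>; \<open>fac_eq\<close> lets
  it be evaluated on any factorisation of this kind.\<close>

lemma ex_functor:
  assumes ext: "PN1 \<alpha> \<in> extensional (Obj B)" "PN2 \<alpha> \<in> extensional (Arr B)"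
  shows "\<exists>H. related U B F E p ob vert lift F' E' p' ob' vert' lift' H \<alpha>"
proof -
  have "\<exists>u. u \<in> Obj (PObj F (OMap p e)) \<and> e = ob (OMap p e) u" if "e \<in> Obj E" for e
    using P.obtain_ob[OF that] by blast
  then obtain idx where idx: "\<And>e. e \<in> Obj E \<Longrightarrow> idx e \<in> Obj (PObj F (OMap p e))"
    "\<And>e. e \<in> Obj E \<Longrightarrow> e = ob (OMap p e) (idx e)"
    by metis
  have "\<exists>\<phi>. \<phi> \<in> Arr (PObj F (Dom B (AMap p k))) \<and> Cod (PObj F (Dom B (AMap p k))) \<phi> =
    pobj F (AMap p k) (idx (Cod E k)) \<and>
      k = lift (AMap p k) (idx (Cod E k)) \<cdot>[E] vert (Dom B (AMap p k)) \<phi>" if k: "k \<in> Arr E" for k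
  proof -
    have "Cod E k \<in> Obj E" using k by simp
    note i = idx(1)[OF this] idx(2)[OF this]
    have "Cod E k = ob (Cod B (AMap p k)) (idx (Cod E k))" "idx (Cod E k) \<in> Obj (PObj F (Cod B (AMap
      p k)))"
      using k i by auto
    from P.obtain_factor[OF k refl this] show ?thesis by blast
  qed
  then obtain fac where fac: "\<And>k. k \<in> Arr E \<Longrightarrow> fac k \<in> Arr (PObj F (Dom B (AMap p k))) \<and>
      Cod (PObj F (Dom B (AMap p k))) (fac k) = pobj F (AMap p k) (idx (Cod E k)) \<and>
      k = lift (AMap p k) (idx (Cod E k)) \<cdot>[E] vert (Dom B (AMap p k)) (fac k)"
    by metis
  have idx_ob: "idx (ob x u) = u" if x: "x \<in> Obj B" and u: "u \<in> Obj (PObj F x)" for x u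
    using idx[of "ob x u"] x u P.ob_eq_iff[OF x u, of "idx (ob x u)"] by simp
  have fac_eq: "fac (lift f u \<cdot>[E] vert (Dom B f) \<phi>) = \<phi>"
    if f: "f \<in> Arr B" and u: "u \<in> Obj (PObj F (Cod B f))" and \<phi>: "\<phi> \<in> Arr (PObj F (Dom B f))"
      "Cod (PObj F (Dom B f)) \<phi> = pobj F f u" for f u \<phi>
  proof -
    let ?k = "lift f u \<cdot>[E] vert (Dom B f) \<phi>"
    have k: "?k \<in> Arr E" "AMap p ?k = f" "Cod E ?k = ob (Cod B f) u"
      "Dom E ?k = ob (Dom B f) (Dom (PObj F (Dom B f)) \<phi>)"
      using f u \<phi> by simp_all
    have i: "idx (ob (Cod B f) u) = u" using idx_ob f u by simp
    note c = fac[OF k(1), unfolded k(2,3) i]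
    \<comment> \<open>The domain of the chosen factor has to be recovered first, since
      \<open>P.lift_cancel\<close> compares arrows with equal domains.\<close>
    have "Dom E (lift f u \<cdot>[E] vert (Dom B f) (fac ?k)) = ob (Dom B f) (Dom (PObj F (Dom B f)) \<phi>)"
      using c k(4) by metis
    then have d: "Dom (PObj F (Dom B f)) (fac ?k) = Dom (PObj F (Dom B f)) \<phi>"
      using c[THEN conjunct1] c[THEN conjunct2, THEN conjunct1] f u \<phi> by (simp add: P.ob_eq_iff)
    show ?thesis
      by (rule P.lift_cancel[OF f u refl c[THEN conjunct1] c[THEN conjunct2, THEN conjunct1]
        \<phi> d c[THEN conjunct2, THEN conjunct2, symmetric]])
  qed
  define H where "H = \<lparr>OMap = (\<lambda>e\<in>Obj E. ob' (OMap p e) (nobj \<alpha> (OMap p e) (idx e))),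
    AMap = (\<lambda>k\<in>Arr E. H_lift (AMap p k) (idx (Cod E k)) \<cdot>[E'] vert' (Dom B (AMap p k)) (narr \<alpha> (Dom
      B (AMap p k)) (fac k)))\<rparr>"
  have H_ob: "OMap H (ob x u) = ob' x (nobj \<alpha> x u)" if "x \<in> Obj B" "u \<in> Obj (PObj F x)" for x u
    using that by (simp add: H_def idx_ob)
  have H_fac: "AMap H (lift f u \<cdot>[E] vert (Dom B f) \<phi>) = H_lift f u \<cdot>[E'] vert' (Dom B f) (narr \<alpha>
    (Dom B f) \<phi>)"
    if f: "f \<in> Arr B" and u: "u \<in> Obj (PObj F (Cod B f))" and \<phi>: "\<phi> \<in> Arr (PObj F (Dom B f))"
      "Cod (PObj F (Dom B f)) \<phi> = pobj F f u" for f u \<phi>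
    using that fac_eq[OF that] by (simp add: H_def idx_ob)
  have decompose: "\<exists>f u \<phi>. f \<in> Arr B \<and> u \<in> Obj (PObj F (Cod B f)) \<and> \<phi> \<in> Arr (PObj F (Dom B f)) \<and>
      Cod (PObj F (Dom B f)) \<phi> = pobj F f u \<and> k = lift f u \<cdot>[E] vert (Dom B f) \<phi>" if k: "k \<in> Arr E"
        for k
    using fac[OF k] idx(1)[of "Cod E k"] k
    by (intro exI[of _ "AMap p k"] exI[of _ "idx (Cod E k)"] exI[of _ "fac k"]) auto
  have H_ftor: "H \<in> functors E E'"
  proof -
    have "is_functor E E' H"
    proof (rule is_functorI)
      show "OMap H e \<in> Obj E'" if "e \<in> Obj E" for e
        using that idx[OF that] by (simp add: H_def)
    next
      fix k assume "k \<in> Arr E"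
      then obtain f u \<phi> where f: "f \<in> Arr B" "u \<in> Obj (PObj F (Cod B f))"
        "\<phi> \<in> Arr (PObj F (Dom B f))"
        "Cod (PObj F (Dom B f)) \<phi> = pobj F f u" and k: "k = lift f u \<cdot>[E] vert (Dom B f) \<phi>"
        using decompose by blast
      show "AMap H k \<in> Arr E'" "Dom E' (AMap H k) = OMap H (Dom E k)" "Cod E' (AMap H k) =
        OMap H (Cod E k)"
        unfolding k H_fac[OF f] using f by (simp_all add: H_ob)
    next
      fix e assume e: "e \<in> Obj E"
      define x where "x = OMap p e"
      define u where "u = idx e"
      have x: "x \<in> Obj B" and u: "u \<in> Obj (PObj F x)" and eq: "e = ob x u"
        using idx[OF e] e by (auto simp: x_def u_def)
      \<comment> \<open>An identity of \<open>E\<close> need not be a chosen lift: it factors as the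
        lift of an identity of \<open>B\<close> after the unit constraint.\<close>
      have "AMap H (Ide E e) = AMap H (lift (Ide B x) u \<cdot>[E] vert x (punit F x u))"
        using P.lift_Ide[OF x u] eq by simp
      also have "\<dots> = Ide E' (OMap H e)"
        using H_fac[of "Ide B x" u "punit F x u"] x u H_lift_Ide[OF x u] by (simp add: eq H_ob)
      finally show "AMap H (Ide E e) = Ide E' (OMap H e)" .
    next
      fix l k assume "l \<in> Arr E" "k \<in> Arr E" and c: "Dom E k = Cod E l"
      then obtain f u \<phi> g v \<psi> where f: "f \<in> Arr B" "u \<in> Obj (PObj F (Cod B f))"
        "\<phi> \<in> Arr (PObj F (Dom B f))"
        "Cod (PObj F (Dom B f)) \<phi> = pobj F f u" and k: "k = lift f u \<cdot>[E] vert (Dom B f) \<phi>"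
        and g: "g \<in> Arr B" "v \<in> Obj (PObj F (Cod B g))" "\<psi> \<in> Arr (PObj F (Dom B g))"
        "Cod (PObj F (Dom B g)) \<psi> = pobj F g v" and l: "l = lift g v \<cdot>[E] vert (Dom B g) \<psi>"
        using decompose by metis
      have "ob (Dom B f) (Dom (PObj F (Dom B f)) \<phi>) = ob (Cod B g) v"
        using c f g by (simp add: k l)
      moreover from this have "OMap p (ob (Dom B f) (Dom (PObj F (Dom B f)) \<phi>)) =
        OMap p (ob (Cod B g) v)" by simp
      then have fg: "Dom B f = Cod B g" using f g by simp
      ultimately have v: "v = Dom (PObj F (Cod B g)) \<phi>" using f g by (simp add: P.ob_eq_iff)
      let ?y = "Cod B g" and ?z = "Dom B g"
      have \<phi>: "\<phi> \<in> Arr (PObj F ?y)" "Cod (PObj F ?y) \<phi> = pobj F f u" using f fg by auto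
      have ob: "?y \<in> Obj B" "?z \<in> Obj B" "Cod B f \<in> Obj B" using f g by auto
      have Fu: "pobj F f u \<in> Obj (PObj F ?y)" using f fg by simp
      let ?\<mu> = "pcomp F g f u" and ?Z = "PObj F ?z"
      \<comment> \<open>This is the vertical part of \<open>k \<cdot>[E] l\<close>:
        \<open>\<phi>\<close> is carried past the lift of \<open>g\<close> by reindexing, and the
        two lifts are merged by the constraint \<open>?\<mu>\<close>.\<close>
      let ?\<chi> = "?\<mu> \<cdot>[?Z] parr F g \<phi> \<cdot>[?Z] \<psi>"
      have \<chi>: "?\<chi> \<in> Arr ?Z" "Cod ?Z ?\<chi> = pobj F (f \<cdot>[B] g) u"
        using f(1,2) g fg \<phi> v by simp_all
      have "k \<cdot>[E] l = lift f u \<cdot>[E] (vert ?y \<phi> \<cdot>[E] lift g v) \<cdot>[E] vert ?z \<psi>"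
        unfolding k l using f(1,2) g fg \<phi> v by simp
      also have "\<dots> = lift f u \<cdot>[E] (lift g (pobj F f u) \<cdot>[E] vert ?z (parr F g \<phi>)) \<cdot>[E] vert ?z \<psi>"
        using P.lift_natural[OF g(1) \<phi>(1)] \<phi>(2) v by simp
      also have "\<dots> = (lift f u \<cdot>[E] lift g (pobj F f u)) \<cdot>[E] vert ?z (parr F g \<phi>) \<cdot>[E] vert ?z \<psi>"
        using f(1,2) g fg \<phi> v Fu ob by simp
      also have "\<dots> = (lift (f \<cdot>[B] g) u \<cdot>[E] vert ?z ?\<mu>) \<cdot>[E] vert ?z (parr F g \<phi>) \<cdot>[E] vert ?z \<psi>"
        using P.lift_Comp[OF f(1) g(1) fg f(2)] by simp
      also have "\<dots> = lift (f \<cdot>[B] g) u \<cdot>[E] vert ?z ?\<chi>"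
        using f(1,2) g fg \<phi> v Fu ob by (simp add: P.vert_Comp)
      finally have "AMap H (k \<cdot>[E] l) = AMap H (lift (f \<cdot>[B] g) u \<cdot>[E] vert ?z ?\<chi>)" by simp
      also have "\<dots> = H_lift (f \<cdot>[B] g) u \<cdot>[E'] vert' ?z (narr \<alpha> ?z ?\<chi>)"
        using H_fac[of "f \<cdot>[B] g" u ?\<chi>] f(1,2) g(1) fg \<chi> by simp
      also have "\<dots> = (H_lift (f \<cdot>[B] g) u \<cdot>[E'] vert' ?z (narr \<alpha> ?z ?\<mu>)) \<cdot>[E']
          vert' ?z (narr \<alpha> ?z (parr F g \<phi>)) \<cdot>[E'] vert' ?z (narr \<alpha> ?z \<psi>)"
        using f(1,2) g fg \<phi> v Fu ob by (simp add: Q.vert_Comp T.PN1_Comp)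
      also have "\<dots> = (H_lift f u \<cdot>[E'] H_lift g (pobj F f u)) \<cdot>[E']
          vert' ?z (narr \<alpha> ?z (parr F g \<phi>)) \<cdot>[E'] vert' ?z (narr \<alpha> ?z \<psi>)"
        using H_lift_Comp[OF f(1) g(1) fg f(2)] by simp
      also have "\<dots> = H_lift f u \<cdot>[E'] (H_lift g (pobj F f u) \<cdot>[E']
          vert' ?z (narr \<alpha> ?z (parr F g \<phi>))) \<cdot>[E'] vert' ?z (narr \<alpha> ?z \<psi>)"
        using f(1,2) g fg \<phi> v Fu ob by simp
      also have "\<dots> = H_lift f u \<cdot>[E'] (vert' ?y (narr \<alpha> ?y \<phi>) \<cdot>[E'] H_lift g v) \<cdot>[E']
        vert' ?z (narr \<alpha> ?z \<psi>)"
        using H_lift_natural[OF g(1) \<phi>(1)] \<phi>(2) v by simp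
      also have "\<dots> = (H_lift f u \<cdot>[E'] vert' ?y (narr \<alpha> ?y \<phi>)) \<cdot>[E'] H_lift g v \<cdot>[E']
        vert' ?z (narr \<alpha> ?z \<psi>)"
        using f(1,2) g fg \<phi> v Fu ob by simp
      also have "\<dots> = AMap H k \<cdot>[E'] AMap H l"
        unfolding k l H_fac[OF f] H_fac[OF g] by (simp add: fg)
      finally show "AMap H (k \<cdot>[E] l) = AMap H k \<cdot>[E'] AMap H l" .
    qed simp_all
    then show ?thesis by (simp add: functors_def H_def)
  qed
  have over: "cartesian_over E E' B p p' H"
    unfolding cartesian_over_def preserves_cartesian_def
  proof (intro conjI ballI allI impI)
    show "OMap p' (OMap H e) = OMap p e" if "e \<in> Obj E" for e
      using that idx[OF that] by (simp add: H_def)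
    show "AMap p' (AMap H k) = AMap p k" if kE: "k \<in> Arr E" for k
    proof -
      obtain f u \<phi> where f: "f \<in> Arr B" "u \<in> Obj (PObj F (Cod B f))" "\<phi> \<in> Arr (PObj F (Dom B f))"
        "Cod (PObj F (Dom B f)) \<phi> = pobj F f u" and k: "k = lift f u \<cdot>[E] vert (Dom B f) \<phi>"
        using decompose[OF kE] by blast
      show ?thesis unfolding k H_fac[OF f] using f by simp
    qed
    fix k assume c: "cartesian E B p k"
    obtain f u \<phi> where f: "f \<in> Arr B" "u \<in> Obj (PObj F (Cod B f))" "\<phi> \<in> Arr (PObj F (Dom B f))"
        "Cod (PObj F (Dom B f)) \<phi> = pobj F f u" and k: "k = lift f u \<cdot>[E] vert (Dom B f) \<phi>"
      using decompose[OF cartesian_Arr[OF c]] by blast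
    have ob: "Dom B f \<in> Obj B" using f by simp
    \<comment> \<open>The vertical part of a cartesian arrow is invertible, functors preserve
      isomorphisms, and a cartesian arrow stays cartesian after composition with one.\<close>
    have "is_iso E (vert (Dom B f) \<phi>)"
      by (rule cartesian_factor_is_iso[OF P.p_is_functor P.lift_cartesian[OF f(1,2)]
        _ _ _ c[unfolded k]])
        (use f in simp_all)
    then have "is_iso E' (vert' (Dom B f) (narr \<alpha> (Dom B f) \<phi>))"
      using f ob functor_is_iso[OF T.PN1_functor[OF ob], of \<phi>]
        by (simp add: P.vert_is_iso Q.vert_is_iso)
    then show "cartesian E' B p' (AMap H k)"
      unfolding k H_fac[OF f] using f by (intro cartesian_comp_iso[OF Q.p_is_functor
        H_lift_cartesian]) simp_all
  qed
  have data: "psnat_data B F F' \<alpha>"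
    unfolding psnat_data_def using ext T.PN1_functor T.PN2_Dom T.PN2_Cod ntransesD(3)[OF
      T.PN2_ntrans] by simp
  have compat: "compat H \<alpha>"
    unfolding compat_def
  proof (intro conjI ballI)
    show "OMap H (ob x u) = ob' x (nobj \<alpha> x u)" if "x \<in> Obj B" "u \<in> Obj (PObj F x)" for x u
      using H_ob that .
    show "AMap H (vert x \<phi>) = vert' x (narr \<alpha> x \<phi>)" if x: "x \<in> Obj B" and \<phi>: "\<phi> \<in> Arr (PObj F x)"
      for x \<phi>
    proof -
      let ?v = "Cod (PObj F x) \<phi>" and ?i = "Ide B x"
      have v: "?v \<in> Obj (PObj F x)" using x \<phi> by simp
      \<comment> \<open>The factorisation of a vertical arrow also contains a lift, that of the
        identity of \<open>x\<close>; the unit constraint compensates for it.\<close>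
      have "lift ?i ?v \<cdot>[E] vert x (punit F x ?v \<cdot>[PObj F x] \<phi>) =
        (lift ?i ?v \<cdot>[E] vert x (punit F x ?v)) \<cdot>[E] vert x \<phi>"
        using x \<phi> v by (simp add: P.vert_Comp)
      also have "\<dots> = vert x \<phi>" using P.lift_Ide[OF x v] x \<phi> by simp
      finally have "AMap H (vert x \<phi>) = AMap H (lift ?i ?v \<cdot>[E] vert x (punit F x ?v \<cdot>[PObj F x]
        \<phi>))" by simp
      also have "\<dots> = (H_lift ?i ?v \<cdot>[E'] vert' x (narr \<alpha> x (punit F x ?v))) \<cdot>[E'] vert' x (narr \<alpha> x
        \<phi>)"
        using H_fac[of ?i ?v "punit F x ?v \<cdot>[PObj F x] \<phi>"] x \<phi> v
          by (simp add: T.PN1_Comp Q.vert_Comp)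
      also have "\<dots> = vert' x (narr \<alpha> x \<phi>)"
        using H_lift_Ide[OF x v] x \<phi> by simp
      finally show ?thesis .
    qed
    show "AMap H (lift f u) \<cdot>[E'] vert' (Dom B f) (ncell \<alpha> f u) = lift' f (nobj \<alpha> (Cod B f) u)"
      if f: "f \<in> Arr B" and u: "u \<in> Obj (PObj F (Cod B f))" for f u
      using H_fac[of f u "Ide (PObj F (Dom B f)) (pobj F f u)"] f u H_lift_PN2[OF f u]
      by (simp add: P.vert_Ide Q.vert_Ide)
  qed
  show ?thesis
    by (intro exI[of _ H] related.intro cartesian_functor.intro cartesian_functor_axioms.intro
      related_axioms.intro
        presentation_pair_axioms H_ftor over compat data)
qed

end

section \<open>2-cells over \<open>B\<close> and modifications\<close>

locale related_cells = presentation_pair U B F E p ob vert lift F' E' p' ob' vert' lift' +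
  D: related U B F E p ob vert lift F' E' p' ob' vert' lift' "NDom \<theta>" "MDom \<Gamma>" +
  C: related U B F E p ob vert lift F' E' p' ob' vert' lift' "NCod \<theta>" "MCod \<Gamma>"
  for U :: "'u set set" and B F E p ob vert lift F' E' p' ob' vert' lift' \<theta> \<Gamma> +
  assumes \<theta>: "\<theta> \<in> ntranses E E'" and \<Gamma>: "modif_data B F F' \<Gamma>"
    and \<theta>_ob: "x \<in> Obj B \<Longrightarrow> u \<in> Obj (PObj F x) \<Longrightarrow> NMap \<theta> (ob x u) = vert' x (mcell \<Gamma> x u)"
begin

lemma MMap_ntrans: "x \<in> Obj B \<Longrightarrow> MMap \<Gamma> x \<in> ntranses (PObj F x) (PObj F' x)"
  and MMap_Dom: "x \<in> Obj B \<Longrightarrow> NDom (MMap \<Gamma> x) = PN1 (MDom \<Gamma>) x"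
  and MMap_Cod: "x \<in> Obj B \<Longrightarrow> NCod (MMap \<Gamma> x) = PN1 (MCod \<Gamma>) x"
  using \<Gamma> by (auto simp: modif_data_def)

lemma
  assumes "x \<in> Obj B" "u \<in> Obj (PObj F x)"
  shows MMap_Arr [simp]: "mcell \<Gamma> x u \<in> Arr (PObj F' x)"
    and Dom_MMap [simp]: "Dom (PObj F' x) (mcell \<Gamma> x u) = nobj (MDom \<Gamma>) x u"
    and Cod_MMap [simp]: "Cod (PObj F' x) (mcell \<Gamma> x u) = nobj (MCod \<Gamma>) x u"
  using ntransesD(4-6)[OF MMap_ntrans[OF assms(1)] assms(2)] assms(1)
    by (auto simp: MMap_Dom MMap_Cod)

text \<open>Naturality of \<open>\<theta>\<close> at a chosen lift becomes the modification equation
  after the image of that lift under the codomain functor is cancelled.\<close>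

lemma in_modifications: "\<Gamma> \<in> modifications (op_cat B) (Cat U) F F'"
  unfolding modifications_iff[OF P.category_B]
proof (intro conjI D.in_pseudonaturals C.in_pseudonaturals \<Gamma> ballI)
  fix f u assume f: "f \<in> Arr B" and u: "u \<in> Obj (PObj F (Cod B f))"
  let ?x = "Cod B f" and ?y = "Dom B f" and ?H = "NDom \<theta>" and ?K = "NCod \<theta>"
  let ?\<alpha> = "MDom \<Gamma>" and ?\<beta> = "MCod \<Gamma>" and ?v = "pobj F f u"
  have ob: "?x \<in> Obj B" "?y \<in> Obj B" using f by auto
  have v: "?v \<in> Obj (PObj F ?y)" using f u by simp
  have "AMap ?K (lift f u) \<cdot>[E'] vert' ?y (ncell ?\<beta> f u \<cdot>[PObj F' ?y] parr F' f (mcell \<Gamma> ?x u)) =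
    (AMap ?K (lift f u) \<cdot>[E'] vert' ?y (ncell ?\<beta> f u)) \<cdot>[E'] vert' ?y (parr F' f (mcell \<Gamma> ?x u))"
    using f u ob by (simp add: Q.vert_Comp)
  also have "\<dots> = vert' ?x (mcell \<Gamma> ?x u) \<cdot>[E'] lift' f (nobj ?\<alpha> ?x u)"
    using C.H_lift[OF f u] Q.lift_natural[OF f, of "mcell \<Gamma> ?x u"] u ob by simp
  also have "\<dots> = vert' ?x (mcell \<Gamma> ?x u) \<cdot>[E'] AMap ?H (lift f u) \<cdot>[E'] vert' ?y (ncell ?\<alpha> f u)"
    using D.H_lift[OF f u] by simp
  also have "\<dots> = (NMap \<theta> (ob ?x u) \<cdot>[E'] AMap ?H (lift f u)) \<cdot>[E'] vert' ?y (ncell ?\<alpha> f u)"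
    using f u ob by (simp add: \<theta>_ob)
  also have "\<dots> = (AMap ?K (lift f u) \<cdot>[E'] NMap \<theta> (ob ?y ?v)) \<cdot>[E'] vert' ?y (ncell ?\<alpha> f u)"
    using ntransesD(7)[OF \<theta>, of "lift f u"] f u by simp
  also have "\<dots> = AMap ?K (lift f u) \<cdot>[E'] vert' ?y (mcell \<Gamma> ?y ?v \<cdot>[PObj F' ?y] ncell ?\<alpha> f u)"
    using f u v ob by (simp add: \<theta>_ob Q.vert_Comp)
  finally have eq: "AMap ?K (lift f u) \<cdot>[E'] vert' ?y (ncell ?\<beta> f u \<cdot>[PObj F' ?y] parr F' f (mcell \<Gamma>
    ?x u)) =
    AMap ?K (lift f u) \<cdot>[E'] vert' ?y (mcell \<Gamma> ?y ?v \<cdot>[PObj F' ?y] ncell ?\<alpha> f u)" .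
  show "ncell ?\<beta> f u \<cdot>[PObj F' ?y] parr F' f (mcell \<Gamma> ?x u) =
      mcell \<Gamma> ?y ?v \<cdot>[PObj F' ?y] ncell ?\<alpha> f u"
    by (rule C.H_lift_cancel[OF f u refl _ _ _ _ _ eq]) (use f u v ob in simp_all)
qed

lemma \<theta>_over: "e \<in> Obj E \<Longrightarrow> AMap p' (NMap \<theta> e) = Ide B (OMap p e)"
proof -
  assume e: "e \<in> Obj E"
  obtain u where u: "u \<in> Obj (PObj F (OMap p e))" "e = ob (OMap p e) u" using P.obtain_ob[OF e] .
  have "AMap p' (NMap \<theta> (ob (OMap p e) u)) = Ide B (OMap p e)" using e u(1) by (simp add: \<theta>_ob)
  then show ?thesis using u(2) by simp
qed

end

context presentation_pair
begin

lemma Fib_objects: "(E, p) \<in> Cell0 (Fib U B)" "(E', p') \<in> Cell0 (Fib U B)"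
  using P.small_E P.p_functor P.fibration Q.small_E Q.p_functor Q.fibration
    by (simp_all add: Fib_Cell0)

text \<open>The components of \<open>\<theta>\<close> are vertical, so \<open>vert'\<close>
  identifies them with arrows of the values of \<open>F'\<close>; naturality of
  \<open>\<theta>\<close> at vertical arrows makes these natural over each \<open>x\<close>.\<close>

lemma ex_modification:
  assumes t: "\<theta> \<in> Cell2 (Fib U B) (E, p) (E', p')"
  shows "\<exists>\<Gamma>. related_cells U B F E p ob vert lift F' E' p' ob' vert' lift' \<theta> \<Gamma>"
proof -
  have \<theta>: "\<theta> \<in> ntranses E E'" and over: "cartesian_over E E' B p p' (NDom \<theta>)"
    "cartesian_over E E' B p p' (NCod \<theta>)"
    and pt: "\<And>e. e \<in> Obj E \<Longrightarrow> AMap p' (NMap \<theta> e) = Ide B (OMap p e)"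
    using t by (auto simp: Fib_Cell2[OF Fib_objects])
  note T = ntransesD[OF \<theta>]
  interpret D: cartesian_functor U B F E p ob vert lift F' E' p' ob' vert' lift' "NDom \<theta>"
    using T over by unfold_locales
  interpret C: cartesian_functor U B F E p ob vert lift F' E' p' ob' vert' lift' "NCod \<theta>"
    using T over by unfold_locales
  obtain \<alpha> where a: "psnat_data B F F' \<alpha>" "compat (NDom \<theta>) \<alpha>" using D.ex_transformation by blast
  obtain \<beta> where b: "psnat_data B F F' \<beta>" "compat (NCod \<theta>) \<beta>" using C.ex_transformation by blast
  interpret DR: related U B F E p ob vert lift F' E' p' ob' vert' lift' "NDom \<theta>" \<alpha> using a
    by unfold_locales
  interpret CR: related U B F E p ob vert lift F' E' p' ob' vert' lift' "NCod \<theta>" \<beta> using b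
    by unfold_locales
  have "\<exists>\<psi>. \<psi> \<in> Arr (PObj F' x) \<and> NMap \<theta> (ob x u) = vert' x \<psi>" if "x \<in> Obj B" "u \<in> Obj (PObj F x)"
    for x u
    using Q.obtain_vert[of x "NMap \<theta> (ob x u)"] that T(4)[of "ob x u"] pt[of "ob x u"] by auto
  then obtain n where n: "\<And>x u. x \<in> Obj B \<Longrightarrow> u \<in> Obj (PObj F x) \<Longrightarrow> n x u \<in> Arr (PObj F' x)"
    "\<And>x u. x \<in> Obj B \<Longrightarrow> u \<in> Obj (PObj F x) \<Longrightarrow> NMap \<theta> (ob x u) = vert' x (n x u)"
    by metis
  have nd: "Dom (PObj F' x) (n x u) = nobj \<alpha> x u \<and> Cod (PObj F' x) (n x u) = nobj \<beta> x u"
    if x: "x \<in> Obj B" and u: "u \<in> Obj (PObj F x)" for x u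
  proof -
    have "ob' x (Dom (PObj F' x) (n x u)) = ob' x (nobj \<alpha> x u)" "ob' x (Cod (PObj F' x) (n x u)) =
      ob' x (nobj \<beta> x u)"
      using T(5,6)[of "ob x u"] n[OF x u] x u by simp_all
    then show ?thesis using n(1)[OF x u] x u by (simp add: Q.ob_eq_iff)
  qed
  define \<Gamma> where "\<Gamma> = \<lparr>MDom = \<alpha>, MCod = \<beta>,
    MMap = (\<lambda>x\<in>Obj B. \<lparr>NDom = PN1 \<alpha> x, NCod = PN1 \<beta> x, NMap = (\<lambda>u\<in>Obj (PObj F x). n x u)\<rparr>)\<rparr>"
  have M: "MMap \<Gamma> x \<in> ntranses (PObj F x) (PObj F' x)" if x: "x \<in> Obj B" for x
  proof (rule ntransesI)
    fix \<phi> assume \<phi>: "\<phi> \<in> Arr (PObj F x)"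
    let ?u = "Dom (PObj F x) \<phi>" and ?v = "Cod (PObj F x) \<phi>"
    have uv: "?u \<in> Obj (PObj F x)" "?v \<in> Obj (PObj F x)" using x \<phi> by auto
    have "vert' x (n x ?v \<cdot>[PObj F' x] narr \<alpha> x \<phi>) = NMap \<theta> (ob x ?v) \<cdot>[E'] AMap (NDom \<theta>) (vert x
      \<phi>)"
      using x \<phi> uv n nd by (simp add: Q.vert_Comp)
    also have "\<dots> = AMap (NCod \<theta>) (vert x \<phi>) \<cdot>[E'] NMap \<theta> (ob x ?u)"
      using T(7)[of "vert x \<phi>"] x \<phi> by simp
    also have "\<dots> = vert' x (narr \<beta> x \<phi> \<cdot>[PObj F' x] n x ?u)"
      using x \<phi> uv n nd by (simp add: Q.vert_Comp)
    finally have "n x ?v \<cdot>[PObj F' x] narr \<alpha> x \<phi> = narr \<beta> x \<phi> \<cdot>[PObj F' x] n x ?u"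
      using x \<phi> uv n(1) nd by (simp add: Q.vert_eq_iff)
    then show "mcell \<Gamma> x ?v \<cdot>[PObj F' x] AMap (NDom (MMap \<Gamma> x)) \<phi> = AMap (NCod (MMap \<Gamma> x)) \<phi> \<cdot>[PObj
      F' x] mcell \<Gamma> x ?u"
      using x uv by (simp add: \<Gamma>_def)
  qed (use x n nd DR.PN1_functor CR.PN1_functor in \<open>simp_all add: \<Gamma>_def\<close>)
  have "modif_data B F F' \<Gamma>" using M by (simp add: modif_data_def) (simp add: \<Gamma>_def)
  moreover have "NMap \<theta> (ob x u) = vert' x (mcell \<Gamma> x u)" if "x \<in> Obj B" "u \<in> Obj (PObj F x)"
    for x u
    using n(2)[OF that] that by (simp add: \<Gamma>_def)
  moreover have "MDom \<Gamma> = \<alpha>" "MCod \<Gamma> = \<beta>" by (simp_all add: \<Gamma>_def)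
  ultimately show ?thesis
    using DR.related_axioms CR.related_axioms presentation_pair_axioms \<theta>
    by (intro exI[of _ \<Gamma>] related_cells.intro related_cells_axioms.intro) simp_all
qed

lemma ex_related_functor:
  assumes "\<alpha> \<in> pseudonaturals (op_cat B) (Cat U) F F'"
  shows "\<exists>H. related U B F E p ob vert lift F' E' p' ob' vert' lift' H \<alpha>"
proof -
  have "indexed_transformation U B F F' \<alpha>"
    using assms by (simp add: pseudonaturals_def pseudonatural_iff)
  then interpret transformation_of_presentations U B F E p ob vert lift F' E' p' ob' vert' lift' \<alpha>
    by (intro transformation_of_presentations.intro presentation_pair_axioms)
  show ?thesis using ex_functor assms by (simp add: pseudonaturals_def)
qed

text \<open>Naturality is checked on the two factors of an arrow: on the lift it is the modification
  equation, on the vertical part it is naturality of the components of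
  \<open>\<Gamma>\<close>.\<close>

lemma ex_2_cell:
  assumes G: "\<Gamma> \<in> modifications (op_cat B) (Cat U) F F'"
  shows "\<exists>\<theta>. related_cells U B F E p ob vert lift F' E' p' ob' vert' lift' \<theta> \<Gamma>"
proof -
  note G' = G[unfolded modifications_iff[OF P.category_B]]
  obtain H where H: "related U B F E p ob vert lift F' E' p' ob' vert' lift' H (MDom \<Gamma>)"
    using ex_related_functor G' by blast
  obtain K where K: "related U B F E p ob vert lift F' E' p' ob' vert' lift' K (MCod \<Gamma>)"
    using ex_related_functor G' by blast
  interpret D: related U B F E p ob vert lift F' E' p' ob' vert' lift' H "MDom \<Gamma>" by fact
  interpret C: related U B F E p ob vert lift F' E' p' ob' vert' lift' K "MCod \<Gamma>" by fact
  interpret DT: indexed_transformation U B F F' "MDom \<Gamma>" by (rule D.indexed_transformation)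
  have M: "modif_data B F F' \<Gamma>" using G' by simp
  have MM: "MMap \<Gamma> x \<in> ntranses (PObj F x) (PObj F' x)" "NDom (MMap \<Gamma> x) = PN1 (MDom \<Gamma>) x"
    "NCod (MMap \<Gamma> x) = PN1 (MCod \<Gamma>) x"
    if "x \<in> Obj B" for x using M that by (auto simp: modif_data_def)
  have m[simp]: "mcell \<Gamma> x u \<in> Arr (PObj F' x)" "Dom (PObj F' x) (mcell \<Gamma> x u) = nobj (MDom \<Gamma>) x u"
    "Cod (PObj F' x) (mcell \<Gamma> x u) = nobj (MCod \<Gamma>) x u"
    if "x \<in> Obj B" "u \<in> Obj (PObj F x)" for x u
    using ntransesD(4-6)[OF MM(1)[OF that(1)] that(2)] MM[OF that(1)] by auto
  have "\<exists>u. u \<in> Obj (PObj F (OMap p e)) \<and> e = ob (OMap p e) u" if "e \<in> Obj E" for e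
    using P.obtain_ob[OF that] by blast
  then obtain idx where idx: "\<And>e. e \<in> Obj E \<Longrightarrow> idx e \<in> Obj (PObj F (OMap p e))"
    "\<And>e. e \<in> Obj E \<Longrightarrow> e = ob (OMap p e) (idx e)"
    by metis
  have idx_ob: "idx (ob x u) = u" if x: "x \<in> Obj B" and u: "u \<in> Obj (PObj F x)" for x u
    using idx[of "ob x u"] x u P.ob_eq_iff[OF x u, of "idx (ob x u)"] by simp
  define \<theta> where "\<theta> = \<lparr>NDom = H, NCod = K, NMap = (\<lambda>e\<in>Obj E. vert' (OMap p e) (mcell \<Gamma> (OMap p e)
    (idx e)))\<rparr>"
  have \<theta>_ob: "NMap \<theta> (ob x u) = vert' x (mcell \<Gamma> x u)" if "x \<in> Obj B" "u \<in> Obj (PObj F x)" for x u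
    using that by (simp add: \<theta>_def idx_ob)
  have \<theta>: "\<theta> \<in> ntranses E E'"
  proof (rule ntransesI)
    show "NDom \<theta> \<in> functors E E'" "NCod \<theta> \<in> functors E E'" "NMap \<theta> \<in> extensional (Obj E)"
      using D.H C.H by (simp_all add: \<theta>_def)
    show "NMap \<theta> e \<in> Arr E'" "Dom E' (NMap \<theta> e) = OMap (NDom \<theta>) e" "Cod E' (NMap \<theta> e) =
      OMap (NCod \<theta>) e"
      if e: "e \<in> Obj E" for e
    proof -
      have x: "OMap p e \<in> Obj B" using e by simp
      have "NMap \<theta> (ob (OMap p e) (idx e)) \<in> Arr E' \<and>
        Dom E' (NMap \<theta> (ob (OMap p e) (idx e))) = OMap (NDom \<theta>) (ob (OMap p e) (idx e)) \<and>
        Cod E' (NMap \<theta> (ob (OMap p e) (idx e))) = OMap (NCod \<theta>) (ob (OMap p e) (idx e))"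
        using x idx(1)[OF e] by (simp add: \<theta>_ob) (simp add: \<theta>_def)
      then show "NMap \<theta> e \<in> Arr E'" "Dom E' (NMap \<theta> e) = OMap (NDom \<theta>) e" "Cod E' (NMap \<theta> e) =
        OMap (NCod \<theta>) e"
        using idx(2)[OF e] by simp_all
    qed
    fix k assume k: "k \<in> Arr E"
    define f where "f = AMap p k"
    have f: "f \<in> Arr B" and pc: "OMap p (Cod E k) = Cod B f" using k by (simp_all add: f_def)
    obtain u where u: "u \<in> Obj (PObj F (Cod B f))" "Cod E k = ob (Cod B f) u"
      using P.obtain_ob[of "Cod E k"] k pc by auto
    obtain \<phi> where \<phi>: "\<phi> \<in> Arr (PObj F (Dom B f))" "Cod (PObj F (Dom B f)) \<phi> = pobj F f u"
      "k = lift f u \<cdot>[E] vert (Dom B f) \<phi>"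
      using P.obtain_factor[OF k f_def[symmetric] u(2,1)] .
    let ?x = "Cod B f" and ?y = "Dom B f" and ?v = "pobj F f u" and ?w = "Dom (PObj F (Dom B f)) \<phi>"
    have ob: "?x \<in> Obj B" "?y \<in> Obj B" using f by auto
    have v: "?v \<in> Obj (PObj F ?y)" "?w \<in> Obj (PObj F ?y)" using f u(1) \<phi> ob by auto
    \<comment> \<open>Tested after composition with the invertible
      \<open>ncell (MDom \<Gamma>) f u\<close>, where images of lifts turn into chosen lifts of
      \<open>E'\<close> and the modification equation applies.\<close>
    have 1: "vert' ?x (mcell \<Gamma> ?x u) \<cdot>[E'] AMap H (lift f u) = AMap K (lift f u) \<cdot>[E']
      vert' ?y (mcell \<Gamma> ?y ?v)"
    proof (rule iso_cancel_right[where a = "vert' ?y (ncell (MDom \<Gamma>) f u)" and C = E'])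
      have "(vert' ?x (mcell \<Gamma> ?x u) \<cdot>[E'] AMap H (lift f u)) \<cdot>[E'] vert' ?y (ncell (MDom \<Gamma>) f u) =
        vert' ?x (mcell \<Gamma> ?x u) \<cdot>[E'] lift' f (nobj (MDom \<Gamma>) ?x u)"
        using f u(1) ob by (simp add: D.H_lift)
      also have "\<dots> = (AMap K (lift f u) \<cdot>[E'] vert' ?y (ncell (MCod \<Gamma>) f u)) \<cdot>[E'] vert' ?y (parr F'
        f (mcell \<Gamma> ?x u))"
        using C.H_lift[OF f u(1)] Q.lift_natural[OF f, of "mcell \<Gamma> ?x u"] u(1) ob by simp
      also have "\<dots> = AMap K (lift f u) \<cdot>[E'] vert' ?y (ncell (MCod \<Gamma>) f u \<cdot>[PObj F' ?y]
        parr F' f (mcell \<Gamma> ?x u))"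
        using f u(1) ob by (simp add: Q.vert_Comp)
      also have "\<dots> = AMap K (lift f u) \<cdot>[E'] vert' ?y (mcell \<Gamma> ?y ?v \<cdot>[PObj F' ?y] ncell (MDom \<Gamma>) f
        u)"
        using G' f u(1) by simp
      also have "\<dots> = (AMap K (lift f u) \<cdot>[E'] vert' ?y (mcell \<Gamma> ?y ?v)) \<cdot>[E'] vert' ?y (ncell (MDom
        \<Gamma>) f u)"
        using f u(1) v ob by (simp add: Q.vert_Comp)
      finally show "(vert' ?x (mcell \<Gamma> ?x u) \<cdot>[E'] AMap H (lift f u)) \<cdot>[E'] vert' ?y (ncell (MDom \<Gamma>)
        f u) =
        (AMap K (lift f u) \<cdot>[E'] vert' ?y (mcell \<Gamma> ?y ?v)) \<cdot>[E'] vert' ?y (ncell (MDom \<Gamma>) f u)" .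
    qed (use f u(1) v ob DT.PN2_is_iso[OF f u(1)] in \<open>simp_all add: Q.vert_is_iso\<close>)
    have "mcell \<Gamma> ?y ?v \<cdot>[PObj F' ?y] narr (MDom \<Gamma>) ?y \<phi> = narr (MCod \<Gamma>) ?y \<phi> \<cdot>[PObj F' ?y]
      mcell \<Gamma> ?y ?w"
      using ntransesD(7)[OF MM(1)[OF ob(2)] \<phi>(1)] MM(2,3)[OF ob(2)] \<phi>(2) by simp
    then have 2: "vert' ?y (mcell \<Gamma> ?y ?v) \<cdot>[E'] vert' ?y (narr (MDom \<Gamma>) ?y \<phi>) =
      vert' ?y (narr (MCod \<Gamma>) ?y \<phi>) \<cdot>[E'] vert' ?y (mcell \<Gamma> ?y ?w)"
      using Q.vert_Comp[OF ob(2), of "narr (MDom \<Gamma>) ?y \<phi>" "mcell \<Gamma> ?y ?v"]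
        Q.vert_Comp[OF ob(2), of "mcell \<Gamma> ?y ?w" "narr (MCod \<Gamma>) ?y \<phi>"] ob v \<phi>(1,2) by simp
    have "vert' ?x (mcell \<Gamma> ?x u) \<cdot>[E'] AMap H k = (vert' ?x (mcell \<Gamma> ?x u) \<cdot>[E'] AMap H (lift f u))
      \<cdot>[E'] vert' ?y (narr (MDom \<Gamma>) ?y \<phi>)"
      unfolding \<phi>(3) using f u(1) ob v \<phi>(1,2) by (simp add: D.H_Comp)
    also have "\<dots> = AMap K (lift f u) \<cdot>[E'] vert' ?y (mcell \<Gamma> ?y ?v) \<cdot>[E'] vert' ?y (narr (MDom \<Gamma>) ?y
      \<phi>)"
      unfolding 1 using f u(1) ob v \<phi>(1,2) by simp
    also have "\<dots> = AMap K k \<cdot>[E'] vert' ?y (mcell \<Gamma> ?y ?w)"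
      unfolding 2 \<phi>(3) using f u(1) ob v \<phi>(1,2) by (simp add: C.H_Comp)
    finally have "NMap \<theta> (ob ?x u) \<cdot>[E'] AMap H k = AMap K k \<cdot>[E'] NMap \<theta> (ob ?y ?w)"
      using \<theta>_ob ob u(1) v by simp
    moreover have "Dom E k = ob ?y ?w" unfolding \<phi>(3) using f u(1) \<phi>(1,2) by simp
    ultimately show "NMap \<theta> (Cod E k) \<cdot>[E'] AMap (NDom \<theta>) k = AMap (NCod \<theta>) k \<cdot>[E']
      NMap \<theta> (Dom E k)"
      using u(2) by (simp add: \<theta>_def)
  qed
  show ?thesis
    using H K \<theta> \<theta>_ob M presentation_pair_axioms
    by (intro exI[of _ \<theta>] related_cells.intro related_cells_axioms.intro) (simp_all add: \<theta>_def)
qed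

lemma modification_unique:
  assumes 1: "related_cells U B F E p ob vert lift F' E' p' ob' vert' lift' \<theta> \<Gamma>"
    and 2: "related_cells U B F E p ob vert lift F' E' p' ob' vert' lift' \<theta> \<Delta>"
  shows "\<Gamma> = \<Delta>"
proof -
  interpret r1: related_cells U B F E p ob vert lift F' E' p' ob' vert' lift' \<theta> \<Gamma> by fact
  interpret r2: related_cells U B F E p ob vert lift F' E' p' ob' vert' lift' \<theta> \<Delta> by fact
  have e: "MDom \<Gamma> = MDom \<Delta>" "MCod \<Gamma> = MCod \<Delta>"
    using transformation_unique r1.D.related_axioms r2.D.related_axioms r1.C.related_axioms
      r2.C.related_axioms by blast+
  have "MMap \<Gamma> x = MMap \<Delta> x" if x: "x \<in> Obj B" for x
  proof (rule ntrans_eqI[where X = "Obj (PObj F x)"])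
    show "mcell \<Gamma> x u = mcell \<Delta> x u" if u: "u \<in> Obj (PObj F x)" for u
      using r1.\<theta>_ob[OF x u] r2.\<theta>_ob[OF x u] Q.vert_eq_iff[OF x r1.MMap_Arr[OF x u] r2.MMap_Arr[OF x
        u]] by simp
  qed (use x e ntransesD(3)[OF r1.MMap_ntrans] ntransesD(3)[OF r2.MMap_ntrans] in
      \<open>simp_all add: r1.MMap_Dom r2.MMap_Dom r1.MMap_Cod r2.MMap_Cod\<close>)
  then have "MMap \<Gamma> = MMap \<Delta>"
    using r1.\<Gamma> r2.\<Gamma> by (auto simp: modif_data_def intro: extensionalityI)
  then show ?thesis using e by simp
qed

lemma two_cell_unique:
  assumes 1: "related_cells U B F E p ob vert lift F' E' p' ob' vert' lift' \<theta> \<Gamma>"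
    and 2: "related_cells U B F E p ob vert lift F' E' p' ob' vert' lift' \<theta>' \<Gamma>"
  shows "\<theta> = \<theta>'"
proof -
  interpret r1: related_cells U B F E p ob vert lift F' E' p' ob' vert' lift' \<theta> \<Gamma> by fact
  interpret r2: related_cells U B F E p ob vert lift F' E' p' ob' vert' lift' \<theta>' \<Gamma> by fact
  show ?thesis
  proof (rule ntrans_eqI[where X = "Obj E"])
    show "NDom \<theta> = NDom \<theta>'" "NCod \<theta> = NCod \<theta>'"
      using functor_unique r1.D.related_axioms r2.D.related_axioms r1.C.related_axioms
        r2.C.related_axioms by blast+
    fix e assume e: "e \<in> Obj E"
    obtain u where u: "u \<in> Obj (PObj F (OMap p e))" "e = ob (OMap p e) u" using P.obtain_ob[OF e] .
    have "OMap p e \<in> Obj B" using e by simp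
    then have "NMap \<theta> (ob (OMap p e) u) = NMap \<theta>' (ob (OMap p e) u)"
      using u(1) by (simp add: r1.\<theta>_ob r2.\<theta>_ob)
    then show "NMap \<theta> e = NMap \<theta>' e" using u(2) by simp
  qed (use ntransesD(3)[OF r1.\<theta>] ntransesD(3)[OF r2.\<theta>] in simp_all)
qed

section \<open>The relations respect identities and all compositions\<close>

lemma related_cells_Ide:
  assumes "related U B F E p ob vert lift F' E' p' ob' vert' lift' H \<alpha>"
  shows "related_cells U B F E p ob vert lift F' E' p' ob' vert' lift'
    (Ide (functor_cat E E') H) (Ide (Psd_hom (op_cat B) (Cat U) F F') \<alpha>)"
proof -
  interpret related U B F E p ob vert lift F' E' p' ob' vert' lift' H \<alpha> by fact
  have 1: "Ide (functor_cat E E') H \<in> ntranses E E'"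
    using Ide_Arr[OF category_functor_cat[OF P.category_E Q.category_E]] H by simp
  have 2: "Ide (functor_cat (PObj F x) (PObj F' x)) (PN1 \<alpha> x) \<in> ntranses (PObj F x) (PObj F' x)"
    if "x \<in> Obj B" for x
    using Ide_Arr[OF category_functor_cat[of "PObj F x" "PObj F' x"]] that PN1_functor by simp
  show ?thesis
    by (intro related_cells.intro related_cells_axioms.intro presentation_pair_axioms)
      (use related_axioms 1 2 in \<open>simp_all add: modif_data_def Q.vert_Ide\<close>)
qed

lemma related_cells_Comp:
  assumes 1: "related_cells U B F E p ob vert lift F' E' p' ob' vert' lift' \<theta> \<Gamma>"
    and 2: "related_cells U B F E p ob vert lift F' E' p' ob' vert' lift' \<theta>' \<Gamma>'"
    and c: "NDom \<theta>' = NCod \<theta>" "MDom \<Gamma>' = MCod \<Gamma>"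
  shows "related_cells U B F E p ob vert lift F' E' p' ob' vert' lift'
    (\<theta>' \<cdot>[functor_cat E E'] \<theta>) (\<Gamma>' \<cdot>[Psd_hom (op_cat B) (Cat U) F F'] \<Gamma>)"
proof -
  interpret r1: related_cells U B F E p ob vert lift F' E' p' ob' vert' lift' \<theta> \<Gamma> by fact
  interpret r2: related_cells U B F E p ob vert lift F' E' p' ob' vert' lift' \<theta>' \<Gamma>' by fact
  have t: "\<theta>' \<cdot>[functor_cat E E'] \<theta> \<in> ntranses E E'"
    using Comp_Arr[OF category_functor_cat[OF P.category_E Q.category_E], of \<theta> \<theta>'] r1.\<theta> r2.\<theta> c
      by simp
  have m: "MMap \<Gamma>' x \<cdot>[functor_cat (PObj F x) (PObj F' x)] MMap \<Gamma> x \<in> ntranses (PObj F x) (PObj F'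
    x)" if x: "x \<in> Obj B" for x
    using Comp_Arr[OF category_functor_cat[of "PObj F x" "PObj F' x"], of "MMap \<Gamma> x" "MMap \<Gamma>' x"]
      r1.MMap_ntrans[OF x] r2.MMap_ntrans[OF x] x c by (simp add: r2.MMap_Dom r1.MMap_Cod)
  show ?thesis
    by (intro related_cells.intro related_cells_axioms.intro presentation_pair_axioms)
      (use r1.D.related_axioms r2.C.related_axioms t m c
        in \<open>simp_all add: modif_data_def r1.MMap_Dom r2.MMap_Cod
        r1.\<theta>_ob r2.\<theta>_ob Q.vert_Comp\<close>)
qed

end

lemma (in presentation) related_Unit:
  "related U B F E p ob vert lift F E p ob vert lift (id_ftor E) (id_psnat (op_cat B) (Cat U) F)"
proof -
  interpret PP: presentation_pair U B F E p ob vert lift F E p ob vert lift ..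
  have 1: "cartesian_over E E B p p (id_ftor E)"
    by (auto simp: cartesian_over_def preserves_cartesian_def cartesian_Arr)
  have 2: "psnat_data B F F (id_psnat (op_cat B) (Cat U) F)"
    using comp_ftor_id_left[OF PArr_functor] comp_ftor_id_right[OF PArr_functor]
    by (simp add: psnat_data_def id_psnat_def id_ftor_in)
  have 3: "PP.compat (id_ftor E) (id_psnat (op_cat B) (Cat U) F)"
    by (simp add: PP.compat_def id_psnat_def vert_Ide)
  show ?thesis
    by (intro related.intro cartesian_functor.intro cartesian_functor_axioms.intro
      related_axioms.intro
        PP.presentation_pair_axioms 1 2 3 id_ftor_in category_E)
qed

text \<open>Comparisons compose: that of \<open>lift''\<close> with the image of
  \<open>lift'\<close> under \<open>K\<close>, followed by the image under \<open>K\<close> of that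
  of \<open>lift'\<close> with the image of \<open>lift\<close> under \<open>H\<close>. This is the
  formula for \<open>PN2\<close> in \<open>comp_psnat\<close>.\<close>

lemma related_comp:
  assumes 1: "related U B F E p ob vert lift F' E' p' ob' vert' lift' H \<alpha>"
    and 2: "related U B F' E' p' ob' vert' lift' F'' E'' p'' ob'' vert'' lift'' K \<beta>"
  shows "related U B F E p ob vert lift F'' E'' p'' ob'' vert'' lift'' (comp_ftor E K H)
    (comp_psnat (op_cat B) (Cat U) F F' F'' \<beta> \<alpha>)"
proof -
  interpret r1: related U B F E p ob vert lift F' E' p' ob' vert' lift' H \<alpha> by fact
  interpret r2: related U B F' E' p' ob' vert' lift' F'' E'' p'' ob'' vert'' lift'' K \<beta> by fact
  interpret PP: presentation_pair U B F E p ob vert lift F'' E'' p'' ob'' vert'' lift'' ..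
  let ?\<gamma> = "comp_psnat (op_cat B) (Cat U) F F' F'' \<beta> \<alpha>"
  have N1: "PN1 ?\<gamma> x = comp_ftor (PObj F x) (PN1 \<beta> x) (PN1 \<alpha> x)" if "x \<in> Obj B" for x
    using that by (simp add: comp_psnat_def)
  have N2: "ncell ?\<gamma> f u = narr \<beta> (Dom B f) (ncell \<alpha> f u) \<cdot>[PObj F'' (Dom B f)] ncell \<beta> f (nobj \<alpha>
    (Cod B f) u)"
    if f: "f \<in> Arr B" and u: "u \<in> Obj (PObj F (Cod B f))" for f u
  proof -
    have "NCod (PN2 \<alpha> f) = comp_ftor (PObj F (Cod B f)) (PN1 \<alpha> (Dom B f)) (PArr F f)"
      "NDom (PN2 \<beta> f) = comp_ftor (PObj F' (Cod B f)) (PArr F'' f) (PN1 \<beta> (Cod B f))"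
      using r1.data r2.data f by (simp_all add: psnat_data_def)
    then show ?thesis using f u by (simp add: comp_psnat_def Let_def)
  qed
  have 3: "psnat_data B F F'' ?\<gamma>"
    unfolding psnat_data_def
  proof (intro conjI ballI)
    show "PN1 ?\<gamma> \<in> extensional (Obj B)" "PN2 ?\<gamma> \<in> extensional (Arr B)"
      by (simp_all add: comp_psnat_def)
    show "PN1 ?\<gamma> x \<in> functors (PObj F x) (PObj F'' x)" if "x \<in> Obj B" for x
      unfolding N1[OF that] using comp_ftor_in[OF r1.PN1_functor r2.PN1_functor] that by simp
    fix f assume f: "f \<in> Arr B"
    have ob: "Cod B f \<in> Obj B" "Dom B f \<in> Obj B" using f by auto
    have d: "NCod (PN2 \<alpha> f) = comp_ftor (PObj F (Cod B f)) (PN1 \<alpha> (Dom B f)) (PArr F f)"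
      "NDom (PN2 \<beta> f) = comp_ftor (PObj F' (Cod B f)) (PArr F'' f) (PN1 \<beta> (Cod B f))"
      using r1.data r2.data f by (simp_all add: psnat_data_def)
    show "NDom (PN2 ?\<gamma> f) = comp_ftor (PObj F (Cod B f)) (PArr F'' f) (PN1 ?\<gamma> (Cod B f))"
      using f ob comp_ftor_assoc[OF r1.PN1_functor[OF ob(1)] r2.PN1_functor[OF ob(1)]
        r2.Q.PArr_functor[OF f]]
      by (simp add: N1 comp_psnat_def d Let_def)
    show "NCod (PN2 ?\<gamma> f) = comp_ftor (PObj F (Cod B f)) (PN1 ?\<gamma> (Dom B f)) (PArr F f)"
      using f ob comp_ftor_assoc[OF r1.P.PArr_functor[OF f] r1.PN1_functor[OF ob(2)]
        r2.PN1_functor[OF ob(2)]]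
      by (simp add: N1 comp_psnat_def d Let_def)
    show "ncell ?\<gamma> f \<in> extensional (Obj (PObj F (Cod B f)))"
      using f by (simp add: comp_psnat_def Let_def)
    fix u assume u: "u \<in> Obj (PObj F (Cod B f))"
    show "ncell ?\<gamma> f u \<in> Arr (PObj F'' (Dom B f))"
      "Dom (PObj F'' (Dom B f)) (ncell ?\<gamma> f u) = pobj F'' f (nobj ?\<gamma> (Cod B f) u)"
      "Cod (PObj F'' (Dom B f)) (ncell ?\<gamma> f u) = nobj ?\<gamma> (Dom B f) (pobj F f u)"
      unfolding N2[OF f u] using f u ob by (simp_all add: N1)
  qed
  have 4: "PP.compat (comp_ftor E K H) ?\<gamma>"
    unfolding PP.compat_def
  proof (intro conjI ballI)
    show "OMap (comp_ftor E K H) (ob x u) = ob'' x (nobj ?\<gamma> x u)" if "x \<in> Obj B"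
      "u \<in> Obj (PObj F x)" for x u
      using that by (simp add: N1)
    show "AMap (comp_ftor E K H) (vert x u) = vert'' x (narr ?\<gamma> x u)" if "x \<in> Obj B"
      "u \<in> Arr (PObj F x)" for x u
      using that by (simp add: N1)
    fix f u assume f: "f \<in> Arr B" and u: "u \<in> Obj (PObj F (Cod B f))"
    have ob: "Cod B f \<in> Obj B" "Dom B f \<in> Obj B" using f by auto
    let ?y = "Dom B f" and ?a = "nobj \<alpha> (Cod B f) u"
    have "AMap (comp_ftor E K H) (lift f u) \<cdot>[E''] vert'' ?y (ncell ?\<gamma> f u) =
      AMap K (AMap H (lift f u) \<cdot>[E'] vert' ?y (ncell \<alpha> f u)) \<cdot>[E''] vert'' ?y (ncell \<beta> f ?a)"
      unfolding N2[OF f u] using f u ob by (simp add: r2.H_Comp r2.Q.vert_Comp)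
    also have "\<dots> = lift'' f (nobj ?\<gamma> (Cod B f) u)"
      using f u ob by (simp add: r1.H_lift r2.H_lift N1)
    finally show "AMap (comp_ftor E K H) (lift f u) \<cdot>[E''] vert'' ?y (ncell ?\<gamma> f u) =
      lift'' f (nobj ?\<gamma> (Cod B f) u)" .
  qed
  show ?thesis
    by (intro related.intro cartesian_functor.intro cartesian_functor_axioms.intro
      related_axioms.intro
        PP.presentation_pair_axioms 3 4 comp_ftor_in[OF r1.H r2.H] cartesian_over_comp[OF r1.H
          r1.over r2.over])
qed

lemma related_cells_hcomp:
  assumes 1: "related_cells U B F E p ob vert lift F' E' p' ob' vert' lift' \<theta> \<Gamma>"
    and 2: "related_cells U B F' E' p' ob' vert' lift' F'' E'' p'' ob'' vert'' lift'' \<theta>' \<Gamma>'"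
  shows "related_cells U B F E p ob vert lift F'' E'' p'' ob'' vert'' lift'' (hcomp_ntrans E E'' \<theta>'
    \<theta>)
    (hcomp_modif (op_cat B) (Cat U) F F' F'' \<Gamma>' \<Gamma>)"
proof -
  interpret r1: related_cells U B F E p ob vert lift F' E' p' ob' vert' lift' \<theta> \<Gamma> by fact
  interpret r2: related_cells U B F' E' p' ob' vert' lift' F'' E'' p'' ob'' vert'' lift'' \<theta>' \<Gamma>'
    by fact
  interpret PP: presentation_pair U B F E p ob vert lift F'' E'' p'' ob'' vert'' lift'' ..
  have m: "hcomp_ntrans (PObj F x) (PObj F'' x) (MMap \<Gamma>' x) (MMap \<Gamma> x) \<in> ntranses (PObj F x) (PObj
    F'' x)" if x: "x \<in> Obj B" for x
    using hcomp_ntrans_in[OF r1.MMap_ntrans[OF x] r2.MMap_ntrans[OF x]] .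
  show ?thesis
    by (intro related_cells.intro related_cells_axioms.intro PP.presentation_pair_axioms)
      (use related_comp[OF r1.D.related_axioms r2.D.related_axioms] related_comp[OF
        r1.C.related_axioms r2.C.related_axioms]
        hcomp_ntrans_in[OF r1.\<theta> r2.\<theta>] m in \<open>simp_all add: hcomp_modif_def modif_data_def
          comp_psnat_def
          r1.MMap_Dom r2.MMap_Dom r1.MMap_Cod r2.MMap_Cod r1.\<theta>_ob r2.\<theta>_ob r2.Q.vert_Comp\<close>)
qed

section \<open>Every pseudofunctor has a presentation: the Grothendieck construction\<close>

text \<open>An infinite set is equipotent to its square; this lets pairs be coded by elements of the
  same type.\<close>

lemma ex_pairing: "infinite (UNIV :: 'u set) \<Longrightarrow> \<exists>e :: 'u \<times> 'u \<Rightarrow> 'u. inj e"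
  using card_of_Times_same_infinite[of "UNIV :: 'u set"]
  by (auto simp: card_of_ordIso[symmetric] bij_betw_def)

lemma universeD:
  assumes "universe U"
  shows "infinite (UNIV :: 'u set)"
    and "X \<in> U \<Longrightarrow> Y \<subseteq> X \<Longrightarrow> (Y :: 'u set) \<in> U"
    and "X \<in> U \<Longrightarrow> h ` X \<in> U"
    and "I \<in> U \<Longrightarrow> (\<And>i. i \<in> I \<Longrightarrow> A i \<in> U) \<Longrightarrow> (\<Union>i\<in>I. A i) \<in> U"
  using assms unfolding universe_def by blast+

text \<open>\<open>enc\<close> codes pairs, because \<open>Cat U\<close> only has categories whose
  objects and arrows are elements of \<open>'u\<close>.\<close>

locale grothendieck = indexed_category U B F
  for U :: "'u set set" and B :: "('u, 'u) cat"
    and F :: "'u cat_psfun" +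
  fixes enc :: "'u \<times> 'u \<Rightarrow> 'u"
  assumes U: "universe U" and small_B: "small_category U B" and enc: "inj enc"
begin

definition gob :: "'u \<Rightarrow> 'u \<Rightarrow> 'u" where "gob x u = enc (x, u)"

text \<open>\<open>gar f \<phi> u\<close> encodes the arrow over \<open>f\<close> to \<open>u\<close> given by \<open>\<phi> : v \<rightarrow> F f u\<close>; its target cannot be
  recovered from \<open>\<phi>\<close> and has to be recorded.\<close>

definition gar :: "'u \<Rightarrow> 'u \<Rightarrow> 'u \<Rightarrow> 'u" where "gar f \<phi> u = enc (f, enc (\<phi>, u))"

text \<open>Objects and arrows both carry their base component first, so \<open>dec1\<close> serves
  as the projection to \<open>B\<close> on either.\<close>

definition "dec1 e = fst (inv enc e)"
definition "dec2 e = snd (inv enc e)"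
definition "dec3 e = fst (inv enc (dec2 e))"
definition "dec4 e = snd (inv enc (dec2 e))"

lemma dec_simps [simp]:
  "dec1 (gob x u) = x" "dec2 (gob x u) = u"
  "dec1 (gar f \<phi> u) = f" "dec3 (gar f \<phi> u) = \<phi>" "dec4 (gar f \<phi> u) = u"
  using enc by (simp_all add: dec1_def dec2_def dec3_def dec4_def gob_def gar_def)

lemma gob_eq_iff [simp]: "gob x u = gob y v \<longleftrightarrow> x = y \<and> u = v"
  and gar_eq_iff [simp]: "gar f \<phi> u = gar g \<psi> v \<longleftrightarrow> f = g \<and> \<phi> = \<psi> \<and> u = v"
  using enc by (auto simp: gob_def gar_def inj_eq)

definition "gObj = {gob x u | x u. x \<in> Obj B \<and> u \<in> Obj (PObj F x)}"

definition "gArr = {gar f \<phi> u | f \<phi> u. f \<in> Arr B \<and> u \<in> Obj (PObj F (Cod B f)) \<and>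
  \<phi> \<in> Arr (PObj F (Dom B f)) \<and>
  Cod (PObj F (Dom B f)) \<phi> = pobj F f u}"

lemma gob_in [simp]: "gob x u \<in> gObj \<longleftrightarrow> x \<in> Obj B \<and> u \<in> Obj (PObj F x)"
  by (auto simp: gObj_def)

lemma gar_in [simp]: "gar f \<phi> u \<in> gArr \<longleftrightarrow> f \<in> Arr B \<and> u \<in> Obj (PObj F (Cod B f)) \<and>
  \<phi> \<in> Arr (PObj F (Dom B f)) \<and>
  Cod (PObj F (Dom B f)) \<phi> = pobj F f u"
  by (auto simp: gArr_def)

lemma gObjE:
  assumes "e \<in> gObj" obtains x u where "e = gob x u" "x \<in> Obj B" "u \<in> Obj (PObj F x)"
  using assms by (auto simp: gObj_def)

lemma gArrE:
  assumes "k \<in> gArr" obtains f \<phi> u where "k = gar f \<phi> u" "f \<in> Arr B" "u \<in> Obj (PObj F (Cod B f))"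
    "\<phi> \<in> Arr (PObj F (Dom B f))"
    "Cod (PObj F (Dom B f)) \<phi> = pobj F f u"
  using assms by (auto simp: gArr_def)

definition "gDom k = gob (Dom B (dec1 k)) (Dom (PObj F (Dom B (dec1 k))) (dec3 k))"
definition "gCod k = gob (Cod B (dec1 k)) (dec4 k)"

text \<open>In a composite the fibre part of the later arrow is reindexed along the earlier one, and
  the two reindexings are merged by \<open>pcomp\<close>. The values \<open>undefined\<close> are
  those required by \<open>small_category\<close>.\<close>

definition G :: "('u, 'u) cat" where
  "G = \<lparr>Obj = gObj, Arr = gArr, Dom = (\<lambda>k\<in>gArr. gDom k), Cod = (\<lambda>k\<in>gArr. gCod k),
    Ide = (\<lambda>e\<in>gObj. gar (Ide B (dec1 e)) (punit F (dec1 e) (dec2 e)) (dec2 e)),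
    Comp = (\<lambda>k l. if l \<in> gArr \<and> k \<in> gArr \<and> gDom k = gCod l then
      gar (dec1 k \<cdot>[B] dec1 l)
        (pcomp F (dec1 l) (dec1 k) (dec4 k) \<cdot>[PObj F (Dom B (dec1 l))]
          parr F (dec1 l) (dec3 k) \<cdot>[PObj F (Dom B (dec1 l))] dec3 l)
        (dec4 k) else undefined)\<rparr>"

lemma G_Obj [simp]: "Obj G = gObj" and G_Arr [simp]: "Arr G = gArr"
  by (simp_all add: G_def)

lemma G_Dom [simp]: "gar f \<phi> u \<in> gArr \<Longrightarrow> Dom G (gar f \<phi> u) = gob (Dom B f) (Dom (PObj F (Dom B f))
  \<phi>)"
  and G_Cod [simp]: "gar f \<phi> u \<in> gArr \<Longrightarrow> Cod G (gar f \<phi> u) = gob (Cod B f) u"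
  and G_Ide [simp]: "gob x v \<in> gObj \<Longrightarrow> Ide G (gob x v) = gar (Ide B x) (punit F x v) v"
  and G_Comp [simp]: "gar f \<phi> u \<in> gArr \<Longrightarrow> gar g \<psi> v \<in> gArr \<Longrightarrow> Dom B f = Cod B g \<Longrightarrow>
    Dom (PObj F (Cod B g)) \<phi> = v \<Longrightarrow>
    gar f \<phi> u \<cdot>[G] gar g \<psi> v = gar (f \<cdot>[B] g)
      (pcomp F g f u \<cdot>[PObj F (Dom B g)] parr F g \<phi> \<cdot>[PObj F (Dom B g)] \<psi>) u"
  by (simp_all add: G_def gDom_def gCod_def)

lemma category_G: "category G"
proof (rule categoryI)
  fix k assume "k \<in> Arr G"
  then obtain f \<phi> u where k: "k = gar f \<phi> u" "f \<in> Arr B" "u \<in> Obj (PObj F (Cod B f))"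
    "\<phi> \<in> Arr (PObj F (Dom B f))"
    "Cod (PObj F (Dom B f)) \<phi> = pobj F f u" by (auto elim: gArrE)
  show "Dom G k \<in> Obj G" "Cod G k \<in> Obj G" using k by simp_all
  let ?x = "Cod B f" and ?y = "Dom B f"
  \<comment> \<open>Because \<open>op_cat B\<close> reverses composition, the right identity law
    comes from \<open>unit_left\<close>, after naturality of the unit constraint, and the left one
    from \<open>unit_right\<close>.\<close>
  have "pcomp F (Ide B ?y) f u \<cdot>[PObj F ?y] parr F (Ide B ?y) \<phi> \<cdot>[PObj F ?y] punit F ?y (Dom (PObj F
    ?y) \<phi>) =
    (pcomp F (Ide B ?y) f u \<cdot>[PObj F ?y] punit F ?y (pobj F f u)) \<cdot>[PObj F ?y] \<phi>"
    using PUnit_natural[of ?y \<phi>] k by simp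
  also have "\<dots> = \<phi>" unfolding unit_left[OF k(2,3)] using k by simp
  finally show "k \<cdot>[G] Ide G (Dom G k) = k" using k by simp
  have "pcomp F f (Ide B ?x) u \<cdot>[PObj F ?y] parr F f (punit F ?x u) \<cdot>[PObj F ?y] \<phi> =
    (pcomp F f (Ide B ?x) u \<cdot>[PObj F ?y] parr F f (punit F ?x u)) \<cdot>[PObj F ?y] \<phi>"
    using k by simp
  also have "\<dots> = \<phi>" unfolding unit_right[OF k(2,3)] using k by simp
  finally show "Ide G (Cod G k) \<cdot>[G] k = k" using k by simp
next
  fix e assume "e \<in> Obj G"
  then show "Ide G e \<in> Arr G" "Dom G (Ide G e) = e" "Cod G (Ide G e) = e" by (auto elim!: gObjE)
next
  fix l k assume "l \<in> Arr G" "k \<in> Arr G" and c: "Dom G k = Cod G l"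
  then obtain f \<phi> u g \<psi> v where k: "k = gar f \<phi> u" "f \<in> Arr B" "u \<in> Obj (PObj F (Cod B f))"
    "\<phi> \<in> Arr (PObj F (Dom B f))"
    "Cod (PObj F (Dom B f)) \<phi> = pobj F f u"
    and l: "l = gar g \<psi> v" "g \<in> Arr B" "v \<in> Obj (PObj F (Cod B g))" "\<psi> \<in> Arr (PObj F (Dom B g))"
    "Cod (PObj F (Dom B g)) \<psi> = pobj F g v" by (auto elim!: gArrE)
  have c': "Dom B f = Cod B g" "Dom (PObj F (Cod B g)) \<phi> = v" using c k l by auto
  show "k \<cdot>[G] l \<in> Arr G" "Dom G (k \<cdot>[G] l) = Dom G l" "Cod G (k \<cdot>[G] l) = Cod G k"
    using k l c' by simp_all
next
  fix m l k assume "m \<in> Arr G" "l \<in> Arr G" "k \<in> Arr G" and c: "Dom G l = Cod G m"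
    "Dom G k = Cod G l"
  then obtain f \<phi> u g \<psi> v h \<chi> w where k: "k = gar f \<phi> u" "f \<in> Arr B" "u \<in> Obj (PObj F (Cod B f))"
    "\<phi> \<in> Arr (PObj F (Dom B f))"
    "Cod (PObj F (Dom B f)) \<phi> = pobj F f u"
    and l: "l = gar g \<psi> v" "g \<in> Arr B" "v \<in> Obj (PObj F (Cod B g))" "\<psi> \<in> Arr (PObj F (Dom B g))"
    "Cod (PObj F (Dom B g)) \<psi> = pobj F g v"
    and m: "m = gar h \<chi> w" "h \<in> Arr B" "w \<in> Obj (PObj F (Cod B h))" "\<chi> \<in> Arr (PObj F (Dom B h))"
    "Cod (PObj F (Dom B h)) \<chi> = pobj F h w" by (auto elim!: gArrE)
  have c': "Dom B f = Cod B g" "Dom (PObj F (Cod B g)) \<phi> = v" "Dom B g = Cod B h"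
    "Dom (PObj F (Cod B h)) \<psi> = w"
    using c k l m by auto
  let ?S = "PObj F (Dom B h)"
  have \<phi>: "\<phi> \<in> Arr (PObj F (Cod B g))" "Cod (PObj F (Cod B g)) \<phi> = pobj F f u"
    and \<psi>: "\<psi> \<in> Arr (PObj F (Cod B h))" "Cod (PObj F (Cod B h)) \<psi> = pobj F g v"
      using k l c' by simp_all
  have ob: "Cod B h \<in> Obj B" "Cod B g \<in> Obj B" "Cod B f \<in> Obj B" "Dom B h \<in> Obj B"
    using k l m by simp_all
  have Fu: "pobj F f u \<in> Obj (PObj F (Cod B g))" using k c' by simp
  let ?\<mu> = "pcomp F g f u"
  have \<mu>: "?\<mu> \<in> Arr (PObj F (Cod B h))" "Dom (PObj F (Cod B h)) ?\<mu> = pobj F g (pobj F f u)"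
    "Cod (PObj F (Cod B h)) ?\<mu> = pobj F (f \<cdot>[B] g) u" using k l c' by simp_all
  have r: "parr F h (?\<mu> \<cdot>[PObj F (Cod B h)] parr F g \<phi> \<cdot>[PObj F (Cod B h)] \<psi>) =
    parr F h ?\<mu> \<cdot>[?S] parr F h (parr F g \<phi>) \<cdot>[?S] parr F h \<psi>"
    using m(2) l(2) \<phi> \<psi> \<mu> c' ob by (simp add: reindex_Comp)
  \<comment> \<open>Associativity is the law \<open>assoc\<close> together with naturality of
    \<open>pcomp\<close>, which moves \<open>\<phi>\<close> past the constraint for \<open>g\<close>
    and \<open>h\<close>.\<close>
  have "pcomp F h (f \<cdot>[B] g) u \<cdot>[?S] parr F h (?\<mu> \<cdot>[PObj F (Cod B h)] parr F g \<phi> \<cdot>[PObj F (Cod B h)]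
    \<psi>) \<cdot>[?S] \<chi> =
    (pcomp F h (f \<cdot>[B] g) u \<cdot>[?S] parr F h ?\<mu>) \<cdot>[?S] parr F h (parr F g \<phi>) \<cdot>[?S] parr F h \<psi> \<cdot>[?S] \<chi>"
    unfolding r using k(2,3) l(2,3) m \<phi> \<psi> \<mu> c' ob Fu by simp
  also have "\<dots> = (pcomp F (g \<cdot>[B] h) f u \<cdot>[?S] pcomp F h g (pobj F f u)) \<cdot>[?S]
      parr F h (parr F g \<phi>) \<cdot>[?S] parr F h \<psi> \<cdot>[?S] \<chi>"
    using assoc[OF k(2) l(2) m(2) c'(1,3) k(3)] by simp
  also have "\<dots> = pcomp F (g \<cdot>[B] h) f u \<cdot>[?S] (pcomp F h g (pobj F f u) \<cdot>[?S]
      parr F h (parr F g \<phi>)) \<cdot>[?S] parr F h \<psi> \<cdot>[?S] \<chi>"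
    using k(2,3) l(2,3) m \<phi> \<psi> \<mu> c' ob Fu by simp
  also have "\<dots> = pcomp F (g \<cdot>[B] h) f u \<cdot>[?S] (parr F (g \<cdot>[B] h) \<phi> \<cdot>[?S] pcomp F h g v) \<cdot>[?S]
    parr F h \<psi> \<cdot>[?S] \<chi>"
    using PComp_natural[OF l(2) m(2) c'(3) \<phi>(1)] \<phi>(2) c'(2) by simp
  also have "\<dots> = pcomp F (g \<cdot>[B] h) f u \<cdot>[?S] parr F (g \<cdot>[B] h) \<phi> \<cdot>[?S] pcomp F h g v \<cdot>[?S]
    parr F h \<psi> \<cdot>[?S] \<chi>"
    using k(2,3) l(2,3) m \<phi> \<psi> \<mu> c' ob Fu by simp
  finally show "(k \<cdot>[G] l) \<cdot>[G] m = k \<cdot>[G] l \<cdot>[G] m"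
    using k(1-3) l(1-3) m \<phi> \<psi> \<mu> c' ob Fu k(4,5) l(4,5) by simp
qed

lemma small_G: "small_category U G"
proof -
  note u = universeD[OF U]
  have B: "Obj B \<in> U" "Arr B \<in> U" using small_B by (simp_all add: small_category_def)
  have F: "Obj (PObj F x) \<in> U" "Arr (PObj F x) \<in> U" if "x \<in> Obj B" for x
    using small_fibre[OF that] by (simp_all add: small_category_def)
  have "gObj = (\<Union>x\<in>Obj B. gob x ` Obj (PObj F x))" by (auto simp: gObj_def)
  also have "\<dots> \<in> U" using u(3,4) B F by simp
  finally have 1: "gObj \<in> U" .
  \<comment> \<open>Dropping the condition on codomains gives an iterated union of images, of which
    \<open>gArr\<close> is a subset.\<close>
  have "(\<Union>f\<in>Arr B. \<Union>u\<in>Obj (PObj F (Cod B f)). (\<lambda>\<phi>. gar f \<phi> u) ` Arr (PObj F (Dom B f))) \<in> U"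
    using B F by (intro u(3,4)) simp_all
  moreover have "gArr \<subseteq> (\<Union>f\<in>Arr B. \<Union>u\<in>Obj (PObj F (Cod B f)). (\<lambda>\<phi>. gar f \<phi> u) ` Arr (PObj F (Dom B
    f)))"
    by (auto simp: gArr_def)
  ultimately have 2: "gArr \<in> U" by (rule u(2))
  show ?thesis
    unfolding small_category_def using category_G 1 2
    by (auto simp: G_def)
qed

definition proj :: "('u, 'u, 'u, 'u) ftor" where
  "proj = \<lparr>OMap = (\<lambda>e\<in>gObj. dec1 e), AMap = (\<lambda>k\<in>gArr. dec1 k)\<rparr>"

lemma proj_simps [simp]: "gob x u \<in> gObj \<Longrightarrow> OMap proj (gob x u) = x" "gar f \<phi> u \<in> gArr \<Longrightarrow>
  AMap proj (gar f \<phi> u) = f"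
  by (simp_all add: proj_def)

lemma proj_functor: "proj \<in> functors G B"
proof -
  have "is_functor G B proj"
  proof (rule is_functorI[OF category_G category_B])
    fix l k assume a: "l \<in> Arr G" "k \<in> Arr G" and c: "Dom G k = Cod G l"
    have "k \<cdot>[G] l \<in> Arr G" by (rule Comp_Arr[OF category_G a c])
    then show "AMap proj (k \<cdot>[G] l) = AMap proj k \<cdot>[B] AMap proj l"
      using a c by (auto elim!: gArrE)
  qed (auto elim!: gArrE gObjE)
  then show ?thesis by (simp add: functors_def proj_def)
qed

text \<open>The fibre part of an arrow over the identity of \<open>x\<close> must end in an object
  of the form \<open>pobj F (Ide B x) u\<close>; composing \<open>\<phi>\<close> with the unit
  constraint brings it into this form.\<close>

definition gvert :: "'u \<Rightarrow> 'u \<Rightarrow> 'u" where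
  "gvert x \<phi> = gar (Ide B x) (punit F x (Cod (PObj F x) \<phi>) \<cdot>[PObj F x] \<phi>) (Cod (PObj F x) \<phi>)"

text \<open>The canonical lift, with an identity as its fibre part; that it is cartesian comes from
  invertibility of \<open>pcomp\<close>.\<close>

definition glift :: "'u \<Rightarrow> 'u \<Rightarrow> 'u" where
  "glift f u = gar f (Ide (PObj F (Dom B f)) (pobj F f u)) u"

lemma gvert_in: "x \<in> Obj B \<Longrightarrow> \<phi> \<in> Arr (PObj F x) \<Longrightarrow> gvert x \<phi> \<in> gArr"
  and glift_in: "f \<in> Arr B \<Longrightarrow> u \<in> Obj (PObj F (Cod B f)) \<Longrightarrow> glift f u \<in> gArr"
  by (simp_all add: gvert_def glift_def)

lemma glift_gar:
  assumes "f \<in> Arr B" "u \<in> Obj (PObj F (Cod B f))" "gar h \<psi> (pobj F f u) \<in> gArr" "Dom B f = Cod B h"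
  shows "glift f u \<cdot>[G] gar h \<psi> (pobj F f u) = gar (f \<cdot>[B] h) (pcomp F h f u \<cdot>[PObj F (Dom B h)]
    \<psi>) u"
  using assms by (simp add: glift_def)

text \<open>The vertical factor of an arrow of \<open>G\<close> is given exactly by its fibre part:
  the constraint from composition and the unit inside \<open>gvert\<close> cancel by
  \<open>unit_left\<close>.\<close>

lemma glift_gvert:
  assumes f: "f \<in> Arr B" and u: "u \<in> Obj (PObj F (Cod B f))" and y: "y = Dom B f" and \<phi>:
    "\<phi> \<in> Arr (PObj F y)"
    "Cod (PObj F y) \<phi> = pobj F f u"
  shows "glift f u \<cdot>[G] gvert y \<phi> = gar f \<phi> u"
proof -
  have "pcomp F (Ide B y) f u \<cdot>[PObj F y] punit F y (pobj F f u) \<cdot>[PObj F y] \<phi> =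
    (pcomp F (Ide B y) f u \<cdot>[PObj F y] punit F y (pobj F f u)) \<cdot>[PObj F y] \<phi>"
    using assms by simp
  also have "\<dots> = \<phi>" unfolding y unit_left[OF f u] using assms by simp
  finally have eq: "pcomp F (Ide B y) f u \<cdot>[PObj F y] punit F y (pobj F f u) \<cdot>[PObj F y] \<phi> = \<phi>" .
  have "y \<in> Obj B" "f \<cdot>[B] Ide B y = f" using f y by simp_all
  moreover have "gar (Ide B y) (punit F y (pobj F f u) \<cdot>[PObj F y] \<phi>) (pobj F f u) \<in> gArr"
    "Dom B f = Cod B (Ide B y)"
    using f u y \<phi> by simp_all
  note glift_gar[OF f u this]
  ultimately show ?thesis
    unfolding gvert_def \<phi>(2) by (simp add: eq)
qed

text \<open>Composition with a vertical arrow at the codomain only reindexes it; the unit constraint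
  inside \<open>gvert\<close> cancels by \<open>unit_right\<close>.\<close>

lemma gvert_gar:
  assumes x: "x \<in> Obj B" and \<psi>: "\<psi> \<in> Arr (PObj F x)" and g: "gar f \<phi> u \<in> gArr" and fx: "Cod B f = x"
    and u: "u = Dom (PObj F x) \<psi>"
  shows "gvert x \<psi> \<cdot>[G] gar f \<phi> u = gar f (parr F f \<psi> \<cdot>[PObj F (Dom B f)] \<phi>) (Cod (PObj F x) \<psi>)"
proof -
  let ?w = "Cod (PObj F x) \<psi>"
  have w: "?w \<in> Obj (PObj F (Cod B f))" using x \<psi> fx by simp
  have f: "f \<in> Arr B" using g by simp
  have "pcomp F f (Ide B x) ?w \<cdot>[PObj F (Dom B f)] parr F f (punit F x ?w \<cdot>[PObj F x]
    \<psi>) \<cdot>[PObj F (Dom B f)] \<phi> =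
    (pcomp F f (Ide B (Cod B f)) ?w \<cdot>[PObj F (Dom B f)] parr F f (punit F (Cod B f) ?w)) \<cdot>[PObj F
      (Dom B f)]
      parr F f \<psi> \<cdot>[PObj F (Dom B f)] \<phi>"
    using x \<psi> g fx u w by (simp add: reindex_Comp)
  also have "\<dots> = parr F f \<psi> \<cdot>[PObj F (Dom B f)] \<phi>"
    unfolding unit_right[OF f w] using x \<psi> g fx u by simp
  finally show ?thesis using x \<psi> g fx u by (simp add: gvert_def)
qed

lemma presentation: "presentation U B F G proj gob gvert glift"
proof -
  note [simp] = category_G
  have cart: "cartesian G B proj (glift f u)" if f: "f \<in> Arr B" and u: "u \<in> Obj (PObj F (Cod B f))"
    for f u
    unfolding cartesian_def
  proof (intro conjI ballI impI)
    show "glift f u \<in> Arr G" using glift_in[OF f u] by simp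
    fix k h assume k: "k \<in> Arr G" and h: "h \<in> Arr B" and c: "Cod G k = Cod G (glift f u)"
      "Cod B h = OMap proj (Dom G (glift f u))"
      and eq: "AMap proj k = AMap proj (glift f u) \<cdot>[B] h"
    have fh: "Dom B f = Cod B h" using c f u by (simp add: glift_def)
    obtain f' \<chi> u' where k': "k = gar f' \<chi> u'" "f' \<in> Arr B" "u' \<in> Obj (PObj F (Cod B f'))"
      "\<chi> \<in> Arr (PObj F (Dom B f'))"
      "Cod (PObj F (Dom B f')) \<chi> = pobj F f' u'" using k by (auto elim: gArrE)
    have e: "f' = f \<cdot>[B] h" "u' = u" using eq c f u k' by (simp_all add: glift_def)
    let ?S = "PObj F (Dom B h)" and ?\<mu> = "pcomp F h f u"
    have S: "category ?S" using h by simp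
    have \<chi>: "\<chi> \<in> Arr ?S" "Cod ?S \<chi> = pobj F (f \<cdot>[B] h) u" using k' e f h fh by simp_all
    have \<mu>: "?\<mu> \<in> Arr ?S" "Dom ?S ?\<mu> = pobj F h (pobj F f u)" "Cod ?S ?\<mu> = pobj F (f \<cdot>[B] h) u"
      using f u h fh by simp_all
    \<comment> \<open>A factorisation of \<open>k\<close> through the lift must have a fibre part
      \<open>\<psi>\<close> with \<open>?\<mu> \<cdot>[?S] \<psi> = \<chi>\<close>; the inverse
      \<open>\<nu>\<close> of the constraint solves this uniquely.\<close>
    obtain \<nu> where \<nu>: "\<nu> \<in> Arr ?S" "Dom ?S \<nu> = pobj F (f \<cdot>[B] h) u"
      "Cod ?S \<nu> = pobj F h (pobj F f u)"
      and 1: "\<nu> \<cdot>[?S] ?\<mu> = Ide ?S (pobj F h (pobj F f u))" and 2: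
        "?\<mu> \<cdot>[?S] \<nu> = Ide ?S (pobj F (f \<cdot>[B] h) u)"
      using PComp_is_iso[OF f h fh u] \<mu> by (auto simp: is_iso_def arrows_iff)
    let ?v = "pobj F f u"
    have v: "?v \<in> Obj (PObj F (Cod B h))" using f u fh by simp
    have in_iff: "m \<in> arrows G (Dom G k) (Dom G (glift f u)) \<and> AMap proj m = h \<and> k = glift f u \<cdot>[G]
      m \<longleftrightarrow>
      m = gar h (\<nu> \<cdot>[?S] \<chi>) ?v" (is "?l \<longleftrightarrow> ?r") for m
    proof
      assume m: ?l
      then have "m \<in> gArr" by (simp add: arrows_iff)
      then obtain h' \<psi> v' where m': "m = gar h' \<psi> v'" "h' \<in> Arr B" "v' \<in> Obj (PObj F (Cod B h'))"
        "\<psi> \<in> Arr (PObj F (Dom B h'))"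
        "Cod (PObj F (Dom B h')) \<psi> = pobj F h' v'" by (auto elim: gArrE)
      have "AMap proj m = h" "Cod G m = Dom G (glift f u)" "k = glift f u \<cdot>[G] m"
        using m by (auto simp: arrows_iff)
      then have e': "h' = h" "v' = ?v" and ke: "gar f' \<chi> u' = glift f u \<cdot>[G] gar h \<psi> ?v"
        using m' f u k' fh by (auto simp: glift_def)
      have \<psi>: "\<psi> \<in> Arr ?S" "Cod ?S \<psi> = pobj F h ?v" using m' e' by simp_all
      have "\<chi> = ?\<mu> \<cdot>[?S] \<psi>"
        using ke glift_gar[OF f u, of h \<psi>] h v \<psi> fh by simp
      then have "\<nu> \<cdot>[?S] \<chi> = (\<nu> \<cdot>[?S] ?\<mu>) \<cdot>[?S] \<psi>" using \<nu> \<mu> \<psi> S by simp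
      also have "\<dots> = \<psi>" unfolding 1 using \<psi> S by simp
      finally show ?r using m' e' by simp
    next
      assume r: ?r
      have "?\<mu> \<cdot>[?S] \<nu> \<cdot>[?S] \<chi> = (?\<mu> \<cdot>[?S] \<nu>) \<cdot>[?S] \<chi>" using \<nu> \<mu> \<chi> S by simp
      also have "\<dots> = \<chi>" unfolding 2 using \<chi> S by simp
      finally have "k = glift f u \<cdot>[G] m"
        using r glift_gar[OF f u, of h "\<nu> \<cdot>[?S] \<chi>"] h v \<nu> \<chi> S fh e k' by simp
      moreover have "m \<in> gArr" using r h v \<nu> \<chi> S by simp
      ultimately show ?l
        using r h f u v \<nu> \<chi> S fh e k'(1) k' by (simp add: arrows_iff glift_def)
    qed
    then show "\<exists>!m. m \<in> arrows G (Dom G k) (Dom G (glift f u)) \<and> AMap proj m = h \<and> k =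
      glift f u \<cdot>[G] m" by simp
  qed
  show ?thesis
  proof (intro presentation.intro presentation_axioms.intro indexed_category_axioms small_G
    proj_functor)
    show "fibration G B proj"
      unfolding fibration_def
    proof (intro conjI ballI impI)
      show "is_functor G B proj" using proj_functor by (simp add: functors_def)
      fix e f assume "e \<in> Obj G" and f: "f \<in> Arr B" "Cod B f = OMap proj e"
      then obtain x u where e: "e = gob x u" "x \<in> Obj B" "u \<in> Obj (PObj F x)" by (auto elim: gObjE)
      then show "\<exists>g. cartesian G B proj g \<and> Cod G g = e \<and> AMap proj g = f"
        using f cart[of f u] by (intro exI[of _ "glift f u"]) (simp add: glift_def)
    qed
  next
    show "bij_betw (gob x) (Obj (PObj F x)) {e \<in> Obj G. OMap proj e = x}" if "x \<in> Obj B" for x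
      using that by (auto simp: bij_betw_def inj_on_def elim!: gObjE)
  next
    fix x assume x: "x \<in> Obj B"
    let ?S = "PObj F x"
    have S: "category ?S" using x by simp
    \<comment> \<open>Injectivity and surjectivity of \<open>gvert x\<close> both amount to
      cancelling the invertible unit constraint.\<close>
    have iso: "\<exists>\<nu>. \<nu> \<in> Arr ?S \<and> Dom ?S \<nu> = pobj F (Ide B x) u \<and> Cod ?S \<nu> = u \<and>
      \<nu> \<cdot>[?S] punit F x u = Ide ?S u \<and> punit F x u \<cdot>[?S] \<nu> = Ide ?S (pobj F (Ide B x) u)" if u:
        "u \<in> Obj ?S" for u
      using PUnit_is_iso[OF x u] x u by (auto simp: is_iso_def arrows_iff)
    show "bij_betw (gvert x) (Arr ?S) {k \<in> Arr G. AMap proj k = Ide B x}"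
      unfolding bij_betw_def
    proof (intro conjI inj_onI equalityI subsetI)
      fix \<phi> \<psi> assume \<phi>: "\<phi> \<in> Arr ?S" and \<psi>: "\<psi> \<in> Arr ?S" and eq: "gvert x \<phi> = gvert x \<psi>"
      let ?u = "Cod ?S \<phi>"
      have c: "Cod ?S \<psi> = ?u" and e: "punit F x ?u \<cdot>[?S] \<phi> = punit F x ?u \<cdot>[?S] \<psi>"
        using eq by (auto simp: gvert_def)
      have u: "?u \<in> Obj ?S" using \<phi> S by simp
      obtain \<nu> where \<nu>: "\<nu> \<in> Arr ?S" "Dom ?S \<nu> = pobj F (Ide B x) ?u" "Cod ?S \<nu> = ?u"
        and 1: "\<nu> \<cdot>[?S] punit F x ?u = Ide ?S ?u" using iso[OF u] by blast
      have "(\<nu> \<cdot>[?S] punit F x ?u) \<cdot>[?S] \<phi> = (\<nu> \<cdot>[?S] punit F x ?u) \<cdot>[?S] \<psi>"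
        using \<nu> x u \<phi> \<psi> c S e by simp
      then show "\<phi> = \<psi>" unfolding 1 using \<phi> \<psi> c S by simp
    next
      fix k assume "k \<in> gvert x ` Arr ?S"
      then show "k \<in> {k \<in> Arr G. AMap proj k = Ide B x}"
        using gvert_in[OF x] x by (auto simp: gvert_def)
    next
      fix k assume "k \<in> {k \<in> Arr G. AMap proj k = Ide B x}"
      then obtain \<chi> u where k: "k = gar (Ide B x) \<chi> u" "u \<in> Obj ?S" "\<chi> \<in> Arr ?S"
        "Cod ?S \<chi> = pobj F (Ide B x) u"
        using x by (auto elim!: gArrE)
      obtain \<nu> where \<nu>: "\<nu> \<in> Arr ?S" "Dom ?S \<nu> = pobj F (Ide B x) u" "Cod ?S \<nu> = u"
        and 2: "punit F x u \<cdot>[?S] \<nu> = Ide ?S (pobj F (Ide B x) u)" using iso[OF k(2)] by blast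
      have "punit F x u \<cdot>[?S] \<nu> \<cdot>[?S] \<chi> = (punit F x u \<cdot>[?S] \<nu>) \<cdot>[?S] \<chi>"
        using \<nu> k S x by simp
      also have "\<dots> = \<chi>" unfolding 2 using k S by simp
      finally have "k = gvert x (\<nu> \<cdot>[?S] \<chi>)" using \<nu> k S by (simp add: gvert_def)
      then show "k \<in> gvert x ` Arr ?S" using \<nu> k S by simp
    qed
  next
    fix x \<phi> assume "x \<in> Obj B" "\<phi> \<in> Arr (PObj F x)"
    then show "Dom G (gvert x \<phi>) = gob x (Dom (PObj F x) \<phi>)" "Cod G (gvert x \<phi>) =
      gob x (Cod (PObj F x) \<phi>)"
      by (simp_all add: gvert_def)
  next
    fix x u assume "x \<in> Obj B" "u \<in> Obj (PObj F x)"
    then show "gvert x (Ide (PObj F x) u) = Ide G (gob x u)" by (simp add: gvert_def)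
  next
    fix x \<phi> \<psi> assume a: "x \<in> Obj B" "\<phi> \<in> Arr (PObj F x)" "\<psi> \<in> Arr (PObj F x)" "Dom (PObj F x) \<psi> =
      Cod (PObj F x) \<phi>"
    \<comment> \<open>Naturality moves the unit constraint past \<open>\<psi>\<close>, into the
      position that \<open>gvert_gar\<close> produces.\<close>
    have "punit F x (Cod (PObj F x) \<psi>) \<cdot>[PObj F x] \<psi> \<cdot>[PObj F x] \<phi> =
      (punit F x (Cod (PObj F x) \<psi>) \<cdot>[PObj F x] \<psi>) \<cdot>[PObj F x] \<phi>" using a by simp
    also have "\<dots> = parr F (Ide B x) \<psi> \<cdot>[PObj F x] punit F x (Cod (PObj F x) \<phi>) \<cdot>[PObj F x] \<phi>"
      unfolding PUnit_natural[OF a(1,3)] using a by simp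
    finally have eq: "punit F x (Cod (PObj F x) \<psi>) \<cdot>[PObj F x] \<psi> \<cdot>[PObj F x] \<phi> =
      parr F (Ide B x) \<psi> \<cdot>[PObj F x] punit F x (Cod (PObj F x) \<phi>) \<cdot>[PObj F x] \<phi>" .
    have "gar (Ide B x) (punit F x (Cod (PObj F x) \<phi>) \<cdot>[PObj F x] \<phi>) (Cod (PObj F x) \<phi>) \<in> gArr"
      "Cod B (Ide B x) = x" using a by simp_all
    from gvert_gar[OF a(1,3) this a(4)[symmetric]]
    have "gvert x \<psi> \<cdot>[G] gvert x \<phi> = gar (Ide B x)
      (parr F (Ide B x) \<psi> \<cdot>[PObj F x] punit F x (Cod (PObj F x) \<phi>) \<cdot>[PObj F x] \<phi>) (Cod (PObj F x)
        \<psi>)"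
      unfolding gvert_def[of x \<phi>] using a(1) by simp
    then show "gvert x (\<psi> \<cdot>[PObj F x] \<phi>) = gvert x \<psi> \<cdot>[G] gvert x \<phi>"
      unfolding gvert_def[of x "\<psi> \<cdot>[PObj F x] \<phi>"] using a by (simp add: eq)
  next
    fix f u assume f: "f \<in> Arr B" and u: "u \<in> Obj (PObj F (Cod B f))"
    then show "cartesian G B proj (glift f u)" by (rule cart)
    show "Dom G (glift f u) = gob (Dom B f) (pobj F f u)" "Cod G (glift f u) = gob (Cod B f) u"
      "AMap proj (glift f u) = f"
      using f u by (simp_all add: glift_def)
  next
    fix f \<phi> assume f: "f \<in> Arr B" and \<phi>: "\<phi> \<in> Arr (PObj F (Cod B f))"
    \<comment> \<open>Both sides are
      \<open>gar f (parr F f \<phi>) (Cod (PObj F (Cod B f)) \<phi>)\<close>.\<close>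
    show "glift f (Cod (PObj F (Cod B f)) \<phi>) \<cdot>[G] gvert (Dom B f) (parr F f \<phi>) =
      gvert (Cod B f) \<phi> \<cdot>[G] glift f (Dom (PObj F (Cod B f)) \<phi>)"
      using f \<phi> glift_gvert[OF f _ refl, of "Cod (PObj F (Cod B f)) \<phi>" "parr F f \<phi>"]
        gvert_gar[OF _ \<phi> _ refl refl, of "Ide (PObj F (Dom B f)) (pobj F f (Dom (PObj F (Cod B f))
          \<phi>))"]
      by (simp add: glift_def[of f "Dom (PObj F (Cod B f)) \<phi>"])
  next
    fix x u assume x: "x \<in> Obj B" and u: "u \<in> Obj (PObj F x)"
    show "glift (Ide B x) u \<cdot>[G] gvert x (punit F x u) = Ide G (gob x u)"
      using x u glift_gvert[of "Ide B x" u x "punit F x u"] by simp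
  next
    fix f g u assume f: "f \<in> Arr B" and g: "g \<in> Arr B" and fg: "Dom B f = Cod B g" and u:
      "u \<in> Obj (PObj F (Cod B f))"
    show "glift (f \<cdot>[B] g) u \<cdot>[G] gvert (Dom B g) (pcomp F g f u) = glift f u \<cdot>[G] glift g (pobj F f
      u)"
      using f g fg u glift_gvert[of "f \<cdot>[B] g" u "Dom B g" "pcomp F g f u"]
        glift_gar[OF f u, of g "Ide (PObj F (Dom B g)) (pobj F g (pobj F f u))"]
      by (simp add: glift_def[of g "pobj F f u"])
  qed
qed

end

section \<open>Every fibration has a presentation: the fibres of a cleavage\<close>

lemma cartesian_Ide:
  assumes p: "is_functor E B p" and e: "e \<in> Obj E"
  shows "cartesian E B p (Ide E e)"
  unfolding cartesian_def
proof (intro conjI ballI impI)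
  note P[simp] = is_functorD[OF p]
  show "Ide E e \<in> Arr E" using e by simp
  fix k h assume k: "k \<in> Arr E" and h: "h \<in> Arr B" and c: "Cod E k = Cod E (Ide E e)"
    "Cod B h = OMap p (Dom E (Ide E e))"
    and eq: "AMap p k = AMap p (Ide E e) \<cdot>[B] h"
  show "\<exists>!m. m \<in> arrows E (Dom E k) (Dom E (Ide E e)) \<and> AMap p m = h \<and> k = Ide E e \<cdot>[E] m"
    by (rule ex1I[of _ k]) (use k h c eq e in \<open>auto simp: arrows_iff\<close>)
qed

lemma cartesian_comp:
  assumes p: "is_functor E B p" and g: "cartesian E B p g" and k: "cartesian E B p k" and c:
    "Dom E g = Cod E k"
  shows "cartesian E B p (g \<cdot>[E] k)"
  unfolding cartesian_def
proof (intro conjI ballI impI)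
  note P[simp] = is_functorD[OF p]
  have ga[simp]: "g \<in> Arr E" "k \<in> Arr E" using cartesian_Arr[OF g] cartesian_Arr[OF k] by auto
  show "g \<cdot>[E] k \<in> Arr E" using c by simp
  fix l h assume l[simp]: "l \<in> Arr E" and h[simp]: "h \<in> Arr B" and c': "Cod E l = Cod E (g \<cdot>[E] k)"
    "Cod B h = OMap p (Dom E (g \<cdot>[E] k))" and eq: "AMap p l = AMap p (g \<cdot>[E] k) \<cdot>[B] h"
  have "Cod E l = Cod E g" "AMap p k \<cdot>[B] h \<in> Arr B" "Cod B (AMap p k \<cdot>[B] h) = OMap p (Dom E g)"
    "AMap p l = AMap p g \<cdot>[B] AMap p k \<cdot>[B] h"
    using c c' eq by simp_all
  then obtain m where m: "m \<in> Arr E" "Dom E m = Dom E l" "Cod E m = Dom E g"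
    and m': "AMap p m = AMap p k \<cdot>[B] h" "l = g \<cdot>[E] m"
    by (rule cartesian_factor[OF g l])
  have "Cod E m = Cod E k" "Cod B h = OMap p (Dom E k)" using m(3) c c' by simp_all
  then obtain n where n: "n \<in> Arr E" "Dom E n = Dom E m" "Cod E n = Dom E k" "AMap p n = h"
    "m = k \<cdot>[E] n"
    by (rule cartesian_factor[OF k m(1) _ h _ m'(1)])
  have Dk: "Dom E (g \<cdot>[E] k) = Dom E k" using c by simp
  show "\<exists>!n. n \<in> arrows E (Dom E l) (Dom E (g \<cdot>[E] k)) \<and> AMap p n = h \<and> l = (g \<cdot>[E] k) \<cdot>[E] n"
    unfolding Dk
  proof (rule ex1I[of _ n])
    have "l = g \<cdot>[E] k \<cdot>[E] n" using m'(2) unfolding n(5) .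
    also have "\<dots> = (g \<cdot>[E] k) \<cdot>[E] n" using n(1,3) c by simp
    finally show "n \<in> arrows E (Dom E l) (Dom E k) \<and> AMap p n = h \<and> l = (g \<cdot>[E] k) \<cdot>[E] n"
      unfolding arrows_iff using n(1,3,4) n(2)[unfolded m(2)] by blast
    fix n' assume "n' \<in> arrows E (Dom E l) (Dom E k) \<and> AMap p n' = h \<and> l = (g \<cdot>[E] k) \<cdot>[E] n'"
    then have n': "n' \<in> Arr E" "Dom E n' = Dom E l" "Cod E n' = Dom E k" "AMap p n' = h"
      "l = (g \<cdot>[E] k) \<cdot>[E] n'"
      unfolding arrows_iff by blast+
    have gm: "g \<cdot>[E] k \<cdot>[E] n' = g \<cdot>[E] m"
      using n'(1,3) n'(5)[symmetric] m'(2)[symmetric] c by simp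
    have km: "k \<cdot>[E] n' = m"
      by (rule cartesian_cancel[OF p g]) (use m(1,2,3) m'(1) n'(1-4) c gm in simp_all)
    show "n' = n"
    proof (rule cartesian_cancel[OF p k])
      show "k \<cdot>[E] n' = k \<cdot>[E] n" using km n(5) by simp
    qed (use n(1,3,4) n'(1,3,4) n'(2) n(2)[unfolded m(2)] in simp_all)
  qed
qed

text \<open>The cleavage \<open>lft\<close> is arbitrary: identities and composites of chosen lifts
  need not be chosen lifts, and \<open>\<eta>\<close> and \<open>\<mu>\<close> below measure the
  difference.\<close>

locale cloven_fibration =
  fixes U :: "'u set set" and B :: "('u, 'u) cat" and E :: "('u, 'u) cat" and p ::
    "('u, 'u, 'u, 'u) ftor"
    and lft :: "'u \<Rightarrow> 'u \<Rightarrow> 'u"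
  assumes U: "universe U" and cat_B [simp]: "category B"
    and small_E: "small_category U E" and p_functor: "p \<in> functors E B"
    and lft: "e \<in> Obj E \<Longrightarrow> f \<in> Arr B \<Longrightarrow> Cod B f = OMap p e \<Longrightarrow>
      cartesian E B p (lft f e) \<and> Cod E (lft f e) = e \<and> AMap p (lft f e) = f"
begin

lemma cat_E [simp]: "category E" using small_E by (rule small_categoryD)

lemma p_is_functor: "is_functor E B p" using p_functor by (simp add: functors_def)

lemmas p_simps [simp] = functorsD(3-8)[OF p_functor]

definition "reindex f e = Dom E (lft f e)"

lemma
  assumes "e \<in> Obj E" "f \<in> Arr B" "Cod B f = OMap p e"
  shows lft_cartesian: "cartesian E B p (lft f e)"
    and lft_Arr [simp]: "lft f e \<in> Arr E" and lft_Dom [simp]: "Dom E (lft f e) = reindex f e"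
    and lft_Cod [simp]: "Cod E (lft f e) = e" and p_lft [simp]: "AMap p (lft f e) = f"
    and reindex_Obj [simp]: "reindex f e \<in> Obj E" and p_reindex [simp]: "OMap p (reindex f e) =
      Dom B f"
proof -
  note l = lft[OF assms]
  show "cartesian E B p (lft f e)" "lft f e \<in> Arr E" "Cod E (lft f e) = e" "AMap p (lft f e) = f"
    "Dom E (lft f e) = reindex f e" using l cartesian_Arr[of E B p "lft f e"]
      by (auto simp: reindex_def)
  then show "reindex f e \<in> Obj E" "OMap p (reindex f e) = Dom B f"
    using p_simps(3)[of "lft f e"] by (auto simp: reindex_def)
qed

text \<open>The vertical arrow comparing \<open>k\<close> with the chosen lift of its image;
  reindexing of arrows and both constraints are instances.\<close>

definition "fill f e k = (SOME m. m \<in> Arr E \<and> Dom E m = Dom E k \<and> Cod E m = reindex f e \<and>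
  AMap p m = Ide B (Dom B f) \<and> lft f e \<cdot>[E] m = k)"

lemma
  assumes k: "k \<in> Arr E" "Cod E k = e" "AMap p k = f"
  shows fill_Arr [simp]: "fill f e k \<in> Arr E" and fill_Dom [simp]: "Dom E (fill f e k) = Dom E k"
    and fill_Cod [simp]: "Cod E (fill f e k) = reindex f e" and p_fill [simp]:
      "AMap p (fill f e k) = Ide B (Dom B f)"
    and lft_fill: "lft f e \<cdot>[E] fill f e k = k"
proof -
  have e: "e \<in> Obj E" "f \<in> Arr B" "Cod B f = OMap p e" using k by auto
  have c: "Cod E k = Cod E (lft f e)" "Ide B (Dom B f) \<in> Arr B" "Cod B (Ide B (Dom B f)) =
    OMap p (Dom E (lft f e))"
    "AMap p k = AMap p (lft f e) \<cdot>[B] Ide B (Dom B f)" using k e by simp_all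
  obtain m where "m \<in> Arr E" "Dom E m = Dom E k" "Cod E m = Dom E (lft f e)"
    "AMap p m = Ide B (Dom B f)"
    "k = lft f e \<cdot>[E] m"
    using cartesian_factor[OF lft_cartesian[OF e] k(1) c] by blast
  then have "\<exists>m. m \<in> Arr E \<and> Dom E m = Dom E k \<and> Cod E m = reindex f e \<and>
    AMap p m = Ide B (Dom B f) \<and> lft f e \<cdot>[E] m = k"
    using lft_Dom[OF e] by metis
  from someI_ex[OF this, folded fill_def]
  show "fill f e k \<in> Arr E" "Dom E (fill f e k) = Dom E k" "Cod E (fill f e k) = reindex f e"
    "AMap p (fill f e k) = Ide B (Dom B f)"
    "lft f e \<cdot>[E] fill f e k = k" by auto
qed

lemma lft_cancel:
  assumes e: "e \<in> Obj E" "f \<in> Arr B" "Cod B f = OMap p e"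
    and m: "m \<in> Arr E" "Cod E m = reindex f e" "AMap p m = Ide B (Dom B f)"
    and n: "n \<in> Arr E" "Cod E n = reindex f e" "AMap p n = Ide B (Dom B f)"
    and eq: "Dom E m = Dom E n" "lft f e \<cdot>[E] m = lft f e \<cdot>[E] n"
  shows "m = n"
  by (rule cartesian_cancel[OF p_is_functor lft_cartesian[OF e]]) (use assms in simp_all)

text \<open>For cartesian \<open>k\<close> the arrow \<open>fill f e k\<close> compares two
  cartesian arrows over \<open>f\<close>; this is the source of the invertibility of
  \<open>\<eta>\<close> and \<open>\<mu>\<close>.\<close>

lemma fill_is_iso:
  assumes k: "cartesian E B p k" "Cod E k = e" "AMap p k = f"
  shows "is_iso E (fill f e k)"
proof -
  have ka: "k \<in> Arr E" using cartesian_Arr[OF k(1)] .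
  have e: "e \<in> Obj E" "f \<in> Arr B" "Cod B f = OMap p e" using k ka by auto
  have "OMap p (Dom E k) = Dom B f" using ka k(3) by auto
  then show ?thesis
    by (intro cartesian_factor_is_iso[OF p_is_functor lft_cartesian[OF e]])
      (use ka k e lft_fill[OF ka k(2,3)] in simp_all)
qed

text \<open>The guards in \<open>Dom\<close>, \<open>Cod\<close>, \<open>Ide\<close> and
  \<open>Comp\<close> give the value \<open>undefined\<close> outside the carriers, as
  \<open>small_category\<close> demands.\<close>

definition fibre :: "'u \<Rightarrow> ('u, 'u) cat" where
  "fibre x = \<lparr>Obj = {e \<in> Obj E. OMap p e = x}, Arr = {k \<in> Arr E. AMap p k = Ide B x},
    Dom = (\<lambda>k\<in>{k \<in> Arr E. AMap p k = Ide B x}. Dom E k), Cod = (\<lambda>k\<in>{k \<in> Arr E. AMap p k =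
      Ide B x}. Cod E k),
    Ide = (\<lambda>e\<in>{e \<in> Obj E. OMap p e = x}. Ide E e),
    Comp = (\<lambda>k l. if l \<in> Arr E \<and> AMap p l = Ide B x \<and> k \<in> Arr E \<and> AMap p k = Ide B x \<and> Dom E k =
      Cod E l
      then k \<cdot>[E] l else undefined)\<rparr>"

lemma fibre_simps [simp]:
  "Obj (fibre x) = {e \<in> Obj E. OMap p e = x}" "Arr (fibre x) = {k \<in> Arr E. AMap p k = Ide B x}"
  "k \<in> Arr E \<Longrightarrow> AMap p k = Ide B x \<Longrightarrow> Dom (fibre x) k = Dom E k"
  "k \<in> Arr E \<Longrightarrow> AMap p k = Ide B x \<Longrightarrow> Cod (fibre x) k = Cod E k"
  "e \<in> Obj E \<Longrightarrow> OMap p e = x \<Longrightarrow> Ide (fibre x) e = Ide E e"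
  "l \<in> Arr E \<Longrightarrow> AMap p l = Ide B x \<Longrightarrow> k \<in> Arr E \<Longrightarrow> AMap p k = Ide B x \<Longrightarrow> Dom E k = Cod E l \<Longrightarrow>
    k \<cdot>[fibre x] l = k \<cdot>[E] l"
  by (simp_all add: fibre_def)

lemma vertical_Dom: "x \<in> Obj B \<Longrightarrow> k \<in> Arr E \<Longrightarrow> AMap p k = Ide B x \<Longrightarrow> OMap p (Dom E k) = x"
  and vertical_Cod: "x \<in> Obj B \<Longrightarrow> k \<in> Arr E \<Longrightarrow> AMap p k = Ide B x \<Longrightarrow> OMap p (Cod E k) = x"
  using p_simps(3,4)[of k] by auto

lemma category_fibre [simp]: "x \<in> Obj B \<Longrightarrow> category (fibre x)"
  by (rule categoryI) (auto simp: vertical_Dom vertical_Cod)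

lemma small_fibre: "x \<in> Obj B \<Longrightarrow> small_category U (fibre x)"
proof -
  assume x: "x \<in> Obj B"
  have "Obj E \<in> U" "Arr E \<in> U" using small_E by (auto simp: small_category_def)
  then have "Obj (fibre x) \<in> U" "Arr (fibre x) \<in> U" using universeD(2)[OF U]
    by (auto simp del: fibre_simps simp: fibre_def)
  then show ?thesis using category_fibre[OF x] unfolding small_category_def
    by (auto simp: fibre_def)
qed

lemma is_iso_fibre:
  assumes x: "x \<in> Obj B" and k: "k \<in> Arr E" "AMap p k = Ide B x" and iso: "is_iso E k"
  shows "is_iso (fibre x) k"
proof -
  obtain l where l: "l \<in> Arr E" "Dom E l = Cod E k" "Cod E l = Dom E k" "l \<cdot>[E] k = Ide E (Dom E k)"
    "k \<cdot>[E] l = Ide E (Cod E k)"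
    using iso by (auto simp: is_iso_def arrows_iff)
  note d = vertical_Dom[OF x k] vertical_Cod[OF x k]
  have "AMap p l = AMap p l \<cdot>[B] AMap p k" using l(1-3) k d p_simps(3)[OF l(1)] by simp
  also have "\<dots> = AMap p (l \<cdot>[E] k)" using l(1-3) k(1) by simp
  also have "\<dots> = Ide B x" unfolding l(4) using k(1) d by simp
  finally show ?thesis using l k d x by (intro is_isoI[where g = l]) auto
qed

definition re :: "'u \<Rightarrow> 'u \<Rightarrow> 'u" where
  "re f k = fill f (Cod E k) (k \<cdot>[E] lft f (Dom E k))"

lemma
  assumes f: "f \<in> Arr B" and k: "k \<in> Arr E" "AMap p k = Ide B (Cod B f)"
  shows re_Arr [simp]: "re f k \<in> Arr E" and re_Dom [simp]: "Dom E (re f k) = reindex f (Dom E k)"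
    and re_Cod [simp]: "Cod E (re f k) = reindex f (Cod E k)" and p_re [simp]: "AMap p (re f k) =
      Ide B (Dom B f)"
    and lft_re: "lft f (Cod E k) \<cdot>[E] re f k = k \<cdot>[E] lft f (Dom E k)"
proof -
  have d: "OMap p (Dom E k) = Cod B f" "OMap p (Cod E k) = Cod B f"
    using vertical_Dom[OF _ k] vertical_Cod[OF _ k] f by auto
  have l: "k \<cdot>[E] lft f (Dom E k) \<in> Arr E" "Cod E (k \<cdot>[E] lft f (Dom E k)) = Cod E k"
    "AMap p (k \<cdot>[E] lft f (Dom E k)) = f"
    using f k d by simp_all
  show "re f k \<in> Arr E" "Dom E (re f k) = reindex f (Dom E k)" "Cod E (re f k) =
    reindex f (Cod E k)" "AMap p (re f k) = Ide B (Dom B f)"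
    "lft f (Cod E k) \<cdot>[E] re f k = k \<cdot>[E] lft f (Dom E k)"
    unfolding re_def using fill_Arr[OF l] fill_Dom[OF l] fill_Cod[OF l] p_fill[OF l] lft_fill[OF l]
      f k d by simp_all
qed

definition "reftor f = \<lparr>OMap = (\<lambda>e\<in>Obj (fibre (Cod B f)). reindex f e), AMap =
  (\<lambda>k\<in>Arr (fibre (Cod B f)). re f k)\<rparr>"

text \<open>The comparison of an identity of \<open>E\<close> with the chosen lift of an identity of
  \<open>B\<close>. Likewise \<open>\<mu>\<close> compares a composite of two chosen lifts with the
  chosen lift of the composite.\<close>

definition \<eta> :: "'u \<Rightarrow> 'u" where "\<eta> e = fill (Ide B (OMap p e)) e (Ide E e)"

definition \<mu> :: "'u \<Rightarrow> 'u \<Rightarrow> 'u \<Rightarrow> 'u" where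
  "\<mu> g f e = fill (f \<cdot>[B] g) e (lft f e \<cdot>[E] lft g (reindex f e))"

lemma
  assumes e: "e \<in> Obj E" and x: "OMap p e = x"
  shows \<eta>_Arr [simp]: "\<eta> e \<in> Arr E" and \<eta>_Dom [simp]: "Dom E (\<eta> e) = e" and \<eta>_Cod [simp]:
    "Cod E (\<eta> e) = reindex (Ide B x) e"
    and p_\<eta> [simp]: "AMap p (\<eta> e) = Ide B x" and lft_\<eta>: "lft (Ide B x) e \<cdot>[E] \<eta> e = Ide E e"
    and \<eta>_iso: "is_iso E (\<eta> e)"
proof -
  have k: "Ide E e \<in> Arr E" "Cod E (Ide E e) = e" "AMap p (Ide E e) = Ide B (OMap p e)"
    using e by simp_all
  show "\<eta> e \<in> Arr E" "Dom E (\<eta> e) = e" "Cod E (\<eta> e) = reindex (Ide B x) e" "AMap p (\<eta> e) = Ide B x"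
    "lft (Ide B x) e \<cdot>[E] \<eta> e = Ide E e"
    unfolding \<eta>_def using fill_Arr[OF k] fill_Dom[OF k] fill_Cod[OF k] p_fill[OF k] lft_fill[OF k]
      e x by auto
  show "is_iso E (\<eta> e)" unfolding \<eta>_def by (rule fill_is_iso[OF cartesian_Ide[OF p_is_functor e]
    k(2,3)])
qed

lemma
  assumes e: "e \<in> Obj E" and f: "f \<in> Arr B" and g: "g \<in> Arr B" and ef: "Cod B f = OMap p e" and fg:
    "Dom B f = Cod B g"
  shows \<mu>_Arr [simp]: "\<mu> g f e \<in> Arr E" and \<mu>_Dom [simp]: "Dom E (\<mu> g f e) =
    reindex g (reindex f e)"
    and \<mu>_Cod [simp]: "Cod E (\<mu> g f e) = reindex (f \<cdot>[B] g) e"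
    and p_\<mu> [simp]: "AMap p (\<mu> g f e) = Ide B (Dom B g)"
    and lft_\<mu>: "lft (f \<cdot>[B] g) e \<cdot>[E] \<mu> g f e = lft f e \<cdot>[E] lft g (reindex f e)"
    and \<mu>_iso: "is_iso E (\<mu> g f e)"
proof -
  let ?k = "lft f e \<cdot>[E] lft g (reindex f e)"
  have k: "?k \<in> Arr E" "Cod E ?k = e" "AMap p ?k = f \<cdot>[B] g" and d:
    "Dom E ?k = reindex g (reindex f e)"
    using e f g ef fg by simp_all
  show "\<mu> g f e \<in> Arr E" "Dom E (\<mu> g f e) = reindex g (reindex f e)" "Cod E (\<mu> g f e) =
    reindex (f \<cdot>[B] g) e"
    "AMap p (\<mu> g f e) = Ide B (Dom B g)" "lft (f \<cdot>[B] g) e \<cdot>[E] \<mu> g f e = ?k"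
    unfolding \<mu>_def using fill_Arr[OF k] fill_Dom[OF k] fill_Cod[OF k] p_fill[OF k] lft_fill[OF k]
      d f g fg by auto
  have "cartesian E B p ?k"
    by (rule cartesian_comp[OF p_is_functor lft_cartesian lft_cartesian]) (use e f g ef fg
      in simp_all)
  then show "is_iso E (\<mu> g f e)" unfolding \<mu>_def by (rule fill_is_iso[OF _ k(2,3)])
qed

definition \<Phi> :: "'u cat_psfun" where
  "\<Phi> = \<lparr>PObj = (\<lambda>x\<in>Obj B. fibre x), PArr = (\<lambda>f\<in>Arr B. reftor f),
     PUnit = (\<lambda>x\<in>Obj B. \<lparr>NDom = id_ftor (fibre x), NCod = reftor (Ide B x), NMap =
       (\<lambda>e\<in>Obj (fibre x). \<eta> e)\<rparr>),
     PComp = (\<lambda>g f. if f \<in> Arr B \<and> g \<in> Arr B \<and> Dom B f = Cod B g then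
       \<lparr>NDom = comp_ftor (fibre (Cod B f)) (reftor g) (reftor f), NCod = reftor (f \<cdot>[B] g),
        NMap = (\<lambda>e\<in>Obj (fibre (Cod B f)). \<mu> g f e)\<rparr> else undefined)\<rparr>"

lemma \<Phi>_simps [simp]:
  "x \<in> Obj B \<Longrightarrow> PObj \<Phi> x = fibre x" "f \<in> Arr B \<Longrightarrow> PArr \<Phi> f = reftor f"
  "x \<in> Obj B \<Longrightarrow> NDom (PUnit \<Phi> x) = id_ftor (fibre x)" "x \<in> Obj B \<Longrightarrow> NCod (PUnit \<Phi> x) =
    reftor (Ide B x)"
  "x \<in> Obj B \<Longrightarrow> punit \<Phi> x = (\<lambda>e\<in>Obj (fibre x). \<eta> e)"
  "f \<in> Arr B \<Longrightarrow> g \<in> Arr B \<Longrightarrow> Dom B f = Cod B g \<Longrightarrow> NDom (PComp \<Phi> g f) = comp_ftor (fibre (Cod B f))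
    (reftor g) (reftor f)"
  "f \<in> Arr B \<Longrightarrow> g \<in> Arr B \<Longrightarrow> Dom B f = Cod B g \<Longrightarrow> NCod (PComp \<Phi> g f) = reftor (f \<cdot>[B] g)"
  "f \<in> Arr B \<Longrightarrow> g \<in> Arr B \<Longrightarrow> Dom B f = Cod B g \<Longrightarrow> pcomp \<Phi> g f = (\<lambda>e\<in>Obj (fibre (Cod B f)). \<mu> g f e)"
  by (simp_all add: \<Phi>_def)

lemma reftor_simps [simp]:
  "e \<in> Obj E \<Longrightarrow> OMap p e = Cod B f \<Longrightarrow> OMap (reftor f) e = reindex f e"
  "k \<in> Arr E \<Longrightarrow> AMap p k = Ide B (Cod B f) \<Longrightarrow> AMap (reftor f) k = re f k"
  by (simp_all add: reftor_def)

section \<open>Functoriality, naturality and coherence of reindexing along a cleavage\<close>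

lemma re_Ide:
  assumes f: "f \<in> Arr B" and e: "e \<in> Obj E" "OMap p e = Cod B f"
  shows "re f (Ide E e) = Ide E (reindex f e)"
  by (rule lft_cancel[of e f]) (use f e lft_re[OF f, of "Ide E e"] in simp_all)

lemma re_Comp:
  assumes f: "f \<in> Arr B" and k: "k \<in> Arr E" "AMap p k = Ide B (Cod B f)" and l: "l \<in> Arr E"
    "AMap p l = Ide B (Cod B f)"
    and c: "Dom E k = Cod E l"
  shows "re f (k \<cdot>[E] l) = re f k \<cdot>[E] re f l"
proof -
  have ob: "Cod B f \<in> Obj B" "Dom B f \<in> Obj B" using f by auto
  note v = vertical_Dom[OF ob(1)] vertical_Cod[OF ob(1)]
  have kl: "k \<cdot>[E] l \<in> Arr E" "AMap p (k \<cdot>[E] l) = Ide B (Cod B f)" using k l c ob by simp_all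
  show ?thesis
  proof (rule lft_cancel[of "Cod E k" f])
    have "lft f (Cod E k) \<cdot>[E] re f (k \<cdot>[E] l) = k \<cdot>[E] l \<cdot>[E] lft f (Dom E l)"
      using lft_re[OF f kl] k l c f v by simp
    also have "\<dots> = k \<cdot>[E] lft f (Dom E k) \<cdot>[E] re f l" using lft_re[OF f l] c by simp
    also have "\<dots> = (k \<cdot>[E] lft f (Dom E k)) \<cdot>[E] re f l" using f k l c v by simp
    also have "\<dots> = (lft f (Cod E k) \<cdot>[E] re f k) \<cdot>[E] re f l" using lft_re[OF f k] by simp
    also have "\<dots> = lft f (Cod E k) \<cdot>[E] re f k \<cdot>[E] re f l" using f k l c v by simp
    finally show "lft f (Cod E k) \<cdot>[E] re f (k \<cdot>[E] l) = lft f (Cod E k) \<cdot>[E] re f k \<cdot>[E] re f l" .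
  qed (use f k l c ob v kl in simp_all)
qed

lemma reftor_functor: "f \<in> Arr B \<Longrightarrow> reftor f \<in> functors (fibre (Cod B f)) (fibre (Dom B f))"
proof -
  assume f: "f \<in> Arr B"
  have ob: "Cod B f \<in> Obj B" "Dom B f \<in> Obj B" using f by auto
  note v = vertical_Dom[OF ob(1)] vertical_Cod[OF ob(1)]
  have "is_functor (fibre (Cod B f)) (fibre (Dom B f)) (reftor f)"
    by (rule is_functorI) (use f ob v in \<open>simp_all add: re_Ide re_Comp\<close>)
  then show ?thesis by (simp add: functors_def reftor_def)
qed

text \<open>Like the other equations for reindexing, this is one between vertical arrows into a
  reindexed object, and is checked by \<open>lft_cancel\<close> after composition with a chosen
  lift.\<close>

lemma \<eta>_natural:
  assumes x: "x \<in> Obj B" and k: "k \<in> Arr E" "AMap p k = Ide B x"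
  shows "\<eta> (Cod E k) \<cdot>[E] k = re (Ide B x) k \<cdot>[E] \<eta> (Dom E k)"
proof -
  let ?i = "Ide B x" and ?u = "Dom E k" and ?v = "Cod E k"
  have uv: "?u \<in> Obj E" "?v \<in> Obj E" "OMap p ?u = x" "OMap p ?v = x"
    using k vertical_Dom[OF x k] vertical_Cod[OF x k] by auto
  have k': "AMap p k = Ide B (Cod B ?i)" using k x by simp
  show ?thesis
  proof (rule lft_cancel[of ?v ?i])
    have "lft ?i ?v \<cdot>[E] \<eta> ?v \<cdot>[E] k = (lft ?i ?v \<cdot>[E] \<eta> ?v) \<cdot>[E] k" using x k uv by simp
    also have "\<dots> = k \<cdot>[E] lft ?i ?u \<cdot>[E] \<eta> ?u" using lft_\<eta>[OF uv(2,4)] lft_\<eta>[OF uv(1,3)] k by simp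
    also have "\<dots> = (k \<cdot>[E] lft ?i ?u) \<cdot>[E] \<eta> ?u" using x k uv by simp
    also have "\<dots> = (lft ?i ?v \<cdot>[E] re ?i k) \<cdot>[E] \<eta> ?u" using lft_re[OF _ k(1) k'] x by simp
    also have "\<dots> = lft ?i ?v \<cdot>[E] re ?i k \<cdot>[E] \<eta> ?u" using x k uv by simp
    finally show "lft ?i ?v \<cdot>[E] \<eta> ?v \<cdot>[E] k = lft ?i ?v \<cdot>[E] re ?i k \<cdot>[E] \<eta> ?u" .
  qed (use x k uv in simp_all)
qed

lemma \<mu>_natural:
  assumes f: "f \<in> Arr B" and g: "g \<in> Arr B" and fg: "Dom B f = Cod B g" and k: "k \<in> Arr E"
    "AMap p k = Ide B (Cod B f)"
  shows "\<mu> g f (Cod E k) \<cdot>[E] re g (re f k) = re (f \<cdot>[B] g) k \<cdot>[E] \<mu> g f (Dom E k)"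
proof -
  let ?h = "f \<cdot>[B] g" and ?u = "Dom E k" and ?v = "Cod E k"
  have ob: "Cod B f \<in> Obj B" "Dom B f \<in> Obj B" "Cod B g \<in> Obj B" "Dom B g \<in> Obj B" using f g by auto
  have uv: "?u \<in> Obj E" "?v \<in> Obj E" "Cod B f = OMap p ?u" "Cod B f = OMap p ?v"
    using k vertical_Dom[OF ob(1) k] vertical_Cod[OF ob(1) k] by auto
  have h: "?h \<in> Arr B" "Cod B ?h = Cod B f" "Dom B ?h = Dom B g" using f g fg by simp_all
  have kh: "AMap p k = Ide B (Cod B ?h)" using k h by simp
  have r: "re f k \<in> Arr E" "AMap p (re f k) = Ide B (Cod B g)" "Cod E (re f k) = reindex f ?v"
    "Dom E (re f k) = reindex f ?u"
    using f k fg by simp_all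
  show ?thesis
  proof (rule lft_cancel[of ?v ?h])
    have "lft ?h ?v \<cdot>[E] \<mu> g f ?v \<cdot>[E] re g (re f k) = (lft ?h ?v \<cdot>[E] \<mu> g f ?v) \<cdot>[E] re g (re f k)"
      using f g fg k uv r h by simp
    also have "\<dots> = lft f ?v \<cdot>[E] lft g (reindex f ?v) \<cdot>[E] re g (re f k)"
      unfolding lft_\<mu>[OF uv(2) f g uv(4) fg] using f g fg k uv(1,2) uv(3,4)[symmetric] r by simp
    also have "\<dots> = lft f ?v \<cdot>[E] re f k \<cdot>[E] lft g (reindex f ?u)"
      using lft_re[OF g r(1,2)] r(3,4) by simp
    also have "\<dots> = (lft f ?v \<cdot>[E] re f k) \<cdot>[E] lft g (reindex f ?u)"
      using f g fg k uv(1,2) uv(3,4)[symmetric] r by simp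
    also have "\<dots> = k \<cdot>[E] lft f ?u \<cdot>[E] lft g (reindex f ?u)"
      unfolding lft_re[OF f k] using f g fg k uv(1,2) uv(3,4)[symmetric] r by simp
    also have "\<dots> = k \<cdot>[E] lft ?h ?u \<cdot>[E] \<mu> g f ?u" unfolding lft_\<mu>[OF uv(1) f g uv(3) fg] ..
    also have "\<dots> = (k \<cdot>[E] lft ?h ?u) \<cdot>[E] \<mu> g f ?u" using f g fg k uv(1,2) uv(3,4)[symmetric] r h
      by simp
    also have "\<dots> = lft ?h ?v \<cdot>[E] re ?h k \<cdot>[E] \<mu> g f ?u"
      unfolding lft_re[OF h(1) k(1) kh, symmetric] using f g fg k uv(1,2) uv(3,4)[symmetric] r h
        by simp
    finally show "lft ?h ?v \<cdot>[E] \<mu> g f ?v \<cdot>[E] re g (re f k) = lft ?h ?v \<cdot>[E] re ?h k \<cdot>[E] \<mu> g f ?u"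
      .
  qed (use f g fg k uv(1,2) uv(3,4)[symmetric] r h ob in simp_all)
qed

lemma \<mu>_unit_right:
  assumes f: "f \<in> Arr B" and e: "e \<in> Obj E" "Cod B f = OMap p e"
  shows "\<mu> f (Ide B (Cod B f)) e \<cdot>[E] re f (\<eta> e) = Ide E (reindex f e)"
proof -
  let ?i = "Ide B (Cod B f)"
  have x: "Cod B f \<in> Obj B" using f by simp
  have i: "?i \<in> Arr B" "Cod B ?i = OMap p e" "Dom B ?i = Cod B f" "?i \<cdot>[B] f = f"
    using f e x by simp_all
  have \<eta>: "\<eta> e \<in> Arr E" "AMap p (\<eta> e) = Ide B (Cod B f)" "Cod E (\<eta> e) = reindex ?i e"
    "Dom E (\<eta> e) = e"
    using e(1) e(2)[symmetric] by simp_all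
  \<comment> \<open>Instantiated by hand: the composite of \<open>?i\<close> and \<open>f\<close>
    has to be rewritten to \<open>f\<close> before the typing facts match.\<close>
  have \<mu>: "\<mu> f ?i e \<in> Arr E" "Dom E (\<mu> f ?i e) = reindex f (reindex ?i e)" "Cod E (\<mu> f ?i e) =
    reindex f e" "AMap p (\<mu> f ?i e) = Ide B (Dom B f)"
    using \<mu>_Arr[OF e(1) i(1) f i(2,3)] \<mu>_Dom[OF e(1) i(1) f i(2,3)] \<mu>_Cod[OF e(1) i(1) f i(2,3)]
      p_\<mu>[OF e(1) i(1) f i(2,3)] i(4) by simp_all
  have re: "OMap p (reindex ?i e) = Cod B f" "reindex ?i e \<in> Obj E"
    using p_reindex[OF e(1) i(1,2)] i(3) reindex_Obj[OF e(1) i(1,2)] by simp_all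
  show ?thesis
  proof (rule lft_cancel[of e f])
    have "lft f e \<cdot>[E] \<mu> f ?i e \<cdot>[E] re f (\<eta> e) = (lft f e \<cdot>[E] \<mu> f ?i e) \<cdot>[E] re f (\<eta> e)"
      using f e \<eta> \<mu> by simp
    also have "\<dots> = lft ?i e \<cdot>[E] lft f (reindex ?i e) \<cdot>[E] re f (\<eta> e)"
      using lft_\<mu>[OF e(1) i(1) f i(2,3)] f e \<eta> \<mu> i re by simp
    also have "\<dots> = lft ?i e \<cdot>[E] \<eta> e \<cdot>[E] lft f e"
      using lft_re[OF f \<eta>(1,2)] \<eta>(3,4) by simp
    also have "\<dots> = (lft ?i e \<cdot>[E] \<eta> e) \<cdot>[E] lft f e" using f e \<eta> i by simp
    also have "\<dots> = lft f e" using lft_\<eta>[OF e(1) e(2)[symmetric]] f e by simp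
    finally show "lft f e \<cdot>[E] \<mu> f ?i e \<cdot>[E] re f (\<eta> e) = lft f e \<cdot>[E] Ide E (reindex f e)"
      using f e by simp
  qed (use f e \<eta> \<mu> re in simp_all)
qed

lemma \<mu>_unit_left:
  assumes f: "f \<in> Arr B" and e: "e \<in> Obj E" "Cod B f = OMap p e"
  shows "\<mu> (Ide B (Dom B f)) f e \<cdot>[E] \<eta> (reindex f e) = Ide E (reindex f e)"
proof -
  let ?i = "Ide B (Dom B f)" and ?v = "reindex f e"
  have i: "?i \<in> Arr B" "Dom B f = Cod B ?i" "f \<cdot>[B] ?i = f" "Dom B ?i = Dom B f" using f by simp_all
  have v: "?v \<in> Obj E" "OMap p ?v = Dom B f" using f e by simp_all
  have \<mu>: "\<mu> ?i f e \<in> Arr E" "Dom E (\<mu> ?i f e) = reindex ?i ?v" "Cod E (\<mu> ?i f e) = ?v"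
    "AMap p (\<mu> ?i f e) = Ide B (Dom B f)"
    using \<mu>_Arr[OF e(1) f i(1) e(2) i(2)] \<mu>_Dom[OF e(1) f i(1) e(2) i(2)] \<mu>_Cod[OF e(1) f i(1) e(2)
      i(2)] p_\<mu>[OF e(1) f i(1) e(2) i(2)] i(3,4) by simp_all
  show ?thesis
  proof (rule lft_cancel[of e f])
    have "lft f e \<cdot>[E] \<mu> ?i f e \<cdot>[E] \<eta> ?v = (lft f e \<cdot>[E] \<mu> ?i f e) \<cdot>[E] \<eta> ?v" using f e v \<mu> by simp
    also have "\<dots> = lft f e \<cdot>[E] lft ?i ?v \<cdot>[E] \<eta> ?v"
      using lft_\<mu>[OF e(1) f i(1) e(2) i(2)] f e v i by simp
    also have "\<dots> = lft f e \<cdot>[E] Ide E ?v" using lft_\<eta>[OF v] by simp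
    finally show "lft f e \<cdot>[E] \<mu> ?i f e \<cdot>[E] \<eta> ?v = lft f e \<cdot>[E] Ide E ?v" .
  qed (use f e v \<mu> in simp_all)
qed

text \<open>Composed with the chosen lift of the triple composite, both sides become the composite
  of the three chosen lifts along \<open>f\<close>, \<open>g\<close> and \<open>h\<close>.\<close>

lemma \<mu>_assoc:
  assumes f: "f \<in> Arr B" and g: "g \<in> Arr B" and h: "h \<in> Arr B" and fg: "Dom B f = Cod B g" and gh:
    "Dom B g = Cod B h"
    and e: "e \<in> Obj E" "Cod B f = OMap p e"
  shows "\<mu> (g \<cdot>[B] h) f e \<cdot>[E] \<mu> h g (reindex f e) = \<mu> h (f \<cdot>[B] g) e \<cdot>[E] re h (\<mu> g f e)"
proof -
  let ?v = "reindex f e" and ?gh = "g \<cdot>[B] h" and ?fg = "f \<cdot>[B] g" and ?fgh = "f \<cdot>[B] g \<cdot>[B] h"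
  have c: "?gh \<in> Arr B" "Dom B f = Cod B ?gh" "?fg \<in> Arr B" "Cod B ?fg = OMap p e"
    "Dom B ?fg = Cod B h" "?fg \<cdot>[B] h = ?fgh"
    "?fgh \<in> Arr B" "Cod B ?fgh = OMap p e" "Dom B ?gh = Dom B h" "Dom B ?fgh = Dom B h"
    using f g h fg gh e by simp_all
  have v: "?v \<in> Obj E" "Cod B g = OMap p ?v" "Cod B ?gh = OMap p ?v" using f e fg g h gh by simp_all
  have w: "reindex g ?v \<in> Obj E" "OMap p (reindex g ?v) = Cod B h" "reindex ?fg e \<in> Obj E"
    "OMap p (reindex ?fg e) = Cod B h"
    using g v gh c e by simp_all
  have r: "reindex h (reindex g ?v) \<in> Obj E" "OMap p (reindex h (reindex g ?v)) = Dom B h"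
    using h w by simp_all
  note m1 = \<mu>_Arr[OF e(1) f c(1) e(2) c(2)] \<mu>_Dom[OF e(1) f c(1) e(2) c(2)] \<mu>_Cod[OF e(1) f c(1)
    e(2) c(2)] p_\<mu>[OF e(1) f c(1) e(2) c(2)]
  note m2 = \<mu>_Arr[OF v(1) g h v(2) gh] \<mu>_Dom[OF v(1) g h v(2) gh] \<mu>_Cod[OF v(1) g h v(2) gh]
    p_\<mu>[OF v(1) g h v(2) gh]
  note m3 = \<mu>_Arr[OF e(1) c(3) h c(4,5)] \<mu>_Dom[OF e(1) c(3) h c(4,5)] \<mu>_Cod[OF e(1) c(3) h c(4,5)]
    p_\<mu>[OF e(1) c(3) h c(4,5)]
  note m4 = \<mu>_Arr[OF e(1) f g e(2) fg] \<mu>_Dom[OF e(1) f g e(2) fg] \<mu>_Cod[OF e(1) f g e(2) fg]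
    p_\<mu>[OF e(1) f g e(2) fg]
  have m4': "AMap p (\<mu> g f e) = Ide B (Cod B h)" using m4 gh by simp
  note l1 = lft_\<mu>[OF e(1) f c(1) e(2) c(2)] and l2 = lft_\<mu>[OF v(1) g h v(2) gh]
    and l3 = lft_\<mu>[OF e(1) c(3) h c(4,5), unfolded c(6)] and l4 = lft_\<mu>[OF e(1) f g e(2) fg]
  note rr = re_Arr[OF h m4(1) m4'] re_Dom[OF h m4(1) m4'] re_Cod[OF h m4(1) m4'] p_re[OF h m4(1)
    m4']
  note lfs = lft_Arr[OF e(1) c(7,8)] lft_Dom[OF e(1) c(7,8)] lft_Arr[OF e(1) f e(2)] lft_Dom[OF e(1)
    f e(2)]
    lft_Arr[OF v(1) c(1) v(3)] lft_Dom[OF v(1) c(1) v(3)] lft_Cod[OF v(1) c(1) v(3)]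
    lft_Arr[OF v(1) g v(2)] lft_Dom[OF v(1) g v(2)] lft_Cod[OF v(1) g v(2)]
    lft_Arr[OF w(1) h w(2)[symmetric]] lft_Dom[OF w(1) h w(2)[symmetric]] lft_Cod[OF w(1) h
      w(2)[symmetric]]
    lft_Arr[OF e(1) c(3,4)] lft_Dom[OF e(1) c(3,4)]
    lft_Arr[OF w(3) h w(4)[symmetric]] lft_Dom[OF w(3) h w(4)[symmetric]] lft_Cod[OF w(3) h
      w(4)[symmetric]]
  show ?thesis
  proof (rule lft_cancel[of e ?fgh])
    have "lft ?fgh e \<cdot>[E] \<mu> ?gh f e \<cdot>[E] \<mu> h g ?v = (lft ?fgh e \<cdot>[E] \<mu> ?gh f e) \<cdot>[E] \<mu> h g ?v"
      using m1 m2 lfs by simp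
    also have "\<dots> = lft f e \<cdot>[E] lft ?gh ?v \<cdot>[E] \<mu> h g ?v" unfolding l1 using m2 lfs by simp
    also have "\<dots> = (lft f e \<cdot>[E] lft g ?v) \<cdot>[E] lft h (reindex g ?v)" unfolding l2 using lfs by simp
    also have "\<dots> = lft ?fg e \<cdot>[E] \<mu> g f e \<cdot>[E] lft h (reindex g ?v)" unfolding l4[symmetric]
      using m4 lfs by simp
    also have "\<dots> = lft ?fg e \<cdot>[E] lft h (reindex ?fg e) \<cdot>[E] re h (\<mu> g f e)"
      using lft_re[OF h m4(1) m4'] unfolding m4(2,3) by simp
    also have "\<dots> = (lft ?fg e \<cdot>[E] lft h (reindex ?fg e)) \<cdot>[E] re h (\<mu> g f e)"
      using lfs rr m4(2,3) by simp
    also have "\<dots> = lft ?fgh e \<cdot>[E] \<mu> h ?fg e \<cdot>[E] re h (\<mu> g f e)" unfolding l3[symmetric]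
      using m3 rr lfs m4(2,3) c(6) by simp
    finally show "lft ?fgh e \<cdot>[E] \<mu> ?gh f e \<cdot>[E] \<mu> h g ?v = lft ?fgh e \<cdot>[E] \<mu> h ?fg e \<cdot>[E]
      re h (\<mu> g f e)" .
  qed (use e c(6-10) m1 m2 m3 rr m4(2,3) h in simp_all)
qed

lemma indexed_category: "indexed_category U B \<Phi>"
proof (rule indexed_category.intro)
  fix x assume x: "x \<in> Obj B"
  show "small_category U (PObj \<Phi> x)" using small_fibre x by simp
  note v = vertical_Dom[OF x] vertical_Cod[OF x]
  have "PUnit \<Phi> x \<in> ntranses (fibre x) (fibre x)"
    by (rule ntransesI) (use x v reftor_functor[of "Ide B x"] \<eta>_natural[OF x]
      in \<open>auto simp: id_ftor_in\<close>)
  then show "PUnit \<Phi> x \<in> ntranses (PObj \<Phi> x) (PObj \<Phi> x)" using x by simp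
  show "NDom (PUnit \<Phi> x) = id_ftor (PObj \<Phi> x)" "NCod (PUnit \<Phi> x) = PArr \<Phi> (Ide B x)"
    using x by simp_all
  fix u assume "u \<in> Obj (PObj \<Phi> x)"
  then show "is_iso (PObj \<Phi> x) (punit \<Phi> x u)" using x is_iso_fibre[OF x, of "\<eta> u"] \<eta>_iso by simp
next
  fix f assume "f \<in> Arr B"
  then show "PArr \<Phi> f \<in> functors (PObj \<Phi> (Cod B f)) (PObj \<Phi> (Dom B f))" using reftor_functor by simp
next
  fix f g assume f: "f \<in> Arr B" and g: "g \<in> Arr B" and fg: "Dom B f = Cod B g"
  have ob: "Cod B f \<in> Obj B" "Dom B f \<in> Obj B" "Cod B g \<in> Obj B" "Dom B g \<in> Obj B" using f g by auto
  note v = vertical_Dom[OF ob(1)] vertical_Cod[OF ob(1)]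
  have 1: "comp_ftor (fibre (Cod B f)) (reftor g) (reftor f) \<in> functors (fibre (Cod B f)) (fibre
    (Dom B g))"
    using comp_ftor_in[OF reftor_functor[OF f, unfolded fg] reftor_functor[OF g]] .
  have 2: "reftor (f \<cdot>[B] g) \<in> functors (fibre (Cod B f)) (fibre (Dom B g))"
    using reftor_functor[of "f \<cdot>[B] g"] f g fg by simp
  have "PComp \<Phi> g f \<in> ntranses (fibre (Cod B f)) (fibre (Dom B g))"
    by (rule ntransesI) (use f g fg v 1 2 \<mu>_natural[OF f g fg] in simp_all)
  then show "PComp \<Phi> g f \<in> ntranses (PObj \<Phi> (Cod B f)) (PObj \<Phi> (Dom B g))" using ob by simp
  show "NDom (PComp \<Phi> g f) = comp_ftor (PObj \<Phi> (Cod B f)) (PArr \<Phi> g) (PArr \<Phi> f)"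
    "NCod (PComp \<Phi> g f) = PArr \<Phi> (f \<cdot>[B] g)"
    using f g fg by simp_all
  fix u assume "u \<in> Obj (PObj \<Phi> (Cod B f))"
  then show "is_iso (PObj \<Phi> (Dom B g)) (pcomp \<Phi> g f u)"
    using f g fg ob is_iso_fibre[OF ob(4), of "\<mu> g f u"] \<mu>_iso by simp
next
  fix f u assume f: "f \<in> Arr B" and "u \<in> Obj (PObj \<Phi> (Cod B f))"
  then have u: "u \<in> Obj E" "OMap p u = Cod B f" by simp_all
  show "pcomp \<Phi> f (Ide B (Cod B f)) u \<cdot>[PObj \<Phi> (Dom B f)] parr \<Phi> f (punit \<Phi> (Cod B f) u) =
      Ide (PObj \<Phi> (Dom B f)) (pobj \<Phi> f u)"
    using f u \<mu>_unit_right[OF f u(1) u(2)[symmetric]] by simp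
  show "pcomp \<Phi> (Ide B (Dom B f)) f u \<cdot>[PObj \<Phi> (Dom B f)] punit \<Phi> (Dom B f) (pobj \<Phi> f u) =
      Ide (PObj \<Phi> (Dom B f)) (pobj \<Phi> f u)"
    using f u \<mu>_unit_left[OF f u(1) u(2)[symmetric]] by simp
next
  fix f g h u assume f: "f \<in> Arr B" and g: "g \<in> Arr B" and h: "h \<in> Arr B" and fg:
    "Dom B f = Cod B g" and gh: "Dom B g = Cod B h"
    and "u \<in> Obj (PObj \<Phi> (Cod B f))"
  then have u: "u \<in> Obj E" "OMap p u = Cod B f" by simp_all
  show "pcomp \<Phi> (g \<cdot>[B] h) f u \<cdot>[PObj \<Phi> (Dom B h)] pcomp \<Phi> h g (pobj \<Phi> f u) =
      pcomp \<Phi> h (f \<cdot>[B] g) u \<cdot>[PObj \<Phi> (Dom B h)] parr \<Phi> h (pcomp \<Phi> g f u)"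
    using f g h fg gh u \<mu>_assoc[OF f g h fg gh u(1) u(2)[symmetric]] by simp
qed simp

text \<open>The compatibility laws of a presentation are here the defining equations
  \<open>lft_re\<close>, \<open>lft_\<eta>\<close> and \<open>lft_\<mu>\<close> of the reindexing
  data.\<close>

lemma presentation: "presentation U B \<Phi> E p (\<lambda>x e. e) (\<lambda>x k. k) lft"
proof (intro presentation.intro presentation_axioms.intro indexed_category small_E p_functor)
  show "fibration E B p"
    unfolding fibration_def using p_is_functor lft by blast
  fix x assume x: "x \<in> Obj B"
  show "bij_betw (\<lambda>e. e) (Obj (PObj \<Phi> x)) {e \<in> Obj E. OMap p e = x}"
    "bij_betw (\<lambda>k. k) (Arr (PObj \<Phi> x)) {k \<in> Arr E. AMap p k = Ide B x}"
    using x by (simp_all add: bij_betw_def)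
  show "lft (Ide B x) u \<cdot>[E] punit \<Phi> x u = Ide E u" if "u \<in> Obj (PObj \<Phi> x)" for u
    using that x lft_\<eta> by simp
next
  fix f k assume f: "f \<in> Arr B" and k: "k \<in> Arr (PObj \<Phi> (Cod B f))"
  show "lft f (Cod (PObj \<Phi> (Cod B f)) k) \<cdot>[E] parr \<Phi> f k = k \<cdot>[E] lft f (Dom (PObj \<Phi> (Cod B f)) k)"
    using f k lft_re[OF f, of k] by simp
next
  fix f g u assume f: "f \<in> Arr B" "g \<in> Arr B" "Dom B f = Cod B g" "u \<in> Obj (PObj \<Phi> (Cod B f))"
  then show "lft (f \<cdot>[B] g) u \<cdot>[E] pcomp \<Phi> g f u = lft f u \<cdot>[E] lft g (pobj \<Phi> f u)"
    using lft_\<mu>[of u f g] by simp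
next
  fix f u assume f: "f \<in> Arr B" "u \<in> Obj (PObj \<Phi> (Cod B f))"
  then show "cartesian E B p (lft f u)" "Dom E (lft f u) = pobj \<Phi> f u" "Cod E (lft f u) = u"
    "AMap p (lft f u) = f"
    using lft_cartesian[of u f] by simp_all
qed simp_all

lemma \<Phi>_in: "\<Phi> \<in> pseudofunctors (op_cat B) (Cat U)"
  using indexed_category.pseudofunctor[OF indexed_category]
  by (auto simp: pseudofunctors_def \<Phi>_def)

end

section \<open>The 2-equivalence\<close>

type_synonym 'u presentation_data = "(('u, 'u) cat \<times> ('u, 'u, 'u, 'u) ftor) \<times>
  'u cat_psfun \<times>
  ('u \<Rightarrow> 'u \<Rightarrow> 'u) \<times> ('u \<Rightarrow> 'u \<Rightarrow> 'u) \<times> ('u \<Rightarrow> 'u \<Rightarrow> 'u)"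

text \<open>Membership in \<open>pseudofunctors\<close> is added because \<open>presentation\<close>
  says nothing about values outside the carriers, while the right leg must land in the 0-cells of
  \<open>Psd\<close>.\<close>

definition presentations :: "'u set set \<Rightarrow> ('u, 'u) cat \<Rightarrow> 'u presentation_data set" where
  "presentations U B = {((E, p), F, ob, vert, lift). presentation U B F E p ob vert lift \<and>
     F \<in> pseudofunctors (op_cat B) (Cat U)}"

fun related1 :: "'u set set \<Rightarrow> ('u, 'u) cat \<Rightarrow> 'u presentation_data \<Rightarrow> 'u presentation_data \<Rightarrow>
    ('u, 'u, 'u, 'u) ftor \<Rightarrow> 'u cat_psnat \<Rightarrow> bool" where
  "related1 U B ((E, p), F, ob, vert, lift) ((E', p'), F', ob', vert', lift') H \<alpha> \<longleftrightarrow>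
     related U B F E p ob vert lift F' E' p' ob' vert' lift' H \<alpha>"

fun related2 :: "'u set set \<Rightarrow> ('u, 'u) cat \<Rightarrow> 'u presentation_data \<Rightarrow> 'u presentation_data \<Rightarrow>
    ('u, 'u, 'u, 'u) ntrans \<Rightarrow> 'u cat_modif \<Rightarrow> bool" where
  "related2 U B ((E, p), F, ob, vert, lift) ((E', p'), F', ob', vert', lift') \<theta> \<Gamma> \<longleftrightarrow>
     related_cells U B F E p ob vert lift F' E' p' ob' vert' lift' \<theta> \<Gamma>"

lemma ex_presentation_of_pseudofunctor:
  assumes U: "universe U" and B: "small_category U B" and F: "F \<in> pseudofunctors (op_cat B) (Cat U)"
  shows "\<exists>i \<in> presentations U B. fst (snd i) = F"
proof -
  obtain enc :: "'a \<times> 'a \<Rightarrow> 'a" where enc: "inj enc" using ex_pairing universeD(1)[OF U] by blast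
  interpret indexed_category U B F
    using F small_categoryD[OF B] by (simp add: pseudofunctors_def pseudofunctor_iff)
  interpret grothendieck U B F enc
    using U B enc by unfold_locales
  show ?thesis
    using presentation F by (intro bexI[of _ "((G, proj), F, gob, gvert, glift)"]) (auto simp:
      presentations_def)
qed

lemma ex_presentation_of_fibration:
  assumes U: "universe U" and B: "small_category U B" and Ep: "(E, p) \<in> Cell0 (Fib U B)"
  shows "\<exists>i \<in> presentations U B. fst i = (E, p)"
proof -
  have fib: "small_category U E" "p \<in> functors E B" "fibration E B p"
    using Ep by (simp_all add: Fib_Cell0)
  \<comment> \<open>All lifts are chosen at once; the axiom of choice turns the fibration into a
    cloven one.\<close>
  define lft where "lft = (\<lambda>f e. SOME g. cartesian E B p g \<and> Cod E g = e \<and> AMap p g = f)"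
  have "cartesian E B p (lft f e) \<and> Cod E (lft f e) = e \<and> AMap p (lft f e) = f"
    if "e \<in> Obj E" "f \<in> Arr B" "Cod B f = OMap p e" for e f
    unfolding lft_def by (rule someI_ex) (use fib(3) that in \<open>auto simp: fibration_def\<close>)
  then interpret cloven_fibration U B E p lft
    using U small_categoryD[OF B] fib(1,2) by (intro cloven_fibration.intro)
  show ?thesis
    using presentation \<Phi>_in by (intro bexI[of _ "((E, p), \<Phi>, \<lambda>x e. e, \<lambda>x k. k, lft)"]) (auto simp:
      presentations_def)
qed

text \<open>The two constructions of presentations make the legs surjective; existence and
  uniqueness of partners are the correspondence results for a pair of presentations.\<close>

lemma presentations_cell_span:
  assumes U: "universe U" and B: "small_category U B"
  shows "cell_span (Fib U B) (Psd (op_cat B) (Cat U)) (presentations U B) fst (\<lambda>i. fst (snd i))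
    (related1 U B) (related2 U B)"
proof (rule cell_span.intro)
  have "fst i \<in> Cell0 (Fib U B)" if i: "i \<in> presentations U B" for i
  proof -
    obtain E p F ob vert lift where i': "i = ((E, p), F, ob, vert, lift)" by (metis prod.exhaust)
    then interpret presentation U B F E p ob vert lift using i by (simp add: presentations_def)
    show ?thesis using small_E p_functor fibration by (simp add: i' Fib_Cell0)
  qed
  then show "fst ` presentations U B = Cell0 (Fib U B)"
    using ex_presentation_of_fibration[OF U B] by (auto simp: image_def) metis
  show "(\<lambda>i. fst (snd i)) ` presentations U B = Cell0 (Psd (op_cat B) (Cat U))"
    using ex_presentation_of_pseudofunctor[OF U B] by (force simp: presentations_def)
next
  fix i j assume ij: "i \<in> presentations U B" "j \<in> presentations U B"
  obtain E p F ob vert lift where i: "i = ((E, p), F, ob, vert, lift)" by (metis prod.exhaust)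
  obtain E' p' F' ob' vert' lift' where j: "j = ((E', p'), F', ob', vert', lift')"
    by (metis prod.exhaust)
  have pr: "presentation U B F E p ob vert lift" "presentation U B F' E' p' ob' vert' lift'"
    using ij by (simp_all add: i j presentations_def)
  interpret presentation_pair U B F E p ob vert lift F' E' p' ob' vert' lift'
    using pr by (rule presentation_pair.intro)
  note Hom = Fib_Hom[OF Fib_objects]
  have r1: "H \<in> Cell1 (Fib U B) (E, p) (E', p') \<and> \<alpha> \<in> pseudonaturals (op_cat B) (Cat U) F F'"
    if r: "related U B F E p ob vert lift F' E' p' ob' vert' lift' H \<alpha>" for H \<alpha>
  proof -
    interpret related U B F E p ob vert lift F' E' p' ob' vert' lift' H \<alpha> by fact
    show ?thesis using H over in_pseudonaturals by (simp add: Fib_Cell1[OF Fib_objects])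
  qed
  have r2: "\<theta> \<in> Cell2 (Fib U B) (E, p) (E', p') \<and> \<Gamma> \<in> modifications (op_cat B) (Cat U) F F'"
    if r: "related_cells U B F E p ob vert lift F' E' p' ob' vert' lift' \<theta> \<Gamma>" for \<theta> \<Gamma>
  proof -
    interpret related_cells U B F E p ob vert lift F' E' p' ob' vert' lift' \<theta> \<Gamma> by fact
    show ?thesis using \<theta> D.over C.over \<theta>_over in_modifications
      by (simp add: Fib_Cell2[OF Fib_objects])
  qed
  show "H \<in> Cell1 (Fib U B) (fst i) (fst j) \<and> \<alpha> \<in> Cell1 (Psd (op_cat B) (Cat U)) (fst (snd i)) (fst
    (snd j))"
    if "related1 U B i j H \<alpha>" for H \<alpha> using r1 that by (simp add: i j)
  show "\<theta> \<in> Cell2 (Fib U B) (fst i) (fst j) \<and> \<Gamma> \<in> Cell2 (Psd (op_cat B) (Cat U)) (fst (snd i)) (fst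
    (snd j))"
    if "related2 U B i j \<theta> \<Gamma>" for \<theta> \<Gamma> using r2 that by (simp add: i j)
  show "\<exists>!\<alpha>. related1 U B i j H \<alpha>" if H: "H \<in> Cell1 (Fib U B) (fst i) (fst j)" for H
  proof -
    interpret cartesian_functor U B F E p ob vert lift F' E' p' ob' vert' lift' H
      using H by unfold_locales (simp_all add: i j Fib_Cell1[OF Fib_objects])
    obtain \<alpha> where "psnat_data B F F' \<alpha>" "compat H \<alpha>" using ex_transformation by blast
    then have "related U B F E p ob vert lift F' E' p' ob' vert' lift' H \<alpha>"
      by (intro related.intro related_axioms.intro cartesian_functor_axioms)
    then show ?thesis using transformation_unique by (auto simp: i j)
  qed
  show "\<exists>!H. related1 U B i j H \<alpha>" if "\<alpha> \<in> Cell1 (Psd (op_cat B) (Cat U)) (fst (snd i)) (fst (snd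
    j))" for \<alpha>
    using ex_related_functor[of \<alpha>] functor_unique that by (auto simp: i j)
  show "\<exists>!\<Gamma>. related2 U B i j \<theta> \<Gamma>" if "\<theta> \<in> Cell2 (Fib U B) (fst i) (fst j)" for \<theta>
    using ex_modification[of \<theta>] modification_unique that by (auto simp: i j)
  show "\<exists>!\<theta>. related2 U B i j \<theta> \<Gamma>" if "\<Gamma> \<in> Cell2 (Psd (op_cat B) (Cat U)) (fst (snd i)) (fst (snd
    j))" for \<Gamma>
    using ex_2_cell[of \<Gamma>] two_cell_unique that by (auto simp: i j)
  show "related1 U B i j (Dom (Hom (Fib U B) (fst i) (fst j)) \<theta>) (Dom (Hom (Psd (op_cat B) (Cat U))
    (fst (snd i)) (fst (snd j))) \<Gamma>)"
    "related1 U B i j (Cod (Hom (Fib U B) (fst i) (fst j)) \<theta>) (Cod (Hom (Psd (op_cat B) (Cat U))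
      (fst (snd i)) (fst (snd j))) \<Gamma>)"
    if "related2 U B i j \<theta> \<Gamma>" for \<theta> \<Gamma>
    using that by (simp_all add: i j Hom related_cells_def)
  show "related2 U B i j (Ide (Hom (Fib U B) (fst i) (fst j)) H) (Ide (Hom (Psd (op_cat B) (Cat U))
    (fst (snd i)) (fst (snd j))) \<alpha>)"
    if "related1 U B i j H \<alpha>" for H \<alpha>
    using that related_cells_Ide by (simp add: i j Hom)
  show "related2 U B i j (\<theta>' \<cdot>[Hom (Fib U B) (fst i) (fst j)] \<theta>) (\<Gamma>' \<cdot>[Hom (Psd (op_cat B) (Cat U))
    (fst (snd i)) (fst (snd j))] \<Gamma>)"
    if "related2 U B i j \<theta> \<Gamma>" "related2 U B i j \<theta>' \<Gamma>'"
      "Dom (Hom (Fib U B) (fst i) (fst j)) \<theta>' = Cod (Hom (Fib U B) (fst i) (fst j)) \<theta>"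
      "Dom (Hom (Psd (op_cat B) (Cat U)) (fst (snd i)) (fst (snd j))) \<Gamma>' =
        Cod (Hom (Psd (op_cat B) (Cat U)) (fst (snd i)) (fst (snd j))) \<Gamma>"
    for \<theta> \<theta>' \<Gamma> \<Gamma>'
    using that related_cells_Comp by (simp add: i j Hom)
next
  fix i assume "i \<in> presentations U B"
  then show "related1 U B i i (Unit (Fib U B) (fst i)) (Unit (Psd (op_cat B) (Cat U)) (fst (snd
    i)))"
    by (auto simp: presentations_def intro: presentation.related_Unit)
next
  fix i j k :: "'a presentation_data" and H \<alpha> H' \<alpha>'
  assume "related1 U B i j H \<alpha>" "related1 U B j k H' \<alpha>'"
  then show "related1 U B i k (hc1 (Fib U B) (fst i) (fst j) (fst k) H' H)
      (hc1 (Psd (op_cat B) (Cat U)) (fst (snd i)) (fst (snd j)) (fst (snd k)) \<alpha>' \<alpha>)"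
    by (cases i; cases j; cases k) (auto intro: related_comp)
next
  fix i j k :: "'a presentation_data" and \<theta> \<Gamma> \<theta>' \<Gamma>'
  assume "related2 U B i j \<theta> \<Gamma>" "related2 U B j k \<theta>' \<Gamma>'"
  then show "related2 U B i k (hc2 (Fib U B) (fst i) (fst j) (fst k) \<theta>' \<theta>)
      (hc2 (Psd (op_cat B) (Cat U)) (fst (snd i)) (fst (snd j)) (fst (snd k)) \<Gamma>' \<Gamma>)"
    by (cases i; cases j; cases k) (auto intro: related_cells_hcomp)
qed

theorem theorem2p2p3:
  fixes U :: "'u set set" and B :: "('u, 'u) cat"
  assumes "universe U" and "small_category U B"
  shows "two_equivalent (Fib U B) (Psd (op_cat B) (Cat U))"
  using cell_span.two_equivalent[OF presentations_cell_span[OF assms] two_category_Fib] .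

end
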